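(* Let $k\in\{1,\dots,d\}$, let $\mathcal{E}\subset\mathbb{R}^d$ be a non-degenerate ellipsoid with semi-axes of lengths $\lambda_1,\dots,\lambda_d$, and let $X_0,\dots,X_k$ be independent random vectors uniformly distributed in $\mathcal{E}$. Let $\eta,\eta',\eta_1,\dots,\eta_k$ be independent random variables, independent of $X_0,\dots,X_k$, such that $$\eta,\eta'\sim B\Big(\frac d2+1,\frac{kd}{2}\Big),\qquad \eta_i\sim B\Big(\frac{d-k+i}{2},\frac{k-i}{2}+1\Big),\quad i=1,\dots,k.$$ Let $\xi$ be a uniformly distributed random $k$-dimensional linear subspace of $\mathbb{R}^d$ with orthogonal projection $P_\xi$, independent of all the variables $X_i,\eta,\eta',\eta_i$. Let $G=(N_{ij})$ be a random $d\times k$ matrix with i.i.d. standard Gaussian entries, independent of $\eta',\eta_1,\dots,\eta_k$, and let $G_\lambda=(\lambda_iN_{ij})$ (a $d\times k$ matrix built from the same variables $N_{ij}$). Then $$(k!)^2\,\eta\,(1-\eta)^k\,|\operatorname{conv}(X_0,\dots,X_k)|^2\ \stackrel{d}{=}\ \kappa_k^{-2}\,(1-\eta')^k\,\eta_1\cdots\eta_k\,|P_\xi\mathcal{E}|^2\ \stackrel{d}{=}\ (1-\eta')^k\,\eta_1\cdots\eta_k\,\frac{\det(G_\lambda^\top G_\lambda)}{\det(G^\top G)},$$ where $\stackrel{d}{=}$ denotes equality in distribution.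
   Context: $|\cdot|$ denotes $k$-dimensional volume. $\kappa_k=\pi^{k/2}/\Gamma(k/2+1)$ is the volume of the unit ball in $\mathbb{R}^k$. $B(\alpha_1,\alpha_2)$, $\alpha_1,\alpha_2>0$, is the Beta distribution with density $\frac{\Gamma(\alpha_1+\alpha_2)}{\Gamma(\alpha_1)\Gamma(\alpha_2)}t^{\alpha_1-1}(1-t)^{\alpha_2-1}$, $t\in(0,1)$. "Uniformly distributed" for a random $k$-dimensional linear subspace means distributed according to the unique rotation invariant probability measure on the Grassmannian $G_{d,k}$ of $k$-dimensional linear subspaces of $\mathbb{R}^d$. *)

theory Defs
  imports "HOL-Probability.Probability"
begin

section \<open>Geometry\<close>

text \<open>
  A solid ellipsoid in general position: an arbitrary centre \<open>c\<close> and an arbitrary orthonormal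
  system \<open>u\<close> of axis directions. Positivity of the semi-axes is non-degeneracy.
\<close>

definition ellipsoid_with_semiaxes :: "real^'n \<Rightarrow> (real^'n) set \<Rightarrow> bool" where
  "ellipsoid_with_semiaxes l E \<longleftrightarrow>
     (\<forall>i. 0 < l $ i) \<and>
     (\<exists>(c :: real^'n) (u :: 'n \<Rightarrow> real^'n).
        (\<forall>i j. u i \<bullet> u j = (if i = j then 1 else 0)) \<and>
        E = {x. (\<Sum>i\<in>UNIV. (((x - c) \<bullet> u i) / l $ i)\<^sup>2) \<le> 1})"

definition orthogonal_projection :: "'a::euclidean_space set \<Rightarrow> 'a \<Rightarrow> 'a" where
  "orthogonal_projection L x = (THE y. y \<in> L \<and> (\<forall>z\<in>L. orthogonal (x - y) z))"

text \<open>
  The \<open>k\<close>-dimensional volume, \<open>k = CARD('k)\<close>, of a set lying in some \<open>k\<close>-dimensional affine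
  subspace of the ambient space: its Lebesgue measure in an isometric chart \<open>y \<mapsto> a + A y\<close>
  (the columns of \<open>A\<close> are orthonormal) of such a subspace. The value does not depend on
  the chart: two charts whose ranges contain the set differ on it by a rigid motion, or the set
  lies in a lower-dimensional affine subspace and is null in both. A set contained in no
  \<open>k\<close>-dimensional affine subspace gets an unspecified value.
\<close>

definition k_volume :: "'k::finite itself \<Rightarrow> (real^'n) set \<Rightarrow> real" where
  "k_volume (_ :: 'k::finite itself) S =
     (THE v. \<exists>a (A :: real^'k^'n). transpose A ** A = mat 1 \<and>
        S \<subseteq> range (\<lambda>y. a + A *v y) \<and> v = measure lebesgue {y. a + A *v y \<in> S})"


section \<open>The uniform distribution on the Grassmannian\<close>

definition grassmannian :: "nat \<Rightarrow> (real^'n) set set" where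
  "grassmannian k = {L. subspace L \<and> dim L = k}"

text \<open>
  The Borel \<open>\<sigma>\<close>-algebra of the Grassmannian, whose topology is that of the embedding
  \<open>L \<mapsto> P\<^sub>L\<close> into the space of matrices.
\<close>

definition grassmannian_borel :: "nat \<Rightarrow> (real^'n) set measure" where
  "grassmannian_borel k =
     vimage_algebra (grassmannian k) (\<lambda>L. matrix (orthogonal_projection L) :: real^'n^'n) borel"

definition rotation_invariant_prob :: "nat \<Rightarrow> (real^'n) set measure \<Rightarrow> bool" where
  "rotation_invariant_prob k \<mu> \<longleftrightarrow>
     prob_space \<mu> \<and> sets \<mu> = sets (grassmannian_borel k) \<and>
     (\<forall>Q :: real^'n^'n. rotation_matrix Q \<longrightarrow>
        distr \<mu> (grassmannian_borel k) (\<lambda>L. (*v) Q ` L) = \<mu>)"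

definition uniform_random_subspace :: "'w measure \<Rightarrow> nat \<Rightarrow> ('w \<Rightarrow> (real^'n) set) \<Rightarrow> bool" where
  "uniform_random_subspace M k \<xi> \<longleftrightarrow>
     \<xi> \<in> measurable M (grassmannian_borel k) \<and>
     rotation_invariant_prob k (distr M (grassmannian_borel k) \<xi>)"


section \<open>Random variables\<close>

definition beta_density :: "real \<Rightarrow> real \<Rightarrow> real \<Rightarrow> real" where
  "beta_density a b t =
     (if 0 < t \<and> t < 1
      then Gamma (a + b) / (Gamma a * Gamma b) * t powr (a - 1) * (1 - t) powr (b - 1)
      else 0)"

definition beta_distributed :: "'w measure \<Rightarrow> ('w \<Rightarrow> real) \<Rightarrow> real \<Rightarrow> real \<Rightarrow> bool" where
  "beta_distributed M Z a b \<longleftrightarrow> distributed M lborel Z (\<lambda>t. ennreal (beta_density a b t))"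

text \<open>
  The library's independence of random variables requires a common value type. Here real numbers,
  vectors, matrices and subspaces occur together, so joint independence is expressed by the
  \<open>\<sigma>\<close>-algebras that the variables generate (cf. \<open>prob_space.indep_vars_def2\<close>).
\<close>

definition generated_events :: "'w measure \<Rightarrow> 'b measure \<Rightarrow> ('w \<Rightarrow> 'b) \<Rightarrow> 'w set set" where
  "generated_events M N Z = {Z -` A \<inter> space M | A. A \<in> sets N}"

definition independent_list :: "'w measure \<Rightarrow> 'w set set list \<Rightarrow> bool" where
  "independent_list M Fs \<longleftrightarrow> prob_space.indep_sets M (\<lambda>i. Fs ! i) {..<length Fs}"

definition equal_in_distribution :: "'w measure \<Rightarrow> ('w \<Rightarrow> real) \<Rightarrow> ('w \<Rightarrow> real) \<Rightarrow> bool" where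
  "equal_in_distribution M Y Z \<longleftrightarrow>
     Y \<in> borel_measurable M \<and> Z \<in> borel_measurable M \<and> distr M borel Y = distr M borel Z"

definition scale_rows :: "real^'n \<Rightarrow> real^'k^'n \<Rightarrow> real^'k^'n" where
  "scale_rows l N = (\<chi> i j. l $ i * N $ i $ j)"

end

theory Submission
  imports Defs
begin

text \<open>All three random variables are bounded, and a bounded law is determined by its moments,
  so it suffices to compare \<open>m\<close>-th moments for every \<open>m\<close>. By independence
  each moment splits into moments of Beta variables, which are quotients of Pochhammer symbols, and
  one geometric moment. All geometric moments are traced back to a single quantity, the mean of
  det((LG)^T LG)^m, where G is a Gaussian matrix and L the diagonal matrix of the semi-axes.

  Projections. If the columns of A form an orthonormal basis of a subspace and the ellipsoid is c +
  T(ball), the squared volume of the projected ellipsoid is the squared volume of the unit ball in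
  dimension k times det(A^T T T^T A) (\<open>k_volume_projected_ellipsoid\<close>). This is a
  function of the projection A A^T alone. Rotation invariance determines the law of this projection
  (\<open>rotation_invariant_integral_eq\<close>), and the column space of a Gaussian matrix has
  that law even after reweighting by a power of det(G^T G)
  (\<open>tilted_column_projection_integral\<close>). Since det(G^T W G) = det(G^T G) det(A^T W A)
  when A is an orthonormal basis of the column space of G, the second and third variables have the
  same geometric moment J(m), the mean of the m-th power of det((LG)^T LG) / det(G^T G). Moreover
  J(m) times the mean of det(G^T G)^m is the mean of det((LG)^T LG)^m
  (\<open>invariant_projection_moments\<close>). The mean of det(G^T G)^m is a product of
  chi-squared moments, because a new column multiplies the Gram determinant by its squared distance
  from the span of the earlier ones (\<open>principal_gram_moment\<close>).

  Simplices. An affine map makes the points uniform in the unit ball, and (k!)^2 times the squared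
  volume becomes the Gram determinant of L times the matrix of edges
  (\<open>k_volume_simplex\<close>). A Gaussian vector is a mixture of uniform vectors in centred
  balls, so a function homogeneous of degree 2j has a Gaussian mean that is an explicit constant,
  depending on j and d only, times its mean over the ball. Inverting this by interpolation, the ball
  mean of a polynomial is a signed combination of Gaussian means at finitely many scales
  (\<open>ball_gauss_ray_polynomial\<close>). Applied to one vertex after another
  (\<open>hybrid_expansion\<close>), this leaves Gaussian simplices with scaled vertices. The edge
  matrix of such a simplex is a Gaussian d by k + 1 matrix times a fixed matrix, so the scales enter
  through one explicit factor (\<open>gauss_simplex_moment\<close>), and the sum over all scales
  collapses by Vandermonde's convolution (\<open>interpolation_sum\<close>,
  \<open>ball_simplex_moment\<close>).

  What remains is an identity between Pochhammer symbols (\<open>moment_identity\<close>).\<close>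

section \<open>Orthonormal frames and Gram determinants\<close>

definition gram :: "real^'k^'n \<Rightarrow> real" where
  "gram A = det (transpose A ** A)"

definition frame :: "real^'k^'n \<Rightarrow> bool" where
  "frame A \<longleftrightarrow> transpose A ** A = mat 1"

lemma gram_frame: "frame A \<Longrightarrow> gram A = 1"
  by (simp add: frame_def gram_def)

lemma gram_mult_square: "gram (A ** C) = (det C)\<^sup>2 * gram A"
  by (simp add: gram_def matrix_transpose_mul matrix_mul_assoc det_mul power2_eq_square)
     (simp add: matrix_mul_assoc[symmetric] det_mul)

lemma frame_mult: "frame A \<Longrightarrow> frame B \<Longrightarrow> frame (A ** B)"
  unfolding frame_def matrix_transpose_mul
  by (metis matrix_mul_assoc matrix_mul_lid)

lemma frame_mult_left: "frame A \<Longrightarrow> transpose (A ** B) ** (A ** C) = transpose B ** C"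
  unfolding frame_def matrix_transpose_mul by (metis matrix_mul_assoc matrix_mul_lid)

lemma gram_frame_left: "frame A \<Longrightarrow> gram (A ** B) = gram B"
  unfolding gram_def by (simp add: frame_mult_left)

lemma frame_inner: "frame A \<Longrightarrow> (A *v x) \<bullet> (A *v y) = x \<bullet> y"
  unfolding frame_def
  by (metis dot_lmul_matrix matrix_vector_mul_assoc matrix_vector_mul_lid transpose_matrix_vector)

lemma frame_norm: "frame A \<Longrightarrow> norm (A *v x) = norm x"
  by (simp add: norm_eq_sqrt_inner frame_inner)

lemma frame_transpose_cancel: "frame A \<Longrightarrow> transpose A *v (A *v x) = x"
  unfolding frame_def by (metis matrix_vector_mul_assoc matrix_vector_mul_lid)

lemma frame_project_cancel:
  assumes "frame A" "x \<in> range ((*v) A)"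
  shows "A *v (transpose A *v x) = x"
  using assms frame_transpose_cancel by fastforce

lemma frame_iff_columns:
  "frame A \<longleftrightarrow> (\<forall>i j. column i A \<bullet> column j A = (if i = j then 1 else 0))"
  unfolding frame_def
  by (simp add: vec_eq_iff matrix_matrix_mult_def transpose_def mat_def column_def inner_vec_def)

lemma range_matrix_span_columns: "range ((*v) (A::real^'k^'n)) = span (columns A)"
proof
  show "range ((*v) A) \<subseteq> span (columns A)" using matrix_vector_mult_in_columnspace by blast
  show "span (columns A) \<subseteq> range ((*v) A)"
    unfolding columns_image_basis
    by (intro span_minimal linear_subspace_image matrix_vector_mul_linear) auto
qed

lemma frame_exists:
  fixes L :: "(real^'n) set"
  assumes "subspace L" "dim L = CARD('k)"
  obtains A :: "real^'k^'n" where "frame A" "range ((*v) A) = L"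
proof -
  obtain B where B: "B \<subseteq> L" "pairwise orthogonal B" "\<And>x. x \<in> B \<Longrightarrow> norm x = 1"
    "independent B" "card B = dim L" "span B = L"
    using orthonormal_basis_subspace[OF assms(1)] by blast
  have "finite B" using B(4) independent_imp_finite by blast
  then obtain b :: "'k \<Rightarrow> real^'n" where b: "bij_betw b UNIV B"
    using B(5) assms(2) finite_same_card_bij[of "UNIV::'k set" B] by auto
  define A :: "real^'k^'n" where "A = (\<chi> i j. b j $ i)"
  have col: "column j A = b j" for j by (simp add: A_def column_def vec_eq_iff)
  have "frame A" unfolding frame_iff_columns col
  proof (intro allI)
    fix i j
    have "b i \<in> B" "b j \<in> B" using b by (auto simp: bij_betw_def)
    moreover have "i \<noteq> j \<Longrightarrow> b i \<noteq> b j" using b by (auto simp: bij_betw_def inj_on_def)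
    ultimately show "b i \<bullet> b j = (if i = j then 1 else 0)"
      using B(2,3) by (auto simp: pairwise_def orthogonal_def dot_square_norm)
  qed
  moreover have "columns A = B" using b by (auto simp: columns_def col bij_betw_def)
  hence "range ((*v) A) = L" using B(6) range_matrix_span_columns[of A] by simp
  ultimately show ?thesis using that by blast
qed

text \<open>A basis of \<open>S\<close> is enlarged to \<open>k\<close> independent vectors, whose
  span then carries a frame. Only an inequality on \<open>dim S\<close> is asked for, so the result
  also serves rank-deficient matrices and degenerate simplices.\<close>

lemma frame_exists_superset:
  fixes S :: "(real^'n) set"
  assumes "dim S \<le> CARD('k)" "CARD('k) \<le> CARD('n)"
  obtains A :: "real^'k^'n" where "frame A" "S \<subseteq> range ((*v) A)"
proof -
  obtain B where B: "B \<subseteq> S" "independent B" "S \<subseteq> span B" "card B = dim S"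
    using basis_exists by blast
  obtain C where C: "B \<subseteq> C" "independent C" "span C = (UNIV::(real^'n) set)"
    by (metis B(2) maximal_independent_subset_extend subset_UNIV top.extremum_uniqueI)
  have fC: "finite C" using C(2) independent_imp_finite by blast
  have cC: "card C = CARD('n)" using C(2,3) dim_eq_card by (metis dim_UNIV DIM_cart DIM_real mult.right_neutral dim_span_eq_card_independent)
  obtain D where D: "B \<subseteq> D" "D \<subseteq> C" "card D = CARD('k)"
    using exists_subset_between[of B "CARD('k)" C] assms B(4) C(1) cC fC by auto
  have iD: "independent D" using D(2) C(2) independent_mono by blast
  obtain A :: "real^'k^'n" where A: "frame A" "range ((*v) A) = span D"
    using frame_exists[of "span D"] iD D(3) by (metis dim_span_eq_card_independent subspace_span)
  have "S \<subseteq> span D" using B(3) D(1) span_mono by blast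
  with A that show ?thesis by auto
qed

text \<open>\<open>A ** transpose A\<close> is the identity on the range of \<open>A\<close>, hence
  on every column of \<open>B\<close>. When \<open>B\<close> has as many columns as
  \<open>A\<close>, the second factor is square; in this form the factorisation plays the part of a
  QR decomposition.\<close>

lemma frame_factor:
  fixes A :: "real^'k^'n" and B :: "real^'m^'n"
  assumes "frame A" "range ((*v) B) \<subseteq> range ((*v) A)"
  shows "B = A ** (transpose A ** B)"
proof -
  have "A *v (transpose A *v (B *v x)) = B *v x" for x
    using assms by (intro frame_project_cancel) auto
  thus ?thesis by (simp add: matrix_eq matrix_vector_mul_assoc matrix_mul_assoc)
qed

lemma dim_range_matrix_le: "dim (range ((*v) (A::real^'k^'n))) \<le> CARD('k)"
  by (metis dim_image_le dim_UNIV matrix_vector_mul_linear DIM_cart DIM_real mult.right_neutral)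

text \<open>In a frame whose range contains the columns of \<open>B\<close>, the Gram determinant is
  the square of the determinant of the coordinate matrix.\<close>

lemma gram_nonneg:
  fixes B :: "real^'k^'n"
  assumes "CARD('k) \<le> CARD('n)"
  shows "0 \<le> gram B"
proof -
  obtain A :: "real^'k^'n" where A: "frame A" "range ((*v) B) \<subseteq> range ((*v) A)"
    using frame_exists_superset[OF dim_range_matrix_le assms] by metis
  have "B = A ** (transpose A ** B)" by (rule frame_factor[OF A])
  then have "gram B = gram (A ** (transpose A ** B))" by simp
  also have "\<dots> = (det (transpose A ** B))\<^sup>2" using gram_mult_square gram_frame[OF A(1)] by (metis mult.right_neutral)
  finally show ?thesis by simp
qed

lemma gram_nonzero_range:
  fixes G :: "real^'k^'n"
  assumes "gram G \<noteq> 0"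
  shows "dim (range ((*v) G)) = CARD('k)"
proof -
  have "invertible (transpose G ** G)" using assms by (simp add: gram_def invertible_det_nz)
  then have inj: "inj ((*v) (transpose G ** G))" 
    by (simp add: invertible_eq_bij bij_is_inj)
  have "inj ((*v) G)"
  proof (rule injI)
    fix x y assume "G *v x = G *v y"
    then have "(transpose G ** G) *v x = (transpose G ** G) *v y" by (simp add: matrix_vector_mul_assoc[symmetric])
    with inj show "x = y" by (simp add: inj_def)
  qed
  then show ?thesis using dim_image_eq[of "(*v) G" UNIV] by (simp add: dim_UNIV)
qed

lemma orthogonal_projection_frame:
  fixes A :: "real^'k^'n"
  assumes "frame A"
  shows "orthogonal_projection (range ((*v) A)) x = A *v (transpose A *v x)"
  unfolding orthogonal_projection_def
proof (rule the_equality, safe)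
  show "A *v (transpose A *v x) \<in> range ((*v) A)" by blast
next
  fix y show "orthogonal (x - A *v (transpose A *v x)) (A *v y)"
    using frame_inner[OF assms, of "transpose A *v x" y]
    by (simp add: orthogonal_def inner_diff_left) 
       (metis dot_lmul_matrix inner_commute transpose_matrix_vector)
next
  fix y assume y: "\<forall>z\<in>range ((*v) A). orthogonal (x - A *v y) z"
  have "(x - A *v y) \<bullet> (A *v z) = 0" for z using y by (auto simp: orthogonal_def)
  then have "(transpose A *v x - y) \<bullet> z = 0" for z
    by (simp add: inner_diff_left frame_inner[OF assms])
       (metis dot_lmul_matrix inner_commute transpose_matrix_vector)
  then have "transpose A *v x = y" by (metis eq_iff_diff_eq_0 inner_eq_zero_iff)
  then show "A *v y = A *v (transpose A *v x)" by simp
qed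

lemma matrix_orthogonal_projection_frame:
  fixes A :: "real^'k^'n"
  assumes "frame A"
  shows "matrix (orthogonal_projection (range ((*v) A))) = A ** transpose A"
proof -
  have "orthogonal_projection (range ((*v) A)) = (*v) (A ** transpose A)"
    unfolding fun_eq_iff matrix_vector_mul_assoc[symmetric] using orthogonal_projection_frame[OF assms] by blast
  then show ?thesis by simp
qed

lemma matrix_add_rdistrib_aux: "((A::real^'m^'n) + B) ** (C::real^'k^'m) = A ** C + B ** C"
  by (simp add: matrix_matrix_mult_def vec_eq_iff distrib_right sum.distrib)

section \<open>Reflections, and rotations carrying one frame to another\<close>

text \<open>Conjugation by an orthogonal \<open>Q\<close> that carries a multiple of a coordinate
  axis to \<open>v\<close> makes the matrix diagonal, with one entry
  \<open>1 + c * (v \<bullet> v)\<close> and all others 1.\<close>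

lemma det_identity_plus_rank_one:
  fixes v :: "real^'n"
  shows "det (mat 1 + (\<chi> i j. c * v $ i * v $ j)) = 1 + c * (v \<bullet> v)"
proof (cases "v = 0")
  case True then show ?thesis by (simp add: zero_vec_def[symmetric])
next
  case False
  \<comment> \<open>This only fixes some index \<open>j\<close>, the axis along which
    \<open>e\<close> will point.\<close>
  obtain j :: 'n where True by simp
  define e :: "real^'n" where "e = norm v *\<^sub>R axis j 1"
  have "norm e = norm v" by (simp add: e_def)
  then obtain f where f: "orthogonal_transformation f" "f e = v"
    using orthogonal_transformation_exists by metis
  define Q where "Q = matrix f"
  have Q: "orthogonal_matrix Q" "Q *v e = v"
    using f by (auto simp: Q_def orthogonal_transformation_matrix matrix_works orthogonal_transformation_linear)
  have QQ: "Q ** transpose Q = mat 1" using Q(1) by (simp add: orthogonal_matrix_def)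
  define E :: "real^'n^'n" where "E = (\<chi> i l. c * e $ i * e $ l)"
  have "Q ** E ** transpose Q = (\<chi> i j. c * (Q *v e) $ i * (Q *v e) $ j)"
  proof -
    have "(\<Sum>n\<in>UNIV. Q $ i $ n * (c * e $ n * e $ k)) = c * (Q *v e) $ i * e $ k" for i k
      by (simp add: matrix_vector_mult_def sum_distrib_left sum_distrib_right algebra_simps)
    then have "(\<Sum>k\<in>UNIV. (\<Sum>n\<in>UNIV. Q $ i $ n * (c * e $ n * e $ k)) * Q $ j $ k)
        = c * (Q *v e) $ i * (\<Sum>k\<in>UNIV. Q $ j $ k * e $ k)" for i j
      by (simp add: sum_distrib_left algebra_simps)
    then show ?thesis
      by (simp add: vec_eq_iff E_def matrix_matrix_mult_def transpose_def) (simp add: matrix_vector_mult_def)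
  qed
  then have "mat 1 + (\<chi> i j. c * v $ i * v $ j) = Q ** (mat 1 + E) ** transpose Q"
    using Q(2) by (simp add: matrix_add_ldistrib matrix_add_rdistrib_aux QQ)
  then have "det (mat 1 + (\<chi> i j. c * v $ i * v $ j)) = det (mat 1 + E) * (det Q * det (transpose Q))"
    by (simp add: det_mul algebra_simps)
  also have "det Q * det (transpose Q) = 1" using QQ by (metis det_I det_mul)
  also have "det (mat 1 + E) = (\<Prod>i\<in>UNIV. (mat 1 + E) $ i $ i)"
    by (rule det_diagonal) (auto simp: E_def e_def axis_def mat_def)
  also have "\<dots> = (\<Prod>i\<in>UNIV. if i = j then 1 + c * (v \<bullet> v) else 1)"
    by (rule prod.cong) (auto simp: E_def e_def axis_def mat_def dot_square_norm power2_eq_square)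
  finally show ?thesis by simp
qed

text \<open>The Householder reflection in the hyperplane orthogonal to \<open>v\<close>; its
  determinant 1 - 2 comes from the rank-one formula.\<close>

lemma reflection_matrix_exists:
  fixes v :: "real^'n"
  assumes "norm v = 1"
  obtains R :: "real^'n^'n" where "orthogonal_matrix R" "det R = -1" "\<And>x. v \<bullet> x = 0 \<Longrightarrow> R *v x = x"
proof -
  define R :: "real^'n^'n" where "R = mat 1 + (\<chi> i j. (-2) * v $ i * v $ j)"
  have vv: "v \<bullet> v = 1" using assms by (simp add: dot_square_norm)
  have d: "det R = -1" unfolding R_def det_identity_plus_rank_one vv by simp
  have Rx: "R *v x = x - (2 * (v \<bullet> x)) *\<^sub>R v" for x
    unfolding R_def matrix_vector_mult_add_rdistrib matrix_vector_mul_lid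
    by (auto simp: vec_eq_iff matrix_vector_mult_def inner_vec_def sum_distrib_left sum_distrib_right algebra_simps sum_negf)
  have "norm (R *v x) = norm x" for x
    unfolding Rx norm_eq_sqrt_inner 
    by (simp add: inner_diff_left inner_diff_right vv inner_commute algebra_simps)
  then have "orthogonal_transformation ((*v) R)" by (simp add: orthogonal_transformation)
  then have "orthogonal_matrix R" by (simp add: orthogonal_transformation_matrix)
  with d show ?thesis using that Rx by auto
qed

text \<open>Transitivity of the rotations on subspaces, phrased with projections because these
  forget the choice of basis. An isometry is glued from a map between the two ranges and a map
  between their orthogonal complements; afterwards the sign of its determinant is corrected.\<close>

lemma rotation_between_frames:
  fixes A B :: "real^'k^'n"
  assumes A: "frame A" and B: "frame B"
  obtains Q :: "real^'n^'n" where "rotation_matrix Q"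
    "Q ** (A ** transpose A) ** transpose Q = B ** transpose B"
proof -
  let ?L = "range ((*v) A)" and ?M = "range ((*v) B)"
  have sL: "subspace ?L" and sM: "subspace ?M"
    by (auto intro!: linear_subspace_image)
  have dL: "dim ?L = CARD('k)" "dim ?M = CARD('k)"
    using gram_nonzero_range gram_frame A B by force+
  define S where "S = {y. \<forall>x\<in>?L. orthogonal x y}"
  define T where "T = {y. \<forall>x\<in>?M. orthogonal x y}"
  have "subspace S" "subspace T" unfolding S_def T_def by (auto simp: subspace_def orthogonal_clauses)
  have dS: "dim S + CARD('k) = CARD('n)" "dim T + CARD('k) = CARD('n)"
    using dim_subspace_orthogonal_to_vectors[OF sL subspace_UNIV] dim_subspace_orthogonal_to_vectors[OF sM subspace_UNIV]
    by (auto simp: S_def T_def dL)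
  then obtain f where f: "linear f" "f ` S = T" "\<And>x. x \<in> S \<Longrightarrow> norm (f x) = norm x"
    using isometries_subspaces[OF \<open>subspace S\<close> \<open>subspace T\<close>] by (metis add_right_cancel)
  define r where "r x = x - A *v (transpose A *v x)" for x
  have r: "r x \<in> S" for x unfolding S_def r_def
  proof safe
    fix y show "orthogonal (A *v y) (x - A *v (transpose A *v x))"
      using frame_inner[OF A, of y "transpose A *v x"]
      by (simp add: orthogonal_def inner_diff_right)
         (metis dot_lmul_matrix inner_commute transpose_matrix_vector)
  qed
  have lr: "linear r" unfolding r_def
    by (intro linear_compose_sub linear_ident linear_compose[OF matrix_vector_mul_linear matrix_vector_mul_linear, unfolded o_def])
  \<comment> \<open>\<open>h\<close> carries \<open>A *v y\<close> to \<open>B *v y\<close> and maps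
    the complement of the first range isometrically onto that of the second.\<close>
  define h where "h x = B *v (transpose A *v x) + f (r x)" for x
  have lh: "linear h" unfolding h_def
    by (intro linear_compose_add linear_compose[OF lr f(1), unfolded o_def]
        linear_compose[OF matrix_vector_mul_linear matrix_vector_mul_linear, unfolded o_def])
  have "norm (h x) = norm x" for x
  proof -
    have "f (r x) \<in> T" using r f(2) by blast
    then have "orthogonal (B *v (transpose A *v x)) (f (r x))" by (auto simp: T_def)
    then have "(norm (h x))\<^sup>2 = (norm (B *v (transpose A *v x)))\<^sup>2 + (norm (f (r x)))\<^sup>2"
      unfolding h_def by (rule norm_add_Pythagorean)
    also have "\<dots> = (norm (A *v (transpose A *v x)))\<^sup>2 + (norm (r x))\<^sup>2"
      using f(3)[OF r] by (simp add: frame_norm[OF A] frame_norm[OF B])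
    also have "\<dots> = (norm (A *v (transpose A *v x) + r x))\<^sup>2"
      using r[of x] by (intro norm_add_Pythagorean[symmetric]) (auto simp: S_def)
    also have "A *v (transpose A *v x) + r x = x" by (simp add: r_def)
    finally show ?thesis by simp
  qed
  then have oh: "orthogonal_transformation h" using lh by (simp add: orthogonal_transformation)
  define Q where "Q = matrix h"
  have oQ: "orthogonal_matrix Q" using oh by (simp add: Q_def orthogonal_transformation_matrix)
  have "Q *v (A *v y) = B *v y" for y
    using lh linear_0[OF f(1)] frame_transpose_cancel[OF A] by (simp add: Q_def matrix_works h_def r_def)
  then have QA: "Q ** A = B" by (simp add: matrix_eq matrix_vector_mul_assoc[symmetric])
  have conj: "Q' ** (A ** transpose A) ** transpose Q' = B ** transpose B" if "Q' ** A = B" for Q'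
    using that by (metis matrix_mul_assoc matrix_transpose_mul)
  show ?thesis
  proof (cases "det Q = 1")
    case True then show ?thesis using that[of Q] oQ conj[OF QA] by (simp add: rotation_matrix_def)
  next
    case False
    then have dQ: "det Q = -1" using det_orthogonal_matrix[OF oQ] by auto
    \<comment> \<open>The sign is repaired by a reflection in a direction orthogonal to the range of
      \<open>B\<close>, which leaves \<open>B\<close> fixed. Such a direction exists unless the
      frames are square, and then both projections are the identity.\<close>
    show ?thesis
    proof (cases "CARD('k) = CARD('n)")
      case True
      have UN: "?L = UNIV" "?M = UNIV"
        using dim_eq_full[of ?L] dim_eq_full[of ?M] sL sM dL True
        by (simp_all add: span_eq_iff[THEN iffD2])
      have "A *v (transpose A *v x) = x" "B *v (transpose B *v x) = x" for x
        using frame_project_cancel[OF A] frame_project_cancel[OF B] UN by auto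
      then have "A ** transpose A = mat 1" "B ** transpose B = mat 1"
        by (auto simp: matrix_eq matrix_vector_mul_assoc[symmetric] simp del: transpose_matrix_vector)
      then show ?thesis using that[of "mat 1"] by (simp add: rotation_matrix_def orthogonal_matrix_def)
    next
      case False
      then have "dim T \<noteq> 0" using dS(2) by linarith
      then obtain w where w: "w \<in> T" "w \<noteq> 0" by (metis dim_eq_0 subset_singleton_iff subsetI singletonI)
      define v where "v = w /\<^sub>R norm w"
      have v: "v \<in> T" "norm v = 1" using w \<open>subspace T\<close> by (auto simp: v_def subspace_scale)
      obtain R :: "real^'n^'n" where R: "orthogonal_matrix R" "det R = -1" "\<And>x. v \<bullet> x = 0 \<Longrightarrow> R *v x = x"
        using reflection_matrix_exists[OF v(2)] by blast
      have "R *v (B *v y) = B *v y" for y using R(3) v(1) by (auto simp: T_def orthogonal_def inner_commute)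
      then have "R ** B = B" by (simp add: matrix_eq matrix_vector_mul_assoc[symmetric])
      then have "(R ** Q) ** A = B" using QA by (simp add: matrix_mul_assoc[symmetric])
      moreover have "rotation_matrix (R ** Q)"
        using R oQ dQ by (simp add: rotation_matrix_def orthogonal_matrix_mul det_mul)
      ultimately show ?thesis using that conj by blast
    qed
  qed
qed

section \<open>The determinant of a compression as a function of the projection\<close>

definition row_selection :: "('k \<Rightarrow> 'n) \<Rightarrow> real^'k^'n" where
  "row_selection s = (\<chi> i j. if i = s j then 1 else 0)"

text \<open>On \<open>A ** D ** transpose A\<close> with a frame \<open>A\<close> this is
  \<open>det D\<close> times a nonzero factor depending on \<open>A\<close> only. Summing over all
  maps \<open>s\<close>, injective or not, gives a plain polynomial in the entries of
  \<open>P\<close>.\<close>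

definition projection_minor_sum :: "'k::finite itself \<Rightarrow> real^'n^'n \<Rightarrow> real" where
  "projection_minor_sum _ P = (\<Sum>s\<in>(UNIV :: ('k \<Rightarrow> 'n) set). det (transpose (row_selection s) ** P ** row_selection s))"

text \<open>For the projection \<open>P\<close> onto the range of a frame \<open>A\<close> this is
  \<open>det (transpose A ** W ** A)\<close>, the determinant of the compression of \<open>W\<close>
  to that range. The quotient of minor sums involves no choice of a basis and is rational in the
  entries of \<open>P\<close>, which yields continuity and measurability.\<close>

definition compressed_det :: "'k::finite itself \<Rightarrow> real^'n^'n \<Rightarrow> real^'n^'n \<Rightarrow> real" where
  "compressed_det K W P = projection_minor_sum K (P ** W ** P) / projection_minor_sum K P"

definition frame_projections :: "'k::finite itself \<Rightarrow> (real^'n^'n) set" where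
  "frame_projections _ = (\<lambda>A :: real^'k^'n. A ** transpose A) ` {A. frame A}"

lemma projection_minor_sum_conj:
  fixes A :: "real^'k^'n"
  shows "projection_minor_sum TYPE('k) (A ** D ** transpose A) =
    det D * (\<Sum>s\<in>(UNIV :: ('k \<Rightarrow> 'n) set). (det (transpose (row_selection s) ** A))\<^sup>2)"
proof -
  have "det (transpose (row_selection s) ** (A ** D ** transpose A) ** row_selection s) =
     det D * (det (transpose (row_selection s) ** A))\<^sup>2" for s :: "'k \<Rightarrow> 'n"
  proof -
    let ?B = "row_selection s :: real^'k^'n"
    have "transpose ?B ** (A ** D ** transpose A) ** ?B = (transpose ?B ** A) ** D ** transpose (transpose ?B ** A)"
      by (simp add: matrix_transpose_mul matrix_mul_assoc)
    then show ?thesis by (simp add: det_mul power2_eq_square del: matrix_transpose_mul)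
  qed
  then show ?thesis by (simp add: projection_minor_sum_def sum_distrib_left)
qed

text \<open>Multilinearity: expanding every row produces a sum of determinants that are all assumed
  to vanish.\<close>

lemma det_rows_sum_eq_0:
  fixes a :: "'k::finite \<Rightarrow> 'n::finite \<Rightarrow> real^'k"
  assumes z: "\<And>s. det (\<chi> i. a i (s i)) = 0"
  shows "det (\<chi> i. \<Sum>l\<in>UNIV. a i l) = 0"
proof -
  \<comment> \<open>Induction on the set \<open>T\<close> of rows that still carry the whole sum.
    The choice \<open>s\<close> for the other rows must vary, since expanding row \<open>z\<close>
    into its summand \<open>l\<close> changes \<open>s z\<close> to \<open>l\<close>.\<close>
  have "det (\<chi> i. if i \<in> T then \<Sum>l\<in>UNIV. a i l else a i (s i)) = 0" if "finite T" for T s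
    using that
  proof (induction T arbitrary: s)
    case empty
    then show ?case using z by simp
  next
    case (insert z T)
    have "(if i \<in> insert z T then \<Sum>l\<in>UNIV. a i l else a i (s i)) =
        (if i = z then \<Sum>l\<in>UNIV. a z l else if i \<in> T then \<Sum>l\<in>UNIV. a i l else a i (s i))" for i
      by auto
    then have "det (\<chi> i. if i \<in> insert z T then \<Sum>l\<in>UNIV. a i l else a i (s i)) =
        (\<Sum>l\<in>UNIV. det (\<chi> i. if i = z then a z l else if i \<in> T then \<Sum>l\<in>UNIV. a i l else a i (s i)))"
      by (simp add: det_linear_row_sum)
    also have "\<dots> = (\<Sum>l\<in>UNIV. det (\<chi> i. if i \<in> T then \<Sum>l\<in>UNIV. a i l else a i ((s(z := l)) i)))"
      using insert.hyps by (intro sum.cong arg_cong[of _ _ det]) (auto simp: vec_eq_iff)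
    also have "\<dots> = 0" using insert.IH by simp
    finally show ?case .
  qed
  from this[of UNIV undefined] show ?thesis by simp
qed

text \<open>Expanding \<open>det (A\<^sup>T A)\<close> along its rows expresses it through the maximal minors of \<open>A\<close>.\<close>

lemma frame_minor_nonzero:
  fixes A :: "real^'k^'n"
  assumes "frame A"
  shows "(\<Sum>s\<in>(UNIV :: ('k \<Rightarrow> 'n) set). (det (transpose (row_selection s) ** A))\<^sup>2) \<noteq> 0"
proof
  assume "(\<Sum>s\<in>(UNIV :: ('k \<Rightarrow> 'n) set). (det (transpose (row_selection s) ** A))\<^sup>2) = 0"
  then have z: "det (transpose (row_selection s) ** A) = 0" for s :: "'k \<Rightarrow> 'n"
    by (subst (asm) sum_nonneg_eq_0_iff) auto
  have sel: "transpose (row_selection s) ** A = (\<chi> j. A $ s j)" for s :: "'k \<Rightarrow> 'n"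
    by (simp add: vec_eq_iff row_selection_def transpose_def matrix_matrix_mult_def if_distrib if_distribR cong: if_cong)
  have "transpose A ** A = (\<chi> i. \<Sum>l\<in>UNIV. A $ l $ i *s A $ l)"
    by (simp add: vec_eq_iff transpose_def matrix_matrix_mult_def)
  then have "1 = det (\<chi> i. \<Sum>l\<in>UNIV. A $ l $ i *s A $ l)"
    using gram_frame[OF assms] by (simp add: gram_def)
  also have "\<dots> = 0"
    by (rule det_rows_sum_eq_0) (use z in \<open>simp add: sel det_rows_mul\<close>)
  finally show False by simp
qed

text \<open>The sum of squared minors of \<open>A\<close> appears in numerator and denominator and
  cancels, being nonzero for a frame.\<close>

lemma compressed_det_frame:
  fixes A :: "real^'k^'n"
  assumes "frame A"
  shows "compressed_det TYPE('k) W (A ** transpose A) = det (transpose A ** W ** A)"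
proof -
  have 1: "(A ** transpose A) ** W ** (A ** transpose A) = A ** (transpose A ** W ** A) ** transpose A"
    by (simp add: matrix_mul_assoc)
  have 2: "projection_minor_sum TYPE('k) (A ** transpose A) =
      (\<Sum>s\<in>(UNIV :: ('k \<Rightarrow> 'n) set). (det (transpose (row_selection s) ** A))\<^sup>2)"
    using projection_minor_sum_conj[of A "mat 1"] by simp
  show ?thesis
    unfolding compressed_det_def 1 projection_minor_sum_conj 2
    by (simp add: frame_minor_nonzero[OF assms])
qed

section \<open>The projection onto the column space of a matrix\<close>

text \<open>The inverse is given by Cramer's rule, entry by entry as a quotient of determinants, so
  that Borel measurability holds on all matrices, singular ones included.\<close>

definition cramer_inverse :: "real^'k^'k \<Rightarrow> real^'k^'k" where
  "cramer_inverse S = (\<chi> i j. det (\<chi> a b. if b = i then mat 1 $ a $ j else S $ a $ b) / det S)"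

lemma cramer_inverse_right:
  fixes S :: "real^'k^'k"
  assumes "det S \<noteq> 0"
  shows "S ** cramer_inverse S = mat 1"
proof -
  have "S *v column j (cramer_inverse S) = column j (mat 1)" for j
    unfolding cramer[OF assms] by (simp add: cramer_inverse_def column_def vec_eq_iff mat_def cong: if_cong)
  then show ?thesis
    by (simp add: vec_eq_iff column_def matrix_vector_mult_def matrix_matrix_mult_def)
qed

text \<open>When \<open>gram G\<close> is nonzero this is the orthogonal projection onto the column
  space of \<open>G\<close>, as an explicit measurable function of \<open>G\<close>.\<close>

definition column_projection :: "real^'k^'n \<Rightarrow> real^'n^'n" where
  "column_projection G = G ** cramer_inverse (transpose G ** G) ** transpose G"

text \<open>With a frame \<open>A\<close> of the column space, \<open>G = A ** C\<close> for an
  invertible square \<open>C\<close>, which cancels in the projection. The last property separates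
  \<open>det (transpose G ** W ** G)\<close> into the Gram determinant and a factor depending on the
  column space alone.\<close>

lemma column_projection_frame:
  fixes G :: "real^'k^'n"
  assumes "gram G \<noteq> 0"
  obtains A :: "real^'k^'n" where "frame A" "column_projection G = A ** transpose A"
    "\<And>W. det (transpose G ** W ** G) = gram G * det (transpose A ** W ** A)"
proof -
  obtain A :: "real^'k^'n" where A: "frame A" "range ((*v) A) = range ((*v) G)"
    using frame_exists[of "range ((*v) G)"] gram_nonzero_range[OF assms]
    by (metis linear_subspace_image matrix_vector_mul_linear subspace_UNIV)
  define C where "C = transpose A ** G"
  have G: "G = A ** C" unfolding C_def using A by (intro frame_factor) auto
  have gG: "gram G = (det C)\<^sup>2" unfolding G gram_mult_square gram_frame[OF A(1)] by simp
  have GG: "transpose G ** G = transpose C ** C" unfolding G by (rule frame_mult_left[OF A(1)])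
  define S where "S = cramer_inverse (transpose G ** G)"
  have "transpose C ** (C ** S) = mat 1"
    using cramer_inverse_right[of "transpose G ** G"] assms by (simp add: S_def gram_def GG matrix_mul_assoc)
  then have "C ** S ** transpose C = mat 1" by (simp add: matrix_left_right_inverse)
  moreover have "column_projection G = A ** (C ** S ** transpose C) ** transpose A"
    unfolding column_projection_def S_def[symmetric] by (simp add: G matrix_mul_assoc matrix_transpose_mul)
  ultimately have "column_projection G = A ** transpose A" by simp
  moreover have "det (transpose G ** W ** G) = gram G * det (transpose A ** W ** A)" for W
  proof -
    have "transpose G ** W ** G = transpose C ** (transpose A ** W ** A) ** C"
      by (simp add: G matrix_mul_assoc matrix_transpose_mul)
    then show ?thesis by (simp add: det_mul gG power2_eq_square)
  qed
  ultimately show ?thesis using that A(1) by blast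
qed

lemma column_projection_orthogonal:
  fixes G :: "real^'k^'n" and Q :: "real^'n^'n"
  assumes "orthogonal_matrix Q"
  shows "column_projection (Q ** G) = Q ** column_projection G ** transpose Q"
proof -
  have "frame Q" using assms by (simp add: orthogonal_matrix_def frame_def)
  then show ?thesis
    unfolding column_projection_def frame_mult_left[OF \<open>frame Q\<close>]
    by (simp add: matrix_transpose_mul matrix_mul_assoc)
qed

section \<open>Compactness, continuity and measurability of these constructions\<close>

lemma compact_frames: "compact {A :: real^'k^'n. frame A}"
proof -
  have "closed {A :: real^'k^'n. frame A}"
    unfolding frame_def matrix_matrix_mult_def transpose_def
    by (intro closed_Collect_eq continuous_intros)
  moreover have "bounded {A :: real^'k^'n. frame A}"
  proof (rule boundedI)
    fix A :: "real^'k^'n" assume "A \<in> {A. frame A}"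
    then have c: "norm (column j A) = 1" for j by (simp add: frame_iff_columns norm_eq_1)
    have "norm A \<le> (\<Sum>i\<in>UNIV. norm (A $ i))" by (simp add: norm_vec_def L2_set_le_sum)
    also have "\<dots> \<le> (\<Sum>i\<in>(UNIV::'n set). \<Sum>j\<in>(UNIV::'k set). \<bar>A $ i $ j\<bar>)"
      by (intro sum_mono norm_le_l1_cart)
    also have "\<dots> \<le> (\<Sum>i\<in>(UNIV::'n set). \<Sum>j\<in>(UNIV::'k set). 1)"
    proof (intro sum_mono)
      fix i j show "\<bar>A $ i $ j\<bar> \<le> 1"
        using component_le_norm_cart[of "column j A" i] c[of j] by (simp add: column_def)
    qed
    finally show "norm A \<le> (\<Sum>i\<in>(UNIV::'n set). \<Sum>j\<in>(UNIV::'k set). 1)" .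
  qed
  ultimately show ?thesis by (simp add: compact_eq_bounded_closed)
qed

lemma continuous_on_matrix_mult [continuous_intros]:
  fixes f :: "'x::topological_space \<Rightarrow> real^'m^'n" and g :: "'x \<Rightarrow> real^'k^'m"
  assumes "continuous_on S f" "continuous_on S g"
  shows "continuous_on S (\<lambda>x. f x ** g x)"
  unfolding matrix_matrix_mult_def by (intro assms continuous_intros)

lemma continuous_on_transpose [continuous_intros]:
  fixes f :: "'x::topological_space \<Rightarrow> real^'m^'n"
  assumes "continuous_on S f"
  shows "continuous_on S (\<lambda>x. transpose (f x))"
  unfolding transpose_def by (intro assms continuous_intros)

lemma continuous_on_det [continuous_intros]:
  fixes f :: "'x::topological_space \<Rightarrow> real^'n^'n"
  assumes "continuous_on S f"
  shows "continuous_on S (\<lambda>x. det (f x))"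
  unfolding det_def by (intro assms continuous_intros)

lemma compact_frame_projections: "compact (frame_projections TYPE('k::finite) :: (real^'n^'n) set)"
  unfolding frame_projections_def
  by (intro compact_continuous_image compact_frames continuous_on_matrix_mult continuous_on_transpose continuous_on_id)

lemma continuous_on_projection_minor_sum [continuous_intros]:
  assumes "continuous_on S f"
  shows "continuous_on S (\<lambda>x. projection_minor_sum K (f x))"
  unfolding projection_minor_sum_def by (intro assms continuous_intros)

lemma continuous_on_compressed_det:
  "continuous_on (frame_projections TYPE('k::finite)) (compressed_det TYPE('k) (W :: real^'n^'n))"
proof -
  have "projection_minor_sum TYPE('k) P \<noteq> 0" if P: "P \<in> frame_projections TYPE('k)" for P :: "real^'n^'n"
  proof -
    obtain A :: "real^'k^'n" where A: "frame A" "P = A ** transpose A"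
      using P unfolding frame_projections_def by blast
    then show ?thesis using projection_minor_sum_conj[of A "mat 1"] frame_minor_nonzero[OF A(1)] by simp
  qed
  then show ?thesis
    unfolding compressed_det_def[abs_def]
    by (intro continuous_on_divide continuous_on_projection_minor_sum continuous_on_matrix_mult
        continuous_on_const continuous_on_id) blast
qed

lemma measurable_projection_minor_sum [measurable]: "(\<lambda>x. projection_minor_sum K x) \<in> borel_measurable borel"
  by (intro borel_measurable_continuous_onI continuous_on_projection_minor_sum continuous_on_id)

lemma measurable_matrix_mult [measurable (raw)]:
  fixes f :: "'x \<Rightarrow> real^'m^'n" and g :: "'x \<Rightarrow> real^'k^'m"
  assumes [measurable]: "f \<in> borel_measurable M" "g \<in> borel_measurable M"
  shows "(\<lambda>x. f x ** g x) \<in> borel_measurable M"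
proof -
  have "(\<lambda>(A :: real^'m^'n, B :: real^'k^'m). A ** B) \<in> borel_measurable borel"
    unfolding case_prod_unfold
    by (intro borel_measurable_continuous_onI continuous_on_matrix_mult continuous_on_fst continuous_on_snd continuous_on_id)
  then have "(\<lambda>(A :: real^'m^'n, B :: real^'k^'m). A ** B) \<in> borel_measurable (borel \<Otimes>\<^sub>M borel)"
    by (simp add: borel_prod)
  from measurable_compose[OF _ this, of "\<lambda>x. (f x, g x)"] show ?thesis by simp
qed

lemma measurable_transpose [measurable]: "(\<lambda>A :: real^'m^'n. transpose A) \<in> borel_measurable borel"
  by (intro borel_measurable_continuous_onI continuous_on_transpose continuous_on_id)

lemma measurable_det [measurable]: "(\<lambda>A :: real^'n^'n. det A) \<in> borel_measurable borel"
  by (intro borel_measurable_continuous_onI continuous_on_det continuous_on_id)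

lemma measurable_gram [measurable]: "(\<lambda>A :: real^'k^'n. gram A) \<in> borel_measurable borel"
  unfolding gram_def by measurable

lemma measurable_compressed_det [measurable]: "(\<lambda>P. compressed_det K W P) \<in> borel_measurable borel"
  unfolding compressed_det_def by measurable

lemma measurable_vec_lambda [measurable (raw)]:
  fixes f :: "'x \<Rightarrow> 'i::finite \<Rightarrow> 'a::euclidean_space"
  assumes "\<And>i. (\<lambda>x. f x i) \<in> borel_measurable M"
  shows "(\<lambda>x. \<chi> i. f x i) \<in> borel_measurable M"
proof -
  have "(\<lambda>x. \<chi> i. f x i) = (\<lambda>x. \<Sum>i\<in>UNIV. axis i (f x i))"
    by (auto simp: vec_eq_iff axis_def if_distrib cong: if_cong)
  moreover have "(\<lambda>x. axis i (f x i)) \<in> borel_measurable M" for i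
  proof -
    have "linear (axis i :: 'a \<Rightarrow> 'a^'i)" by (intro linearI) (auto simp: vec_eq_iff axis_def)
    then have "continuous_on UNIV (axis i :: 'a \<Rightarrow> 'a^'i)" by (intro linear_continuous_on) (simp add: linear_conv_bounded_linear)
    then show ?thesis using assms[of i] by (rule borel_measurable_continuous_on)
  qed
  ultimately show ?thesis by simp
qed

lemma measurable_vec_nth' [measurable]: "(\<lambda>x :: 'a::euclidean_space^'i. x $ i) \<in> borel_measurable borel"
  by (intro borel_measurable_continuous_onI continuous_on_component continuous_on_id)

lemma measurable_cramer_inverse [measurable]: "(\<lambda>S :: real^'k^'k. cramer_inverse S) \<in> borel_measurable borel"
proof -
  have "(\<lambda>S :: real^'k^'k. (\<chi> a b. if b = i then mat 1 $ a $ j else S $ a $ b) :: real^'k^'k) \<in> borel_measurable borel" for i j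
  proof (intro measurable_vec_lambda)
    fix a b show "(\<lambda>S :: real^'k^'k. if b = i then mat 1 $ a $ j else S $ a $ b) \<in> borel_measurable borel"
      by (cases "b = i") simp_all
  qed
  from measurable_compose[OF this measurable_det]
  have [measurable]: "(\<lambda>S :: real^'k^'k. det ((\<chi> a b. if b = i then mat 1 $ a $ j else S $ a $ b) :: real^'k^'k)) \<in> borel_measurable borel" for i j .
  show ?thesis unfolding cramer_inverse_def
    by (intro measurable_vec_lambda borel_measurable_divide) measurable
qed

lemma measurable_column_projection [measurable]: "(\<lambda>G :: real^'k^'n. column_projection G) \<in> borel_measurable borel"
  unfolding column_projection_def by measurable

section \<open>Lebesgue measure under linear maps\<close>

text \<open>Uniqueness of the translation-invariant measure up to a factor, stated without
  quotients. Both sides equal the double integral of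
  \<open>indicator A x * indicator B (y - x)\<close> over \<open>M\<close> and Lebesgue measure,
  with \<open>B\<close> the unit ball: the two orders of integration, together with the invariance
  of the two measures, give the two values.\<close>

lemma translation_invariant_measure:
  fixes M :: "'a::euclidean_space measure"
  assumes [measurable_cong]: "sets M = sets borel" and "sigma_finite_measure M"
    and inv: "\<And>a. distr M borel ((+) a) = M"
    and [measurable]: "A \<in> sets borel"
  shows "emeasure M A * emeasure lborel (ball 0 1 :: 'a set) = emeasure lborel A * emeasure M (ball 0 1)"
proof -
  define B where "B = (ball 0 1 :: 'a set)"
  have [measurable]: "B \<in> sets borel" by (simp add: B_def)
  have B_uminus: "- x \<in> B \<longleftrightarrow> x \<in> B" for x by (simp add: B_def)
  interpret M: sigma_finite_measure M by fact
  interpret P: pair_sigma_finite M "lborel :: 'a measure" by unfold_locales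
  have shift: "(\<integral>\<^sup>+y. f y \<partial>N) = (\<integral>\<^sup>+y. f (a + y) \<partial>N)"
    if "distr N borel ((+) a) = N" "f \<in> borel_measurable borel" "sets N = sets borel" for N :: "'a measure" and f a
    using that by (subst that(1)[symmetric], subst nn_integral_distr) (auto cong: measurable_cong_sets)
  have "emeasure M A * emeasure lborel B = (\<integral>\<^sup>+x. indicator A x * emeasure lborel B \<partial>M)"
    by (simp add: nn_integral_multc sets_eq_imp_space_eq[OF assms(1)])
  also have "\<dots> = (\<integral>\<^sup>+x. \<integral>\<^sup>+y. indicator A x * indicator B (- x + y) \<partial>lborel \<partial>M)"
  proof (intro nn_integral_cong)
    fix x :: 'a
    have "emeasure lborel B = (\<integral>\<^sup>+y. indicator B y \<partial>lborel)" by simp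
    also have "\<dots> = (\<integral>\<^sup>+y. indicator B (- x + y) \<partial>lborel)"
      by (rule shift[OF lborel_distr_plus]) auto
    finally show "indicator A x * emeasure lborel B = (\<integral>\<^sup>+y. indicator A x * indicator B (- x + y) \<partial>lborel)"
      by (subst nn_integral_cmult) auto
  qed
  also have "\<dots> = (\<integral>\<^sup>+y. \<integral>\<^sup>+x. indicator A x * indicator B (- x + y) \<partial>M \<partial>lborel)"
    by (rule P.Fubini'[symmetric]) measurable
  \<comment> \<open>Shifting \<open>x\<close> by \<open>y\<close> turns the second factor into
    \<open>indicator B (- x)\<close>, and the ball is symmetric.\<close>
  also have "\<dots> = (\<integral>\<^sup>+y. \<integral>\<^sup>+x. indicator A (y + x) * indicator B (- (y + x) + y) \<partial>M \<partial>lborel)"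
  proof (rule nn_integral_cong)
    fix y :: 'a
    show "(\<integral>\<^sup>+x. indicator A x * indicator B (- x + y) \<partial>M) =
      (\<integral>\<^sup>+x. indicator A (y + x) * indicator B (- (y + x) + y) \<partial>M)"
      by (rule shift[OF inv _ assms(1), where f="\<lambda>x. indicator A x * indicator B (- x + y)"]) measurable
  qed
  also have "\<dots> = (\<integral>\<^sup>+y. \<integral>\<^sup>+x. indicator A (x + y) * indicator B x \<partial>M \<partial>lborel)"
    by (intro nn_integral_cong) (auto simp: indicator_def add.commute B_uminus)
  also have "\<dots> = (\<integral>\<^sup>+x. \<integral>\<^sup>+y. indicator A (x + y) * indicator B x \<partial>lborel \<partial>M)"
    by (rule P.Fubini') measurable
  also have "\<dots> = (\<integral>\<^sup>+x. emeasure lborel A * indicator B x \<partial>M)"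
  proof (intro nn_integral_cong)
    fix x :: 'a
    have "emeasure lborel A = (\<integral>\<^sup>+y. indicator A y \<partial>lborel)" by simp
    also have "\<dots> = (\<integral>\<^sup>+y. indicator A (x + y) \<partial>lborel)"
      by (rule shift[OF lborel_distr_plus]) auto
    finally show "(\<integral>\<^sup>+y. indicator A (x + y) * indicator B x \<partial>lborel) = emeasure lborel A * indicator B x"
      by (simp add: nn_integral_multc)
  qed
  also have "\<dots> = emeasure lborel A * emeasure M B"
    by (simp add: nn_integral_cmult sets_eq_imp_space_eq[OF assms(1)])
  finally show ?thesis unfolding B_def .
qed

lemma ennreal_mult_right_cancel:
  fixes x y b :: ennreal
  assumes "x * b = y * b" "b \<noteq> 0" "b \<noteq> \<infinity>"
  shows "x = y"
  using assms by (metis mult_divide_eq_ennreal infinity_ennreal_def)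

lemma emeasure_unit_ball: 
  "emeasure lborel (ball 0 1 :: 'a::euclidean_space set) \<noteq> 0" "emeasure lborel (ball 0 1 :: 'a::euclidean_space set) \<noteq> \<infinity>"
proof -
  have "emeasure lborel (ball 0 1 :: 'a set) = ennreal (unit_ball_vol (real DIM('a)))"
    by (subst emeasure_ball) simp_all
  moreover have "0 < unit_ball_vol (real DIM('a))" by (rule unit_ball_vol_pos) simp
  ultimately show "emeasure lborel (ball 0 1 :: 'a set) \<noteq> 0" "emeasure lborel (ball 0 1 :: 'a set) \<noteq> \<infinity>"
    by (metis ennreal_eq_0_iff not_le) (metis \<open>emeasure lborel (ball 0 1) = _\<close> ennreal_neq_top infinity_ennreal_def)
qed

text \<open>A shift by \<open>f b\<close> after \<open>f\<close> is a shift by \<open>b\<close>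
  before \<open>f\<close>, so the pushforward along a linear bijection inherits translation
  invariance and the uniqueness result applies to it.\<close>

lemma distr_lborel_linear_translation:
  fixes f :: "'a::euclidean_space \<Rightarrow> 'a"
  assumes f: "linear f" "bij f"
  shows "distr (distr lborel borel f) borel ((+) a) = distr lborel borel f"
    and "sigma_finite_measure (distr lborel borel f)"
    and "f \<in> borel_measurable borel" "inv f \<in> borel_measurable borel" "linear (inv f)"
proof -
  show fm: "f \<in> borel_measurable borel"
    using f(1) by (intro borel_measurable_continuous_onI linear_continuous_on) (simp add: linear_conv_bounded_linear)
  show "linear (inv f)"
  proof (rule linearI)
    fix x y c
    have "f (inv f x) = x" "f (inv f y) = y" using f(2) by (simp_all add: bij_is_surj surj_f_inv_f)
    then have "f (inv f x + inv f y) = x + y" "f (c *\<^sub>R inv f x) = c *\<^sub>R x"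
      by (simp_all add: linear_add[OF f(1)] linear_scale[OF f(1)])
    then show "inv f (x + y) = inv f x + inv f y" "inv f (c *\<^sub>R x) = c *\<^sub>R inv f x"
      using f(2) by (metis bij_is_inj inv_f_f)+
  qed
  then show gm: "inv f \<in> borel_measurable borel"
    by (intro borel_measurable_continuous_onI linear_continuous_on) (simp add: linear_conv_bounded_linear)
  obtain b where b: "a = f b" using f(2) by (metis bij_pointE)
  have "distr (distr lborel borel f) borel ((+) a) = distr (distr lborel borel ((+) b)) borel f"
    using fm by (subst (1 2) distr_distr) (auto simp: o_def b linear_add[OF f(1)])
  then show "distr (distr lborel borel f) borel ((+) a) = distr lborel borel f" by (simp add: lborel_distr_plus)
  have "distr (distr lborel borel f) borel (inv f) = lborel"
    using fm gm f(2) distr_id2[of borel lborel] by (subst distr_distr) (simp_all add: bij_is_inj id_def)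
  then show "sigma_finite_measure (distr lborel borel f)"
    by (intro sigma_finite_measure_distr[of "distr lborel borel f" borel "inv f"])
       (use gm in \<open>auto simp: lborel.sigma_finite_measure_axioms\<close>)
qed

lemma linear_bij_borel:
  fixes f :: "'a::euclidean_space \<Rightarrow> 'a"
  assumes "linear f" "bij f" "A \<in> sets borel"
  shows "f ` A \<in> sets borel"
proof -
  have "inv f -` A \<inter> space borel \<in> sets borel"
    using assms by (intro measurable_sets[OF distr_lborel_linear_translation(4)])
  moreover have "f ` A = inv f -` A" using assms(2) by (simp add: bij_vimage_eq_inv_image bij_imp_bij_inv inv_inv_eq)
  ultimately show ?thesis by simp
qed

text \<open>The pushforward of Lebesgue measure along the inverse of \<open>f\<close> is
  proportional to Lebesgue measure, and evaluation on the unit ball identifies the factor.\<close>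

lemma emeasure_linear_bij:
  fixes f :: "'a::euclidean_space \<Rightarrow> 'a"
  assumes f: "linear f" "bij f" and A: "A \<in> sets borel"
  shows "emeasure lborel (f ` A) * emeasure lborel (ball 0 1 :: 'a set)
    = emeasure lborel A * emeasure lborel (f ` ball 0 1)"
proof -
  have g: "linear (inv f)" "bij (inv f)" using f by (auto simp: distr_lborel_linear_translation bij_imp_bij_inv)
  have eq: "emeasure (distr lborel borel (inv f)) S = emeasure lborel (f ` S)" if "S \<in> sets borel" for S
    using that distr_lborel_linear_translation(3)[OF g] f(2)
    by (simp add: emeasure_distr bij_vimage_eq_inv_image g(2) inv_inv_eq)
  show ?thesis
    using translation_invariant_measure[OF _ distr_lborel_linear_translation(2)[OF g] distr_lborel_linear_translation(1)[OF g] A]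
    unfolding eq[OF A] eq[of "ball 0 1", simplified] by simp
qed

lemma emeasure_orthogonal_image:
  fixes f :: "'a::euclidean_space \<Rightarrow> 'a"
  assumes f: "orthogonal_transformation f" and A: "A \<in> sets borel"
  shows "emeasure lborel (f ` A) = emeasure lborel A"
proof -
  have "f ` ball 0 1 = ball 0 1" using image_orthogonal_transformation_ball[OF f, of 0 1] f
    by (simp add: linear_0 orthogonal_transformation_linear)
  then have "emeasure lborel (f ` A) * emeasure lborel (ball 0 1 :: 'a set)
    = emeasure lborel A * emeasure lborel (ball 0 1 :: 'a set)"
    using emeasure_linear_bij[of f A] f A by (simp add: orthogonal_transformation_linear orthogonal_transformation_bij)
  then show ?thesis using emeasure_unit_ball by (rule ennreal_mult_right_cancel)
qed

lemma distr_lborel_orthogonal: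
  fixes f :: "'a::euclidean_space \<Rightarrow> 'a"
  assumes f: "orthogonal_transformation f"
  shows "distr lborel borel f = lborel"
proof (rule measure_eqI)
  fix A assume "A \<in> sets (distr lborel borel f)"
  then have A: "A \<in> sets borel" by simp
  have g: "orthogonal_transformation (inv f)" using f by (rule orthogonal_transformation_inv)
  have "f -` A = inv f ` A"
    using f by (simp add: bij_vimage_eq_inv_image orthogonal_transformation_bij)
  then show "emeasure (distr lborel borel f) A = emeasure lborel A"
    using emeasure_orthogonal_image[OF g A] A distr_lborel_linear_translation(3)[of f] f
    by (simp add: emeasure_distr orthogonal_transformation_bij orthogonal_transformation_linear)
qed simp

lemma matrix_shear:
  fixes m n :: "'n::finite"
  assumes "m \<noteq> n"
  shows "det (matrix (\<lambda>x :: real^'n. \<chi> i. if i = m then x $ m + x $ n else x $ i)) = 1"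
proof -
  have "matrix (\<lambda>x :: real^'n. \<chi> i. if i = m then x $ m + x $ n else x $ i)
     = (\<chi> k. if k = m then row m (mat 1) + 1 *s row n (mat 1) else row k (mat 1))"
    by (auto simp: matrix_def vec_eq_iff row_def mat_def axis_def)
  then show ?thesis using det_row_operation[OF assms, where c=1 and A="mat 1 :: real^'n^'n"] by (simp only: det_I)
qed

text \<open>Let \<open>d\<close> change the sign of coordinate \<open>m\<close>. Then applying
  \<open>f\<close>, \<open>d\<close> and \<open>f\<close> in turn gives \<open>d\<close> again.
  Since \<open>d\<close> preserves volume, the factor by which \<open>f\<close> scales volume has
  square 1.\<close>

lemma emeasure_shear:
  fixes m n :: "'n::finite"
  assumes "m \<noteq> n" "A \<in> sets borel"
  defines "f \<equiv> (\<lambda>x :: real^'n. \<chi> i. if i = m then x $ m + x $ n else x $ i)"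
  shows "emeasure lborel (f ` A) = emeasure lborel A"
proof -
  define d where "d = (\<lambda>x :: real^'n. \<chi> i. if i = m then - x $ m else x $ i)"
  let ?B = "ball 0 1 :: (real^'n) set"
  have lin: "linear f" "linear d" by (auto intro!: linearI simp: f_def d_def vec_eq_iff algebra_simps)
  have inv: "d (f (d (f x))) = x" "d (d x) = x" "f (d (f (d x))) = x" for x
    using assms(1) by (auto simp: f_def d_def vec_eq_iff)
  have "d v \<bullet> d w = v \<bullet> w" for v w unfolding inner_vec_def d_def by (intro sum.cong) auto
  then have d: "orthogonal_transformation d" using lin by (simp add: orthogonal_transformation_def)
  have bf: "bij f" by (rule o_bij[where g="d \<circ> f \<circ> d"]) (simp_all add: fun_eq_iff inv)
  have fB: "f ` S \<in> sets borel" if "S \<in> sets borel" for S using linear_bij_borel[OF lin(1) bf that] .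
  have dB: "d ` S \<in> sets borel" if "S \<in> sets borel" for S
    using linear_bij_borel[OF lin(2) _ that] d orthogonal_transformation_bij by blast
  let ?b = "emeasure lborel ?B" and ?c = "emeasure lborel (f ` ?B)"
  have b: "?b \<noteq> 0" "?b \<noteq> \<infinity>" using emeasure_unit_ball by auto
  have "f (d (f x)) = d x" for x using inv(3)[of "d x"] inv(2) by simp
  then have *: "f ` d ` f ` ?B = d ` ?B" by (simp add: image_image)
  have "?b * ?b = emeasure lborel (d ` ?B) * ?b" using emeasure_orthogonal_image[OF d, of ?B] by simp
  also have "\<dots> = emeasure lborel (f ` d ` f ` ?B) * ?b" using * by simp
  also have "\<dots> = emeasure lborel (d ` f ` ?B) * ?c" by (rule emeasure_linear_bij[OF lin(1) bf]) (intro dB fB, simp)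
  also have "\<dots> = ?c * ?c" using emeasure_orthogonal_image[OF d fB, of ?B] by simp
  finally have "?b * ?b = ?c * ?c" .
  moreover have "?b = ennreal (enn2real ?b)" using b(2) by (simp add: less_top)
  moreover have "?c \<noteq> \<infinity>" using b(2) \<open>?b * ?b = ?c * ?c\<close> by (auto simp: ennreal_mult_eq_top_iff)
  then have "?c = ennreal (enn2real ?c)" by (simp add: less_top)
  ultimately have "enn2real ?b * enn2real ?b = enn2real ?c * enn2real ?c" by (metis enn2real_mult)
  then have "enn2real ?b = enn2real ?c" by (metis enn2real_nonneg power2_eq_iff_nonneg power2_eq_square)
  then have "?c = ?b" using \<open>?b = ennreal (enn2real ?b)\<close> \<open>?c = ennreal (enn2real ?c)\<close> by simp
  then have "emeasure lborel (f ` A) * ?b = emeasure lborel A * ?b" 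
    using emeasure_linear_bij[OF lin(1) bf assms(2)] by simp
  then show ?thesis using b by (rule ennreal_mult_right_cancel)
qed

lemma emeasure_stretch:
  fixes c :: "'n::finite \<Rightarrow> real"
  assumes c: "\<And>i. c i \<noteq> 0" and A: "A \<in> sets borel"
  shows "emeasure lborel ((\<lambda>x :: real^'n. \<chi> i. c i * x $ i) ` A) = ennreal \<bar>\<Prod>i\<in>UNIV. c i\<bar> * emeasure lborel A"
proof -
  let ?f = "\<lambda>x :: real^'n. \<chi> i. c i * x $ i"
  define c' where "c' b = c (THE i. b = axis i (1::real))" for b :: "real^'n"
  have c'[simp]: "c' (axis i 1) = c i" for i
    by (auto simp: c'_def axis_eq_axis)
  have bas: "(Basis :: (real^'n) set) = range (\<lambda>i. axis i 1)" by (auto simp: Basis_vec_def)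
  have inj: "inj (\<lambda>i::'n. axis i (1::real))" by (auto simp: inj_def axis_eq_axis)
  have f: "0 + (\<Sum>j\<in>Basis. (c' j * (x \<bullet> j)) *\<^sub>R j) = ?f x" for x
    unfolding bas sum.reindex[OF inj] using basis_expansion[of "?f x"] 
    by (simp add: inner_axis scalar_mult_eq_scaleR)
  have lb: "lborel = density (distr lborel borel ?f) (\<lambda>_. \<Prod>j\<in>Basis. \<bar>c' j\<bar>)"
  proof -
    have "c' j \<noteq> 0" if "j \<in> Basis" for j using that c unfolding bas by (metis c' imageE)
    then show ?thesis using lborel_affine_euclidean[of c' 0] unfolding f by blast
  qed
  have linf: "linear ?f" by (auto intro!: linearI simp: vec_eq_iff algebra_simps)
  have bf: "bij ?f"
    by (rule o_bij[where g="\<lambda>x. \<chi> i. x $ i / c i"]) (auto simp: fun_eq_iff vec_eq_iff c)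
  have fA: "?f ` A \<in> sets borel" by (rule linear_bij_borel[OF linf bf A])
  have fm: "?f \<in> borel_measurable borel" using distr_lborel_linear_translation(3)[OF linf bf] .
  have "emeasure lborel (?f ` A) = emeasure (density (distr lborel borel ?f) (\<lambda>_. ennreal (\<Prod>j\<in>Basis. \<bar>c' j\<bar>))) (?f ` A)"
    using lb by metis
  also have "\<dots> = ennreal (\<Prod>j\<in>Basis. \<bar>c' j\<bar>) * emeasure lborel (?f -` ?f ` A)"
    using fA fm by (simp add: emeasure_density_const emeasure_distr)
  also have "?f -` ?f ` A = A" using bf by (simp add: bij_is_inj inj_vimage_image_eq)
  also have "(\<Prod>j\<in>Basis. \<bar>c' j\<bar>) = \<bar>\<Prod>i\<in>UNIV. c i\<bar>"
    unfolding bas prod.reindex[OF inj] by (simp add: abs_prod)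
  finally show ?thesis .
qed

text \<open>Induction over elementary linear maps. Compactness is carried along because it survives
  singular maps too and thus keeps every intermediate image Borel.\<close>

lemma emeasure_linear_image_compact:
  fixes f :: "real^'n \<Rightarrow> real^'n"
  assumes "linear f" "compact S"
  shows "emeasure lborel (f ` S) = ennreal \<bar>det (matrix f)\<bar> * emeasure lborel S"
proof -
  have cb: "compact S \<Longrightarrow> S \<in> sets borel" for S :: "(real^'n) set" by (simp add: borel_closed compact_imp_closed)
  have ci: "linear f \<Longrightarrow> compact S \<Longrightarrow> compact (f ` S)" for f :: "real^'n \<Rightarrow> real^'n" and S
    by (simp add: compact_continuous_image linear_continuous_on linear_conv_bounded_linear)
  have zero: "emeasure lborel (f ` S) = ennreal \<bar>det (matrix f)\<bar> * emeasure lborel S"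
    if "linear f" "\<And>x. f x $ i = 0" "compact S" for f :: "real^'n \<Rightarrow> real^'n" and i S
  proof -
    have "negligible (f ` S)"
      by (rule negligible_subset[OF negligible_standard_hyperplane_cart[of i]]) (use that in auto)
    then have "f ` S \<in> null_sets lborel"
      using cb[OF ci[OF that(1,3)]] by (simp add: negligible_iff_null_sets null_sets_completion_iff)
    moreover have "det (matrix f) = 0"
      by (rule det_zero_row(1)[where i=i]) (simp add: row_def matrix_def that(2) vec_eq_iff)
    ultimately show ?thesis by (simp add: null_setsD1)
  qed
  have "\<forall>S. compact S \<longrightarrow> emeasure lborel (f ` S) = ennreal \<bar>det (matrix f)\<bar> * emeasure lborel S"
  proof (rule induct_linear_elementary[OF assms(1)]; intro allI impI)
    fix f g :: "real^'n \<Rightarrow> real^'n" and S :: "(real^'n) set"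
    assume fg: "linear f" "linear g"
      and "\<forall>S. compact S \<longrightarrow> emeasure lborel (f ` S) = ennreal \<bar>det (matrix f)\<bar> * emeasure lborel S"
      and "\<forall>S. compact S \<longrightarrow> emeasure lborel (g ` S) = ennreal \<bar>det (matrix g)\<bar> * emeasure lborel S"
      and S: "compact S"
    then show "emeasure lborel ((f \<circ> g) ` S) = ennreal \<bar>det (matrix (f \<circ> g))\<bar> * emeasure lborel S"
      using ci[OF fg(2) S]
      unfolding image_comp[symmetric] by (simp add: matrix_compose[OF fg(2,1)] det_mul abs_mult ennreal_mult mult.assoc)
  next
    fix f :: "real^'n \<Rightarrow> real^'n" and i and S :: "(real^'n) set"
    assume "linear f" "\<And>x. f x $ i = 0" "compact S"
    then show "emeasure lborel (f ` S) = ennreal \<bar>det (matrix f)\<bar> * emeasure lborel S" by (rule zero)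
  next
    fix c :: "'n \<Rightarrow> real" and S :: "(real^'n) set"
    assume S: "compact S"
    let ?f = "\<lambda>x :: real^'n. \<chi> i. c i * x $ i"
    have lf: "linear ?f" by (auto intro!: linearI simp: vec_eq_iff algebra_simps)
    have "det (matrix ?f) = (\<Prod>i\<in>UNIV. c i)"
      by (subst det_diagonal) (auto simp: matrix_def axis_def)
    moreover have "\<exists>i. c i = 0 \<Longrightarrow> emeasure lborel (?f ` S) = ennreal \<bar>det (matrix ?f)\<bar> * emeasure lborel S"
      using zero[OF lf _ S] by auto
    ultimately show "emeasure lborel (?f ` S) = ennreal \<bar>det (matrix ?f)\<bar> * emeasure lborel S"
      using emeasure_stretch[OF _ cb[OF S], of c] by force
  next
    fix m n :: 'n and S :: "(real^'n) set"
    assume S: "compact S"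
    let ?p = "Transposition.transpose m n"
    let ?f = "\<lambda>x :: real^'n. \<chi> i. x $ ?p i"
    have lf: "linear ?f" by (auto intro!: linearI simp: vec_eq_iff algebra_simps)
    have "?f v \<bullet> ?f w = v \<bullet> w" for v w
    proof -
      have "bij ?p" by (rule o_bij[where g="?p"]) (simp_all add: fun_eq_iff)
      then show ?thesis
        using sum.reindex_bij_betw[of ?p UNIV UNIV "\<lambda>i. v $ i \<bullet> w $ i"] by (simp add: inner_vec_def)
    qed
    then have o: "orthogonal_transformation ?f" using lf by (simp add: orthogonal_transformation_def)
    then have "\<bar>det (matrix ?f)\<bar> = 1"
      using det_orthogonal_matrix orthogonal_transformation_matrix by fastforce
    then show "emeasure lborel (?f ` S) = ennreal \<bar>det (matrix ?f)\<bar> * emeasure lborel S"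
      using emeasure_orthogonal_image[OF o cb[OF S]] by simp
  next
    fix m n :: 'n and S :: "(real^'n) set"
    assume "m \<noteq> n" and S: "compact S"
    then show "emeasure lborel ((\<lambda>x. \<chi> i. if i = m then x $ m + x $ n else x $ i) ` S) =
      ennreal \<bar>det (matrix (\<lambda>x :: real^'n. \<chi> i. if i = m then x $ m + x $ n else x $ i))\<bar> * emeasure lborel S"
      by (simp add: matrix_shear emeasure_shear cb)
  qed
  then show ?thesis using assms(2) by blast
qed

lemma measure_matrix_image_compact:
  fixes A :: "real^'n^'n"
  assumes "compact S"
  shows "measure lebesgue ((*v) A ` S) = \<bar>det A\<bar> * measure lebesgue S"
proof -
  have b: "S \<in> sets borel" "(*v) A ` S \<in> sets borel"
    using assms by (auto intro!: borel_closed compact_imp_closed compact_continuous_image matrix_vector_mult_linear_continuous_on)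
  show ?thesis
    using emeasure_linear_image_compact[OF matrix_vector_mul_linear[of A] assms] b
    by (simp add: measure_completion measure_def enn2real_mult)
qed

lemma continuous_on_matrix_vector: "continuous_on S ((*v) (A :: real^'m^'n))"
  by (simp add: linear_continuous_on linear_conv_bounded_linear[symmetric])

section \<open>Independence of the k-dimensional volume from the chart\<close>

text \<open>On the coordinates of \<open>S\<close> the change of chart is the linear map
  \<open>transpose B ** A\<close> followed by a translation.\<close>

lemma measure_affine_chart:
  fixes A B :: "real^'k^'n"
  assumes A: "frame A" and B: "frame B" and S: "compact S"
    and SA: "S \<subseteq> range (\<lambda>y. a + A *v y)" and SB: "S \<subseteq> range (\<lambda>y. b + B *v y)"
  shows "measure lebesgue {y. b + B *v y \<in> S} =
      \<bar>det (transpose B ** A)\<bar> * measure lebesgue {y. a + A *v y \<in> S}"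
    and "compact {y. a + A *v y \<in> S}"
proof -
  have chart: "{y. a + A *v y \<in> S} = (\<lambda>x. transpose A *v (x - a)) ` S"
    if A: "frame A" and SA: "S \<subseteq> range (\<lambda>y. a + A *v y)" for A :: "real^'k^'n" and a
  proof (intro equalityI subsetI)
    fix y assume "y \<in> {y. a + A *v y \<in> S}"
    then show "y \<in> (\<lambda>x. transpose A *v (x - a)) ` S"
      by (intro image_eqI[where x="a + A *v y"]) (auto simp: frame_transpose_cancel[OF A] simp del: transpose_matrix_vector)
  next
    fix y assume "y \<in> (\<lambda>x. transpose A *v (x - a)) ` S"
    then obtain x where x: "x \<in> S" "y = transpose A *v (x - a)" by blast
    then obtain z where "x = a + A *v z" using SA by blast
    then show "y \<in> {y. a + A *v y \<in> S}"
      using x by (simp add: frame_transpose_cancel[OF A] del: transpose_matrix_vector)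
  qed
  let ?T = "{y. a + A *v y \<in> S}"
  show T: "compact ?T" unfolding chart[OF A SA]
    by (intro compact_continuous_image S continuous_on_compose2[OF continuous_on_matrix_vector[of UNIV]] continuous_intros) auto
  have "{y. b + B *v y \<in> S} = (\<lambda>y. transpose B *v (a - b) + y) ` (*v) (transpose B ** A) ` ?T"
  proof -
    have "S = (\<lambda>y. a + A *v y) ` ?T" using SA by auto
    then have "(\<lambda>x. transpose B *v (x - b)) ` S = (\<lambda>x. transpose B *v (x - b)) ` (\<lambda>y. a + A *v y) ` ?T" by metis
    also have "\<dots> = (\<lambda>y. transpose B *v (a - b) + y) ` (*v) (transpose B ** A) ` ?T"
      unfolding image_image
      by (intro image_cong refl) (simp add: matrix_vector_mul_assoc[symmetric] matrix_vector_right_distrib matrix_vector_mult_diff_distrib algebra_simps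
         del: transpose_matrix_vector)
    finally show ?thesis unfolding chart[OF B SB] .
  qed
  then show "measure lebesgue {y. b + B *v y \<in> S} = \<bar>det (transpose B ** A)\<bar> * measure lebesgue ?T"
    by (simp add: measure_translation measure_matrix_image_compact[OF T])
qed

text \<open>Both changes of chart scale the volume by \<open>\<bar>det (B\<^sup>T A)\<bar>\<close>, so either this factor is 1 or
  both volumes vanish.\<close>

lemma k_volume_chart:
  fixes A :: "real^'k^'n"
  assumes A: "frame A" and S: "compact S" and SA: "S \<subseteq> range (\<lambda>y. a + A *v y)"
  shows "k_volume TYPE('k) S = measure lebesgue {y. a + A *v y \<in> S}"
  unfolding k_volume_def
proof (rule the_equality)
  show "\<exists>a' (A' :: real^'k^'n). transpose A' ** A' = mat 1 \<and> S \<subseteq> range (\<lambda>y. a' + A' *v y) \<and>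
      measure lebesgue {y. a + A *v y \<in> S} = measure lebesgue {y. a' + A' *v y \<in> S}"
    using A SA by (auto simp: frame_def)
next
  fix v assume "\<exists>a (A :: real^'k^'n). transpose A ** A = mat 1 \<and> S \<subseteq> range (\<lambda>y. a + A *v y) \<and>
      v = measure lebesgue {y. a + A *v y \<in> S}"
  then obtain b and B :: "real^'k^'n" where B: "frame B" "S \<subseteq> range (\<lambda>y. b + B *v y)"
    and v: "v = measure lebesgue {y. b + B *v y \<in> S}" by (auto simp: frame_def)
  let ?d = "\<bar>det (transpose B ** A)\<bar>" and ?u = "measure lebesgue {y. a + A *v y \<in> S}"
  have 1: "v = ?d * ?u" unfolding v by (rule measure_affine_chart[OF A B(1) S SA B(2)])
  have 2: "?u = \<bar>det (transpose A ** B)\<bar> * v" unfolding v by (rule measure_affine_chart[OF B(1) A S B(2) SA])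
  have "det (transpose A ** B) = det (transpose B ** A)"
    by (metis det_transpose matrix_transpose_mul transpose_transpose)
  then have "?u = ?d * (?d * ?u)" using 1 2 by simp
  then have "?u = 0 \<or> ?d * ?d = 1" by auto
  then show "v = ?u" using 1 by (auto simp: square_eq_1_iff mult_eq_1_iff power2_eq_square)
qed

section \<open>Volumes of simplices and of projected ellipsoids\<close>

text \<open>The type \<open>'k option\<close> has one element more than \<open>'k\<close> and so
  indexes the vertices of a simplex; \<open>None\<close> is the base vertex at which all edges
  start.\<close>

definition edge_matrix :: "('k::finite option \<Rightarrow> real^'n) \<Rightarrow> real^'k^'n" where
  "edge_matrix x = (\<chi> i j. (x (Some j) - x None) $ i)"

lemma edge_matrix_axis: "edge_matrix x *v axis j 1 = x (Some j) - x None"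
  by (simp add: edge_matrix_def matrix_vector_mult_basis column_def vec_eq_iff)

lemma option_range: "range (x :: 'k option \<Rightarrow> 'a) = insert (x None) ((\<lambda>j. x (Some j)) ` UNIV)"
  by (metis image_image image_insert UNIV_option_conv)

lemma convex_hull_affine_image:
  fixes A :: "real^'m^'n"
  shows "convex hull ((\<lambda>y. a + A *v y) ` S) = (\<lambda>y. a + A *v y) ` (convex hull S)"
proof -
  have "(\<lambda>y. a + A *v y) ` S = (+) a ` (*v) A ` S" for S by (simp add: image_image)
  then show ?thesis
    by (simp only: convex_hull_translation convex_hull_linear_image[OF matrix_vector_mul_linear])
qed

lemma compact_affine_image: "compact S \<Longrightarrow> compact ((\<lambda>y. a + (A :: real^'m^'n) *v y) ` S)"
  by (intro compact_continuous_image continuous_on_add continuous_on_const continuous_on_matrix_vector)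

text \<open>The edge matrix maps the standard simplex, whose volume is
  \<open>1 / fact CARD('k)\<close>, onto a translate of the given one.\<close>

lemma measure_full_simplex:
  fixes y :: "'k::finite option \<Rightarrow> real^'k"
  shows "measure lebesgue (convex hull range y) = \<bar>det (edge_matrix y)\<bar> / fact CARD('k)"
proof -
  let ?s = "convex hull (insert 0 Basis) :: (real^'k) set"
  have c: "compact ?s" by (intro finite_imp_compact_convex_hull) simp
  have bas: "(Basis :: (real^'k) set) = range (\<lambda>i. axis i 1)" by (auto simp: Basis_vec_def)
  have "range y = (\<lambda>z. y None + edge_matrix y *v z) ` (insert 0 Basis)"
    by (simp add: option_range bas image_image edge_matrix_axis)
  then have "convex hull range y = (\<lambda>z. y None + edge_matrix y *v z) ` ?s"
    by (simp only: convex_hull_affine_image)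
  then have "convex hull range y = (\<lambda>z. y None + z) ` (*v) (edge_matrix y) ` ?s"
    by (simp add: image_image)
  then have "measure lebesgue (convex hull range y) = \<bar>det (edge_matrix y)\<bar> * measure lebesgue ?s"
    by (simp add: measure_translation measure_matrix_image_compact[OF c])
  also have "measure lebesgue ?s = measure lborel ?s"
    using c by (intro measure_completion) (auto dest: compact_imp_closed)
  finally show ?thesis by (simp add: content_std_simplex)
qed

lemma affine_chart_vimage:
  fixes A :: "real^'k^'n"
  assumes "frame A"
  shows "{y. a + A *v y \<in> (\<lambda>y. a + A *v y) ` S} = S"
proof -
  have "inj ((*v) A)" by (metis assms frame_transpose_cancel injI)
  then show ?thesis by (auto dest: injD)
qed

text \<open>In a chart whose frame \<open>A\<close> spans all edges the simplex has vertices
  \<open>y\<close> in \<open>k\<close>-space, and \<open>edge_matrix x = A ** edge_matrix y\<close>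
  has Gram determinant \<open>(det (edge_matrix y))^2\<close>. Degenerate simplices fit into such a
  chart as well.\<close>

theorem k_volume_simplex:
  fixes x :: "'k::finite option \<Rightarrow> real^'n"
  assumes "CARD('k) \<le> CARD('n)"
  shows "(fact CARD('k) * k_volume TYPE('k) (convex hull range x))\<^sup>2 = gram (edge_matrix x)"
proof -
  obtain A :: "real^'k^'n" where A: "frame A" "range ((*v) (edge_matrix x)) \<subseteq> range ((*v) A)"
    using frame_exists_superset[OF dim_range_matrix_le assms] by metis
  define y where "y j = transpose A *v (x j - x None)" for j
  have xy: "x j = x None + A *v y j" for j
  proof -
    have "x j - x None \<in> range ((*v) A)"
    proof (cases j)
      case None
      then show ?thesis using matrix_vector_mult_0_right[of A] by (metis cancel_comm_monoid_add_class.diff_cancel rangeI)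
    next
      case (Some i)
      then show ?thesis using A(2) edge_matrix_axis[of x i] by (metis rangeI subsetD)
    qed
    then show ?thesis using frame_project_cancel[OF A(1)] by (simp add: y_def del: transpose_matrix_vector)
  qed
  let ?f = "\<lambda>z. x None + A *v z"
  have "range x = (\<lambda>j. ?f (y j)) ` UNIV" by (rule image_cong[OF refl xy])
  then have "range x = ?f ` range y" by (simp only: image_image)
  then have S: "convex hull range x = ?f ` (convex hull range y)" by (simp only: convex_hull_affine_image)
  have cy: "compact (convex hull range y)" by (intro finite_imp_compact_convex_hull) simp
  have "k_volume TYPE('k) (convex hull range x) = measure lebesgue {z. ?f z \<in> convex hull range x}"
    by (rule k_volume_chart[OF A(1)]) (auto simp: S compact_affine_image cy)
  also have "\<dots> = \<bar>det (edge_matrix y)\<bar> / fact CARD('k)"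
    unfolding S affine_chart_vimage[OF A(1)] measure_full_simplex ..
  finally have "(fact CARD('k) * k_volume TYPE('k) (convex hull range x))\<^sup>2 = (det (edge_matrix y))\<^sup>2" by simp
  moreover have "edge_matrix x = A ** edge_matrix y"
  proof -
    have "x (Some j) - x None = A *v (y (Some j) - y None)" for j
      using xy[of "Some j"] xy[of None] by (simp add: matrix_vector_mult_diff_distrib algebra_simps)
    then show ?thesis by (simp add: edge_matrix_def vec_eq_iff matrix_vector_mult_def matrix_matrix_mult_def)
  qed
  ultimately show ?thesis by (simp add: gram_mult_square gram_frame[OF A(1)])
qed

text \<open>\<open>transpose F\<close> does not increase norms, and \<open>F\<close> is a
  norm-preserving right inverse of it.\<close>

lemma frame_transpose_cball:
  fixes F :: "real^'k^'n"
  assumes "frame F"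
  shows "(*v) (transpose F) ` cball 0 1 = cball 0 1"
proof (intro equalityI subsetI)
  fix y assume "y \<in> (*v) (transpose F) ` cball 0 1"
  then obtain z where z: "norm z \<le> 1" "y = transpose F *v z" by auto
  have "y \<bullet> y = (F *v y) \<bullet> z"
    unfolding z(2) by (metis dot_lmul_matrix inner_commute transpose_matrix_vector)
  also have "\<dots> \<le> norm y * norm z" using norm_cauchy_schwarz[of "F *v y" z] frame_norm[OF assms] by simp
  finally have "norm y * norm y \<le> norm y * norm z" by (simp add: dot_square_norm power2_eq_square)
  then have "norm y \<le> norm z" by (cases "norm y = 0") auto
  then show "y \<in> cball 0 1" using z by simp
next
  fix y :: "real^'k" assume "y \<in> cball 0 1"
  then show "y \<in> (*v) (transpose F) ` cball 0 1"
    using frame_norm[OF assms, of y] frame_transpose_cancel[OF assms, of y]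
    by (intro image_eqI[where x="F *v y"]) (simp_all del: transpose_matrix_vector)
qed

text \<open>Writing \<open>transpose T ** A = F ** R\<close> with a frame \<open>F\<close> gives
  \<open>transpose A ** T = transpose R ** transpose F\<close>. As \<open>transpose F\<close> maps
  the large unit ball onto the small one, the projected ellipsoid is, in the chart \<open>A\<close>,
  a translate of the image of the small ball under \<open>transpose R\<close>; and
  \<open>(det R)^2\<close> is the Gram determinant of \<open>transpose T ** A\<close>.\<close>

theorem k_volume_projected_ellipsoid:
  fixes A :: "real^'k^'n" and T :: "real^'n^'n"
  assumes A: "frame A" and kn: "CARD('k) \<le> CARD('n)"
  shows "(k_volume TYPE('k) ((\<lambda>x. A *v (transpose A *v x)) ` (\<lambda>z. c + T *v z) ` cball 0 1))\<^sup>2 =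
     (unit_ball_vol (real CARD('k)))\<^sup>2 * det (transpose A ** (T ** transpose T) ** A)"
proof -
  define B where "B = transpose T ** A"
  obtain F :: "real^'k^'n" where F: "frame F" "range ((*v) B) \<subseteq> range ((*v) F)"
    using frame_exists_superset[OF dim_range_matrix_le kn] by metis
  define R where "R = transpose F ** B"
  have B: "B = F ** R" unfolding R_def by (rule frame_factor[OF F])
  have "gram B = (det R)\<^sup>2" unfolding B gram_mult_square gram_frame[OF F(1)] by simp
  moreover have "gram B = det (transpose A ** (T ** transpose T) ** A)"
    unfolding gram_def B_def by (simp add: matrix_transpose_mul matrix_mul_assoc)
  ultimately have g: "det (transpose A ** (T ** transpose T) ** A) = (det R)\<^sup>2" by simp
  let ?a = "transpose A *v c"
  let ?D = "(\<lambda>z. ?a + z) ` (*v) (transpose R) ` cball 0 1"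
  have AT: "transpose A ** T = transpose R ** transpose F"
    using B by (metis B_def matrix_transpose_mul transpose_transpose)
  have D: "(\<lambda>x. transpose A *v x) ` (\<lambda>z. c + T *v z) ` cball 0 1 = ?D"
  proof -
    have "(\<lambda>x. transpose A *v x) ` (\<lambda>z. c + T *v z) ` cball 0 1 =
        (\<lambda>z. ?a + transpose R *v z) ` (*v) (transpose F) ` cball 0 1"
      unfolding image_image
      by (intro image_cong refl) (simp add: matrix_vector_right_distrib matrix_vector_mul_assoc AT del: transpose_matrix_vector)
    then show ?thesis by (simp add: frame_transpose_cball[OF F(1)] image_image del: transpose_matrix_vector)
  qed
  have S: "(\<lambda>x. A *v (transpose A *v x)) ` (\<lambda>z. c + T *v z) ` cball 0 1 = (\<lambda>y. 0 + A *v y) ` ?D"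
    unfolding D[symmetric] by (simp add: image_image del: transpose_matrix_vector)
  have cD: "compact ?D"
    by (intro compact_continuous_image continuous_on_add continuous_on_const continuous_on_id continuous_on_matrix_vector compact_cball)
  have "k_volume TYPE('k) ((\<lambda>x. A *v (transpose A *v x)) ` (\<lambda>z. c + T *v z) ` cball 0 1) =
      measure lebesgue {y. 0 + A *v y \<in> (\<lambda>y. 0 + A *v y) ` ?D}"
    unfolding S by (rule k_volume_chart[OF A compact_affine_image[OF cD]]) blast
  also have "\<dots> = measure lebesgue ?D" unfolding affine_chart_vimage[OF A] ..
  also have "\<dots> = \<bar>det R\<bar> * measure lebesgue (cball 0 1 :: (real^'k) set)"
    by (simp only: measure_translation measure_matrix_image_compact[OF compact_cball] det_transpose)
  also have "measure lebesgue (cball 0 1 :: (real^'k) set) = unit_ball_vol (real CARD('k))"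
    by (simp add: measure_completion content_cball)
  finally show ?thesis by (simp add: g power_mult_distrib)
qed

section \<open>Uniqueness of the rotation-invariant law of a random projection\<close>

text \<open>Integrating the indicator of \<open>dist x y < r\<close> against both measures shows that they give balls of radius
  \<open>r\<close> the same mass; inserting \<open>f x - f y\<close> and letting \<open>r\<close> tend to 0 compares the integrals of \<open>f\<close>.\<close>

theorem uniformly_distributed_integral_eq:
  fixes M N :: "'a::{metric_space, second_countable_topology} measure" and f :: "'a \<Rightarrow> real"
  assumes pM: "prob_space M" and pN: "prob_space N"
    and sM[measurable_cong]: "sets M = sets borel" and sN[measurable_cong]: "sets N = sets borel"
    and S: "compact S" and AM: "AE x in M. x \<in> S" and AN: "AE x in N. x \<in> S"
    and bM: "\<And>x y r. x \<in> S \<Longrightarrow> y \<in> S \<Longrightarrow> measure M (ball x r) = measure M (ball y r)"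
    and bN: "\<And>x y r. x \<in> S \<Longrightarrow> y \<in> S \<Longrightarrow> measure N (ball x r) = measure N (ball y r)"
    and f: "continuous_on S f" "f \<in> borel_measurable borel"
  shows "(\<integral>x. f x \<partial>M) = (\<integral>x. f x \<partial>N)"
proof -
  interpret M: prob_space M by fact
  interpret N: prob_space N by fact
  interpret P: pair_prob_space M N ..
  have spM: "space M = UNIV" and spN: "space N = UNIV" using sets_eq_imp_space_eq[OF sM] sets_eq_imp_space_eq[OF sN] by auto
  have Sb[measurable]: "S \<in> sets borel" using S by (simp add: borel_closed compact_imp_closed)
  \<comment> \<open>Cutting \<open>f\<close> off outside \<open>S\<close> makes it bounded
    everywhere and changes neither integral.\<close>
  define F where "F x = indicator S x * f x" for x
  have [measurable]: "F \<in> borel_measurable borel" unfolding F_def using f(2) by measurable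
  have FM: "(\<integral>x. f x \<partial>M) = (\<integral>x. F x \<partial>M)"
    using AM f(2) by (intro integral_cong_AE) (auto simp: F_def indicator_def measurable_cong_sets[OF sM refl])
  have FN: "(\<integral>x. f x \<partial>N) = (\<integral>x. F x \<partial>N)"
    using AN f(2) by (intro integral_cong_AE) (auto simp: F_def indicator_def measurable_cong_sets[OF sN refl])
  obtain C where C: "\<And>x. x \<in> S \<Longrightarrow> \<bar>f x\<bar> \<le> C"
    using compact_imp_bounded[OF compact_continuous_image[OF f(1) S]] by (auto simp: bounded_iff)
  have FC: "\<bar>F x\<bar> \<le> \<bar>C\<bar>" for x using C[of x] by (auto simp: F_def indicator_def)
  have "S \<noteq> {}" using AM M.AE_False by auto
  then obtain x0 where x0: "x0 \<in> S" by blast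
  have "\<bar>(\<integral>x. F x \<partial>M) - (\<integral>x. F x \<partial>N)\<bar> \<le> e" if e: "e > 0" for e :: real
  proof -
    have "uniformly_continuous_on S f" using f(1) S by (rule compact_uniformly_continuous)
    then obtain r where r: "r > 0" "\<And>x y. x \<in> S \<Longrightarrow> y \<in> S \<Longrightarrow> dist y x < r \<Longrightarrow> dist (f y) (f x) < e"
      using e unfolding uniformly_continuous_on_def by metis
    define g where "g = measure M (ball x0 r)"
    define h where "h = measure N (ball x0 r)"
    define I where "I x y = (indicator {p. dist (fst p) (snd p) < r} (x, y) :: real)" for x y :: 'a
    have Im[measurable]: "(\<lambda>p. I (fst p) (snd p)) \<in> borel_measurable (borel \<Otimes>\<^sub>M borel)"
    proof -
      have "open {p :: 'a \<times> 'a. dist (fst p) (snd p) < r}"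
        by (intro open_Collect_less continuous_intros)
      then have "{p :: 'a \<times> 'a. dist (fst p) (snd p) < r} \<in> sets (borel \<Otimes>\<^sub>M borel)"
        unfolding borel_prod by (rule borel_open)
      then show ?thesis by (simp add: I_def)
    qed
    have IMm: "(\<lambda>y. \<integral>x. I x y \<partial>M) \<in> borel_measurable borel"
    proof (rule M.borel_measurable_lebesgue_integral)
      have "(\<lambda>p. I (fst (snd p, fst p)) (snd (snd p, fst p))) \<in> borel_measurable (borel \<Otimes>\<^sub>M M)"
        by (rule measurable_compose[OF _ Im]) measurable
      then show "(\<lambda>(y, x). I x y) \<in> borel_measurable (borel \<Otimes>\<^sub>M M)" by (simp add: case_prod_unfold)
    qed
    have IM: "(\<integral>x. I x y \<partial>M) = g" if "y \<in> S" for y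
    proof -
      have "(\<integral>x. I x y \<partial>M) = (\<integral>x. indicator (ball y r) x \<partial>M)"
        by (intro Bochner_Integration.integral_cong) (auto simp: I_def indicator_def dist_commute)
      also have "\<dots> = measure M (ball y r)" using spM by simp
      finally show ?thesis using bM[OF that x0] by (simp add: g_def)
    qed
    have IN: "(\<integral>y. I x y \<partial>N) = h" if "x \<in> S" for x
    proof -
      have "(\<integral>y. I x y \<partial>N) = (\<integral>y. indicator (ball x r) y \<partial>N)"
        by (intro Bochner_Integration.integral_cong) (auto simp: I_def indicator_def dist_commute)
      also have "\<dots> = measure N (ball x r)" using spN by simp
      finally show ?thesis using bN[OF that x0] by (simp add: h_def)
    qed
    have intb: "integrable (M \<Otimes>\<^sub>M N) (\<lambda>p. G p * I (fst p) (snd p))"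
      if [measurable]: "G \<in> borel_measurable (borel \<Otimes>\<^sub>M borel)" and "\<And>p. \<bar>G p\<bar> \<le> B" for G and B :: real
    proof (rule P.integrable_const_bound[where B=B])
      show "AE p in M \<Otimes>\<^sub>M N. norm (G p * I (fst p) (snd p)) \<le> B"
        using that(2) by (auto simp: I_def indicator_def intro: order_trans[OF abs_ge_zero])
    qed measurable
    have left: "(\<integral>p. G (fst p) * I (fst p) (snd p) \<partial>(M \<Otimes>\<^sub>M N)) = h * (\<integral>x. G x \<partial>M)"
      if [measurable]: "G \<in> borel_measurable borel" and "\<And>p. \<bar>G p\<bar> \<le> B" for G and B :: real
    proof -
      have "(\<integral>p. G (fst p) * I (fst p) (snd p) \<partial>(M \<Otimes>\<^sub>M N)) = (\<integral>x. \<integral>y. G x * I x y \<partial>N \<partial>M)"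
        using P.integral_fst'[OF intb[of "\<lambda>p. G (fst p)" B]] that by simp
      also have "\<dots> = (\<integral>x. h * G x \<partial>M)"
        using AM by (intro integral_cong_AE) (auto simp: IN mult.commute measurable_cong_sets[OF sM refl])
      finally show ?thesis by simp
    qed
    have right: "(\<integral>p. G (snd p) * I (fst p) (snd p) \<partial>(M \<Otimes>\<^sub>M N)) = g * (\<integral>x. G x \<partial>N)"
      if [measurable]: "G \<in> borel_measurable borel" and "\<And>p. \<bar>G p\<bar> \<le> B" for G and B :: real
    proof -
      have "(\<integral>p. G (snd p) * I (fst p) (snd p) \<partial>(M \<Otimes>\<^sub>M N)) = (\<integral>y. \<integral>x. G y * I x y \<partial>M \<partial>N)"
        using P.integral_snd[of "\<lambda>x y. G y * I x y"] intb[of "\<lambda>p. G (snd p)" B] that by (simp add: case_prod_unfold)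
      also have "\<dots> = (\<integral>x. g * G x \<partial>N)"
        using AN by (intro integral_cong_AE) (auto simp: IM mult.commute measurable_cong_sets[OF sN refl] intro!: borel_measurable_times IMm)
      finally show ?thesis by simp
    qed
    have gh: "g = h" using left[of "\<lambda>_. 1" 1] right[of "\<lambda>_. 1" 1] by (simp add: M.prob_space[unfolded spM] N.prob_space[unfolded spN] spM spN)
    \<comment> \<open>Otherwise the compact set \<open>S\<close>, covered by finitely many balls of
      radius \<open>r\<close>, would be a null set of \<open>M\<close>.\<close>
    have "g > 0"
    proof (rule ccontr)
      assume "\<not> g > 0"
      then have g0: "g = 0" by (simp add: g_def zero_less_measure_iff)
      obtain D where D: "D \<subseteq> S" "finite D" "S \<subseteq> (\<Union>x\<in>D. ball x r)"
        using compactE_image[OF S, of S "\<lambda>x. ball x r"] r(1) by (metis centre_in_ball open_ball UN_I subsetI)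
      have "measure M S \<le> measure M (\<Union>x\<in>D. ball x r)"
        by (intro M.finite_measure_mono D(3)) (auto simp: sM intro!: borel_open)
      also have "\<dots> \<le> (\<Sum>x\<in>D. measure M (ball x r))"
        by (intro M.finite_measure_subadditive_finite D(2)) (auto simp: sM intro!: borel_open)
      also have "\<dots> = 0" using bM[OF _ x0, of _ r] D(1) g0 by (intro sum.neutral) (auto simp: g_def)
      finally show False using M.prob_eq_1[of S] AM Sb sM by simp
    qed
    have bdF: "\<bar>F x - F y\<bar> \<le> \<bar>C\<bar> + \<bar>C\<bar>" for x y using FC[of x] FC[of y] by linarith
    have "g * (\<integral>x. F x \<partial>M) - g * (\<integral>x. F x \<partial>N) =
       (\<integral>p. (F (fst p) - F (snd p)) * I (fst p) (snd p) \<partial>(M \<Otimes>\<^sub>M N))"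
      using left[of F, OF _ FC] right[of F, OF _ FC] intb[of "\<lambda>p. F (fst p)", OF _ FC] intb[of "\<lambda>p. F (snd p)", OF _ FC]
      by (simp add: gh left_diff_distrib)
    then have "\<bar>g * (\<integral>x. F x \<partial>M) - g * (\<integral>x. F x \<partial>N)\<bar> \<le>
      (\<integral>p. \<bar>(F (fst p) - F (snd p)) * I (fst p) (snd p)\<bar> \<partial>(M \<Otimes>\<^sub>M N))"
      by (simp add: integral_abs_bound)
    \<comment> \<open>Where \<open>I\<close> is nonzero the two points are closer than
      \<open>r\<close>, so for points of \<open>S\<close> the values of \<open>F\<close> differ by
      less than \<open>e\<close>.\<close>
    also have "\<dots> \<le> (\<integral>p. e * I (fst p) (snd p) \<partial>(M \<Otimes>\<^sub>M N))"
    proof (rule integral_mono_AE)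
      show "integrable (M \<Otimes>\<^sub>M N) (\<lambda>p. \<bar>(F (fst p) - F (snd p)) * I (fst p) (snd p)\<bar>)"
        by (intro integrable_abs intb[OF _ bdF]) measurable
      show "integrable (M \<Otimes>\<^sub>M N) (\<lambda>p. e * I (fst p) (snd p))"
        by (rule intb[of "\<lambda>_. e" "\<bar>e\<bar>"]) auto
      have A1: "AE p in M \<Otimes>\<^sub>M N. fst p \<in> S"
        by (rule P.AE_pair_measure) (measurable, use AM in \<open>auto simp: N.AE_const\<close>)
      have A2: "AE p in M \<Otimes>\<^sub>M N. snd p \<in> S"
        by (rule P.AE_pair_measure) (measurable, use AN in auto)
      show "AE p in M \<Otimes>\<^sub>M N. \<bar>(F (fst p) - F (snd p)) * I (fst p) (snd p)\<bar> \<le> e * I (fst p) (snd p)"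
        using A1 A2
      proof eventually_elim
        case (elim p)
        then show ?case using r(2)[of "snd p" "fst p"]
          by (auto simp: I_def indicator_def F_def dist_real_def)
      qed
    qed
    also have "\<dots> = g * e" using right[of "\<lambda>_. e" "\<bar>e\<bar>"] by (simp add: N.prob_space[unfolded spN] spN)
    finally have "g * \<bar>(\<integral>x. F x \<partial>M) - (\<integral>x. F x \<partial>N)\<bar> \<le> g * e"
      using \<open>g > 0\<close> by (simp add: abs_mult right_diff_distrib[symmetric])
    then show ?thesis using \<open>g > 0\<close> by simp
  qed
  then have "\<bar>(\<integral>x. F x \<partial>M) - (\<integral>x. F x \<partial>N)\<bar> \<le> 0" by (rule field_le_epsilon[of _ 0, simplified])
  then show ?thesis using FM FN by simp
qed

lemma norm_transpose_matrix: "norm (transpose (A :: real^'m^'n)) = norm A"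
  unfolding norm_eq_sqrt_inner inner_vec_def transpose_def by (simp add: sum.swap[of _ "UNIV :: 'n set"])

lemma norm_matrix_rows: "(norm (A :: real^'m^'n))\<^sup>2 = (\<Sum>i\<in>UNIV. (norm (A $ i))\<^sup>2)"
  by (simp add: power2_norm_eq_inner inner_vec_def)

lemma norm_orthogonal_mult:
  fixes Q :: "real^'n^'n" and A :: "real^'m^'n"
  assumes "orthogonal_matrix Q"
  shows "norm (Q ** A) = norm A"
proof -
  have Q: "frame Q" using assms by (simp add: frame_def orthogonal_matrix_def)
  have rows: "transpose (Q ** A) $ j = Q *v (transpose A $ j)" for j
    by (simp add: vec_eq_iff transpose_def matrix_matrix_mult_def matrix_vector_mult_def)
  have "(norm (transpose (Q ** A)))\<^sup>2 = (norm (transpose A))\<^sup>2"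
    unfolding norm_matrix_rows rows frame_norm[OF Q] ..
  then show ?thesis by (simp add: norm_transpose_matrix del: matrix_transpose_mul)
qed

text \<open>The distance of matrices is the Euclidean distance of their entries, which
  multiplication by an orthogonal matrix preserves on either side.\<close>

lemma dist_orthogonal_conj:
  fixes Q :: "real^'n^'n"
  assumes Q: "orthogonal_matrix Q"
  shows "dist (Q ** A ** transpose Q) (Q ** B ** transpose Q) = dist A B"
proof -
  have sub: "C ** (D - E) = C ** D - C ** E" for C D E :: "real^'n^'n"
    by (simp add: matrix_matrix_mult_def vec_eq_iff right_diff_distrib sum_subtractf)
  have nr: "norm (C ** transpose Q) = norm C" for C :: "real^'n^'n"
  proof -
    have "norm (C ** transpose Q) = norm (transpose (Q ** transpose C))"
      by (simp add: matrix_transpose_mul)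
    then show ?thesis by (simp add: norm_transpose_matrix norm_orthogonal_mult[OF Q] del: matrix_transpose_mul)
  qed
  have "Q ** A ** transpose Q - Q ** B ** transpose Q = Q ** ((A - B) ** transpose Q)"
    by (simp add: matrix_mul_assoc[symmetric] sub[symmetric])
       (simp add: matrix_matrix_mult_def vec_eq_iff left_diff_distrib sum_subtractf)
  then show ?thesis unfolding dist_norm by (simp add: norm_orthogonal_mult[OF Q] nr)
qed

text \<open>Rotations act on the projections transitively, and by isometries. Hence an invariant law
  gives equal mass to balls of equal radius around any two projections, which is the hypothesis of
  the comparison above.\<close>

theorem rotation_invariant_integral_eq:
  fixes M N :: "(real^'n^'n) measure" and f :: "real^'n^'n \<Rightarrow> real"
  assumes M: "prob_space M" "sets M = sets borel" "AE P in M. P \<in> frame_projections TYPE('k::finite)"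
      "\<And>Q. rotation_matrix Q \<Longrightarrow> distr M borel (\<lambda>P. Q ** P ** transpose Q) = M"
    and N: "prob_space N" "sets N = sets borel" "AE P in N. P \<in> frame_projections TYPE('k)"
      "\<And>Q. rotation_matrix Q \<Longrightarrow> distr N borel (\<lambda>P. Q ** P ** transpose Q) = N"
    and f: "continuous_on (frame_projections TYPE('k)) f" "f \<in> borel_measurable borel"
  shows "(\<integral>P. f P \<partial>M) = (\<integral>P. f P \<partial>N)"
proof -
  have ball: "measure L (ball x r) = measure L (ball y r)"
    if L: "sets L = sets borel" "\<And>Q. rotation_matrix Q \<Longrightarrow> distr L borel (\<lambda>P. Q ** P ** transpose Q) = L"
      and xy: "x \<in> frame_projections TYPE('k)" "y \<in> frame_projections TYPE('k)"
    for L :: "(real^'n^'n) measure" and x y r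
  proof -
    obtain A B :: "real^'k^'n" where AB: "frame A" "x = A ** transpose A" "frame B" "y = B ** transpose B"
      using xy unfolding frame_projections_def by blast
    obtain Q where Q: "rotation_matrix Q" "Q ** x ** transpose Q = y"
      using rotation_between_frames[OF AB(1,3)] AB by metis
    have "(\<lambda>P. Q ** P ** transpose Q) -` ball y r = ball x r"
      using dist_orthogonal_conj[of Q x] Q by (auto simp: rotation_matrix_def)
    moreover have "(\<lambda>P. Q ** P ** transpose Q) \<in> measurable L borel"
      by (intro measurable_matrix_mult) (simp_all add: measurable_cong_sets[OF L(1) refl])
    moreover have "measure L (ball y r) = measure (distr L borel (\<lambda>P. Q ** P ** transpose Q)) (ball y r)"
      using L(2)[OF Q(1)] by simp
    ultimately show ?thesis
      using sets_eq_imp_space_eq[OF L(1)] by (simp add: measure_distr)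
  qed
  show ?thesis
    by (rule uniformly_distributed_integral_eq[OF M(1) N(1) M(2) N(2) compact_frame_projections M(3) N(3)
          ball[OF M(2,4)] ball[OF N(2,4)] f])
qed

section \<open>Gaussian vectors and matrices\<close>

abbreviation std_normal :: "real measure" where "std_normal \<equiv> density lborel std_normal_density"

definition std_gauss :: "(real^'p::finite) measure" where
  "std_gauss = distr (\<Pi>\<^sub>M i\<in>(UNIV :: 'p set). std_normal) borel (\<lambda>f. \<chi> i. f i)"

lemma prob_space_std_normal: "prob_space std_normal"
  by (rule prob_space_normal_density) simp

lemma measurable_PiM_vec [measurable]:
  "(\<lambda>f. \<chi> i. f i) \<in> measurable (\<Pi>\<^sub>M i\<in>(UNIV :: 'p::finite set). borel) (borel :: (real^'p) measure)"
  by (intro measurable_vec_lambda) measurable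

lemma sets_std_normal_PiM: "sets (\<Pi>\<^sub>M i\<in>I. std_normal) = sets (\<Pi>\<^sub>M i\<in>I. (borel :: real measure))"
  by (intro sets_PiM_cong) simp_all

lemma measurable_std_normal_vec:
  "(\<lambda>f. \<chi> i. f i) \<in> measurable (\<Pi>\<^sub>M i\<in>(UNIV :: 'p::finite set). std_normal) (borel :: (real^'p) measure)"
  by (simp add: measurable_cong_sets[OF sets_std_normal_PiM refl] measurable_PiM_vec)

lemma prob_space_std_gauss: "prob_space std_gauss"
  unfolding std_gauss_def
  by (intro prob_space.prob_space_distr prob_space_PiM prob_space_std_normal measurable_std_normal_vec)

lemma sets_std_gauss [simp, measurable_cong]: "sets std_gauss = sets borel"
  by (simp add: std_gauss_def)

lemma space_std_gauss [simp]: "space std_gauss = UNIV"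
  by (simp add: std_gauss_def)

lemma distr_PiM_lborel_vec:
 
  "distr (\<Pi>\<^sub>M i\<in>(UNIV :: 'p set). lborel) borel (\<lambda>f. (\<chi> i. f i) :: real^'p) = lborel"
proof (rule lborel_eqI[symmetric])
  interpret product_sigma_finite "\<lambda>_ :: 'p. lborel :: real measure" ..
  fix l u :: "real^'p" assume le: "\<And>b. b \<in> Basis \<Longrightarrow> l \<bullet> b \<le> u \<bullet> b"
  then have le': "l $ i \<le> u $ i" for i
    using le[of "axis i 1"] by (auto simp: inner_axis Basis_vec_def)
  have s: "sets (\<Pi>\<^sub>M i\<in>(UNIV :: 'p set). lborel) = sets (\<Pi>\<^sub>M i\<in>(UNIV :: 'p set). (borel :: real measure))"
    by (intro sets_PiM_cong) simp_all
  have m: "(\<lambda>f. \<chi> i. f i) \<in> measurable (\<Pi>\<^sub>M i\<in>(UNIV :: 'p set). lborel) (borel :: (real^'p) measure)"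
    by (simp add: measurable_cong_sets[OF s refl] measurable_PiM_vec)
  have "(\<lambda>f. \<chi> i. f i) -` box l u \<inter> space (\<Pi>\<^sub>M i\<in>(UNIV :: 'p set). lborel) = (\<Pi>\<^sub>E i\<in>UNIV. {l $ i <..< u $ i})"
    by (auto simp: mem_box_cart space_PiM PiE_iff)
  then have "emeasure (distr (\<Pi>\<^sub>M i\<in>(UNIV :: 'p set). lborel) borel (\<lambda>f. (\<chi> i. f i) :: real^'p)) (box l u) =
      (\<Prod>i\<in>UNIV. ennreal (u $ i - l $ i))"
    using m le' by (simp add: emeasure_distr emeasure_PiM)
  also have "\<dots> = ennreal (\<Prod>i\<in>UNIV. u $ i - l $ i)" using le' by (simp add: prod_ennreal)
  also have "(\<Prod>i\<in>UNIV. u $ i - l $ i) = (\<Prod>b\<in>Basis. (u - l) \<bullet> b)"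
  proof -
    have 1: "(Basis :: (real^'p) set) = range (\<lambda>i. axis i 1)" by (auto simp: Basis_vec_def)
    have 2: "inj (\<lambda>i::'p. axis i (1::real))" by (auto simp: inj_def axis_eq_axis)
    show ?thesis unfolding 1 prod.reindex[OF 2] by (simp add: inner_axis)
  qed
  finally show "emeasure (distr (\<Pi>\<^sub>M i\<in>(UNIV :: 'p set). lborel) borel (\<lambda>f. (\<chi> i. f i) :: real^'p)) (box l u) =
      ennreal (\<Prod>b\<in>Basis. (u - l) \<bullet> b)" .
qed simp

definition std_gauss_density :: "real^'p::finite \<Rightarrow> real" where
  "std_gauss_density x = (1 / sqrt (2 * pi)) ^ CARD('p) * exp (- (norm x)\<^sup>2 / 2)"

lemma prod_std_normal_density:
  "(\<Prod>i\<in>UNIV. std_normal_density (f i)) = std_gauss_density ((\<chi> i. f i) :: real^'p)"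
proof -
  have "(norm ((\<chi> i. f i) :: real^'p))\<^sup>2 = (\<Sum>i\<in>UNIV. (f i)\<^sup>2)"
    unfolding power2_norm_eq_inner inner_vec_def by (simp add: power2_eq_square)
  then show ?thesis
    by (simp add: std_gauss_density_def normal_density_def prod_dividef exp_sum[symmetric] sum_divide_distrib sum_negf power_divide)
qed

lemma measurable_std_gauss_density [measurable]: "std_gauss_density \<in> borel_measurable borel"
  unfolding std_gauss_density_def[abs_def] by measurable

lemma std_gauss_eq_density: "(std_gauss :: (real^'p::finite) measure) = density lborel (\<lambda>x. ennreal (std_gauss_density x))"
proof -
  let ?L = "\<Pi>\<^sub>M i\<in>(UNIV :: 'p set). (lborel :: real measure)"
  interpret L: product_sigma_finite "\<lambda>_ :: 'p. lborel :: real measure" ..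
  interpret N: product_prob_space "\<lambda>_ :: 'p. std_normal" by (intro product_prob_spaceI prob_space_std_normal)
  let ?g = "\<lambda>f :: 'p \<Rightarrow> real. ennreal (std_gauss_density (\<chi> i. f i))"
  have s: "sets ?L = sets (\<Pi>\<^sub>M i\<in>(UNIV :: 'p set). (borel :: real measure))"
    by (intro sets_PiM_cong) simp_all
  have m: "(\<lambda>f. \<chi> i. f i) \<in> measurable ?L (borel :: (real^'p) measure)"
    by (simp add: measurable_cong_sets[OF s refl] measurable_PiM_vec)
  have gm: "?g \<in> borel_measurable ?L"
    by (intro measurable_compose[OF m] measurable_compose[OF measurable_std_gauss_density]) simp
  have "density ?L ?g = (\<Pi>\<^sub>M i\<in>(UNIV :: 'p set). std_normal)"
  proof (rule N.PiM_eqI)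
    show "sets (density ?L ?g) = sets (\<Pi>\<^sub>M i\<in>(UNIV :: 'p set). std_normal)"
      by (simp add: s sets_std_normal_PiM)
    fix A :: "'p \<Rightarrow> real set" assume A: "\<And>i. i \<in> UNIV \<Longrightarrow> A i \<in> sets std_normal"
    have "emeasure (density ?L ?g) (\<Pi>\<^sub>E i\<in>UNIV. A i) = (\<integral>\<^sup>+f. ?g f * indicator (\<Pi>\<^sub>E i\<in>UNIV. A i) f \<partial>?L)"
      using A gm by (intro emeasure_density sets_PiM_I_finite) auto
    also have "\<dots> = (\<integral>\<^sup>+f. (\<Prod>i\<in>UNIV. ennreal (std_normal_density (f i)) * indicator (A i) (f i)) \<partial>?L)"
    proof (intro nn_integral_cong)
      fix f :: "'p \<Rightarrow> real"
      have "indicator (\<Pi>\<^sub>E i\<in>UNIV. A i) f = (\<Prod>i\<in>UNIV. indicator (A i) (f i) :: ennreal)"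
        by (cases "\<forall>i. f i \<in> A i") (auto simp: indicator_def)
      then show "?g f * indicator (\<Pi>\<^sub>E i\<in>UNIV. A i) f = (\<Prod>i\<in>UNIV. ennreal (std_normal_density (f i)) * indicator (A i) (f i))"
        by (simp add: prod.distrib prod_std_normal_density[symmetric] prod_ennreal)
    qed
    also have "\<dots> = (\<Prod>i\<in>UNIV. \<integral>\<^sup>+x. ennreal (std_normal_density x) * indicator (A i) x \<partial>lborel)"
      using A by (intro L.product_nn_integral_prod) auto
    also have "\<dots> = (\<Prod>i\<in>UNIV. emeasure std_normal (A i))"
      using A by (intro prod.cong refl emeasure_density[symmetric]) auto
    finally show "emeasure (density ?L ?g) (\<Pi>\<^sub>E i\<in>UNIV. A i) = (\<Prod>i\<in>UNIV. emeasure std_normal (A i))" .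
  qed simp
  then have "std_gauss = distr (density ?L ?g) borel (\<lambda>f. \<chi> i. f i)" by (simp add: std_gauss_def)
  also have "\<dots> = density (distr ?L borel (\<lambda>f. \<chi> i. f i)) (\<lambda>x. ennreal (std_gauss_density x))"
    using m by (intro density_distr[symmetric]) auto
  finally show ?thesis by (simp add: distr_PiM_lborel_vec)
qed

text \<open>The density depends on the norm only, and Lebesgue measure is invariant under orthogonal
  maps.\<close>

lemma distr_std_gauss_orthogonal:
  fixes f :: "real^'p \<Rightarrow> real^'p"
  assumes "orthogonal_transformation f"
  shows "distr std_gauss borel f = std_gauss"
proof -
  have f: "linear f" "\<And>x. norm (f x) = norm x" using assms by (auto simp: orthogonal_transformation)
  then have [measurable]: "f \<in> borel_measurable borel"
    by (intro borel_measurable_continuous_onI linear_continuous_on) (simp add: linear_conv_bounded_linear)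
  have "std_gauss = density (distr lborel borel f) (\<lambda>x. ennreal (std_gauss_density x))"
    by (simp add: distr_lborel_orthogonal[OF assms] std_gauss_eq_density)
  also have "\<dots> = distr (density lborel (\<lambda>x. ennreal (std_gauss_density (f x)))) borel f"
    by (intro density_distr) auto
  also have "\<dots> = distr std_gauss borel f"
    by (simp add: std_gauss_eq_density std_gauss_density_def f)
  finally show ?thesis by simp
qed

definition gauss_matrix :: "(real^'m^'n) measure" where
  "gauss_matrix = distr (std_gauss :: (real^('n \<times> 'm)) measure) borel (\<lambda>z. \<chi> i j. z $ (i, j))"

lemma measurable_uncurry_vec: "(\<lambda>z :: real^('n::finite \<times> 'm::finite). \<chi> i j. z $ (i, j)) \<in> borel_measurable borel"
  by (intro measurable_vec_lambda) measurable

lemma prob_space_gauss_matrix: "prob_space gauss_matrix"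
  unfolding gauss_matrix_def
  by (intro prob_space.prob_space_distr prob_space_std_gauss) (simp add: measurable_uncurry_vec)

lemma sets_gauss_matrix [simp, measurable_cong]: "sets gauss_matrix = sets borel"
  by (simp add: gauss_matrix_def)

lemma space_gauss_matrix [simp]: "space gauss_matrix = UNIV"
  by (simp add: gauss_matrix_def)

text \<open>Flattening a matrix into the vector of its entries turns \<open>f\<close> into an
  orthogonal transformation.\<close>

lemma distr_gauss_matrix_isometry:
  fixes f :: "real^'m^'n \<Rightarrow> real^'m^'n"
  assumes f: "linear f" "\<And>A. norm (f A) = norm A"
  shows "distr gauss_matrix borel f = gauss_matrix"
proof -
  let ?u = "\<lambda>z :: real^('n \<times> 'm). \<chi> i j. z $ (i, j)"
  let ?v = "\<lambda>A :: real^'m^'n. (\<chi> p. A $ fst p $ snd p) :: real^('n \<times> 'm)"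
  have lin: "linear ?u" "linear ?v" by (auto intro!: linearI simp: vec_eq_iff)
  have norm: "norm (?u z) = norm z" "norm (?v A) = norm A" for z A
    unfolding norm_eq_sqrt_inner inner_vec_def
    by (simp_all add: sum.cartesian_product UNIV_Times_UNIV[symmetric] case_prod_unfold del: UNIV_Times_UNIV)
  have uv: "?u (?v A) = A" for A by (simp add: vec_eq_iff)
  have fm[measurable]: "f \<in> borel_measurable borel"
    using f(1) by (intro borel_measurable_continuous_onI linear_continuous_on) (simp add: linear_conv_bounded_linear)
  have "orthogonal_transformation (\<lambda>z. ?v (f (?u z)))"
    using lin f norm by (auto simp: orthogonal_transformation intro!: linear_compose[of ?u "\<lambda>z. ?v (f z)", unfolded o_def] linear_compose[of f ?v, unfolded o_def])
  then have o: "distr std_gauss borel (\<lambda>z. ?v (f (?u z))) = std_gauss" by (rule distr_std_gauss_orthogonal)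
  have vm: "?v \<in> borel_measurable borel" by (intro measurable_vec_lambda) measurable
  have um: "?u \<in> borel_measurable borel" by (rule measurable_uncurry_vec)
  have "gauss_matrix = distr (distr std_gauss borel (\<lambda>z. ?v (f (?u z)))) borel ?u"
    unfolding o gauss_matrix_def ..
  also have "\<dots> = distr std_gauss borel (\<lambda>z. f (?u z))"
    using measurable_compose[OF um measurable_compose[OF fm vm]] um
    by (subst distr_distr) (simp_all add: o_def uv cong: measurable_cong_sets)
  also have "\<dots> = distr gauss_matrix borel f"
    unfolding gauss_matrix_def using um by (subst distr_distr) (simp_all add: o_def cong: measurable_cong_sets)
  finally show ?thesis by simp
qed

lemma distr_gauss_matrix_left:
  assumes "orthogonal_matrix (Q :: real^'n^'n)"
  shows "distr gauss_matrix borel (\<lambda>G :: real^'m^'n. Q ** G) = gauss_matrix"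
  by (intro distr_gauss_matrix_isometry norm_orthogonal_mult assms linearI)
     (simp_all add: vec_eq_iff matrix_matrix_mult_def distrib_left sum.distrib sum_distrib_left ac_simps)

lemma distr_gauss_matrix_right:
  assumes "orthogonal_matrix (Q :: real^'m^'m)"
  shows "distr gauss_matrix borel (\<lambda>G :: real^'m^'n. G ** Q) = gauss_matrix"
proof (rule distr_gauss_matrix_isometry)
  show "linear (\<lambda>G :: real^'m^'n. G ** Q)"
    by (intro linearI) (simp_all add: vec_eq_iff matrix_matrix_mult_def distrib_right distrib_left sum.distrib sum_distrib_left ac_simps)
  have "norm (G ** Q) = norm (transpose Q ** transpose G)" for G :: "real^'m^'n"
    by (metis matrix_transpose_mul norm_transpose_matrix)
  then show "norm (G ** Q) = norm G" for G :: "real^'m^'n"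
    using assms by (simp add: norm_orthogonal_mult norm_transpose_matrix orthogonal_matrix_transpose)
qed

definition matrix_of_columns :: "('m \<Rightarrow> real^'n) \<Rightarrow> real^'m^'n" where
  "matrix_of_columns x = (\<chi> i j. x j $ i)"

lemma measurable_matrix_of_columns:
  "matrix_of_columns \<in> measurable (\<Pi>\<^sub>M j\<in>(UNIV :: 'm::finite set). (borel :: (real^'n) measure)) borel"
  unfolding matrix_of_columns_def[abs_def] by (intro measurable_vec_lambda) measurable

lemma sets_PiM_std_gauss: "sets (\<Pi>\<^sub>M j\<in>I. std_gauss) = sets (\<Pi>\<^sub>M j\<in>I. (borel :: (real^'n::finite) measure))"
  by (intro sets_PiM_cong) simp_all

lemma measurable_matrix_of_columns_gauss:
  "matrix_of_columns \<in> measurable (\<Pi>\<^sub>M j\<in>(UNIV :: 'm::finite set). (std_gauss :: (real^'n) measure)) borel"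
  by (simp add: measurable_cong_sets[OF sets_PiM_std_gauss refl] measurable_matrix_of_columns)

lemma PiM_std_normal_columns:
  "distr (\<Pi>\<^sub>M j\<in>(UNIV :: 'm::finite set). (std_gauss :: (real^'n::finite) measure)) (\<Pi>\<^sub>M p\<in>(UNIV :: ('n \<times> 'm) set). borel)
     (\<lambda>x p. x (snd p) $ fst p) = (\<Pi>\<^sub>M p\<in>(UNIV :: ('n \<times> 'm) set). std_normal)" (is "distr ?G ?B ?f = ?N")
proof -
  interpret N: product_prob_space "\<lambda>_ :: 'n \<times> 'm. std_normal" UNIV by (intro product_prob_spaceI prob_space_std_normal)
  interpret N1: product_prob_space "\<lambda>_ :: 'n. std_normal" UNIV by (intro product_prob_spaceI prob_space_std_normal)
  interpret G: product_prob_space "\<lambda>_ :: 'm. std_gauss :: (real^'n) measure" UNIV by (intro product_prob_spaceI prob_space_std_gauss)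
  have fm: "?f \<in> measurable ?G ?B"
  proof (rule measurable_PiM_single')
    fix p :: "'n \<times> 'm"
    have "(\<lambda>x. x (snd p)) \<in> measurable ?G std_gauss" by (rule measurable_component_singleton) simp
    then show "(\<lambda>x. x (snd p) $ fst p) \<in> borel_measurable ?G"
      by (rule measurable_compose) simp
  qed auto
  show ?thesis
  proof (rule N.PiM_eqI)
    show "sets (distr ?G ?B ?f) = sets ?N" by (simp add: sets_std_normal_PiM)
    fix A :: "'n \<times> 'm \<Rightarrow> real set" assume "\<And>p. p \<in> UNIV \<Longrightarrow> A p \<in> sets std_normal"
    then have A: "A p \<in> sets borel" for p by simp
    let ?C = "\<lambda>j. {v :: real^'n. \<forall>i. v $ i \<in> A (i, j)}"
    have C: "?C j \<in> sets borel" for j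
    proof -
      have "?C j = (\<Inter>i\<in>UNIV. (\<lambda>v. v $ i) -` A (i, j) \<inter> space borel)" by auto
      also have "\<dots> \<in> sets borel" using A by (intro sets.finite_INT measurable_sets[of _ borel borel]) auto
      finally show ?thesis .
    qed
    have "emeasure (distr ?G ?B ?f) (\<Pi>\<^sub>E p\<in>UNIV. A p) = emeasure ?G (?f -` (\<Pi>\<^sub>E p\<in>UNIV. A p) \<inter> space ?G)"
      using A fm by (intro emeasure_distr sets_PiM_I_finite) auto
    also have "?f -` (\<Pi>\<^sub>E p\<in>UNIV. A p) \<inter> space ?G = (\<Pi>\<^sub>E j\<in>UNIV. ?C j)"
      by (auto simp: space_PiM PiE_iff)
    also have "emeasure ?G \<dots> = (\<Prod>j\<in>UNIV. emeasure std_gauss (?C j))"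
      using C by (intro G.emeasure_PiM) auto
    also have "\<dots> = (\<Prod>j\<in>UNIV. \<Prod>i\<in>UNIV. emeasure std_normal (A (i, j)))"
    proof (intro prod.cong refl)
      fix j
      have "emeasure std_gauss (?C j) = emeasure (\<Pi>\<^sub>M i\<in>(UNIV :: 'n set). std_normal) (\<Pi>\<^sub>E i\<in>UNIV. A (i, j))"
        unfolding std_gauss_def using C
        by (subst emeasure_distr[OF measurable_std_normal_vec]) (auto simp: space_PiM PiE_iff intro!: arg_cong2[of _ _ _ _ emeasure])
      also have "\<dots> = (\<Prod>i\<in>UNIV. emeasure std_normal (A (i, j)))"
        using A by (intro N1.emeasure_PiM) auto
      finally show "emeasure std_gauss (?C j) = (\<Prod>i\<in>UNIV. emeasure std_normal (A (i, j)))" .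
    qed
    also have "\<dots> = (\<Prod>p\<in>UNIV. emeasure std_normal (A p))"
      unfolding prod.cartesian_product
      by (rule prod.reindex_bij_witness[of _ "\<lambda>(i, j). (j, i)" "\<lambda>(j, i). (i, j)"]) auto
    finally show "emeasure (distr ?G ?B ?f) (\<Pi>\<^sub>E p\<in>UNIV. A p) = (\<Prod>p\<in>UNIV. emeasure std_normal (A p))" .
  qed simp
qed

lemma gauss_matrix_entries:
  "(gauss_matrix :: (real^'m::finite^'n::finite) measure) =
    distr (\<Pi>\<^sub>M p\<in>(UNIV :: ('n \<times> 'm) set). std_normal) borel (\<lambda>f. \<chi> i j. f (i, j))"
  unfolding gauss_matrix_def std_gauss_def
  by (subst distr_distr[OF measurable_uncurry_vec measurable_std_normal_vec]) (simp add: o_def)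

lemma gauss_matrix_columns:
  "(gauss_matrix :: (real^'m::finite^'n::finite) measure) =
    distr (\<Pi>\<^sub>M j\<in>(UNIV :: 'm set). (std_gauss :: (real^'n) measure)) borel matrix_of_columns"
proof -
  let ?G = "\<Pi>\<^sub>M j\<in>(UNIV :: 'm set). (std_gauss :: (real^'n) measure)"
  let ?B = "\<Pi>\<^sub>M p\<in>(UNIV :: ('n \<times> 'm) set). (borel :: real measure)"
  have fm: "(\<lambda>x p. x (snd p) $ fst p) \<in> measurable ?G ?B"
  proof (rule measurable_PiM_single')
    fix p :: "'n \<times> 'm"
    have "(\<lambda>x. x (snd p)) \<in> measurable ?G std_gauss" by (rule measurable_component_singleton) simp
    then show "(\<lambda>x. x (snd p) $ fst p) \<in> borel_measurable ?G"
      by (rule measurable_compose) simp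
  qed auto
  have gm: "(\<lambda>f. \<chi> i j. f (i, j)) \<in> measurable ?B (borel :: (real^'m^'n) measure)"
    by (intro measurable_vec_lambda) measurable
  show ?thesis
    unfolding gauss_matrix_entries PiM_std_normal_columns[symmetric]
    by (subst distr_distr[OF gm fm]) (simp add: o_def matrix_of_columns_def[abs_def])
qed

text \<open>The missing column is a unit vector orthogonal to the range of \<open>B\<close>, placed
  in position \<open>None\<close>.\<close>

lemma extend_frame_by_column:
  fixes B :: "real^'k::finite^'k option"
  assumes "frame B"
  obtains Q :: "real^'k option^'k option" where "orthogonal_matrix Q" "\<And>i j. Q $ i $ Some j = B $ i $ j"
proof -
  let ?L = "range ((*v) B)"
  have "dim ?L = CARD('k)" using gram_nonzero_range[of B] gram_frame[OF assms] by simp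
  then have "dim ?L < DIM(real^'k option)" by simp
  then obtain w where w: "w \<noteq> 0" "\<And>x. x \<in> span ?L \<Longrightarrow> orthogonal w x"
    using orthogonal_to_subspace_exists by blast
  define b where "b = w /\<^sub>R norm w"
  define Q :: "real^'k option^'k option" where "Q = (\<chi> i j. case j of None \<Rightarrow> b $ i | Some l \<Rightarrow> B $ i $ l)"
  have col: "column None Q = b" "column (Some j) Q = column j B" for j
    by (auto simp: Q_def column_def vec_eq_iff)
  have "orthogonal b (column j B)" for j
  proof -
    have "column j B \<in> ?L" by (metis matrix_vector_mult_basis rangeI)
    then show ?thesis using w(2)[of "column j B"] by (simp add: b_def span_base orthogonal_clauses)
  qed
  moreover have "norm b = 1" using w(1) by (simp add: b_def)
  then have "b \<bullet> b = 1" by (simp add: norm_eq_1)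
  ultimately have "frame Q"
    using assms unfolding frame_iff_columns
    by (auto simp: col orthogonal_def inner_commute split_option_all)
  then have "orthogonal_matrix Q"
    unfolding frame_def orthogonal_matrix by simp
  then show ?thesis using that by (simp add: Q_def)
qed

lemma matrix_of_columns_of_Some:
  "distr (gauss_matrix :: (real^'k option^'n) measure) borel (\<lambda>G. \<chi> i j. G $ i $ Some j)
    = (gauss_matrix :: (real^'k::finite^'n::finite) measure)"
proof -
  let ?G = "\<Pi>\<^sub>M j\<in>(UNIV :: 'k option set). (std_gauss :: (real^'n) measure)"
  let ?H = "\<Pi>\<^sub>M j\<in>(UNIV :: 'k set). (std_gauss :: (real^'n) measure)"
  have dm: "(\<lambda>G :: real^'k option^'n. \<chi> i j. G $ i $ Some j) \<in> borel_measurable borel"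
    by (intro measurable_vec_lambda) measurable
  have sm: "(\<lambda>x j. x (Some j)) \<in> measurable ?G ?H"
    by (rule measurable_PiM_single') auto
  have "distr ?G (\<Pi>\<^sub>M i\<in>(UNIV :: 'k set). std_gauss) (\<lambda>\<omega>. \<lambda>n\<in>UNIV. \<omega> (Some n)) = ?H"
    by (rule distr_PiM_reindex[where M="\<lambda>_. std_gauss"]) (auto intro: prob_space_std_gauss)
  then have r: "distr ?G ?H (\<lambda>x j. x (Some j)) = ?H" unfolding restrict_UNIV .
  have "distr (gauss_matrix :: (real^'k option^'n) measure) borel (\<lambda>G. \<chi> i j. G $ i $ Some j) =
     distr ?G borel (\<lambda>x. matrix_of_columns (\<lambda>j. x (Some j)))"
    unfolding gauss_matrix_columns by (subst distr_distr[OF dm measurable_matrix_of_columns_gauss])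
      (simp add: o_def matrix_of_columns_def)
  also have "\<dots> = distr (distr ?G ?H (\<lambda>x j. x (Some j))) borel matrix_of_columns"
    by (subst distr_distr[OF measurable_matrix_of_columns_gauss sm]) (simp add: o_def)
  finally show ?thesis unfolding r gauss_matrix_columns .
qed

text \<open>If \<open>B\<close> is completed to an orthogonal matrix \<open>Q\<close>, then
  \<open>G ** B\<close> is \<open>G ** Q\<close> without its column \<open>None\<close>.
  Multiplication by \<open>Q\<close> keeps the Gaussian law, and dropping a column leaves
  independent Gaussian columns.\<close>

lemma distr_gauss_matrix_frame:
  fixes B :: "real^'k::finite^'k option"
  assumes "frame B"
  shows "distr (gauss_matrix :: (real^'k option^'n) measure) borel (\<lambda>G. G ** B) = gauss_matrix"
proof -
  obtain Q where Q: "orthogonal_matrix Q" "\<And>i j. Q $ i $ Some j = B $ i $ j"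
    using extend_frame_by_column[OF assms] by blast
  let ?d = "\<lambda>G :: real^'k option^'n. (\<chi> i j. G $ i $ Some j) :: real^'k^'n"
  have dm: "?d \<in> borel_measurable borel" by (intro measurable_vec_lambda) measurable
  have qm: "(\<lambda>G :: real^'k option^'n. G ** Q) \<in> measurable gauss_matrix borel" by measurable
  have "?d (G ** Q) = G ** B" for G
    by (simp add: vec_eq_iff matrix_matrix_mult_def Q(2))
  then have "distr (gauss_matrix :: (real^'k option^'n) measure) borel (\<lambda>G. G ** B) =
      distr (distr gauss_matrix borel (\<lambda>G. G ** Q)) borel ?d"
    by (subst distr_distr[OF dm qm]) (simp add: o_def)
  then show ?thesis by (simp add: distr_gauss_matrix_right[OF Q(1)] matrix_of_columns_of_Some)
qed

section \<open>Moments of the Gaussian Gram determinant\<close>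

lemma pochhammer_nonneg_real: "(x::real) \<ge> 0 \<Longrightarrow> pochhammer x n \<ge> 0"
  by (auto simp: pochhammer_prod intro!: prod_nonneg)

text \<open>The factorial form of the even moments is rewritten with Pochhammer symbols, so that
  Vandermonde's identity can add up degrees of freedom.\<close>

lemma std_normal_nn_moment_even:
  "(\<integral>\<^sup>+x. ennreal (x ^ (2 * b)) \<partial>std_normal) = ennreal (2 ^ b * pochhammer (1/2) b)"
proof -
  have "(\<integral>\<^sup>+x. ennreal (x ^ (2 * b)) \<partial>std_normal) = (\<integral>\<^sup>+x. ennreal (std_normal_density x * x ^ (2 * b)) \<partial>lborel)"
    by (subst nn_integral_density) (auto simp: ennreal_mult'[symmetric])
  also have "\<dots> = ennreal (fact (2 * b) / (2 ^ b * fact b))"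
    using std_normal_moment_even[of b]
    by (subst nn_integral_eq_integral) (auto simp: has_bochner_integral_iff)
  also have "fact (2 * b) / (2 ^ b * fact b) = (2 ^ b * pochhammer (1/2) b :: real)"
    using fact_double[of b, where 'a=real] by (simp add: power_mult power2_eq_square power_mult_distrib field_simps flip: power_add)
  finally show ?thesis .
qed

text \<open>Moments of a chi-squared variable with \<open>card (I \<inter> T)\<close> degrees of freedom.\<close>

lemma chi_squared_moment_PiM:
  assumes "finite I"
  shows "(\<integral>\<^sup>+y. ennreal ((\<Sum>i\<in>I \<inter> T. (y i)\<^sup>2) ^ s) \<partial>(\<Pi>\<^sub>M i\<in>I. std_normal)) =
    ennreal (2 ^ s * pochhammer (card (I \<inter> T) / 2) s)"
  using assms
proof (induction I arbitrary: s)
  case empty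
  interpret product_prob_space "\<lambda>_ :: 'a. std_normal" UNIV by (intro product_prob_spaceI prob_space_std_normal)
  show ?case by (cases s) (auto simp: pochhammer_rec prob_space.emeasure_space_1[OF prob_space_PiM] prob_space_std_normal)
next
  case (insert j I)
  interpret N: product_prob_space "\<lambda>_ :: 'a. std_normal" UNIV by (intro product_prob_spaceI prob_space_std_normal)
  have [measurable]: "(\<lambda>y. ennreal ((\<Sum>i\<in>J \<inter> T. (y i)\<^sup>2) ^ t)) \<in> borel_measurable (\<Pi>\<^sub>M i\<in>K. std_normal)"
    if "J \<subseteq> K" for J K t
    using that by (intro measurable_compose[OF _ measurable_ennreal] borel_measurable_power borel_measurable_sum)
      (auto intro!: measurable_component_singleton[THEN measurable_compose])
  have "(\<integral>\<^sup>+y. ennreal ((\<Sum>i\<in>insert j I \<inter> T. (y i)\<^sup>2) ^ s) \<partial>(\<Pi>\<^sub>M i\<in>insert j I. std_normal)) =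
     (\<integral>\<^sup>+y. \<integral>\<^sup>+x. ennreal ((\<Sum>i\<in>insert j I \<inter> T. ((y(j := x)) i)\<^sup>2) ^ s) \<partial>std_normal \<partial>(\<Pi>\<^sub>M i\<in>I. std_normal))"
    by (rule N.product_nn_integral_insert[OF insert.hyps]) simp
  also have "\<dots> = ennreal (2 ^ s * pochhammer (card (insert j I \<inter> T) / 2) s)"
  proof (cases "j \<in> T")
    case False
    have eq: "(\<Sum>i\<in>insert j I \<inter> T. ((y(j := x)) i)\<^sup>2) = (\<Sum>i\<in>I \<inter> T. (y i)\<^sup>2)" for y x
      using False insert.hyps by (intro sum.cong) auto
    show ?thesis unfolding eq
      using False prob_space.emeasure_space_1[OF prob_space_std_normal] insert.IH by simp
  next
    case True
    have split: "(\<Sum>i\<in>insert j I \<inter> T. ((y(j := x)) i)\<^sup>2) = x\<^sup>2 + (\<Sum>i\<in>I \<inter> T. (y i)\<^sup>2)" for y x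
    proof -
      have "(\<Sum>i\<in>I \<inter> T. ((y(j := x)) i)\<^sup>2) = (\<Sum>i\<in>I \<inter> T. (y i)\<^sup>2)"
        using insert.hyps by (intro sum.cong) auto
      then show ?thesis using True insert.hyps by (simp add: Int_insert_left)
    qed
    have inner: "(\<integral>\<^sup>+x. ennreal ((\<Sum>i\<in>insert j I \<inter> T. ((y(j := x)) i)\<^sup>2) ^ s) \<partial>std_normal) =
      (\<Sum>b\<le>s. ennreal (of_nat (s choose b) * (2 ^ b * pochhammer (1/2) b)) * ennreal ((\<Sum>i\<in>I \<inter> T. (y i)\<^sup>2) ^ (s - b)))" for y
    proof -
      let ?a = "\<Sum>i\<in>I \<inter> T. (y i)\<^sup>2"
      have a: "?a \<ge> 0" by (intro sum_nonneg) simp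
      have "(\<integral>\<^sup>+x. ennreal ((\<Sum>i\<in>insert j I \<inter> T. ((y(j := x)) i)\<^sup>2) ^ s) \<partial>std_normal) =
         (\<integral>\<^sup>+x. (\<Sum>b\<le>s. ennreal (of_nat (s choose b) * ?a ^ (s - b)) * ennreal (x ^ (2 * b))) \<partial>std_normal)"
        unfolding split binomial_ring using a
      proof (intro nn_integral_cong)
        fix x
        have "ennreal (of_nat (s choose b) * ?a ^ (s - b)) * ennreal (x ^ (2 * b)) =
            ennreal (of_nat (s choose b) * (x\<^sup>2) ^ b * ?a ^ (s - b))" for b
          using a by (simp only: ennreal_mult'[symmetric] power_mult[symmetric] mult.assoc mult.commute[of "?a ^ _"] zero_le_power
              mult_nonneg_nonneg of_nat_0_le_iff)
        then show "ennreal (\<Sum>k\<le>s. of_nat (s choose k) * (x\<^sup>2) ^ k * ?a ^ (s - k)) =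
            (\<Sum>b\<le>s. ennreal (of_nat (s choose b) * ?a ^ (s - b)) * ennreal (x ^ (2 * b)))"
          using a by (subst sum_ennreal[symmetric]) auto
      qed
      also have "\<dots> = (\<Sum>b\<le>s. ennreal (of_nat (s choose b) * ?a ^ (s - b)) * ennreal (2 ^ b * pochhammer (1/2) b))"
        by (simp add: nn_integral_sum nn_integral_cmult std_normal_nn_moment_even)
      also have "\<dots> = (\<Sum>b\<le>s. ennreal (of_nat (s choose b) * (2 ^ b * pochhammer (1/2) b)) * ennreal (?a ^ (s - b)))"
        using a by (intro sum.cong refl) (simp add: ennreal_mult'[symmetric] pochhammer_nonneg_real ac_simps flip: ennreal_mult)
      finally show ?thesis .
    qed
    have "(\<integral>\<^sup>+y. \<integral>\<^sup>+x. ennreal ((\<Sum>i\<in>insert j I \<inter> T. ((y(j := x)) i)\<^sup>2) ^ s) \<partial>std_normal \<partial>(\<Pi>\<^sub>M i\<in>I. std_normal)) =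
      (\<Sum>b\<le>s. ennreal (of_nat (s choose b) * (2 ^ b * pochhammer (1/2) b)) * ennreal (2 ^ (s - b) * pochhammer (card (I \<inter> T) / 2) (s - b)))"
      unfolding inner by (simp add: nn_integral_sum nn_integral_cmult insert.IH)
    also have "\<dots> = ennreal (\<Sum>b\<le>s. 2 ^ s * (of_nat (s choose b) * pochhammer (1/2) b * pochhammer (card (I \<inter> T) / 2) (s - b)))"
    proof -
      have "ennreal (of_nat (s choose b) * (2 ^ b * pochhammer (1/2) b)) * ennreal (2 ^ (s - b) * pochhammer (card (I \<inter> T) / 2) (s - b))
         = ennreal (2 ^ s * (of_nat (s choose b) * pochhammer (1/2) b * pochhammer (card (I \<inter> T) / 2) (s - b)))" if "b \<le> s" for b
      proof -
        have "(2::real) ^ s = 2 ^ b * 2 ^ (s - b)" using that by (simp flip: power_add)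
        then show ?thesis by (subst ennreal_mult[symmetric]) (auto simp: pochhammer_nonneg_real ac_simps intro!: mult_nonneg_nonneg)
      qed
      then show ?thesis by (subst sum_ennreal[symmetric]) (auto simp: pochhammer_nonneg_real)
    qed
    \<comment> \<open>Vandermonde's identity for Pochhammer symbols: the new coordinate adds 1/2 to
      the parameter.\<close>
    also have "(\<Sum>b\<le>s. 2 ^ s * (of_nat (s choose b) * pochhammer (1/2) b * pochhammer (card (I \<inter> T) / 2) (s - b)))
       = 2 ^ s * pochhammer (1/2 + card (I \<inter> T) / 2 :: real) s"
      by (simp add: pochhammer_binomial_sum sum_distrib_left)
    also have "1/2 + card (I \<inter> T) / 2 = card (insert j I \<inter> T) / (2 :: real)"
      using True insert.hyps by (simp add: Int_insert_left add_divide_distrib)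
    finally show ?thesis .
  qed
  finally show ?case .
qed

lemma chi_squared_moment:
  fixes T :: "'n::finite set"
  shows "(\<integral>\<^sup>+y. ennreal ((\<Sum>i\<in>T. (y $ i)\<^sup>2) ^ s) \<partial>std_gauss) = ennreal (2 ^ s * pochhammer (card T / 2) s)"
proof -
  have "(\<integral>\<^sup>+y. ennreal ((\<Sum>i\<in>T. (y $ i)\<^sup>2) ^ s) \<partial>std_gauss) =
     (\<integral>\<^sup>+y. ennreal ((\<Sum>i\<in>T. (y i)\<^sup>2) ^ s) \<partial>(\<Pi>\<^sub>M i\<in>(UNIV::'n set). std_normal))"
    unfolding std_gauss_def by (subst nn_integral_distr[OF measurable_std_normal_vec]) simp_all
  then show ?thesis using chi_squared_moment_PiM[of UNIV T s] by simp
qed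

text \<open>The Gram determinant of the subfamily indexed by \<open>S\<close>. Padding with the
  identity keeps the format of the matrix fixed, so that \<open>S\<close> can grow one index at a
  time.\<close>

definition principal_gram :: "'k::finite set \<Rightarrow> ('k \<Rightarrow> real^'n) \<Rightarrow> real" where
  "principal_gram S x = det ((\<chi> i j. if i \<in> S \<and> j \<in> S then x i \<bullet> x j else if i = j then 1 else 0) :: real^'k^'k)"

lemma principal_gram_UNIV: "principal_gram UNIV x = gram (matrix_of_columns x)"
proof -
  have "transpose (matrix_of_columns x) ** matrix_of_columns x = (\<chi> i j. x i \<bullet> x j)"
    by (simp add: vec_eq_iff matrix_of_columns_def transpose_def matrix_matrix_mult_def inner_vec_def)
  then show ?thesis by (simp add: principal_gram_def gram_def)
qed

lemma principal_gram_empty: "principal_gram {} (x :: 'k::finite \<Rightarrow> real^'n) = 1"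
proof -
  have "principal_gram {} x = det (mat 1 :: real^'k^'k)" unfolding principal_gram_def mat_def by simp
  then show ?thesis by simp
qed

lemma principal_gram_cong:
  assumes "\<And>i. i \<in> S \<Longrightarrow> x i = y i"
  shows "principal_gram S x = principal_gram S y"
proof -
  have "(if i \<in> S \<and> j \<in> S then x i \<bullet> x j else if i = j then 1 else 0) =
    (if i \<in> S \<and> j \<in> S then y i \<bullet> y j else if i = j then 1 else 0)" for i j
    using assms by simp
  then show ?thesis unfolding principal_gram_def by simp
qed

text \<open>A permutation contributes to the Leibniz sum only if it fixes \<open>j\<close>, and then
  it meets column \<open>j\<close> only in row \<open>j\<close>.\<close>

lemma det_axis_row:
  fixes A :: "real^'k^'k"
  assumes "A $ j = axis j 1"
  shows "det A = det (\<chi> a b. if b = j \<and> a \<noteq> j then 0 else A $ a $ b)"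
  unfolding det_def
proof (intro sum.cong refl)
  fix p assume "p \<in> {p. p permutes (UNIV :: 'k set)}"
  then have p: "p i = j \<Longrightarrow> p j = j \<Longrightarrow> i = j" for i
    by (metis mem_Collect_eq permutes_inj injD)
  show "of_int (sign p) * (\<Prod>i\<in>UNIV. A $ i $ p i) =
      of_int (sign p) * (\<Prod>i\<in>UNIV. (\<chi> a b. if b = j \<and> a \<noteq> j then 0 else A $ a $ b) $ i $ p i)"
  proof (cases "p j = j")
    case True
    then have "p i = j \<Longrightarrow> i = j" for i using p by blast
    then show ?thesis by (intro arg_cong2[of _ _ _ _ "(*)"] prod.cong refl) auto
  next
    case False
    then have "A $ j $ p j = 0" using assms by (simp add: axis_def)
    then have "(\<Prod>i\<in>UNIV. A $ i $ p i) = 0"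
      "(\<Prod>i\<in>UNIV. (\<chi> a b. if b = j \<and> a \<noteq> j then 0 else A $ a $ b) $ i $ p i) = 0"
      using False by (auto intro!: prod_zero bexI[of _ j])
    then show ?thesis by (simp only:)
  qed
qed

text \<open>Base times height, squared. The map \<open>h\<close> sends the vectors of the family to
  rows of the Gram matrix, so \<open>h v\<close> is a combination of the other rows, and subtracting
  it from row \<open>j\<close> leaves \<open>r \<bullet> r\<close> times a unit row.\<close>

lemma principal_gram_insert:
  fixes x :: "'k::finite \<Rightarrow> real^'n"
  assumes j: "j \<notin> S" and x: "x j = v + r" and v: "v \<in> span (x ` S)" and r: "\<And>w. w \<in> span (x ` S) \<Longrightarrow> r \<bullet> w = 0"
  shows "principal_gram (insert j S) x = (r \<bullet> r) * principal_gram S x"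
proof -
  define M :: "real^'k^'k" where
    "M = (\<chi> i l. if i \<in> insert j S \<and> l \<in> insert j S then x i \<bullet> x l else if i = l then 1 else 0)"
  define h :: "real^'n \<Rightarrow> real^'k" where "h u = (\<chi> l. if l \<in> insert j S then u \<bullet> x l else 0)" for u
  have lh: "linear h" by (intro linearI) (auto simp: h_def vec_eq_iff inner_add_left)
  have hrow: "h (x i) = row i M" if "i \<in> insert j S" for i
    using that by (auto simp: h_def M_def row_def vec_eq_iff)
  have "h v \<in> span (h ` x ` S)" using v by (simp add: linear_span_image[OF lh])
  moreover have "h ` x ` S \<subseteq> {row i M |i. i \<noteq> j}" using hrow j by auto
  ultimately have "h v \<in> span {row i M |i. i \<noteq> j}" using span_mono by blast
  then have "- h v \<in> vec.span {row i M |i. i \<noteq> j}" by (simp add: span_vec_eq span_neg)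
  from det_row_span[OF this]
  have "det M = det (\<chi> k. if k = j then row j M + - h v else row k M)" by simp
  also have "row j M + - h v = (r \<bullet> r) *s axis j 1"
  proof -
    have "row j M = h v + h r" using hrow[of j] x by (simp add: linear_add[OF lh])
    then have "row j M + - h v = h r" by simp
    also have "\<dots> = (r \<bullet> r) *s axis j 1"
      using j r[of v] v r[OF span_base] by (auto simp: h_def vec_eq_iff axis_def x inner_add_right)
    finally show ?thesis .
  qed
  also have "det (\<chi> k. if k = j then (r \<bullet> r) *s axis j 1 else row k M) =
      (r \<bullet> r) * det (\<chi> k. if k = j then axis j 1 else row k M)"
    by (rule det_row_mul)
  also have "det (\<chi> k. if k = j then axis j 1 else row k M) =
      det (\<chi> a b. if b = j \<and> a \<noteq> j then 0 else (\<chi> k. if k = j then axis j 1 else row k M) $ a $ b)"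
    by (rule det_axis_row) simp
  also have "\<dots> = principal_gram S x"
    unfolding principal_gram_def using j
    by (intro arg_cong[of _ _ det]) (auto simp: vec_eq_iff M_def row_def axis_def)
  finally show ?thesis by (simp add: principal_gram_def M_def)
qed

lemma orthogonal_decomposition:
  fixes x :: "'a::euclidean_space"
  obtains v r where "x = v + r" "v \<in> span S" "\<And>w. w \<in> span S \<Longrightarrow> r \<bullet> w = 0"
  using orthogonal_subspace_decomp_exists[of S x] unfolding orthogonal_def by metis

lemma principal_gram_nonneg: "0 \<le> principal_gram S x"
proof -
  have "finite S" by simp
  then show ?thesis
  proof (induction S)
    case (insert j S)
    obtain v r where "x j = v + r" "v \<in> span (x ` S)" "\<And>w. w \<in> span (x ` S) \<Longrightarrow> r \<bullet> w = 0"
      using orthogonal_decomposition[of "x j" "x ` S"] by blast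
    then show ?case using principal_gram_insert[of j S x v r] insert by simp
  qed (simp add: principal_gram_empty)
qed

lemma principal_gram_nonzero_dim: "principal_gram S x \<noteq> 0 \<Longrightarrow> dim (x ` S) = card S"
proof -
  have "finite S" by simp
  then show "principal_gram S x \<noteq> 0 \<Longrightarrow> dim (x ` S) = card S"
  proof (induction S)
    case (insert j S)
    obtain v r where vr: "x j = v + r" "v \<in> span (x ` S)" "\<And>w. w \<in> span (x ` S) \<Longrightarrow> r \<bullet> w = 0"
      using orthogonal_decomposition[of "x j" "x ` S"] by blast
    have pg: "principal_gram (insert j S) x = (r \<bullet> r) * principal_gram S x"
      using principal_gram_insert[of j S x v r] vr insert.hyps by simp
    then have "r \<noteq> 0" "principal_gram S x \<noteq> 0" using insert.prems by auto
    moreover have "r = 0" if "x j \<in> span (x ` S)"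
    proof -
      have "x j - v \<in> span (x ` S)" using that vr(2) by (rule span_diff)
      then show ?thesis using vr(1) vr(3)[of r] by simp
    qed
    ultimately show ?case using insert by (auto simp: dim_insert)
  qed simp
qed

text \<open>The rows of \<open>Q\<close> are orthonormal bases of \<open>L\<close> and of its
  orthogonal complement, and \<open>T\<close> marks the latter. Thus the squared distance of
  \<open>y\<close> from \<open>L\<close> is a sum of as many squared coordinates of
  \<open>Q *v y\<close> as the complement has dimensions.\<close>

lemma orthonormal_residual:
  fixes L :: "(real^'n) set"
  assumes L: "subspace L"
  obtains Q :: "real^'n^'n" and T where "orthogonal_matrix Q" "card T + dim L = CARD('n)"
    "\<And>y. \<exists>v r. y = v + r \<and> v \<in> L \<and> (\<forall>w\<in>L. r \<bullet> w = 0) \<and> r \<bullet> r = (\<Sum>i\<in>T. ((Q *v y) $ i)\<^sup>2)"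
proof -
  define K where "K = {y. \<forall>x\<in>L. orthogonal x y}"
  have sK: "subspace K" unfolding K_def by (auto simp: subspace_def orthogonal_clauses)
  have dK: "dim K + dim L = CARD('n)"
    using dim_subspace_orthogonal_to_vectors[OF L subspace_UNIV] by (simp add: K_def)
  obtain B where B: "B \<subseteq> L" "pairwise orthogonal B" "\<And>x. x \<in> B \<Longrightarrow> norm x = 1"
    "independent B" "card B = dim L" "span B = L"
    using orthonormal_basis_subspace[OF L] by blast
  obtain C where C: "C \<subseteq> K" "pairwise orthogonal C" "\<And>x. x \<in> C \<Longrightarrow> norm x = 1"
    "independent C" "card C = dim K" "span C = K"
    using orthonormal_basis_subspace[OF sK] by blast
  have fin: "finite B" "finite C" using B(4) C(4) independent_imp_finite by auto
  have BC: "x \<in> B \<Longrightarrow> y \<in> C \<Longrightarrow> x \<bullet> y = 0" for x y using B(1) C(1) by (auto simp: K_def orthogonal_def)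
  have disj: "B \<inter> C = {}" using BC B(3) by (metis disjoint_iff norm_eq_1 zero_neq_one)
  have "card (B \<union> C) = CARD('n)" using dK B(5) C(5) by (simp add: card_Un_disjoint fin disj)
  then obtain b :: "'n \<Rightarrow> real^'n" where b: "bij_betw b UNIV (B \<union> C)"
    using fin finite_same_card_bij[of "UNIV::'n set" "B \<union> C"] by auto
  have orth: "b i \<bullet> b j = (if i = j then 1 else 0)" for i j
  proof (cases "i = j")
    case True
    have "b i \<in> B \<union> C" using b by (auto simp: bij_betw_def)
    then show ?thesis using True B(3) C(3) by (auto simp: norm_eq_1)
  next
    case False
    then have "b i \<noteq> b j" "b i \<in> B \<union> C" "b j \<in> B \<union> C" using b by (auto simp: bij_betw_def inj_on_def)
    then show ?thesis using False BC BC[of "b j" "b i"] B(2) C(2)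
      by (auto simp: pairwise_def orthogonal_def inner_commute)
  qed
  define Q :: "real^'n^'n" where "Q = (\<chi> i. b i)"
  have "frame (transpose Q)"
    unfolding frame_iff_columns by (simp add: column_def transpose_def Q_def orth vec_nth_inverse flip: inner_vec_def)
  then have oQ: "orthogonal_matrix Q"
    by (simp add: frame_def orthogonal_matrix_def matrix_left_right_inverse)
  define T where "T = {i. b i \<in> C}"
  have "b ` T = C" using b disj by (auto simp: T_def bij_betw_def)
  moreover have "inj_on b T" using b by (auto simp: bij_betw_def inj_on_def)
  ultimately have cT: "card T = dim K" using card_image C(5) by metis
  have Qy: "(Q *v y) $ i = b i \<bullet> y" for y i
    by (simp add: Q_def matrix_vector_mult_def inner_vec_def)
  show ?thesis
  proof (rule that[OF oQ])
    show "card T + dim L = CARD('n)" using cT dK by simp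
    fix y
    define r where "r = (\<Sum>i\<in>T. (b i \<bullet> y) *\<^sub>R b i)"
    define v where "v = (\<Sum>i\<in>-T. (b i \<bullet> y) *\<^sub>R b i)"
    have "y = transpose Q *v (Q *v y)"
      using oQ by (simp add: orthogonal_matrix_def matrix_vector_mul_assoc del: transpose_matrix_vector)
    also have "\<dots> = (\<Sum>i\<in>UNIV. (b i \<bullet> y) *\<^sub>R b i)"
      by (simp add: vec_eq_iff matrix_vector_mult_def transpose_def Qy[unfolded matrix_vector_mult_def, simplified] del: transpose_matrix_vector)
         (simp add: Q_def mult.commute)
    also have "\<dots> = v + r" unfolding r_def v_def
      by (subst sum.subset_diff[of T UNIV]) (auto simp: Compl_eq_Diff_UNIV)
    finally have y: "y = v + r" .
    have "b i \<in> L" if "i \<in> -T" for i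
      using that b B(1) by (auto simp: T_def bij_betw_def)
    then have vL: "v \<in> L" unfolding v_def by (intro subspace_sum[OF L] subspace_scale[OF L])
    have "b i \<in> K" if "i \<in> T" for i using that C(1) by (auto simp: T_def)
    then have "r \<in> K" unfolding r_def by (intro subspace_sum[OF sK] subspace_scale[OF sK])
    then have rL: "\<forall>w\<in>L. r \<bullet> w = 0" by (auto simp: K_def orthogonal_def inner_commute)
    have "r \<bullet> r = r \<bullet> y" using rL vL y by (simp add: inner_add_right)
    also have "\<dots> = (\<Sum>i\<in>T. ((Q *v y) $ i)\<^sup>2)"
      unfolding Qy by (simp add: r_def inner_sum_left power2_eq_square)
    finally show "\<exists>v r. y = v + r \<and> v \<in> L \<and> (\<forall>w\<in>L. r \<bullet> w = 0) \<and> r \<bullet> r = (\<Sum>i\<in>T. ((Q *v y) $ i)\<^sup>2)"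
      using y vL rL by blast
  qed
qed

lemma measurable_PiM_gauss_component:
  "i \<in> I \<Longrightarrow> (\<lambda>x. x i) \<in> borel_measurable (\<Pi>\<^sub>M i\<in>I. (std_gauss :: (real^'n::finite) measure))"
  using measurable_component_singleton[of i I "\<lambda>_. std_gauss :: (real^'n) measure"]
  by (simp add: measurable_cong_sets[OF refl sets_std_gauss])

lemma measurable_principal_gram:
  fixes S :: "'k::finite set"
  assumes "S \<subseteq> I"
  shows "principal_gram S \<in> borel_measurable (\<Pi>\<^sub>M i\<in>I. (std_gauss :: (real^'n::finite) measure))"
proof -
  let ?M = "\<Pi>\<^sub>M i\<in>I. (std_gauss :: (real^'n::finite) measure)"
  have "(\<lambda>x. (\<chi> i j. if i \<in> S \<and> j \<in> S then x i \<bullet> x j else if i = j then 1 else 0) :: real^'k^'k) \<in> borel_measurable ?M"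
  proof (intro measurable_vec_lambda)
    fix i j
    show "(\<lambda>x. if i \<in> S \<and> j \<in> S then x i \<bullet> x j else if i = j then 1 else 0) \<in> borel_measurable ?M"
      using assms by (cases "i \<in> S \<and> j \<in> S") (auto intro!: borel_measurable_inner measurable_PiM_gauss_component)
  qed
  from measurable_compose[OF this measurable_det] show ?thesis
    by (simp add: principal_gram_def[abs_def])
qed

lemma nn_integral_std_gauss_orthogonal:
  fixes Q :: "real^'n^'n"
  assumes "orthogonal_matrix Q" and [measurable]: "f \<in> borel_measurable borel"
  shows "(\<integral>\<^sup>+y. f (Q *v y) \<partial>std_gauss) = (\<integral>\<^sup>+y. f y \<partial>std_gauss)"
proof -
  have o: "orthogonal_transformation ((*v) Q)" using assms(1) by (simp add: orthogonal_transformation_matrix)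
  have m: "(*v) Q \<in> measurable std_gauss borel"
    by (simp add: measurable_cong_sets[OF sets_std_gauss refl] borel_measurable_continuous_onI continuous_on_matrix_vector)
  have "(\<integral>\<^sup>+y. f y \<partial>std_gauss) = (\<integral>\<^sup>+y. f y \<partial>distr std_gauss borel ((*v) Q))"
    by (simp add: distr_std_gauss_orthogonal[OF o])
  also have "\<dots> = (\<integral>\<^sup>+y. f (Q *v y) \<partial>std_gauss)" by (rule nn_integral_distr[OF m]) simp
  finally show ?thesis by simp
qed

lemma AE_std_gauss_coordinate_nonzero: "AE y in (std_gauss :: (real^'n::finite) measure). y $ i \<noteq> 0"
proof -
  have "negligible {y :: real^'n. y $ i = 0}" by (rule negligible_standard_hyperplane_cart)
  moreover have "{y :: real^'n. y $ i = 0} \<in> sets borel"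
    by (intro borel_closed closed_Collect_eq continuous_on_component continuous_on_id continuous_on_const)
  ultimately have "{y :: real^'n. y $ i = 0} \<in> null_sets lborel"
    by (simp add: negligible_iff_null_sets null_sets_completion_iff)
  then have "AE y in lborel. (y :: real^'n) $ i \<noteq> 0" by (rule AE_I') auto
  then show ?thesis unfolding std_gauss_eq_density by (subst AE_density) auto
qed

text \<open>The dependence of the Gram determinant on the last vector alone: after an orthogonal map
  determined by the earlier vectors it is proportional to a sum of squared coordinates, whose
  Gaussian moments are known.\<close>

lemma principal_gram_update:
  fixes x :: "'k::finite \<Rightarrow> real^'n"
  assumes "j \<notin> S"
  obtains Q :: "real^'n^'n" and T where "orthogonal_matrix Q" "card T + dim (x ` S) = CARD('n)"
    "\<And>y. principal_gram (insert j S) (x(j := y)) = (\<Sum>i\<in>T. ((Q *v y) $ i)\<^sup>2) * principal_gram S x"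
proof -
  obtain Q :: "real^'n^'n" and T where Q: "orthogonal_matrix Q" "card T + dim (x ` S) = CARD('n)"
    "\<And>y. \<exists>v r. y = v + r \<and> v \<in> span (x ` S) \<and> (\<forall>w\<in>span (x ` S). r \<bullet> w = 0) \<and> r \<bullet> r = (\<Sum>i\<in>T. ((Q *v y) $ i)\<^sup>2)"
    using orthonormal_residual[of "span (x ` S)"] by (metis dim_span subspace_span)
  have "principal_gram (insert j S) (x(j := y)) = (\<Sum>i\<in>T. ((Q *v y) $ i)\<^sup>2) * principal_gram S x" for y
  proof -
    have im: "(x(j := y)) ` S = x ` S" using assms by auto
    obtain v r where "y = v + r" "v \<in> span (x ` S)" "\<forall>w\<in>span (x ` S). r \<bullet> w = 0"
      and rr: "r \<bullet> r = (\<Sum>i\<in>T. ((Q *v y) $ i)\<^sup>2)" using Q(3) by blast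
    then have "(x(j := y)) j = v + r" "v \<in> span ((x(j := y)) ` S)" "\<And>w. w \<in> span ((x(j := y)) ` S) \<Longrightarrow> r \<bullet> w = 0"
      unfolding im by simp_all
    then have "principal_gram (insert j S) (x(j := y)) = (r \<bullet> r) * principal_gram S (x(j := y))"
      by (rule principal_gram_insert[OF assms])
    also have "principal_gram S (x(j := y)) = principal_gram S x"
      using assms by (intro principal_gram_cong) auto
    finally show ?thesis unfolding rr .
  qed
  then show ?thesis using that Q(1,2) by blast
qed

text \<open>If the earlier vectors are independent, their span is a proper subspace, so
  \<open>T\<close> contains some index \<open>i\<close>. The new determinant can then vanish only if
  coordinate \<open>i\<close> of the transformed new vector is 0, which has probability 0.\<close>

lemma AE_principal_gram_nonzero:
  fixes S :: "'k::finite set"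
  assumes "finite S" "card S \<le> CARD('n)"
  shows "AE x in (\<Pi>\<^sub>M i\<in>S. (std_gauss :: (real^'n::finite) measure)). principal_gram S x \<noteq> 0"
  using assms
proof (induction S)
  case empty
  then show ?case by (simp add: principal_gram_empty)
next
  case (insert j S)
  interpret G: product_prob_space "\<lambda>_ :: 'k. std_gauss :: (real^'n) measure" UNIV
    by (intro product_prob_spaceI prob_space_std_gauss)
  have meas: "principal_gram (insert j S) \<in> borel_measurable (\<Pi>\<^sub>M i\<in>insert j S. (std_gauss :: (real^'n) measure))"
    by (rule measurable_principal_gram) simp
  let ?f = "\<lambda>x :: 'k \<Rightarrow> real^'n. indicator {0::real} (principal_gram (insert j S) x) :: ennreal"
  have fm: "?f \<in> borel_measurable (\<Pi>\<^sub>M i\<in>insert j S. (std_gauss :: (real^'n) measure))"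
    using meas by (intro measurable_compose[OF meas]) simp
  have "(\<integral>\<^sup>+x. ?f x \<partial>(\<Pi>\<^sub>M i\<in>insert j S. (std_gauss :: (real^'n) measure))) =
     (\<integral>\<^sup>+x. \<integral>\<^sup>+y. ?f (x(j := y)) \<partial>std_gauss \<partial>(\<Pi>\<^sub>M i\<in>S. (std_gauss :: (real^'n) measure)))"
    by (rule G.product_nn_integral_insert[OF insert.hyps fm])
  also have "\<dots> = (\<integral>\<^sup>+x. 0 \<partial>(\<Pi>\<^sub>M i\<in>S. (std_gauss :: (real^'n) measure)))"
  proof (rule nn_integral_cong_AE)
    have "card S \<le> CARD('n)" using insert by simp
    from insert.IH[OF this]
    show "AE x in (\<Pi>\<^sub>M i\<in>S. (std_gauss :: (real^'n) measure)). (\<integral>\<^sup>+y. ?f (x(j := y)) \<partial>std_gauss) = 0"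
    proof eventually_elim
      case (elim x)
      obtain Q T where Q: "orthogonal_matrix Q" "card T + dim (x ` S) = CARD('n)"
        "\<And>y. principal_gram (insert j S) (x(j := y)) = (\<Sum>i\<in>T. ((Q *v y) $ i)\<^sup>2) * principal_gram S x"
        using principal_gram_update[OF insert.hyps(2)] by blast
      have "card T \<noteq> 0" using Q(2) principal_gram_nonzero_dim[OF elim] insert.hyps insert.prems by (simp del: card_0_eq)
      then obtain i where i: "i \<in> T" by fastforce
      have "(\<integral>\<^sup>+y. ?f (x(j := y)) \<partial>std_gauss) \<le> (\<integral>\<^sup>+y. indicator {y. y $ i = 0} (Q *v y) \<partial>std_gauss)"
      proof (intro nn_integral_mono)
        fix y :: "real^'n"
        have "(\<Sum>i\<in>T. ((Q *v y) $ i)\<^sup>2) = 0 \<Longrightarrow> (Q *v y) $ i = 0"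
          using i by (subst (asm) sum_nonneg_eq_0_iff) auto
        then show "?f (x(j := y)) \<le> indicator {y. y $ i = 0} (Q *v y)"
          using elim by (auto simp: indicator_def Q(3))
      qed
      also have "\<dots> = (\<integral>\<^sup>+y. indicator {y. y $ i = (0::real)} y \<partial>std_gauss)"
        by (intro nn_integral_std_gauss_orthogonal Q(1)) measurable
      also have "\<dots> = (\<integral>\<^sup>+y. 0 \<partial>(std_gauss :: (real^'n) measure))"
        using AE_std_gauss_coordinate_nonzero by (intro nn_integral_cong_AE) (auto simp: indicator_def)
      finally show ?case by simp
    qed
  qed
  finally have "(\<integral>\<^sup>+x. ?f x \<partial>(\<Pi>\<^sub>M i\<in>insert j S. (std_gauss :: (real^'n) measure))) = 0" by simp
  then have "AE x in (\<Pi>\<^sub>M i\<in>insert j S. (std_gauss :: (real^'n) measure)). ?f x = 0"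
    using nn_integral_0_iff_AE[OF fm] by simp
  then show ?case by eventually_elim (auto simp: indicator_def split: if_splits)
qed

text \<open>The product of the \<open>s\<close>-th moments of chi-squared variables with n, n - 1,
  ..., n - k + 1 degrees of freedom.\<close>

definition gram_moment :: "nat \<Rightarrow> nat \<Rightarrow> nat \<Rightarrow> real" where
  "gram_moment n k s = (\<Prod>i<k. 2 ^ s * pochhammer ((real n - real i) / 2) s)"

text \<open>Bartlett's decomposition on the level of moments: given independent earlier vectors, the
  squared height of the next one is chi-squared with \<open>CARD('n) - card S\<close> degrees of
  freedom.\<close>

lemma principal_gram_moment:
  fixes S :: "'k::finite set"
  assumes "finite S" "card S \<le> CARD('n)"
  shows "(\<integral>\<^sup>+x. ennreal (principal_gram S x ^ s) \<partial>(\<Pi>\<^sub>M i\<in>S. (std_gauss :: (real^'n::finite) measure))) =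
    ennreal (gram_moment CARD('n) (card S) s)"
  using assms
proof (induction S)
  case empty
  show ?case
    by (simp add: principal_gram_empty gram_moment_def prob_space.emeasure_space_1[OF prob_space_PiM] prob_space_std_gauss)
next
  case (insert j S)
  interpret G: product_prob_space "\<lambda>_ :: 'k. std_gauss :: (real^'n) measure" UNIV
    by (intro product_prob_spaceI prob_space_std_gauss)
  let ?p = "2 ^ s * pochhammer ((real CARD('n) - real (card S)) / 2) s"
  have p: "?p \<ge> 0" using insert by (intro mult_nonneg_nonneg pochhammer_nonneg_real) auto
  have meas: "(\<lambda>x. principal_gram K x) \<in> borel_measurable (\<Pi>\<^sub>M i\<in>K. (std_gauss :: (real^'n) measure))" for K :: "'k set"
    by (rule measurable_principal_gram) simp
  have "(\<integral>\<^sup>+x. ennreal (principal_gram (insert j S) x ^ s) \<partial>(\<Pi>\<^sub>M i\<in>insert j S. (std_gauss :: (real^'n) measure))) =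
     (\<integral>\<^sup>+x. \<integral>\<^sup>+y. ennreal (principal_gram (insert j S) (x(j := y)) ^ s) \<partial>std_gauss \<partial>(\<Pi>\<^sub>M i\<in>S. (std_gauss :: (real^'n) measure)))"
    by (intro G.product_nn_integral_insert insert.hyps measurable_compose[OF _ measurable_ennreal] borel_measurable_power meas)
  also have "\<dots> = (\<integral>\<^sup>+x. ennreal ?p * ennreal (principal_gram S x ^ s) \<partial>(\<Pi>\<^sub>M i\<in>S. (std_gauss :: (real^'n) measure)))"
  proof (rule nn_integral_cong)
    fix x :: "'k \<Rightarrow> real^'n"
    obtain Q T where Q: "orthogonal_matrix Q" "card T + dim (x ` S) = CARD('n)"
      "\<And>y. principal_gram (insert j S) (x(j := y)) = (\<Sum>i\<in>T. ((Q *v y) $ i)\<^sup>2) * principal_gram S x"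
      using principal_gram_update[OF insert.hyps(2)] by blast
    have "(\<integral>\<^sup>+y. ennreal (principal_gram (insert j S) (x(j := y)) ^ s) \<partial>std_gauss) =
       (\<integral>\<^sup>+y. ennreal (principal_gram S x ^ s) * ennreal ((\<Sum>i\<in>T. ((Q *v y) $ i)\<^sup>2) ^ s) \<partial>std_gauss)"
      unfolding Q(3) power_mult_distrib
      by (intro nn_integral_cong) (simp add: ennreal_mult principal_gram_nonneg sum_nonneg mult.commute)
    also have "\<dots> = (\<integral>\<^sup>+y. ennreal (principal_gram S x ^ s) * ennreal ((\<Sum>i\<in>T. (y $ i)\<^sup>2) ^ s) \<partial>std_gauss)"
      by (rule nn_integral_std_gauss_orthogonal[OF Q(1)]) measurable
    also have "\<dots> = ennreal (principal_gram S x ^ s) * ennreal (2 ^ s * pochhammer (card T / 2) s)"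
      by (subst nn_integral_cmult) (simp_all add: chi_squared_moment)
    also have "\<dots> = ennreal ?p * ennreal (principal_gram S x ^ s)"
    \<comment> \<open>If the earlier vectors are dependent, the size of \<open>T\<close> is not the
      expected one; but then both sides vanish for positive \<open>s\<close>, and all factors are 1
      for \<open>s = 0\<close>.\<close>
    proof (cases "principal_gram S x = 0")
      case True
      then show ?thesis by (cases s) auto
    next
      case False
      then have "real (card T) = real CARD('n) - real (card S)"
        using Q(2) principal_gram_nonzero_dim[OF False] by linarith
      then show ?thesis by (simp add: mult.commute)
    qed
    finally show "(\<integral>\<^sup>+y. ennreal (principal_gram (insert j S) (x(j := y)) ^ s) \<partial>std_gauss) =
        ennreal ?p * ennreal (principal_gram S x ^ s)" .
  qed
  also have "\<dots> = ennreal ?p * ennreal (gram_moment CARD('n) (card S) s)"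
    using insert meas[of S] by (subst nn_integral_cmult) auto
  also have "\<dots> = ennreal (gram_moment CARD('n) (card (insert j S)) s)"
    using insert.hyps p by (subst ennreal_mult'[symmetric]) (simp_all add: gram_moment_def mult.commute)
  finally show ?case .
qed

lemma gram_moment_pos: "k \<le> n \<Longrightarrow> gram_moment n k s > 0"
  unfolding gram_moment_def by (intro prod_pos mult_pos_pos ballI pochhammer_pos) auto

lemma measurable_gram_pow [measurable]: "(\<lambda>G :: real^'k^'n. gram G ^ s) \<in> borel_measurable borel"
  by measurable

theorem gauss_matrix_gram:
  assumes kn: "CARD('k) \<le> CARD('n)"
  shows "AE G in (gauss_matrix :: (real^'k::finite^'n::finite) measure). gram G \<noteq> 0"
    and "(\<integral>\<^sup>+G. ennreal (gram G ^ s) \<partial>(gauss_matrix :: (real^'k^'n) measure)) = ennreal (gram_moment CARD('n) CARD('k) s)"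
proof -
  show "AE G in (gauss_matrix :: (real^'k::finite^'n::finite) measure). gram G \<noteq> 0"
    unfolding gauss_matrix_columns
    using AE_principal_gram_nonzero[of "UNIV :: 'k set", where 'n='n] kn
    by (subst AE_distr_iff[OF measurable_matrix_of_columns_gauss]) (simp_all add: principal_gram_UNIV)
  show "(\<integral>\<^sup>+G. ennreal (gram G ^ s) \<partial>(gauss_matrix :: (real^'k^'n) measure)) = ennreal (gram_moment CARD('n) CARD('k) s)"
    unfolding gauss_matrix_columns
    using principal_gram_moment[of "UNIV :: 'k set", where 'n='n] kn
    by (subst nn_integral_distr[OF measurable_matrix_of_columns_gauss]) (simp_all add: principal_gram_UNIV)
qed

section \<open>The column space of a Gaussian matrix as a uniform subspace\<close>

lemma gram_pow_nonneg:
  fixes G :: "real^'k^'n"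
  assumes "CARD('k) \<le> CARD('n)"
  shows "0 \<le> gram G ^ s"
  using gram_nonneg[OF assms, of G] by simp

text \<open>The column space of a Gaussian matrix stays uniformly distributed under any reweighting by a power of the
  Gram determinant, because the reweighted law is still rotation invariant.\<close>

lemma tilted_column_projection_integral:
  fixes M :: "(real^'n^'n) measure" and f :: "real^'n^'n \<Rightarrow> real"
  assumes kn: "CARD('k::finite) \<le> CARD('n)"
    and M: "prob_space M" "sets M = sets borel" "AE P in M. P \<in> frame_projections TYPE('k)"
      "\<And>Q. rotation_matrix Q \<Longrightarrow> distr M borel (\<lambda>P. Q ** P ** transpose Q) = M"
    and f: "continuous_on (frame_projections TYPE('k)) f" "f \<in> borel_measurable borel"
  shows "gram_moment CARD('n) CARD('k) s * (\<integral>P. f P \<partial>M) =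
    (\<integral>G. gram G ^ s * f (column_projection G) \<partial>(gauss_matrix :: (real^'k^'n) measure))"
proof -
  let ?g = "gauss_matrix :: (real^'k^'n) measure" and ?c = "gram_moment CARD('n) CARD('k) s"
  have c: "?c > 0" using gram_moment_pos[OF kn] .
  define w where "w G = gram G ^ s / ?c" for G :: "real^'k^'n"
  have w0: "w G \<ge> 0" for G using gram_pow_nonneg[OF kn] c by (simp add: w_def)
  have wm[measurable]: "w \<in> borel_measurable borel" unfolding w_def[abs_def] by measurable
  define T where "T = density ?g (\<lambda>G. ennreal (w G))"
  define N where "N = distr T borel column_projection"
  have sT[simp, measurable_cong]: "sets T = sets borel" by (simp add: T_def)
  have spT[simp]: "space T = UNIV" by (simp add: T_def)
  have cpm[measurable]: "(column_projection :: real^'k^'n \<Rightarrow> _) \<in> borel_measurable borel"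
    using measurable_column_projection by simp
  have "emeasure T (space T) = (\<integral>\<^sup>+G. ennreal (w G) \<partial>?g)"
    unfolding spT T_def by (subst emeasure_density) simp_all
  also have "\<dots> = (\<integral>\<^sup>+G. ennreal (1 / ?c) * ennreal (gram G ^ s) \<partial>?g)"
    using c gram_pow_nonneg[OF kn] by (intro nn_integral_cong) (simp add: w_def ennreal_mult'[symmetric])
  also have "\<dots> = ennreal (1 / ?c) * ennreal ?c"
    by (subst nn_integral_cmult) (simp_all add: gauss_matrix_gram(2)[OF kn])
  also have "\<dots> = 1" using c by (simp add: ennreal_mult'[symmetric])
  finally have pT: "prob_space T" by (rule prob_spaceI)
  have pN: "prob_space N" unfolding N_def by (intro prob_space.prob_space_distr pT) simp
  have AET: "AE G in T. gram G \<noteq> 0"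
    unfolding T_def using gauss_matrix_gram(1)[OF kn] by (subst AE_density) auto
  have mem: "column_projection G \<in> frame_projections TYPE('k)" if "gram G \<noteq> 0" for G :: "real^'k^'n"
    using column_projection_frame[OF that] unfolding frame_projections_def by blast
  have fpb: "frame_projections TYPE('k) \<in> sets (borel :: (real^'n^'n) measure)"
    by (intro borel_closed compact_imp_closed compact_frame_projections)
  have AEN: "AE P in N. P \<in> frame_projections TYPE('k)"
    unfolding N_def using AET mem fpb by (subst AE_distr_iff) auto
  have inv: "distr N borel (\<lambda>P. Q ** P ** transpose Q) = N" if "rotation_matrix Q" for Q :: "real^'n^'n"
  proof -
    have oQ: "orthogonal_matrix Q" using that by (simp add: rotation_matrix_def)
    then have fQ: "frame Q" by (simp add: orthogonal_matrix_def frame_def)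
    \<comment> \<open>The Gram determinant, and with it the weight, does not change under
      multiplication by an orthogonal matrix from the left.\<close>
    have wQ: "w (Q ** G) = w G" for G by (simp add: w_def gram_frame_left[OF fQ])
    have "distr T borel ((**) Q) = distr (density ?g (\<lambda>G. ennreal (w (Q ** G)))) borel ((**) Q)"
      by (simp add: wQ T_def)
    also have "\<dots> = density (distr ?g borel ((**) Q)) (\<lambda>G. ennreal (w G))"
      by (intro density_distr[symmetric]) measurable
    also have "\<dots> = T" by (simp add: distr_gauss_matrix_left[OF oQ] T_def)
    finally have T: "distr T borel ((**) Q) = T" .
    have "distr N borel (\<lambda>P. Q ** P ** transpose Q) = distr T borel (\<lambda>G. Q ** column_projection G ** transpose Q)"
      unfolding N_def by (subst distr_distr) (simp_all add: o_def)
    also have "\<dots> = distr (distr T borel ((**) Q)) borel column_projection"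
      by (subst distr_distr) (simp_all add: o_def column_projection_orthogonal[OF oQ])
    finally show ?thesis unfolding T N_def .
  qed
  have sN: "sets N = sets borel" by (simp add: N_def)
  have "(\<integral>P. f P \<partial>M) = (\<integral>P. f P \<partial>N)"
    by (rule rotation_invariant_integral_eq[OF M pN sN AEN inv f])
  also have "\<dots> = (\<integral>G. f (column_projection G) \<partial>T)"
    unfolding N_def using f(2) by (subst integral_distr) simp_all
  also have "\<dots> = (\<integral>G. w G * f (column_projection G) \<partial>?g)"
    unfolding T_def using w0 f(2) by (subst integral_real_density) (simp_all add: measurable_compose[OF cpm f(2)])
  also have "\<dots> = (\<integral>G. gram G ^ s * f (column_projection G) \<partial>?g) / ?c"
    by (simp add: w_def)
  finally show ?thesis using c by simp
qed

text \<open>At the column space of \<open>G\<close>, \<open>compressed_det\<close> is almost surely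
  the ratio \<open>det (transpose G ** W ** G) / gram G\<close>. The first identity uses the
  Gaussian law without a weight; in the second, the weight \<open>gram G ^ s\<close> cancels the
  denominator of the ratio.\<close>

theorem invariant_projection_moments:
  fixes M :: "(real^'n^'n) measure" and W :: "real^'n^'n"
  assumes kn: "CARD('k::finite) \<le> CARD('n)"
    and M: "prob_space M" "sets M = sets borel" "AE P in M. P \<in> frame_projections TYPE('k)"
      "\<And>Q. rotation_matrix Q \<Longrightarrow> distr M borel (\<lambda>P. Q ** P ** transpose Q) = M"
  shows "(\<integral>P. compressed_det TYPE('k) W P ^ s \<partial>M) =
      (\<integral>G. (det (transpose G ** W ** G) / gram G) ^ s \<partial>(gauss_matrix :: (real^'k^'n) measure))"
    and "gram_moment CARD('n) CARD('k) s * (\<integral>P. compressed_det TYPE('k) W P ^ s \<partial>M) =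
      (\<integral>G. det (transpose G ** W ** G) ^ s \<partial>(gauss_matrix :: (real^'k^'n) measure))"
proof -
  let ?g = "gauss_matrix :: (real^'k^'n) measure"
  let ?f = "\<lambda>P. compressed_det TYPE('k) W P ^ s"
  have f: "continuous_on (frame_projections TYPE('k)) ?f" "?f \<in> borel_measurable borel"
    by (intro continuous_on_power continuous_on_compressed_det) measurable
  have cd: "gram G * compressed_det TYPE('k) W (column_projection G) = det (transpose G ** W ** G)"
    if "gram G \<noteq> 0" for G :: "real^'k^'n"
    using column_projection_frame[OF that] compressed_det_frame by metis
  note AE = gauss_matrix_gram(1)[OF kn]
  have fm: "?f \<circ> column_projection \<in> borel_measurable ?g"
    unfolding o_def by measurable
  have "(\<integral>P. ?f P \<partial>M) = (\<integral>G. ?f (column_projection G) \<partial>?g)"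
    using tilted_column_projection_integral[OF kn M f, of 0] by (simp add: gram_moment_def)
  also have "\<dots> = (\<integral>G. (det (transpose G ** W ** G) / gram G) ^ s \<partial>?g)"
  proof (rule integral_cong_AE)
    show "AE G in ?g. ?f (column_projection G) = (det (transpose G ** W ** G) / gram G) ^ s"
      using AE by eventually_elim (simp add: cd[symmetric])
  qed measurable
  finally show "(\<integral>P. ?f P \<partial>M) = (\<integral>G. (det (transpose G ** W ** G) / gram G) ^ s \<partial>?g)" .
  have "gram_moment CARD('n) CARD('k) s * (\<integral>P. ?f P \<partial>M) = (\<integral>G. gram G ^ s * ?f (column_projection G) \<partial>?g)"
    by (rule tilted_column_projection_integral[OF kn M f])
  also have "\<dots> = (\<integral>G. det (transpose G ** W ** G) ^ s \<partial>?g)"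
  proof (rule integral_cong_AE)
    show "AE G in ?g. gram G ^ s * ?f (column_projection G) = det (transpose G ** W ** G) ^ s"
      using AE by eventually_elim (simp add: power_mult_distrib[symmetric] cd)
  qed measurable
  finally show "gram_moment CARD('n) CARD('k) s * (\<integral>P. ?f P \<partial>M) = (\<integral>G. det (transpose G ** W ** G) ^ s \<partial>?g)" .
qed

section \<open>Interpolation weights, and polynomials along rays\<close>

text \<open>A Vandermonde system with the nodes 1, ..., D + 1, solved by adding one node at a
  time.\<close>

lemma interpolation_weights:
  fixes b :: "nat \<Rightarrow> real"
  shows "\<exists>w. \<forall>p\<le>D. (\<Sum>m\<le>D. w m * real (Suc m) ^ p) = b p"
proof (induction D arbitrary: b)
  case 0
  show ?case by (rule exI[of _ "\<lambda>_. b 0"]) simp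
next
  case (Suc D)
  let ?z = "real (Suc (Suc D))"
  \<comment> \<open>The right-hand side for \<open>u\<close>, and the later division by
    \<open>?z\<close> minus the node, are chosen so that the residual satisfies
    \<open>e (Suc p) = ?z * e p\<close>. A residual geometric in \<open>?z\<close> is removed by the
    weight \<open>e 0\<close> at the new node \<open>?z\<close>.\<close>
  obtain u where u: "\<And>p. p \<le> D \<Longrightarrow> (\<Sum>m\<le>D. u m * real (Suc m) ^ p) = ?z * b p - b (Suc p)"
    using Suc.IH[of "\<lambda>p. ?z * b p - b (Suc p)"] by auto
  define w where "w m = u m / (?z - real (Suc m))" for m
  define e where "e p = b p - (\<Sum>m\<le>D. w m * real (Suc m) ^ p)" for p
  have step: "e (Suc p) = ?z * e p" if "p \<le> D" for p
  proof -
    have "(\<Sum>m\<le>D. u m * real (Suc m) ^ p) = (\<Sum>m\<le>D. w m * (?z - real (Suc m)) * real (Suc m) ^ p)"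
      by (intro sum.cong refl) (simp add: w_def)
    also have "\<dots> = ?z * (\<Sum>m\<le>D. w m * real (Suc m) ^ p) - (\<Sum>m\<le>D. w m * real (Suc m) ^ Suc p)"
      unfolding sum_distrib_left sum_subtractf[symmetric] by (intro sum.cong refl) (simp add: algebra_simps)
    finally show ?thesis using u[OF that] by (simp add: e_def algebra_simps)
  qed
  have e: "e p = ?z ^ p * e 0" if "p \<le> Suc D" for p
    using that by (induction p) (auto simp: step)
  have "(\<Sum>m\<le>Suc D. (w(Suc D := e 0)) m * real (Suc m) ^ p) = b p" if "p \<le> Suc D" for p
  proof -
    have "(\<Sum>m\<le>D. (w(Suc D := e 0)) m * real (Suc m) ^ p) = (\<Sum>m\<le>D. w m * real (Suc m) ^ p)"
      by (intro sum.cong) auto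
    then show ?thesis using e[OF that] by (simp add: e_def mult.commute)
  qed
  then show ?case by blast
qed

text \<open>A polynomial on the space enters only through its restrictions to lines through the
  origin, with coefficients depending continuously on the direction vector. This suffices for
  splitting it into homogeneous parts.\<close>

definition ray_polynomial :: "nat \<Rightarrow> ('a::real_normed_vector \<Rightarrow> real) \<Rightarrow> bool" where
  "ray_polynomial d f \<longleftrightarrow> (\<exists>P. (\<forall>x. degree (P x) \<le> d) \<and> (\<forall>p. continuous_on UNIV (\<lambda>x. coeff (P x) p)) \<and>
     (\<forall>t x. f (t *\<^sub>R x) = poly (P x) t))"

text \<open>Comparing the expansions along \<open>x\<close> and along \<open>t *\<^sub>R x\<close>
  shows that the coefficient \<open>p\<close> is homogeneous of degree \<open>p\<close>.\<close>

lemma ray_polynomialE: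
  assumes "ray_polynomial d f"
  obtains c where "\<And>p. continuous_on UNIV (c p)" "\<And>t x. f (t *\<^sub>R x) = (\<Sum>p\<le>d. c p x * t ^ p)"
    "\<And>p t x. c p (t *\<^sub>R x) = t ^ p * c p x"
proof -
  obtain P where P: "\<And>x. degree (P x) \<le> d" "\<And>p. continuous_on UNIV (\<lambda>x. coeff (P x) p)"
    "\<And>t x. f (t *\<^sub>R x) = poly (P x) t"
    using assms unfolding ray_polynomial_def by blast
  have "poly (P x) t = (\<Sum>p\<le>d. coeff (P x) p * t ^ p)" for x t
    unfolding poly_altdef using P(1)[of x] by (intro sum.mono_neutral_left) (auto simp: coeff_eq_0)
  moreover have "coeff (P (t *\<^sub>R x)) p = t ^ p * coeff (P x) p" for p t x
  proof -
    have "poly (P (t *\<^sub>R x)) u = poly (pcompose (P x) [:0, t:]) u" for u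
      using P(3)[of u "t *\<^sub>R x"] P(3)[of "u * t" x] by (simp add: poly_pcompose)
    then have "P (t *\<^sub>R x) = pcompose (P x) [:0, t:]" by (simp add: poly_eq_poly_eq_iff[symmetric] fun_eq_iff)
    then show ?thesis by (simp add: coeff_pcompose_linear)
  qed
  ultimately show ?thesis using that[of "\<lambda>p x. coeff (P x) p"] P(2,3) by simp
qed

lemma ray_polynomial_const: "ray_polynomial d (\<lambda>_. a)"
  unfolding ray_polynomial_def
  by (intro exI[of _ "\<lambda>_. [:a:]"]) simp

lemma ray_polynomial_linear:
  fixes g :: "'a::euclidean_space \<Rightarrow> real"
  assumes "linear g"
  shows "ray_polynomial 1 g"
  unfolding ray_polynomial_def
proof (intro exI[of _ "\<lambda>x. [:0, g x:]"] conjI allI)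
  fix p
  have "continuous_on UNIV g" using assms by (simp add: linear_continuous_on linear_conv_bounded_linear)
  moreover have "coeff [:0, g x:] p = (if p = 1 then g x else 0)" for x
    by (auto simp: coeff_pCons split: nat.split)
  ultimately show "continuous_on UNIV (\<lambda>x. coeff [:0, g x:] p)" by (cases "p = 1") auto
qed (auto simp: linear_scale[OF assms])

lemma ray_polynomial_add:
  assumes "ray_polynomial d f" "ray_polynomial d g"
  shows "ray_polynomial d (\<lambda>x. f x + g x)"
proof -
  obtain P Q where P: "\<And>x. degree (P x) \<le> d" "\<And>p. continuous_on UNIV (\<lambda>x. coeff (P x) p)" "\<And>t x. f (t *\<^sub>R x) = poly (P x) t"
    and Q: "\<And>x. degree (Q x) \<le> d" "\<And>p. continuous_on UNIV (\<lambda>x. coeff (Q x) p)" "\<And>t x. g (t *\<^sub>R x) = poly (Q x) t"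
    using assms unfolding ray_polynomial_def by metis
  show ?thesis
    unfolding ray_polynomial_def
    by (intro exI[of _ "\<lambda>x. P x + Q x"]) (auto simp: P Q degree_add_le intro!: continuous_on_add)
qed

lemma ray_polynomial_mult:
  assumes "ray_polynomial d f" "ray_polynomial e g"
  shows "ray_polynomial (d + e) (\<lambda>x. f x * g x)"
proof -
  obtain P where P: "\<And>x. degree (P x) \<le> d" "\<And>p. continuous_on UNIV (\<lambda>x. coeff (P x) p)" "\<And>t x. f (t *\<^sub>R x) = poly (P x) t"
    using assms unfolding ray_polynomial_def by metis
  obtain Q where Q: "\<And>x. degree (Q x) \<le> e" "\<And>p. continuous_on UNIV (\<lambda>x. coeff (Q x) p)" "\<And>t x. g (t *\<^sub>R x) = poly (Q x) t"
    using assms unfolding ray_polynomial_def by metis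
  have "degree (P x * Q x) \<le> d + e" for x using degree_mult_le[of "P x" "Q x"] P(1)[of x] Q(1)[of x] by linarith
  then show ?thesis
    unfolding ray_polynomial_def
    by (intro exI[of _ "\<lambda>x. P x * Q x"])
       (auto simp: P Q coeff_mult intro!: continuous_on_sum continuous_on_mult)
qed

lemma ray_polynomial_sum:
  "finite I \<Longrightarrow> (\<And>i. i \<in> I \<Longrightarrow> ray_polynomial d (f i)) \<Longrightarrow> ray_polynomial d (\<lambda>x. \<Sum>i\<in>I. f i x)"
  by (induction I rule: finite_induct) (auto intro: ray_polynomial_const ray_polynomial_add)

lemma ray_polynomial_prod:
  "finite I \<Longrightarrow> (\<And>i. i \<in> I \<Longrightarrow> ray_polynomial d (f i)) \<Longrightarrow> ray_polynomial (card I * d) (\<lambda>x. \<Prod>i\<in>I. f i x)"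
  by (induction I rule: finite_induct) (auto intro: ray_polynomial_const ray_polynomial_mult)

lemma ray_polynomial_power: "ray_polynomial d f \<Longrightarrow> ray_polynomial (s * d) (\<lambda>x. f x ^ s)"
  by (induction s) (auto intro: ray_polynomial_const ray_polynomial_mult)

lemma ray_polynomial_det:
  fixes A :: "'a::real_normed_vector \<Rightarrow> real^'k^'k"
  assumes "\<And>i j. ray_polynomial d (\<lambda>x. A x $ i $ j)"
  shows "ray_polynomial (CARD('k) * d) (\<lambda>x. det (A x))"
  unfolding det_def
proof (intro ray_polynomial_sum)
  fix p :: "'k \<Rightarrow> 'k"
  have "ray_polynomial (0 + CARD('k) * d) (\<lambda>x. of_int (sign p) * (\<Prod>i\<in>UNIV. A x $ i $ p i))"
    using assms by (intro ray_polynomial_mult ray_polynomial_const ray_polynomial_prod) auto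
  then show "ray_polynomial (CARD('k) * d) (\<lambda>x. of_int (sign p) * (\<Prod>i\<in>UNIV. A x $ i $ p i))" by simp
qed (simp add: finite_permutations)

section \<open>Comparison of the uniform law on the ball with the Gaussian law\<close>

definition unif_ball :: "(real^'n::finite) measure" where
  "unif_ball = uniform_measure lborel (cball 0 1)"

lemma emeasure_unit_cball:
  "emeasure lborel (cball 0 1 :: (real^'n::finite) set) = ennreal (unit_ball_vol (real CARD('n)))"
  by (subst emeasure_cball) simp_all

lemma unit_ball_vol_pos_card: "0 < unit_ball_vol (real CARD('n::finite))"
  by (rule unit_ball_vol_pos) simp

lemma prob_space_unif_ball: "prob_space unif_ball"
  unfolding unif_ball_def
  by (rule prob_space_uniform_measure) (use unit_ball_vol_pos_card in \<open>simp_all add: emeasure_unit_cball ennreal_eq_0_iff not_le\<close>)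

lemma sets_unif_ball [simp, measurable_cong]: "sets unif_ball = sets borel"
  by (simp add: unif_ball_def)

lemma space_unif_ball [simp]: "space unif_ball = UNIV"
  by (simp add: unif_ball_def)

lemma AE_unif_ball: "AE x in unif_ball. norm x \<le> 1"
  unfolding unif_ball_def by (rule AE_uniform_measureI) auto

lemma nn_integral_unif_ball:
  fixes h :: "real^'n::finite \<Rightarrow> ennreal"
  assumes [measurable]: "h \<in> borel_measurable borel"
  shows "(\<integral>\<^sup>+x. h x * indicator (cball 0 1) x \<partial>lborel) = ennreal (unit_ball_vol (real CARD('n))) * (\<integral>\<^sup>+x. h x \<partial>unif_ball)"
proof -
  let ?v = "ennreal (unit_ball_vol (real CARD('n)))"
  have v: "?v \<noteq> 0" "?v \<noteq> \<infinity>" using unit_ball_vol_pos_card[where 'n='n] by (simp_all add: ennreal_eq_0_iff not_le)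
  have "(\<integral>\<^sup>+x. h x \<partial>unif_ball) = (\<integral>\<^sup>+x. h x * indicator (cball 0 1) x \<partial>lborel) / ?v"
    unfolding unif_ball_def emeasure_unit_cball[symmetric] by (rule nn_integral_uniform_measure) simp_all
  then show ?thesis using v mult_divide_eq_ennreal[of ?v "\<integral>\<^sup>+x. h x * indicator (cball 0 1) x \<partial>lborel"]
    by (simp only: ennreal_times_divide mult.commute[of ?v] infinity_ennreal_def not_False_eq_True)
qed

lemma nn_integral_lborel_scale:
  fixes f :: "real^'n::finite \<Rightarrow> ennreal"
  assumes "a > 0" and [measurable]: "f \<in> borel_measurable borel"
  shows "(\<integral>\<^sup>+x. f x \<partial>lborel) = ennreal (a ^ CARD('n)) * (\<integral>\<^sup>+x. f (a *\<^sub>R x) \<partial>lborel)"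
proof -
  have "(lborel :: (real^'n) measure) = density (distr lborel borel (\<lambda>x. 0 + a *\<^sub>R x)) (\<lambda>_. ennreal (\<bar>a\<bar> ^ DIM(real^'n)))"
    using assms(1) by (intro lborel_affine) simp
  then have "(\<integral>\<^sup>+x. f x \<partial>lborel) =
      (\<integral>\<^sup>+x. f x \<partial>density (distr lborel borel (\<lambda>x. 0 + a *\<^sub>R x)) (\<lambda>_. ennreal (\<bar>a\<bar> ^ DIM(real^'n))))"
    by metis
  also have "\<dots> = ennreal (a ^ CARD('n)) * (\<integral>\<^sup>+x. f (a *\<^sub>R x) \<partial>lborel)"
    using assms(1) by (subst nn_integral_density) (simp_all add: nn_integral_cmult nn_integral_distr)
  finally show ?thesis .
qed

lemma nn_integral_exp_tail: "(\<integral>\<^sup>+u. ennreal (exp (- u)) * indicator {a..} u \<partial>lborel) = ennreal (exp (- a))"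
proof -
  have "(\<integral>\<^sup>+u. ennreal (exp (- u)) * indicator {a..} u \<partial>lborel) = ennreal (0 - (- exp (- a)))"
  proof (rule nn_integral_FTC_atLeast)
    show "((\<lambda>u::real. - exp (- u)) \<longlongrightarrow> 0) at_top" by real_asymp
  qed (auto intro!: derivative_eq_intros)
  then show ?thesis by simp
qed

lemma ennreal_mult4:
  fixes I :: ennreal
  assumes "0 \<le> a" "0 \<le> b" "0 \<le> c" "0 \<le> d"
  shows "ennreal a * (ennreal b * I * ennreal c * ennreal d) = ennreal (a * b * c * d) * I"
proof -
  have "ennreal (a * b * c * d) = ennreal a * ennreal b * ennreal c * ennreal d"
    using assms by (simp add: ennreal_mult)
  then show ?thesis by (simp only: mult.assoc mult.commute[of I] mult.left_commute)
qed

text \<open>The Gaussian law is a mixture of the uniform laws on centred balls of radius \<open>sqrt (2 * u)\<close>, with \<open>u\<close>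
  Gamma distributed; this is the layer cake \<open>exp (- (norm x)\<^sup>2 / 2) = (\<integral>\<^sup>+u. exp (- u) * indicator {(norm x)\<^sup>2 / 2..} u)\<close>.\<close>

lemma gauss_ball_homogeneous_aux:
  fixes h :: "real^'n::finite \<Rightarrow> ennreal"
  assumes [measurable]: "h \<in> borel_measurable borel"
    and hom: "\<And>t x. t > 0 \<Longrightarrow> h (t *\<^sub>R x) = ennreal (t ^ (2 * m)) * h x"
  shows "(\<integral>\<^sup>+x. h x \<partial>std_gauss) = ennreal ((1 / sqrt (2 * pi)) ^ CARD('n) * unit_ball_vol (real CARD('n)) *
     2 powr (real CARD('n) / 2 + real m) * Gamma (real CARD('n) / 2 + 1 + real m)) * (\<integral>\<^sup>+x. h x \<partial>unif_ball)"
proof -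
  let ?n = "real CARD('n)" and ?K = "(1 / sqrt (2 * pi)) ^ CARD('n)" and ?I = "\<integral>\<^sup>+x. h x \<partial>unif_ball"
  have hm: "(\<lambda>x. h x * indicator (cball 0 1) x) \<in> borel_measurable borel"
    by (intro borel_measurable_times_ennreal assms(1) borel_measurable_indicator) simp
  have "(\<integral>\<^sup>+x. h x \<partial>std_gauss) = (\<integral>\<^sup>+x. ennreal (std_gauss_density x) * h x \<partial>lborel)"
    unfolding std_gauss_eq_density by (subst nn_integral_density) simp_all
  also have "\<dots> = (\<integral>\<^sup>+x. ennreal ?K * (\<integral>\<^sup>+u. h x * (ennreal (exp (- u)) * indicator {(norm x)\<^sup>2 / 2..} u) \<partial>lborel) \<partial>lborel)"
  proof (rule nn_integral_cong)
    fix x :: "real^'n"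
    have "(\<integral>\<^sup>+u. h x * (ennreal (exp (- u)) * indicator {(norm x)\<^sup>2 / 2..} u) \<partial>lborel) = h x * ennreal (exp (- ((norm x)\<^sup>2 / 2)))"
      by (subst nn_integral_cmult) (simp_all add: nn_integral_exp_tail)
    then show "ennreal (std_gauss_density x) * h x = ennreal ?K * (\<integral>\<^sup>+u. h x * (ennreal (exp (- u)) * indicator {(norm x)\<^sup>2 / 2..} u) \<partial>lborel)"
      by (simp add: std_gauss_density_def ennreal_mult ac_simps)
  qed
  also have "\<dots> = ennreal ?K * (\<integral>\<^sup>+x. \<integral>\<^sup>+u. h x * (ennreal (exp (- u)) * indicator {0..} (u - (norm x)\<^sup>2 / 2)) \<partial>lborel \<partial>lborel)"
    by (subst nn_integral_cmult[symmetric]) (measurable, auto intro!: nn_integral_cong simp: indicator_def)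
  also have "(\<integral>\<^sup>+x. \<integral>\<^sup>+u. h x * (ennreal (exp (- u)) * indicator {0..} (u - (norm x)\<^sup>2 / 2)) \<partial>lborel \<partial>lborel) =
     (\<integral>\<^sup>+u. \<integral>\<^sup>+x. h x * (ennreal (exp (- u)) * indicator {0..} (u - (norm x)\<^sup>2 / 2)) \<partial>lborel \<partial>lborel)"
    by (rule lborel_pair.Fubini') measurable
  also have "\<dots> = (\<integral>\<^sup>+u. ennreal (unit_ball_vol ?n) * ?I * ennreal (2 powr (?n / 2 + m)) *
      ennreal (indicator {0..} u * u powr (?n / 2 + 1 + m - 1) / exp u) \<partial>lborel)"
  proof (rule nn_integral_cong_AE)
    have "AE u in lborel. u \<noteq> (0::real)" by (rule AE_lborel_singleton)
    then show "AE u in lborel. (\<integral>\<^sup>+x. h x * (ennreal (exp (- u)) * indicator {0..} (u - (norm x)\<^sup>2 / 2)) \<partial>lborel) =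
       ennreal (unit_ball_vol ?n) * ?I * ennreal (2 powr (?n / 2 + m)) * ennreal (indicator {0..} u * u powr (?n / 2 + 1 + m - 1) / exp u)"
    proof eventually_elim
      case (elim u)
      show ?case
      proof (cases "u > 0")
        case False
        then have "u < 0" using elim by simp
        then have "indicator {0..} (u - (norm x)\<^sup>2 / 2) = (0 :: ennreal)" for x :: "real^'n"
        proof -
          have "\<not> 0 \<le> u - (norm x)\<^sup>2 / 2" using zero_le_power2[of "norm x"] \<open>u < 0\<close> by linarith
          then show ?thesis by simp
        qed
        then show ?thesis using \<open>u < 0\<close> by simp
      next
        case True
        let ?r = "sqrt (2 * u)"
        have r: "?r > 0" using True by simp
        have ind: "indicator {0..} (u - (norm (?r *\<^sub>R x))\<^sup>2 / 2) = (indicator (cball 0 1) x :: ennreal)" for x :: "real^'n"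
        proof -
          have "(norm (?r *\<^sub>R x))\<^sup>2 = 2 * u * (norm x)\<^sup>2"
          proof -
            have "norm (?r *\<^sub>R x) = ?r * norm x" using True by simp
            moreover have "?r\<^sup>2 = 2 * u" using True by (intro real_sqrt_pow2) simp
            ultimately show ?thesis by (simp only: power_mult_distrib)
          qed
          then have "u - (norm (?r *\<^sub>R x))\<^sup>2 / 2 = u * (1 - (norm x)\<^sup>2)"
            by (simp only:) (simp add: algebra_simps)
          moreover have "0 \<le> u * (1 - (norm x)\<^sup>2) \<longleftrightarrow> norm x \<le> 1"
            using True by (simp add: zero_le_mult_iff power_le_one_iff abs_square_le_1)
          ultimately show ?thesis by (simp add: indicator_def)
        qed
        \<comment> \<open>The scaling of Lebesgue measure and the homogeneity of \<open>h\<close>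
          together contribute the power \<open>?n + 2 * m\<close> of the radius, that is, the power
          \<open>?n / 2 + m\<close> of \<open>2 * u\<close>.\<close>
        have rp: "?r ^ CARD('n) * ?r ^ (2 * m) = 2 powr (?n / 2 + m) * u powr (?n / 2 + m)"
        proof -
          have "?r ^ CARD('n) * ?r ^ (2 * m) = ?r powr (?n + 2 * m)"
            using r by (simp add: powr_realpow[symmetric] powr_add)
          also have "\<dots> = ((2 * u) powr (1/2)) powr (?n + 2 * m)" using True by (simp only: powr_half_sqrt)
          also have "\<dots> = (2 * u) powr (?n / 2 + m)"
            by (simp add: powr_powr add_divide_distrib)
          finally show ?thesis using True by (simp add: powr_mult)
        qed
        have "(\<integral>\<^sup>+x. h x * (ennreal (exp (- u)) * indicator {0..} (u - (norm x)\<^sup>2 / 2)) \<partial>lborel) =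
           ennreal (?r ^ CARD('n)) * (\<integral>\<^sup>+x. h (?r *\<^sub>R x) * (ennreal (exp (- u)) * indicator {0..} (u - (norm (?r *\<^sub>R x))\<^sup>2 / 2)) \<partial>lborel)"
          by (rule nn_integral_lborel_scale[OF r]) measurable
        also have "\<dots> = ennreal (?r ^ CARD('n)) * (\<integral>\<^sup>+x. ennreal (?r ^ (2 * m) * exp (- u)) * (h x * indicator (cball 0 1) x) \<partial>lborel)"
          unfolding ind hom[OF r] using True by (simp add: ennreal_mult ac_simps)
        also have "\<dots> = ennreal (?r ^ CARD('n)) * (ennreal (?r ^ (2 * m) * exp (- u)) * (ennreal (unit_ball_vol ?n) * ?I))"
          using hm by (subst nn_integral_cmult) (simp_all add: nn_integral_unif_ball)
        also have "\<dots> = ennreal (unit_ball_vol ?n) * ?I * ennreal (?r ^ CARD('n) * ?r ^ (2 * m) * exp (- u))"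
          using True by (simp add: ennreal_mult ac_simps)
        also have "\<dots> = ennreal (unit_ball_vol ?n) * ?I * ennreal (2 powr (?n / 2 + m) * (u powr (?n / 2 + m) * exp (- u)))"
          unfolding rp by (simp add: ac_simps)
        also have "ennreal (2 powr (?n / 2 + m) * (u powr (?n / 2 + m) * exp (- u))) =
            ennreal (2 powr (?n / 2 + m)) * ennreal (indicator {0..} u * u powr (?n / 2 + 1 + m - 1) / exp u)"
        proof -
          have "indicator {0..} u * u powr (?n / 2 + 1 + m - 1) / exp u = u powr (?n / 2 + m) * exp (- u)"
          proof -
            have "?n / 2 + 1 + m - 1 = ?n / 2 + m" by simp
            then show ?thesis using True by (simp only: exp_minus divide_inverse) simp
          qed
          then show ?thesis by (simp only: ennreal_mult[OF powr_ge_zero mult_nonneg_nonneg[OF powr_ge_zero exp_ge_zero]])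
        qed
        finally show ?thesis by (simp only: mult.assoc)
      qed
    qed
  qed
  also have "\<dots> = ennreal (unit_ball_vol ?n) * ?I * ennreal (2 powr (?n / 2 + m)) * ennreal (Gamma (?n / 2 + 1 + m))"
  proof -
    have "ennreal (Gamma (?n / 2 + 1 + m)) = (\<integral>\<^sup>+u. ennreal (indicator {0..} u * u powr (?n / 2 + 1 + m - 1) / exp u) \<partial>lborel)"
      by (rule Gamma_conv_nn_integral_real) simp
    moreover have "(\<lambda>u. ennreal (indicator {0..} u * u powr (?n / 2 + 1 + m - 1) / exp u)) \<in> borel_measurable lborel"
      by measurable
    ultimately show ?thesis by (simp only: nn_integral_cmult)
  qed
  finally show ?thesis
    using unit_ball_vol_pos_card[where 'n='n] Gamma_real_pos[of "?n / 2 + 1 + m"]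
    by (simp only:, intro ennreal_mult4) auto
qed

text \<open>The constant found above is divided by its value for the function 1 and
  \<open>m = 0\<close>, where both integrals are 1. What remains is a power of 2 and a quotient of
  Gamma values.\<close>

theorem gauss_ball_homogeneous:
  fixes h :: "real^'n::finite \<Rightarrow> ennreal"
  assumes "h \<in> borel_measurable borel" and "\<And>t x. t > 0 \<Longrightarrow> h (t *\<^sub>R x) = ennreal (t ^ (2 * m)) * h x"
  shows "(\<integral>\<^sup>+x. h x \<partial>std_gauss) = ennreal (2 ^ m * pochhammer (real CARD('n) / 2 + 1) m) * (\<integral>\<^sup>+x. h x \<partial>unif_ball)"
proof -
  let ?n = "real CARD('n)"
  let ?C = "\<lambda>m::nat. (1 / sqrt (2 * pi)) ^ CARD('n) * unit_ball_vol ?n * 2 powr (?n / 2 + real m) * Gamma (?n / 2 + 1 + real m)"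
  have e1: "emeasure (std_gauss :: (real^'n) measure) UNIV = 1"
    using prob_space.emeasure_space_1[OF prob_space_std_gauss] by (metis space_std_gauss)
  have e2: "emeasure (unif_ball :: (real^'n) measure) UNIV = 1"
    using prob_space.emeasure_space_1[OF prob_space_unif_ball] by (metis space_unif_ball)
  have one: "ennreal (?C 0) = 1"
    using gauss_ball_homogeneous_aux[of "\<lambda>_ :: real^'n. 1" 0] 
      e1 e2 by simp
  have nz: "?n / 2 + 1 \<notin> \<int>\<^sub>\<le>\<^sub>0" using nonpos_Ints_nonpos by fastforce
  have "?C m = ?C 0 * (2 ^ m * pochhammer (?n / 2 + 1) m)"
    using Gamma_real_pos[of "?n / 2 + 1", THEN less_imp_neq] by (simp add: pochhammer_Gamma[OF nz] powr_add powr_realpow)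
  moreover have "?C 0 = 1" using one by (metis ennreal_eq_1)
  ultimately have "?C m = 2 ^ m * pochhammer (?n / 2 + 1) m" by (metis mult_1)
  then show ?thesis using gauss_ball_homogeneous_aux[OF assms] by (simp only:)
qed

lemma continuous_on_UNIV_borel: "continuous_on UNIV f \<Longrightarrow> f \<in> borel_measurable borel"
  by (rule borel_measurable_continuous_onI)

lemma continuous_on_bounded_ball:
  fixes h :: "real^'n::finite \<Rightarrow> real"
  assumes "continuous_on UNIV h"
  obtains B where "B \<ge> 0" "\<And>x. norm x \<le> 1 \<Longrightarrow> \<bar>h x\<bar> \<le> B"
proof -
  have "compact (h ` cball 0 1)" using assms by (intro compact_continuous_image continuous_on_subset[OF assms]) auto
  then have "bounded (h ` cball 0 1)" by (rule compact_imp_bounded)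
  then obtain B where "\<forall>y\<in>h ` cball 0 1. norm y \<le> B" unfolding bounded_iff by blast
  then have B: "\<bar>h x\<bar> \<le> B" if "norm x \<le> 1" for x using that by auto
  have "B \<ge> 0" using B[of 0] by simp
  with B show ?thesis using that by blast
qed

lemma integrable_unif_ball:
  fixes h :: "real^'n::finite \<Rightarrow> real"
  assumes "continuous_on UNIV h"
  shows "integrable unif_ball h"
proof -
  obtain B where B: "\<And>x. norm x \<le> 1 \<Longrightarrow> \<bar>h x\<bar> \<le> B" using continuous_on_bounded_ball[OF assms] by metis
  interpret prob_space "unif_ball :: (real^'n) measure" by (rule prob_space_unif_ball)
  have "AE x in unif_ball. norm (h x) \<le> B" using AE_unif_ball by eventually_elim (simp add: B)
  then show ?thesis
    using continuous_on_UNIV_borel[OF assms]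
    by (intro integrable_const_bound[where B=B]) (simp_all add: measurable_cong_sets[OF sets_unif_ball refl])
qed

text \<open>The identity for nonnegative functions is applied to the positive and the negative part
  of \<open>h\<close>, which are again homogeneous.\<close>

lemma homogeneous_integral:
  fixes h :: "real^'n::finite \<Rightarrow> real"
  assumes h: "continuous_on UNIV h" and hom: "\<And>t x. h (t *\<^sub>R x) = t ^ (2 * m) * h x"
  shows "integrable std_gauss h"
    and "(\<integral>x. h x \<partial>std_gauss) = 2 ^ m * pochhammer (real CARD('n) / 2 + 1) m * (\<integral>x. h x \<partial>unif_ball)"
proof -
  let ?c = "2 ^ m * pochhammer (real CARD('n) / 2 + 1) m"
  have c: "?c \<ge> 0" by (intro mult_nonneg_nonneg pochhammer_nonneg_real) auto
  have hm[measurable]: "h \<in> borel_measurable borel" using h by (rule continuous_on_UNIV_borel)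
  have iU: "integrable unif_ball h" by (rule integrable_unif_ball[OF h])
  have pos: "(\<integral>\<^sup>+x. ennreal (g (h x)) \<partial>std_gauss) = ennreal ?c * (\<integral>\<^sup>+x. ennreal (g (h x)) \<partial>unif_ball)"
    if g[measurable]: "g \<in> borel_measurable borel" and gs: "\<And>a x. a \<ge> 0 \<Longrightarrow> g (a * x) = a * g x" for g :: "real \<Rightarrow> real"
    by (rule gauss_ball_homogeneous) (auto simp: hom gs ennreal_mult')
  have n: "(\<integral>\<^sup>+x. ennreal \<bar>h x\<bar> \<partial>std_gauss) = ennreal ?c * (\<integral>\<^sup>+x. ennreal \<bar>h x\<bar> \<partial>unif_ball)"
    by (rule pos[of abs]) (auto simp: abs_mult)
  show iG: "integrable std_gauss h"
    using iU unfolding integrable_iff_bounded by (auto simp: n ennreal_mult_less_top)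
  have p: "(\<integral>\<^sup>+x. ennreal (h x) \<partial>std_gauss) = ennreal ?c * (\<integral>\<^sup>+x. ennreal (h x) \<partial>unif_ball)"
    using pos[of "\<lambda>x. x"] by simp
  have q: "(\<integral>\<^sup>+x. ennreal (- h x) \<partial>std_gauss) = ennreal ?c * (\<integral>\<^sup>+x. ennreal (- h x) \<partial>unif_ball)"
    by (rule pos[of uminus]) auto
  show "(\<integral>x. h x \<partial>std_gauss) = ?c * (\<integral>x. h x \<partial>unif_ball)"
    unfolding real_lebesgue_integral_def[OF iG] real_lebesgue_integral_def[OF iU] p q
    using c by (simp add: enn2real_mult right_diff_distrib)
qed

lemma integrable_gauss_growth: "integrable (std_gauss :: (real^'n::finite) measure) (\<lambda>x. (1 + norm x) ^ N)"
proof -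
  interpret prob_space "std_gauss :: (real^'n) measure" by (rule prob_space_std_gauss)
  have "integrable std_gauss (\<lambda>x :: real^'n. norm x ^ (2 * N))"
    by (intro homogeneous_integral(1)[of _ N] continuous_intros) (simp add: power_mult_distrib power_mult)
  then have i: "integrable std_gauss (\<lambda>x :: real^'n. 2 ^ N * (1 + norm x ^ (2 * N)))" by simp
  show ?thesis
  proof (rule Bochner_Integration.integrable_bound[OF i])
    have "(1 + a) ^ N \<le> 2 ^ N * (1 + a ^ (2 * N))" if "a \<ge> 0" for a :: real
    proof (cases "a \<le> 1")
      case True
      then have "(1 + a) ^ N \<le> 2 ^ N" using that by (intro power_mono) auto
      also have "\<dots> \<le> 2 ^ N * (1 + a ^ (2 * N))" using that by simp
      finally show ?thesis .
    next
      case False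
      then have "(1 + a) ^ N \<le> (2 * a) ^ N" by (intro power_mono) auto
      also have "\<dots> = 2 ^ N * a ^ N" by (simp add: power_mult_distrib)
      also have "a ^ N \<le> a ^ (2 * N)" using False by (intro power_increasing) auto
      then have "2 ^ N * a ^ N \<le> 2 ^ N * (1 + a ^ (2 * N))" by (intro mult_left_mono) auto
      finally show ?thesis .
    qed
    then show "AE x in std_gauss. norm ((1 + norm (x :: real^'n)) ^ N) \<le> norm (2 ^ N * (1 + norm x ^ (2 * N)))"
      by simp
  qed measurable
qed

lemma integrable_ball_growth: "integrable (unif_ball :: (real^'n::finite) measure) (\<lambda>x. (1 + norm x) ^ N)"
  by (intro integrable_unif_ball continuous_on_power continuous_on_add continuous_on_const continuous_on_norm continuous_on_id)

lemma distr_unif_ball_uminus: "distr (unif_ball :: (real^'n::finite) measure) borel uminus = unif_ball"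
proof -
  have o: "orthogonal_transformation (uminus :: real^'n \<Rightarrow> real^'n)"
    by (auto simp: orthogonal_transformation_def intro!: linearI)
  let ?g = "\<lambda>x :: real^'n. indicator (cball 0 1) x / emeasure lborel (cball 0 1 :: (real^'n) set)"
  have gm: "?g \<in> borel_measurable borel" by (intro borel_measurable_divide_ennreal borel_measurable_indicator) auto
  have "distr (density lborel (\<lambda>x. ?g (- x))) borel uminus = density (distr lborel borel uminus) ?g"
    using gm by (intro density_distr[symmetric]) auto
  then show ?thesis
    by (simp add: distr_lborel_orthogonal[OF o] unif_ball_def uniform_measure_def indicator_def)
qed

lemma distr_std_gauss_uminus: "distr (std_gauss :: (real^'n::finite) measure) borel uminus = std_gauss"
  by (rule distr_std_gauss_orthogonal) (auto simp: orthogonal_transformation_def intro!: linearI)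

lemma odd_integral_eq_0:
  fixes h :: "real^'n::finite \<Rightarrow> real"
  assumes "distr M borel uminus = M" "sets M = sets borel" and [measurable]: "h \<in> borel_measurable borel" and odd: "\<And>x. h (- x) = - h x"
  shows "(\<integral>x. h x \<partial>M) = 0"
proof -
  have "(\<integral>x. h x \<partial>M) = (\<integral>x. h x \<partial>distr M borel uminus)" by (simp add: assms(1))
  also have "\<dots> = (\<integral>x. h (- x) \<partial>M)"
    by (subst integral_distr) (auto simp: measurable_cong_sets[OF assms(2) refl])
  finally show ?thesis by (simp add: odd)
qed

lemma sum_even_terms:
  fixes f :: "nat \<Rightarrow> real"
  assumes "\<And>p. odd p \<Longrightarrow> f p = 0"
  shows "(\<Sum>p\<le>2 * D. f p) = (\<Sum>j\<le>D. f (2 * j))"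
proof (induction D)
  case (Suc D)
  have "2 * Suc D = Suc (Suc (2 * D))" by simp
  then show ?case using Suc assms[of "Suc (2 * D)"] by (simp only: sum.atMost_Suc) simp
qed simp

text \<open>The homogeneous part of degree \<open>2 * j\<close> has a Gaussian mean that is
  \<open>?k j\<close> times its ball mean, and scaling the argument by \<open>sqrt (Suc m)\<close>
  multiplies it by \<open>Suc m ^ j\<close>. The weights undo the factors \<open>?k j\<close> for
  all \<open>j \<le> D\<close> at once. Parts of odd degree have mean 0 under both laws.\<close>

theorem ball_gauss_ray_polynomial:
  fixes q :: "real^'n::finite \<Rightarrow> real"
  assumes q: "ray_polynomial (2 * D) q"
    and w: "\<And>p. p \<le> D \<Longrightarrow> (\<Sum>m\<le>D. w m * real (Suc m) ^ p) = 1 / (2 ^ p * pochhammer (real CARD('n) / 2 + 1) p)"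
  shows "(\<integral>x. q x \<partial>unif_ball) = (\<Sum>m\<le>D. w m * (\<integral>x. q (sqrt (real (Suc m)) *\<^sub>R x) \<partial>std_gauss))"
proof -
  obtain c where c: "\<And>p. continuous_on UNIV (c p)" "\<And>t x. q (t *\<^sub>R x) = (\<Sum>p\<le>2 * D. c p x * t ^ p)"
    "\<And>p t x. c p (t *\<^sub>R x) = t ^ p * c p x"
    by (rule ray_polynomialE[OF q]) blast
  let ?k = "\<lambda>j. 2 ^ j * pochhammer (real CARD('n) / 2 + 1) j"
  have k: "?k j \<noteq> 0" for j
  proof -
    have "pochhammer (real CARD('n) / 2 + 1) j > 0" by (intro pochhammer_pos) simp
    then show ?thesis by simp
  qed
  have odd: "c p (- x) = - c p x" if "odd p" for p x
    using c(3)[of p "-1" x] that by simp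
  have cm: "c p \<in> borel_measurable borel" for p using c(1) by (rule continuous_on_UNIV_borel)
  have oddU: "(\<integral>x. c p x \<partial>unif_ball) = 0" and oddG: "(\<integral>x. c p x \<partial>std_gauss) = 0" if "odd p" for p
    using odd_integral_eq_0[OF distr_unif_ball_uminus sets_unif_ball cm odd[OF that]]
      odd_integral_eq_0[OF distr_std_gauss_uminus sets_std_gauss cm odd[OF that]] by auto
  have iU: "integrable unif_ball (c p)" for p by (rule integrable_unif_ball[OF c(1)])
  have iG: "integrable std_gauss (c p)" for p
  proof -
    obtain B where B: "B \<ge> 0" "\<And>x. norm x \<le> 1 \<Longrightarrow> \<bar>c p x\<bar> \<le> B" by (rule continuous_on_bounded_ball[OF c(1)]) blast
    show ?thesis
    proof (rule Bochner_Integration.integrable_bound[OF integrable_mult_right[OF integrable_gauss_growth[where N=p], of B]])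
      have "\<bar>c p x\<bar> \<le> B * (1 + norm x) ^ p" for x
      proof -
        \<comment> \<open>Homogeneity transports the bound from the unit ball, into which
          \<open>1 / t\<close> scales \<open>x\<close>.\<close>
        define t where "t = 1 + norm x"
        have t: "t > 0" "norm x \<le> t" by (simp_all add: t_def add_pos_nonneg)
        have "t *\<^sub>R (x /\<^sub>R t) = x" using t by simp
        then have "c p x = t ^ p * c p (x /\<^sub>R t)" by (metis c(3))
        moreover have "\<bar>c p (x /\<^sub>R t)\<bar> \<le> B" using t by (intro B(2)) (simp add: divide_simps)
        ultimately show ?thesis
          using t mult_left_mono[of "\<bar>c p (x /\<^sub>R t)\<bar>" B "t ^ p"] unfolding t_def[symmetric] by (simp add: abs_mult mult.commute)
      qed
      then show "AE x in std_gauss. norm (c p x) \<le> norm (B * (1 + norm x) ^ p)" using B(1) by simp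
    qed (simp add: cm measurable_cong_sets[OF sets_std_gauss refl])
  qed
  have hom: "(\<integral>x. c (2 * j) x \<partial>std_gauss) = ?k j * (\<integral>x. c (2 * j) x \<partial>unif_ball)" for j
    by (rule homogeneous_integral(2)[OF c(1) c(3)])
  have "(\<integral>x. q x \<partial>unif_ball) = (\<integral>x. (\<Sum>p\<le>2 * D. c p x) \<partial>unif_ball)" using c(2)[of 1] by simp
  also have "\<dots> = (\<Sum>p\<le>2 * D. \<integral>x. c p x \<partial>unif_ball)" by (rule Bochner_Integration.integral_sum) (rule iU)
  also have "\<dots> = (\<Sum>j\<le>D. \<integral>x. c (2 * j) x \<partial>unif_ball)" by (rule sum_even_terms[OF oddU])
  finally have L: "(\<integral>x. q x \<partial>unif_ball) = (\<Sum>j\<le>D. \<integral>x. c (2 * j) x \<partial>unif_ball)" .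
  have R: "(\<integral>x. q (sqrt (real (Suc m)) *\<^sub>R x) \<partial>std_gauss) = (\<Sum>j\<le>D. real (Suc m) ^ j * (?k j * (\<integral>x. c (2 * j) x \<partial>unif_ball)))" for m
  proof -
    have "(\<integral>x. q (sqrt (real (Suc m)) *\<^sub>R x) \<partial>std_gauss) = (\<Sum>p\<le>2 * D. (\<integral>x. c p x \<partial>std_gauss) * sqrt (real (Suc m)) ^ p)"
      unfolding c(2) by (subst Bochner_Integration.integral_sum) (auto intro!: integrable_mult_left iG)
    also have "\<dots> = (\<Sum>j\<le>D. (\<integral>x. c (2 * j) x \<partial>std_gauss) * sqrt (real (Suc m)) ^ (2 * j))"
      by (rule sum_even_terms) (simp add: oddG)
    also have "\<dots> = (\<Sum>j\<le>D. real (Suc m) ^ j * (?k j * (\<integral>x. c (2 * j) x \<partial>unif_ball)))"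
      by (intro sum.cong refl) (simp add: hom power_mult)
    finally show ?thesis .
  qed
  have "(\<Sum>m\<le>D. w m * (\<integral>x. q (sqrt (real (Suc m)) *\<^sub>R x) \<partial>std_gauss)) =
     (\<Sum>j\<le>D. (\<Sum>m\<le>D. w m * real (Suc m) ^ j) * (?k j * (\<integral>x. c (2 * j) x \<partial>unif_ball)))"
    unfolding R sum_distrib_left sum_distrib_right by (subst sum.swap) (simp add: mult.assoc)
  also have "\<dots> = (\<Sum>j\<le>D. \<integral>x. c (2 * j) x \<partial>unif_ball)"
    by (intro sum.cong refl) (use w k in simp)
  finally show ?thesis using L by simp
qed

lemma ray_polynomial_scale:
  assumes "ray_polynomial d f"
  shows "ray_polynomial d (\<lambda>x. f (a *\<^sub>R x))"
proof -
  obtain P where P: "\<And>x. degree (P x) \<le> d" "\<And>p. continuous_on UNIV (\<lambda>x. coeff (P x) p)"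
    "\<And>t x. f (t *\<^sub>R x) = poly (P x) t"
    using assms unfolding ray_polynomial_def by metis
  have "continuous_on UNIV (\<lambda>x. coeff (P (a *\<^sub>R x)) p)" for p
    by (rule continuous_on_compose2[OF P(2)[of p]]) (auto intro!: continuous_on_scaleR continuous_on_const continuous_on_id)
  moreover have "f (a *\<^sub>R t *\<^sub>R x) = poly (P (a *\<^sub>R x)) t" for t x
    using P(3)[of t "a *\<^sub>R x"] by (simp add: mult.commute)
  ultimately show ?thesis
    unfolding ray_polynomial_def using P(1) by (intro exI[of _ "\<lambda>x. P (a *\<^sub>R x)"]) auto
qed

section \<open>Exchanging uniform points for Gaussian points one at a time\<close>

definition hybrid :: "'m set \<Rightarrow> 'm \<Rightarrow> (real^'n::finite) measure" where
  "hybrid S i = (if i \<in> S then std_gauss else unif_ball)"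

lemma sets_hybrid [simp, measurable_cong]: "sets (hybrid S i) = sets borel"
  by (simp add: hybrid_def)

lemma space_hybrid [simp]: "space (hybrid S i) = UNIV"
  by (simp add: hybrid_def)

lemma prob_space_hybrid: "prob_space (hybrid S i)"
  by (simp add: hybrid_def prob_space_std_gauss prob_space_unif_ball)

text \<open>The growth bound gives integrability against every mixed product of Gaussian and ball
  laws. Polynomial dependence is asked for in one point at a time, which is how the points are
  exchanged.\<close>

definition separately_polynomial :: "nat \<Rightarrow> (('m::finite \<Rightarrow> real^'n::finite) \<Rightarrow> real) \<Rightarrow> bool" where
  "separately_polynomial d F \<longleftrightarrow> F \<in> borel_measurable (\<Pi>\<^sub>M i\<in>UNIV. borel) \<and>
     (\<exists>C N. \<forall>x. \<bar>F x\<bar> \<le> C * (\<Prod>i\<in>UNIV. (1 + norm (x i)) ^ N)) \<and>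
     (\<forall>i x. ray_polynomial d (\<lambda>y. F (x(i := y))))"

lemma separately_polynomial_scale:
  fixes F :: "('m::finite \<Rightarrow> real^'n::finite) \<Rightarrow> real"
  assumes "separately_polynomial d F"
  shows "separately_polynomial d (\<lambda>x. F (\<lambda>i. a i *\<^sub>R x i))"
proof -
  from assms obtain C N where F: "F \<in> borel_measurable (\<Pi>\<^sub>M i\<in>UNIV. borel)"
    "\<And>x. \<bar>F x\<bar> \<le> C * (\<Prod>i\<in>UNIV. (1 + norm (x i)) ^ N)" "\<And>i x. ray_polynomial d (\<lambda>y. F (x(i := y)))"
    unfolding separately_polynomial_def by blast
  have C: "C \<ge> 0" using order_trans[OF abs_ge_zero F(2)[of "\<lambda>_. 0"]] by simp
  have m: "(\<lambda>x i. a i *\<^sub>R x i) \<in> measurable (\<Pi>\<^sub>M i\<in>UNIV. borel) (\<Pi>\<^sub>M i\<in>(UNIV :: 'm set). (borel :: (real^'n) measure))"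
    by (rule measurable_PiM_single') auto
  have "\<bar>F (\<lambda>i. a i *\<^sub>R x i)\<bar> \<le> (C * (\<Prod>i\<in>UNIV. (1 + \<bar>a i\<bar>) ^ N)) * (\<Prod>i\<in>UNIV. (1 + norm (x i)) ^ N)" for x
  proof -
    have "(1 + norm (a i *\<^sub>R x i)) ^ N \<le> (1 + \<bar>a i\<bar>) ^ N * (1 + norm (x i)) ^ N" for i
      unfolding power_mult_distrib[symmetric] by (intro power_mono) (auto simp: algebra_simps)
    then have "(\<Prod>i\<in>UNIV. (1 + norm (a i *\<^sub>R x i)) ^ N) \<le> (\<Prod>i\<in>UNIV. (1 + \<bar>a i\<bar>) ^ N * (1 + norm (x i)) ^ N)"
      by (intro prod_mono) auto
    then show ?thesis
      using F(2)[of "\<lambda>i. a i *\<^sub>R x i"] C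
      by (auto simp: prod.distrib mult.assoc intro: order_trans mult_left_mono)
  qed
  moreover have "ray_polynomial d (\<lambda>y. F (\<lambda>l. a l *\<^sub>R (x(i := y)) l))" for i x
  proof -
    have "(\<lambda>l. a l *\<^sub>R (x(i := y)) l) = (\<lambda>l. a l *\<^sub>R x l)(i := a i *\<^sub>R y)" for y by auto
    then show ?thesis using ray_polynomial_scale[OF F(3), of "\<lambda>l. a l *\<^sub>R x l" i "a i"] by simp
  qed
  ultimately show ?thesis
    unfolding separately_polynomial_def using measurable_compose[OF m F(1)] by blast
qed

lemma sets_PiM_hybrid: "sets (\<Pi>\<^sub>M i\<in>I. hybrid S i) = sets (\<Pi>\<^sub>M i\<in>I. (borel :: (real^'n::finite) measure))"
  by (intro sets_PiM_cong) simp_all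

lemma integrable_separately_polynomial:
  fixes F :: "('m::finite \<Rightarrow> real^'n::finite) \<Rightarrow> real"
  assumes "separately_polynomial d F"
  shows "integrable (\<Pi>\<^sub>M i\<in>UNIV. hybrid S i) F"
proof -
  from assms obtain C N where F: "F \<in> borel_measurable (\<Pi>\<^sub>M i\<in>UNIV. borel)"
    "\<And>x. \<bar>F x\<bar> \<le> C * (\<Prod>i\<in>UNIV. (1 + norm (x i)) ^ N)"
    unfolding separately_polynomial_def by blast
  have C: "C \<ge> 0" using order_trans[OF abs_ge_zero F(2)[of "\<lambda>_. 0"]] by simp
  interpret product_prob_space "hybrid S :: 'm \<Rightarrow> (real^'n) measure" UNIV
    by (intro product_prob_spaceI prob_space_hybrid)
  have "integrable (\<Pi>\<^sub>M i\<in>UNIV. hybrid S i) (\<lambda>x :: 'm \<Rightarrow> real^'n. C * (\<Prod>i\<in>UNIV. (1 + norm (x i)) ^ N))"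
    by (intro integrable_mult_right product_integrable_prod)
       (auto simp: hybrid_def integrable_gauss_growth integrable_ball_growth)
  then show ?thesis
    by (rule Bochner_Integration.integrable_bound)
       (use F C in \<open>auto simp: measurable_cong_sets[OF sets_PiM_hybrid refl] intro!: AE_I2 order_trans[OF F(2)] mult_nonneg_nonneg prod_nonneg\<close>)
qed

text \<open>All points except \<open>j\<close> are held fixed, and the exchange for a single point
  is applied to the integral over point \<open>j\<close>.\<close>

lemma hybrid_step:
  fixes F :: "('m::finite \<Rightarrow> real^'n::finite) \<Rightarrow> real"
  assumes F: "separately_polynomial (2 * D) F" and j: "j \<notin> S"
    and w: "\<And>p. p \<le> D \<Longrightarrow> (\<Sum>m\<le>D. w m * real (Suc m) ^ p) = 1 / (2 ^ p * pochhammer (real CARD('n) / 2 + 1) p)"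
  shows "(\<integral>x. F x \<partial>(\<Pi>\<^sub>M i\<in>UNIV. hybrid S i)) =
    (\<Sum>m\<le>D. w m * (\<integral>x. F (\<lambda>i. (if i = j then sqrt (real (Suc m)) else 1) *\<^sub>R x i) \<partial>(\<Pi>\<^sub>M i\<in>UNIV. hybrid (insert j S) i)))"
proof -
  let ?I = "UNIV - {j}"
  have ins: "insert j ?I = UNIV" by auto
  interpret A: product_prob_space "hybrid S :: 'm \<Rightarrow> (real^'n) measure" UNIV
    by (intro product_prob_spaceI prob_space_hybrid)
  interpret B: product_prob_space "hybrid (insert j S) :: 'm \<Rightarrow> (real^'n) measure" UNIV
    by (intro product_prob_spaceI prob_space_hybrid)
  let ?P = "\<Pi>\<^sub>M i\<in>?I. (hybrid S i :: (real^'n) measure)"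
  have P: "(\<Pi>\<^sub>M i\<in>?I. (hybrid (insert j S) i :: (real^'n) measure)) = ?P"
    by (intro PiM_cong) (auto simp: hybrid_def)
  define Fm where "Fm m x = F (\<lambda>i. (if i = j then sqrt (real (Suc m)) else 1) *\<^sub>R x i)" for m x
  have spm: "separately_polynomial (2 * D) (Fm m)" for m
    unfolding Fm_def by (rule separately_polynomial_scale[OF F])
  have upd: "Fm m (x(j := y)) = F (x(j := sqrt (real (Suc m)) *\<^sub>R y))" for m x y
    unfolding Fm_def by (intro arg_cong[of _ _ F]) auto
  have gj: "hybrid (insert j S) j = std_gauss" "hybrid S j = unif_ball" using j by (auto simp: hybrid_def)
  have RHS: "(\<integral>x. Fm m x \<partial>(\<Pi>\<^sub>M i\<in>UNIV. hybrid (insert j S) i)) =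
      (\<integral>x. (\<integral>y. F (x(j := sqrt (real (Suc m)) *\<^sub>R y)) \<partial>std_gauss) \<partial>?P)" for m
    using B.product_integral_insert[of ?I j "Fm m"] integrable_separately_polynomial[OF spm[of m], of "insert j S"]
    by (simp add: ins P gj upd)
  \<comment> \<open>Integrability of the inner integral allows the finite sum to be moved out of the
    outer one.\<close>
  have int: "integrable ?P (\<lambda>x. \<integral>y. F (x(j := sqrt (real (Suc m)) *\<^sub>R y)) \<partial>std_gauss)" for m
  proof -
    interpret g: prob_space "std_gauss :: (real^'n) measure" by (rule prob_space_std_gauss)
    interpret p: prob_space ?P by (intro prob_space_PiM prob_space_hybrid)
    interpret pp: pair_prob_space "std_gauss :: (real^'n) measure" ?P ..
    have d: "distr (std_gauss \<Otimes>\<^sub>M ?P) (\<Pi>\<^sub>M i\<in>UNIV. hybrid (insert j S) i) (\<lambda>(x, X). X(j := x)) =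
        (\<Pi>\<^sub>M i\<in>UNIV. (hybrid (insert j S) i :: (real^'n) measure))"
      using distr_pair_PiM_eq_PiM[of ?I "hybrid (insert j S) :: 'm \<Rightarrow> (real^'n) measure" j]
      by (simp add: ins P gj prob_space_hybrid prob_space_std_gauss)
    have m: "(\<lambda>(x, X). X(j := x)) \<in> measurable (std_gauss \<Otimes>\<^sub>M ?P) (\<Pi>\<^sub>M i\<in>UNIV. (hybrid (insert j S) i :: (real^'n) measure))"
    proof -
      have "(\<lambda>p. (snd p)(j := fst p)) \<in> measurable (std_gauss \<Otimes>\<^sub>M ?P) (\<Pi>\<^sub>M i\<in>UNIV. (hybrid (insert j S) i :: (real^'n) measure))"
      proof (rule measurable_PiM_single')
        fix i :: 'm
        show "(\<lambda>p. ((snd p)(j := fst p)) i) \<in> measurable (std_gauss \<Otimes>\<^sub>M ?P) (hybrid (insert j S) i)"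
        proof (cases "i = j")
          case True
          then show ?thesis by (simp add: gj)
        next
          case False
          then have "(\<lambda>X. X i) \<in> measurable ?P (hybrid S i)" by (intro measurable_component_singleton) simp
          then have "(\<lambda>p. snd p i) \<in> measurable (std_gauss \<Otimes>\<^sub>M ?P) (hybrid S i)"
            by (rule measurable_compose[OF measurable_snd])
          then show ?thesis using False by (simp add: hybrid_def)
        qed
      qed auto
      then show ?thesis by (simp add: case_prod_unfold)
    qed
    have "integrable (distr (std_gauss \<Otimes>\<^sub>M ?P) (\<Pi>\<^sub>M i\<in>UNIV. hybrid (insert j S) i) (\<lambda>(x, X). X(j := x))) (Fm m)"
      unfolding d by (rule integrable_separately_polynomial[OF spm])
    then have "integrable (std_gauss \<Otimes>\<^sub>M ?P) (\<lambda>(y, x). F (x(j := sqrt (real (Suc m)) *\<^sub>R y)))"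
      by (subst (asm) integrable_distr_eq[OF m])
         (use integrable_separately_polynomial[OF spm[of m], of "insert j S"] in \<open>auto simp: case_prod_unfold upd\<close>)
    then show ?thesis by (rule pp.integrable_snd)
  qed
  have "(\<integral>x. F x \<partial>(\<Pi>\<^sub>M i\<in>UNIV. hybrid S i)) = (\<integral>x. (\<integral>y. F (x(j := y)) \<partial>unif_ball) \<partial>?P)"
    using A.product_integral_insert[of ?I j F] integrable_separately_polynomial[OF F, of S]
    by (simp add: ins gj)
  also have "\<dots> = (\<integral>x. (\<Sum>m\<le>D. w m * (\<integral>y. F (x(j := sqrt (real (Suc m)) *\<^sub>R y)) \<partial>std_gauss)) \<partial>?P)"
    using F unfolding separately_polynomial_def
    by (intro Bochner_Integration.integral_cong refl ball_gauss_ray_polynomial w) auto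
  also have "\<dots> = (\<Sum>m\<le>D. w m * (\<integral>x. (\<integral>y. F (x(j := sqrt (real (Suc m)) *\<^sub>R y)) \<partial>std_gauss) \<partial>?P))"
    by (subst Bochner_Integration.integral_sum, intro integrable_mult_right int) (simp only: integral_mult_right_zero)
  also have "\<dots> = (\<Sum>m\<le>D. w m * (\<integral>x. Fm m x \<partial>(\<Pi>\<^sub>M i\<in>UNIV. hybrid (insert j S) i)))"
    by (simp add: RHS)
  finally show ?thesis by (simp add: Fm_def)
qed

lemma sum_PiE_insert:
  fixes g :: "('m \<Rightarrow> nat) \<Rightarrow> real"
  assumes "finite S" "j \<notin> S" "finite A"
  shows "(\<Sum>J\<in>PiE (insert j S) (\<lambda>_. A). g J) = (\<Sum>J\<in>PiE S (\<lambda>_. A). \<Sum>m\<in>A. g (J(j := m)))"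
proof -
  have "(\<Sum>J\<in>PiE (insert j S) (\<lambda>_. A). g J) = (\<Sum>(m, J)\<in>A \<times> PiE S (\<lambda>_. A). g (J(j := m)))"
    unfolding PiE_insert_eq using inj_combinator[OF assms(2), of "\<lambda>_. A"]
    by (subst sum.reindex) (auto simp: case_prod_unfold)
  also have "\<dots> = (\<Sum>m\<in>A. \<Sum>J\<in>PiE S (\<lambda>_. A). g (J(j := m)))"
    by (rule sum.cartesian_product[symmetric])
  finally show ?thesis by (subst sum.swap)
qed

text \<open>Iteration of the exchange over the points in \<open>S\<close>; the function
  \<open>J\<close> records which scale was chosen at each point.\<close>

lemma hybrid_expansion:
  fixes F :: "('m::finite \<Rightarrow> real^'n::finite) \<Rightarrow> real"
  assumes F: "separately_polynomial (2 * D) F"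
    and w: "\<And>p. p \<le> D \<Longrightarrow> (\<Sum>m\<le>D. w m * real (Suc m) ^ p) = 1 / (2 ^ p * pochhammer (real CARD('n) / 2 + 1) p)"
    and "finite S"
  shows "(\<integral>x. F x \<partial>(\<Pi>\<^sub>M i\<in>UNIV. hybrid {} i)) =
    (\<Sum>J\<in>PiE S (\<lambda>_. {..D}). (\<Prod>i\<in>S. w (J i)) *
      (\<integral>x. F (\<lambda>i. (if i \<in> S then sqrt (real (Suc (J i))) else 1) *\<^sub>R x i) \<partial>(\<Pi>\<^sub>M i\<in>UNIV. hybrid S i)))"
  using \<open>finite S\<close>
proof (induction S)
  case empty
  show ?case by simp
next
  case (insert j S)
  let ?G = "\<lambda>S J. \<integral>x. F (\<lambda>i. (if i \<in> S then sqrt (real (Suc (J i))) else 1) *\<^sub>R x i) \<partial>(\<Pi>\<^sub>M i\<in>UNIV. hybrid S i)"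
  have "?G S J = (\<Sum>m\<le>D. w m * ?G (insert j S) (J(j := m)))" for J
  proof -
    have feq: "(\<lambda>i. (if i \<in> S then sqrt (real (Suc (J i))) else 1) *\<^sub>R (if i = j then sqrt (real (Suc m)) else 1) *\<^sub>R x i) =
       (\<lambda>i. (if i \<in> insert j S then sqrt (real (Suc ((J(j := m)) i))) else 1) *\<^sub>R x i)" for m and x :: "'m \<Rightarrow> real^'n"
      using insert.hyps by auto
    show ?thesis
      using hybrid_step[OF separately_polynomial_scale[OF F] insert.hyps(2) w,
          of "\<lambda>i. if i \<in> S then sqrt (real (Suc (J i))) else 1"] unfolding feq by simp
  qed
  moreover have "(\<Prod>i\<in>insert j S. w ((J(j := m)) i)) = w m * (\<Prod>i\<in>S. w (J i))" for J m
  proof -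
    have "(\<Prod>i\<in>S. w ((J(j := m)) i)) = (\<Prod>i\<in>S. w (J i))" using insert.hyps by (intro prod.cong) auto
    then show ?thesis using insert.hyps by simp
  qed
  ultimately show ?case
    unfolding insert.IH sum_PiE_insert[OF insert.hyps finite_atMost]
    by (simp add: sum_distrib_left mult.assoc mult.left_commute)
qed

section \<open>Gaussian simplices with scaled vertices\<close>

lemma option_UNIV_sum: "(\<Sum>i\<in>(UNIV :: 'k::finite option set). f i) = f None + (\<Sum>j\<in>UNIV. f (Some j))"
  unfolding UNIV_option_conv by (subst sum.insert) (auto simp: sum.reindex)

lemma option_UNIV_prod: "(\<Prod>i\<in>(UNIV :: 'k::finite option set). f i) = f None * (\<Prod>j\<in>UNIV. f (Some j))"
  unfolding UNIV_option_conv by (subst prod.insert) (auto simp: prod.reindex)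

text \<open>Multiplying the matrix with columns \<open>x i\<close> by this one yields the edges of
  the simplex with vertices \<open>a i *\<^sub>R x i\<close>.\<close>

definition scaled_edges :: "('k::finite option \<Rightarrow> real) \<Rightarrow> real^'k^'k option" where
  "scaled_edges a = (\<chi> i j. case i of None \<Rightarrow> - a None | Some l \<Rightarrow> if l = j then a (Some l) else 0)"

lemma sum_delta_mult:
  fixes f h :: "'k::finite \<Rightarrow> real"
  shows "(\<Sum>l\<in>UNIV. (if l = i then f l else 0) * h l) = f i * h i"
    and "(\<Sum>l\<in>UNIV. h l * (if l = i then f l else 0)) = h i * f i"
    and "(\<Sum>l\<in>UNIV. (if i = l then f l else 0) * h l) = f i * h i"
proof -
  have "(\<Sum>l\<in>UNIV. (if l = i then f l else 0) * h l) = (\<Sum>l\<in>UNIV. if l = i then f l * h l else 0)"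
    by (intro sum.cong) auto
  then show 1: "(\<Sum>l\<in>UNIV. (if l = i then f l else 0) * h l) = f i * h i" by simp
  show "(\<Sum>l\<in>UNIV. h l * (if l = i then f l else 0)) = h i * f i"
    using 1 by (simp only: mult.commute)
  show "(\<Sum>l\<in>UNIV. (if i = l then f l else 0) * h l) = f i * h i"
    using 1 by (simp only: eq_commute[of i])
qed

lemma edge_matrix_scaled:
  "edge_matrix (\<lambda>i. a i *\<^sub>R x i) = matrix_of_columns x ** scaled_edges a"
proof -
  have "(matrix_of_columns x ** scaled_edges a) $ i $ j = a (Some j) * x (Some j) $ i - a None * x None $ i" for i j
    by (simp add: matrix_of_columns_def scaled_edges_def matrix_matrix_mult_def option_UNIV_sum sum_delta_mult)
  then show ?thesis by (simp add: vec_eq_iff edge_matrix_def)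
qed

text \<open>The Gram matrix is \<open>Dg ** Dg\<close> plus a matrix with all entries
  \<open>(a None)^2\<close>. Pulling out \<open>Dg\<close> on both sides leaves a rank-one
  perturbation of the identity.\<close>

lemma gram_scaled_edges:
  fixes a :: "'k::finite option \<Rightarrow> real"
  assumes a: "\<And>i. a i > 0"
  shows "gram (scaled_edges a) = (\<Prod>i\<in>UNIV. (a i)\<^sup>2) * (\<Sum>i\<in>UNIV. 1 / (a i)\<^sup>2)"
proof -
  define Dg :: "real^'k^'k" where "Dg = (\<chi> i j. if i = j then a (Some i) else 0)"
  define v :: "real^'k" where "v = (\<chi> i. 1 / a (Some i))"
  let ?c = "(a None)\<^sup>2"
  have nz: "a i \<noteq> 0" for i using a[of i] by simp
  have Dl: "(Dg ** X) $ i $ j = a (Some i) * X $ i $ j" for X i j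
    using sum_delta_mult(3)[of i "\<lambda>_. a (Some i)" "\<lambda>l. X $ l $ j"] by (simp add: Dg_def matrix_matrix_mult_def)
  have Dr: "(X ** Dg) $ i $ j = X $ i $ j * a (Some j)" for X i j
  proof -
    have "(X ** Dg) $ i $ j = (\<Sum>l\<in>UNIV. X $ i $ l * (if l = j then a (Some l) else 0))"
      by (simp add: Dg_def matrix_matrix_mult_def)
    then show ?thesis by (simp only: sum_delta_mult)
  qed
  have "transpose (scaled_edges a) ** scaled_edges a = (\<chi> i j. ?c + (if i = j then (a (Some i))\<^sup>2 else 0))"
  proof -
    have "(transpose (scaled_edges a) ** scaled_edges a) $ i $ j =
        ?c + (\<Sum>l\<in>UNIV. (if l = i then a (Some l) else 0) * (if l = j then a (Some l) else 0))" for i j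
      by (simp add: scaled_edges_def transpose_def matrix_matrix_mult_def option_UNIV_sum power2_eq_square)
    then show ?thesis unfolding sum_delta_mult by (simp add: vec_eq_iff power2_eq_square)
  qed
  also have "\<dots> = Dg ** (mat 1 + (\<chi> i j. ?c * v $ i * v $ j)) ** Dg"
    unfolding vec_eq_iff Dl Dr using nz by (auto simp: mat_def v_def power2_eq_square field_simps)
  finally have "gram (scaled_edges a) = (det Dg)\<^sup>2 * (1 + ?c * (v \<bullet> v))"
    unfolding gram_def by (simp add: det_mul det_identity_plus_rank_one power2_eq_square)
  also have "det Dg = (\<Prod>j\<in>UNIV. a (Some j))"
    by (subst det_diagonal) (auto simp: Dg_def)
  also have "v \<bullet> v = (\<Sum>j\<in>UNIV. 1 / (a (Some j))\<^sup>2)"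
    by (simp add: inner_vec_def v_def power2_eq_square)
  finally show ?thesis using nz[of None]
    by (simp add: option_UNIV_prod option_UNIV_sum prod_power_distrib field_simps)
qed

text \<open>Let \<open>scaled_edges a = B ** C\<close> with a frame \<open>B\<close>. The Gaussian
  matrix of the vertices times \<open>B\<close> is a Gaussian matrix with one column fewer, and the
  square matrix \<open>C\<close> contributes only the constant
  \<open>(det C)^2 = gram (scaled_edges a)\<close>.\<close>

lemma gauss_simplex_moment:
  fixes a :: "'k::finite option \<Rightarrow> real" and L :: "real^'n::finite^'n"
  assumes a: "\<And>i. a i > 0"
  shows "(\<integral>x. gram (L ** edge_matrix (\<lambda>i. a i *\<^sub>R x i)) ^ s \<partial>(\<Pi>\<^sub>M i\<in>(UNIV :: 'k option set). std_gauss)) =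
    ((\<Prod>i\<in>UNIV. (a i)\<^sup>2) * (\<Sum>i\<in>UNIV. 1 / (a i)\<^sup>2)) ^ s * (\<integral>G. gram (L ** G) ^ s \<partial>(gauss_matrix :: (real^'k^'n) measure))"
proof -
  let ?M = "scaled_edges a"
  obtain B :: "real^'k^'k option" where B: "frame B" "range ((*v) ?M) \<subseteq> range ((*v) B)"
    by (rule frame_exists_superset[OF dim_range_matrix_le[of ?M]]) auto
  define C where "C = transpose B ** ?M"
  have M: "?M = B ** C" unfolding C_def by (rule frame_factor[OF B])
  have dC: "(det C)\<^sup>2 = gram ?M" unfolding M gram_mult_square gram_frame[OF B(1)] by simp
  have g: "gram (L ** (X ** ?M)) = gram ?M * gram (L ** (X ** B))" for X :: "real^'k option^'n"
  proof -
    have "L ** (X ** ?M) = (L ** (X ** B)) ** C" unfolding M by (simp add: matrix_mul_assoc)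
    then show ?thesis by (simp add: gram_mult_square dC)
  qed
  have gm: "(\<lambda>G :: real^'k^'n. gram (L ** G) ^ s) \<in> borel_measurable borel" by measurable
  have gm2: "(\<lambda>X :: real^'k option^'n. gram (L ** (X ** ?M)) ^ s) \<in> borel_measurable borel" by measurable
  have fm: "(\<lambda>X :: real^'k option^'n. X ** B) \<in> measurable gauss_matrix borel" by measurable
  have "(\<integral>x. gram (L ** edge_matrix (\<lambda>i. a i *\<^sub>R x i)) ^ s \<partial>(\<Pi>\<^sub>M i\<in>(UNIV :: 'k option set). (std_gauss :: (real^'n) measure))) =
     (\<integral>X. gram (L ** (X ** ?M)) ^ s \<partial>(gauss_matrix :: (real^'k option^'n) measure))"
    unfolding gauss_matrix_columns edge_matrix_scaled
    by (rule integral_distr[OF measurable_matrix_of_columns_gauss gm2, symmetric])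
  also have "\<dots> = gram ?M ^ s * (\<integral>X. gram (L ** (X ** B)) ^ s \<partial>(gauss_matrix :: (real^'k option^'n) measure))"
    unfolding g power_mult_distrib by simp
  also have "(\<integral>X. gram (L ** (X ** B)) ^ s \<partial>(gauss_matrix :: (real^'k option^'n) measure)) =
     (\<integral>G. gram (L ** G) ^ s \<partial>distr gauss_matrix borel (\<lambda>X :: real^'k option^'n. X ** B))"
    by (rule integral_distr[OF fm gm, symmetric])
  finally show ?thesis by (simp add: distr_gauss_matrix_frame[OF B(1)] gram_scaled_edges[OF a])
qed

section \<open>Summation over the scales\<close>

text \<open>Brings the values prescribed for the interpolation into the form of a constant times
  \<open>2 ^ p * fact p\<close> times a generalised binomial coefficient, to which Vandermonde's
  convolution applies.\<close>

lemma interpolation_weight_shift: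
  fixes c :: real
  assumes c: "c > 0" and p: "p \<le> s"
  shows "1 / (2 ^ (s - p) * pochhammer c (s - p)) =
    1 / (2 ^ s * pochhammer c s) * (2 ^ p * (fact p * ((c + real s - 1) gchoose p)))"
proof -
  have 1: "pochhammer c s = pochhammer c (s - p) * pochhammer (c + real (s - p)) p"
    using pochhammer_product[of "s - p" s c] p by simp
  have 2: "fact p * ((c + real s - 1) gchoose p) = pochhammer (c + real (s - p)) p"
    using p by (simp add: gbinomial_pochhammer' of_nat_diff algebra_simps)
  have 3: "(2::real) ^ s = 2 ^ (s - p) * 2 ^ p" using p by (simp flip: power_add)
  have "pochhammer (c + real (s - p)) p > 0" "pochhammer c (s - p) > 0" using c by (auto intro!: pochhammer_pos add_pos_nonneg)
  then show ?thesis unfolding 2 1 3 by (simp add: field_simps)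
qed

text \<open>The exponent \<open>n\<close> of the sum of reciprocals is kept free for the induction
  on \<open>S\<close>. Splitting off one index expands the power binomially, the sum over its scale
  is given by the interpolation property, and Vandermonde's convolution adds the upper arguments of
  the two binomial coefficients.\<close>

lemma interpolation_sum:
  fixes c :: real and w :: "nat \<Rightarrow> real"
  assumes c: "c > 0" and sD: "s \<le> D" and "finite S" "n \<le> s"
    and w: "\<And>p. p \<le> D \<Longrightarrow> (\<Sum>m\<le>D. w m * real (Suc m) ^ p) = 1 / (2 ^ p * pochhammer c p)"
  shows "(\<Sum>J\<in>PiE S (\<lambda>_. {..D}). (\<Prod>i\<in>S. w (J i) * real (Suc (J i)) ^ s) * (\<Sum>i\<in>S. 1 / real (Suc (J i))) ^ n) =
    (1 / (2 ^ s * pochhammer c s)) ^ card S * (2 ^ n * (fact n * ((real (card S) * (c + real s - 1)) gchoose n)))"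
  using \<open>finite S\<close> \<open>n \<le> s\<close>
proof (induction S arbitrary: n)
  case empty
  show ?case by (cases n) auto
next
  case (insert j S)
  let ?b = "1 / (2 ^ s * pochhammer c s)" and ?x = "c + real s - 1"
  let ?A = "\<lambda>n. (\<Sum>J\<in>PiE S (\<lambda>_. {..D}). (\<Prod>i\<in>S. w (J i) * real (Suc (J i)) ^ s) * (\<Sum>i\<in>S. 1 / real (Suc (J i))) ^ n)"
  \<comment> \<open>As \<open>p \<le> n \<le> s\<close>, each reciprocal node lowers the exponent
    \<open>s\<close> by one, and \<open>s - p\<close> stays within the range of the
    interpolation.\<close>
  have node: "(\<Sum>m\<le>D. w m * real (Suc m) ^ s * (1 / real (Suc m)) ^ p) = ?b * (2 ^ p * (fact p * (?x gchoose p)))" if "p \<le> n" for p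
  proof -
    have ps: "p \<le> s" using that insert.prems by simp
    have "real (Suc m) ^ s * (1 / real (Suc m)) ^ p = real (Suc m) ^ (s - p)" for m
      using ps by (simp add: power_divide power_diff)
    then have "(\<Sum>m\<le>D. w m * real (Suc m) ^ s * (1 / real (Suc m)) ^ p) = (\<Sum>m\<le>D. w m * real (Suc m) ^ (s - p))"
      by (simp add: mult.assoc)
    also have "\<dots> = 1 / (2 ^ (s - p) * pochhammer c (s - p))" using sD by (intro w) simp
    finally show ?thesis unfolding interpolation_weight_shift[OF c ps] .
  qed
  have tm: "(\<Prod>i\<in>insert j S. w ((J(j := m)) i) * real (Suc ((J(j := m)) i)) ^ s) * (\<Sum>i\<in>insert j S. 1 / real (Suc ((J(j := m)) i))) ^ n =
     (\<Sum>p\<le>n. of_nat (n choose p) * (w m * real (Suc m) ^ s * (1 / real (Suc m)) ^ p) *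
        ((\<Prod>i\<in>S. w (J i) * real (Suc (J i)) ^ s) * (\<Sum>i\<in>S. 1 / real (Suc (J i))) ^ (n - p)))" for J m
  proof -
    have 1: "(\<Prod>i\<in>S. w ((J(j := m)) i) * real (Suc ((J(j := m)) i)) ^ s) = (\<Prod>i\<in>S. w (J i) * real (Suc (J i)) ^ s)"
      using insert.hyps by (intro prod.cong) auto
    have 2: "(\<Sum>i\<in>S. 1 / real (Suc ((J(j := m)) i))) = (\<Sum>i\<in>S. 1 / real (Suc (J i)))"
      using insert.hyps by (intro sum.cong) auto
    show ?thesis
      unfolding prod.insert[OF insert.hyps] sum.insert[OF insert.hyps] 1 2 binomial_ring fun_upd_same sum_distrib_left
      by (intro sum.cong refl) (simp only: ac_simps)
  qed
  have "(\<Sum>J\<in>PiE (insert j S) (\<lambda>_. {..D}). (\<Prod>i\<in>insert j S. w (J i) * real (Suc (J i)) ^ s) * (\<Sum>i\<in>insert j S. 1 / real (Suc (J i))) ^ n) =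
     (\<Sum>J\<in>PiE S (\<lambda>_. {..D}). \<Sum>m\<le>D. \<Sum>p\<le>n. of_nat (n choose p) * (w m * real (Suc m) ^ s * (1 / real (Suc m)) ^ p) *
        ((\<Prod>i\<in>S. w (J i) * real (Suc (J i)) ^ s) * (\<Sum>i\<in>S. 1 / real (Suc (J i))) ^ (n - p)))"
    unfolding sum_PiE_insert[OF insert.hyps finite_atMost] tm ..
  also have "\<dots> = (\<Sum>p\<le>n. of_nat (n choose p) * (\<Sum>m\<le>D. w m * real (Suc m) ^ s * (1 / real (Suc m)) ^ p) * ?A (n - p))"
  proof -
    have "(\<Sum>J\<in>PiE S (\<lambda>_. {..D}). \<Sum>m\<le>D. \<Sum>p\<le>n. of_nat (n choose p) * u m p * t J p) =
        (\<Sum>p\<le>n. of_nat (n choose p) * (\<Sum>m\<le>D. u m p) * (\<Sum>J\<in>PiE S (\<lambda>_. {..D}). t J p))" for u :: "nat \<Rightarrow> nat \<Rightarrow> real" and t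
    proof -
      have "(\<Sum>J\<in>PiE S (\<lambda>_. {..D}). \<Sum>m\<le>D. \<Sum>p\<le>n. of_nat (n choose p) * u m p * t J p) =
          (\<Sum>J\<in>PiE S (\<lambda>_. {..D}). \<Sum>p\<le>n. \<Sum>m\<le>D. of_nat (n choose p) * u m p * t J p)"
        by (intro sum.cong refl sum.swap)
      also have "\<dots> = (\<Sum>p\<le>n. \<Sum>J\<in>PiE S (\<lambda>_. {..D}). \<Sum>m\<le>D. of_nat (n choose p) * u m p * t J p)"
        by (rule sum.swap)
      finally show ?thesis by (simp only: sum_distrib_left sum_distrib_right)
    qed
    then show ?thesis .
  qed
  also have "\<dots> = (\<Sum>p\<le>n. of_nat (n choose p) * (?b * (2 ^ p * (fact p * (?x gchoose p)))) *
      (?b ^ card S * (2 ^ (n - p) * (fact (n - p) * ((real (card S) * ?x) gchoose (n - p))))))"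
    by (intro sum.cong refl) (use insert.prems in \<open>simp only: node atMost_iff insert.IH diff_le_self le_trans[OF diff_le_self]\<close>)
  also have "\<dots> = (\<Sum>p\<le>n. ?b ^ card (insert j S) * (2 ^ n * (fact n * ((?x gchoose p) * ((real (card S) * ?x) gchoose (n - p))))))"
  proof (intro sum.cong refl)
    fix p assume "p \<in> {..n}"
    then have p: "p \<le> n" by simp
    have 1: "(2::real) ^ n = 2 ^ p * 2 ^ (n - p)" using p by (simp flip: power_add)
    have 2: "(fact n :: real) = of_nat (n choose p) * (fact p * fact (n - p))"
      using binomial_fact_lemma[OF p] by (metis mult.commute of_nat_fact of_nat_mult)
    have 3: "?b ^ card (insert j S) = ?b * ?b ^ card S" using insert.hyps by simp
    show "of_nat (n choose p) * (?b * (2 ^ p * (fact p * (?x gchoose p)))) *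
      (?b ^ card S * (2 ^ (n - p) * (fact (n - p) * ((real (card S) * ?x) gchoose (n - p))))) =
      ?b ^ card (insert j S) * (2 ^ n * (fact n * ((?x gchoose p) * ((real (card S) * ?x) gchoose (n - p)))))"
      unfolding 1 2 3 by (simp only: ac_simps)
  qed
  also have "\<dots> = ?b ^ card (insert j S) * (2 ^ n * (fact n * ((?x + real (card S) * ?x) gchoose n)))"
    unfolding sum_distrib_left[symmetric] gbinomial_Vandermonde[symmetric] atLeast0AtMost ..
  also have "?x + real (card S) * ?x = real (card (insert j S)) * ?x"
    using insert.hyps by (simp add: algebra_simps)
  finally show ?case .
qed

section \<open>Moments of random simplices in the unit ball\<close>

lemma det_bound:
  fixes A :: "real^'k^'k"
  assumes "\<And>i j. \<bar>A $ i $ j\<bar> \<le> B"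
  shows "\<bar>det A\<bar> \<le> fact CARD('k) * B ^ CARD('k)"
proof -
  have "\<bar>det A\<bar> \<le> (\<Sum>p | p permutes (UNIV :: 'k set). \<bar>of_int (sign p) * (\<Prod>i\<in>UNIV. A $ i $ p i)\<bar>)"
    unfolding det_def by (rule sum_abs)
  also have "\<dots> \<le> (\<Sum>p | p permutes (UNIV :: 'k set). B ^ CARD('k))"
  proof (rule sum_mono)
    fix p :: "'k \<Rightarrow> 'k"
    have "\<bar>of_int (sign p) * (\<Prod>i\<in>UNIV. A $ i $ p i)\<bar> = (\<Prod>i\<in>UNIV. \<bar>A $ i $ p i\<bar>)"
      by (simp add: abs_mult abs_prod sign_def)
    also have "\<dots> \<le> (\<Prod>i\<in>(UNIV :: 'k set). B)" by (intro prod_mono) (auto simp: assms)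
    finally show "\<bar>of_int (sign p) * (\<Prod>i\<in>UNIV. A $ i $ p i)\<bar> \<le> B ^ CARD('k)" by simp
  qed
  also have "\<dots> = fact CARD('k) * B ^ CARD('k)" by (simp add: card_permutations)
  finally show ?thesis .
qed

lemma edge_gram_entry:
  fixes L :: "real^'n::finite^'n" and x :: "'k::finite option \<Rightarrow> real^'n"
  shows "(transpose (L ** edge_matrix x) ** (L ** edge_matrix x)) $ i $ j =
    (\<Sum>l\<in>UNIV. (L *v (x (Some i) - x None)) $ l * (L *v (x (Some j) - x None)) $ l)"
proof -
  have "(L ** edge_matrix x) $ l $ i = (L *v (x (Some i) - x None)) $ l" for l i
    by (simp add: edge_matrix_def matrix_matrix_mult_def matrix_vector_mult_def)
  then show ?thesis by (simp add: transpose_def matrix_matrix_mult_def)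
qed

lemma one_le_prod:
  fixes f :: "'i \<Rightarrow> real"
  shows "finite I \<Longrightarrow> (\<And>i. i \<in> I \<Longrightarrow> 1 \<le> f i) \<Longrightarrow> 1 \<le> prod f I"
  by (induction I rule: finite_induct) (auto intro: order_trans mult_mono[of 1 _ 1, simplified])

text \<open>Entries of the Gram matrix have degree at most 2 in any single vertex, so the
  determinant has degree at most \<open>2 * CARD('k)\<close> there. The growth bound comes from
  crude estimates of the entries.\<close>

lemma separately_polynomial_simplex:
  fixes L :: "real^'n::finite^'n"
  shows "separately_polynomial (2 * (CARD('k) * s)) (\<lambda>x :: 'k::finite option \<Rightarrow> real^'n. gram (L ** edge_matrix x) ^ s)"
  unfolding separately_polynomial_def
proof (intro conjI allI)
  have "(\<lambda>x :: 'k option \<Rightarrow> real^'n. edge_matrix x) \<in> borel_measurable (\<Pi>\<^sub>M i\<in>UNIV. borel)"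
    unfolding edge_matrix_def[abs_def] by (intro measurable_vec_lambda) measurable
  then show "(\<lambda>x :: 'k option \<Rightarrow> real^'n. gram (L ** edge_matrix x) ^ s) \<in> borel_measurable (\<Pi>\<^sub>M i\<in>UNIV. borel)"
    by measurable
next
  fix i0 and x :: "'k option \<Rightarrow> real^'n"
  have lin: "ray_polynomial 1 (\<lambda>y. (L *v ((x(i0 := y)) i - (x(i0 := y)) j)) $ l)" for i j l
  proof -
    have c: "ray_polynomial 1 (\<lambda>y :: real^'n. (L *v x i) $ l)" for i by (rule ray_polynomial_const)
    have v: "ray_polynomial 1 (\<lambda>y. (L *v y) $ l)"
      by (intro ray_polynomial_linear linearI) (simp_all add: matrix_vector_right_distrib matrix_vector_mult_scaleR)
    have e: "ray_polynomial 1 (\<lambda>y. (L *v ((x(i0 := y)) i)) $ l)" for i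
      using c v by (cases "i = i0") auto
    have "ray_polynomial (0 + 1) (\<lambda>y. (-1) * (L *v ((x(i0 := y)) j)) $ l)"
      by (intro ray_polynomial_mult ray_polynomial_const e)
    then have "ray_polynomial 1 (\<lambda>y. (L *v ((x(i0 := y)) i)) $ l + (-1) * (L *v ((x(i0 := y)) j)) $ l)"
      by (intro ray_polynomial_add e) simp
    then show ?thesis by (simp add: matrix_vector_mult_diff_distrib)
  qed
  have "ray_polynomial (s * (CARD('k) * 2)) (\<lambda>y. gram (L ** edge_matrix (x(i0 := y))) ^ s)"
    unfolding gram_def
  proof (intro ray_polynomial_power ray_polynomial_det)
    fix i j
    have "ray_polynomial (1 + 1) (\<lambda>y. (L *v ((x(i0 := y)) (Some i) - (x(i0 := y)) None)) $ l *
        (L *v ((x(i0 := y)) (Some j) - (x(i0 := y)) None)) $ l)" for l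
      by (rule ray_polynomial_mult[OF lin lin])
    then show "ray_polynomial 2 (\<lambda>y. (transpose (L ** edge_matrix (x(i0 := y))) ** (L ** edge_matrix (x(i0 := y)))) $ i $ j)"
      unfolding edge_gram_entry by (intro ray_polynomial_sum) (simp_all add: numeral_2_eq_2)
  qed
  then show "ray_polynomial (2 * (CARD('k) * s)) (\<lambda>y. gram (L ** edge_matrix (x(i0 := y))) ^ s)"
    by (simp add: mult.commute mult.left_commute)
next
  obtain K where K: "K \<ge> 0" "\<And>v. norm (L *v v) \<le> norm v * K"
    using bounded_linear.nonneg_bounded[OF matrix_vector_mul_bounded_linear[of L]] by blast
  let ?R = "\<lambda>x :: 'k option \<Rightarrow> real^'n. \<Prod>i\<in>UNIV. (1 + norm (x i))"
  have R: "norm (x i) \<le> ?R x" for x :: "'k option \<Rightarrow> real^'n" and i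
  proof -
    have "norm (x i) \<le> (1 + norm (x i)) * 1" by simp
    also have "\<dots> \<le> (1 + norm (x i)) * (\<Prod>i\<in>UNIV - {i}. (1 + norm (x i)))"
      by (intro mult_left_mono one_le_prod) auto
    also have "\<dots> = ?R x" by (rule prod.remove[symmetric]) auto
    finally show ?thesis .
  qed
  have entry: "\<bar>(L *v (x i - x j)) $ l\<bar> \<le> 2 * K * ?R x" for x :: "'k option \<Rightarrow> real^'n" and i j l
  proof -
    have "\<bar>(L *v (x i - x j)) $ l\<bar> \<le> norm (x i - x j) * K"
      using component_le_norm_cart[of "L *v (x i - x j)" l] K(2)[of "x i - x j"] by linarith
    also have "\<dots> \<le> (?R x + ?R x) * K"
      using norm_triangle_ineq4[of "x i" "x j"] R[of x i] R[of x j] K(1) by (intro mult_right_mono) auto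
    finally show ?thesis by (simp add: mult.assoc mult.commute[of K])
  qed
  let ?C = "(fact CARD('k) * (real CARD('n) * (2 * K)\<^sup>2) ^ CARD('k)) ^ s"
  have "\<bar>gram (L ** edge_matrix x) ^ s\<bar> \<le> ?C * (\<Prod>i\<in>UNIV. (1 + norm (x i)) ^ (2 * CARD('k) * s))" for x :: "'k option \<Rightarrow> real^'n"
  proof -
    have "\<bar>gram (L ** edge_matrix x)\<bar> \<le> fact CARD('k) * (real CARD('n) * ((2 * K * ?R x) * (2 * K * ?R x))) ^ CARD('k)"
      unfolding gram_def
    proof (rule det_bound)
      fix i j
      have "\<bar>(transpose (L ** edge_matrix x) ** (L ** edge_matrix x)) $ i $ j\<bar> \<le>
          (\<Sum>l\<in>(UNIV::'n set). \<bar>(L *v (x (Some i) - x None)) $ l * (L *v (x (Some j) - x None)) $ l\<bar>)"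
        unfolding edge_gram_entry by (rule sum_abs)
      also have "\<dots> \<le> (\<Sum>l\<in>(UNIV::'n set). (2 * K * ?R x) * (2 * K * ?R x))"
        unfolding abs_mult
        by (intro sum_mono mult_mono entry) (auto intro!: mult_nonneg_nonneg K prod_nonneg)
      finally show "\<bar>(transpose (L ** edge_matrix x) ** (L ** edge_matrix x)) $ i $ j\<bar> \<le>
          real CARD('n) * ((2 * K * ?R x) * (2 * K * ?R x))" by simp
    qed
    also have "(2 * K * ?R x) * (2 * K * ?R x) = (2 * K)\<^sup>2 * ?R x ^ 2" by (simp add: power2_eq_square ac_simps)
    finally have "\<bar>gram (L ** edge_matrix x)\<bar> ^ s \<le> (fact CARD('k) * (real CARD('n) * ((2 * K)\<^sup>2 * ?R x ^ 2)) ^ CARD('k)) ^ s"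
      by (intro power_mono) auto
    also have "\<dots> = ?C * ?R x ^ (2 * CARD('k) * s)"
      by (simp only: power_mult_distrib power_mult[symmetric] mult.assoc)
    also have "?R x ^ (2 * CARD('k) * s) = (\<Prod>i\<in>UNIV. (1 + norm (x i)) ^ (2 * CARD('k) * s))"
      by (rule prod_power_distrib)
    finally show ?thesis by (simp add: power_abs)
  qed
  then show "\<exists>C N. \<forall>x :: 'k option \<Rightarrow> real^'n. \<bar>gram (L ** edge_matrix x) ^ s\<bar> \<le> C * (\<Prod>i\<in>UNIV. (1 + norm (x i)) ^ N)"
    by blast
qed

text \<open>The value of \<open>interpolation_sum\<close> for k + 1 points, with
  \<open>c = n / 2 + 1\<close> and exponent \<open>s\<close> of the sum of reciprocals. It is the
  ratio between the moment for uniform points in the ball and the moment of a Gaussian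
  matrix.\<close>

definition simplex_factor :: "nat \<Rightarrow> nat \<Rightarrow> nat \<Rightarrow> real" where
  "simplex_factor n k s = (1 / (2 ^ s * pochhammer (real n / 2 + 1) s)) ^ Suc k *
     (2 ^ s * (fact s * ((real (Suc k) * (real n / 2 + real s)) gchoose s)))"

text \<open>All vertices are exchanged for scaled Gaussian ones. Every choice of scales contributes
  the same Gaussian integral times an explicit factor, and the weighted factors add up to
  \<open>simplex_factor\<close>.\<close>

theorem ball_simplex_moment:
  fixes L :: "real^'n::finite^'n"
  shows "(\<integral>x. gram (L ** edge_matrix x) ^ s \<partial>(\<Pi>\<^sub>M i\<in>(UNIV :: 'k::finite option set). unif_ball)) =
    simplex_factor CARD('n) CARD('k) s * (\<integral>G. gram (L ** G) ^ s \<partial>(gauss_matrix :: (real^'k^'n) measure))"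
proof -
  \<comment> \<open>The integrand has degree at most \<open>2 * ?D\<close> in each vertex, so
    \<open>?D + 1\<close> scales suffice.\<close>
  let ?D = "CARD('k) * s" and ?c = "real CARD('n) / 2 + 1"
  obtain w where w: "\<And>p. p \<le> ?D \<Longrightarrow> (\<Sum>m\<le>?D. w m * real (Suc m) ^ p) = 1 / (2 ^ p * pochhammer ?c p)"
    using interpolation_weights[of ?D "\<lambda>p. 1 / (2 ^ p * pochhammer ?c p)"] by blast
  let ?I = "\<integral>G. gram (L ** G) ^ s \<partial>(gauss_matrix :: (real^'k^'n) measure)"
  have hyb: "(\<Pi>\<^sub>M i\<in>(UNIV :: 'k option set). (hybrid {} i :: (real^'n) measure)) = (\<Pi>\<^sub>M i\<in>UNIV. unif_ball)"
    "(\<Pi>\<^sub>M i\<in>(UNIV :: 'k option set). (hybrid UNIV i :: (real^'n) measure)) = (\<Pi>\<^sub>M i\<in>UNIV. std_gauss)"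
    by (simp_all add: hybrid_def)
  have "(\<integral>x. gram (L ** edge_matrix x) ^ s \<partial>(\<Pi>\<^sub>M i\<in>(UNIV :: 'k option set). unif_ball)) =
     (\<Sum>J\<in>PiE (UNIV :: 'k option set) (\<lambda>_. {..?D}). (\<Prod>i\<in>UNIV. w (J i)) *
        (\<integral>x. gram (L ** edge_matrix (\<lambda>i. sqrt (real (Suc (J i))) *\<^sub>R x i)) ^ s \<partial>(\<Pi>\<^sub>M i\<in>UNIV. std_gauss)))"
    using hybrid_expansion[OF separately_polynomial_simplex[where 'k='k and L=L and s=s] w finite[of UNIV]]
    unfolding hyb by simp
  also have "\<dots> = (\<Sum>J\<in>PiE (UNIV :: 'k option set) (\<lambda>_. {..?D}).
      ((\<Prod>i\<in>UNIV. w (J i) * real (Suc (J i)) ^ s) * (\<Sum>i\<in>UNIV. 1 / real (Suc (J i))) ^ s) * ?I)"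
  proof (intro sum.cong refl)
    fix J :: "'k option \<Rightarrow> nat"
    have "(\<integral>x. gram (L ** edge_matrix (\<lambda>i. sqrt (real (Suc (J i))) *\<^sub>R x i)) ^ s \<partial>(\<Pi>\<^sub>M i\<in>(UNIV :: 'k option set). std_gauss)) =
      ((\<Prod>i\<in>UNIV. real (Suc (J i))) * (\<Sum>i\<in>UNIV. 1 / real (Suc (J i)))) ^ s * ?I"
      by (subst gauss_simplex_moment) simp_all
    then show "(\<Prod>i\<in>UNIV. w (J i)) *
        (\<integral>x. gram (L ** edge_matrix (\<lambda>i. sqrt (real (Suc (J i))) *\<^sub>R x i)) ^ s \<partial>(\<Pi>\<^sub>M i\<in>UNIV. std_gauss)) =
        ((\<Prod>i\<in>UNIV. w (J i) * real (Suc (J i)) ^ s) * (\<Sum>i\<in>UNIV. 1 / real (Suc (J i))) ^ s) * ?I"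
      by (simp only: power_mult_distrib prod.distrib prod_power_distrib mult.assoc)
  qed
  also have "\<dots> = (\<Sum>J\<in>PiE (UNIV :: 'k option set) (\<lambda>_. {..?D}).
      (\<Prod>i\<in>UNIV. w (J i) * real (Suc (J i)) ^ s) * (\<Sum>i\<in>UNIV. 1 / real (Suc (J i))) ^ s) * ?I"
    by (rule sum_distrib_right[symmetric])
  also have "(\<Sum>J\<in>PiE (UNIV :: 'k option set) (\<lambda>_. {..?D}).
      (\<Prod>i\<in>UNIV. w (J i) * real (Suc (J i)) ^ s) * (\<Sum>i\<in>UNIV. 1 / real (Suc (J i))) ^ s) = simplex_factor CARD('n) CARD('k) s"
  proof -
    have "s \<le> ?D" using zero_less_card_finite[where 'a='k] by (metis Suc_leI mult.left_neutral mult_le_mono1 One_nat_def)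
    then show ?thesis
      using interpolation_sum[of ?c s ?D "UNIV :: 'k option set" s w, OF _ _ finite order_refl w]
      by (simp add: simplex_factor_def card_UNIV_option add.commute)
  qed
  finally show ?thesis .
qed

section \<open>Bounded laws are determined by their moments\<close>

text \<open>The Taylor polynomial of degree \<open>n\<close> of the characteristic function involves
  moments only, and for a variable bounded by \<open>B\<close> its error is at most
  \<open>2 * (\<bar>t\<bar> * B) ^ n / fact n\<close>, which tends to 0. Equal moments therefore
  give equal characteristic functions.\<close>

lemma (in prob_space) bounded_moments_determine_distribution:
  fixes Y Z :: "'a \<Rightarrow> real"
  assumes Y[measurable]: "Y \<in> borel_measurable M" and Z[measurable]: "Z \<in> borel_measurable M"
    and bY: "AE x in M. \<bar>Y x\<bar> \<le> B" and bZ: "AE x in M. \<bar>Z x\<bar> \<le> B"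
    and mom: "\<And>s::nat. expectation (\<lambda>x. Y x ^ s) = expectation (\<lambda>x. Z x ^ s)"
  shows "distr M borel Y = distr M borel Z"
proof (rule Levy_uniqueness)
  show "real_distribution (distr M borel Y)" "real_distribution (distr M borel Z)"
    by (auto intro!: real_distribution_distr)
  have B0: "B \<ge> 0"
  proof -
    have "AE x in M. 0 \<le> B" using bY by eventually_elim linarith
    then show ?thesis by simp
  qed
  have approx: "cmod (char (distr M borel X) t - (\<Sum>k\<le>n. ((\<i> * t) ^ k / fact k) * expectation (\<lambda>x. X x ^ k))) \<le> 2 * (\<bar>t\<bar> * B) ^ n / fact n"
    if X[measurable]: "X \<in> borel_measurable M" and bX: "AE x in M. \<bar>X x\<bar> \<le> B" for X :: "'a \<Rightarrow> real" and t n
  proof -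
    have bp: "AE x in M. \<bar>X x\<bar> ^ k \<le> B ^ k" for k
      using bX by eventually_elim (intro power_mono, auto)
    have int: "integrable M (\<lambda>x. X x ^ k)" for k
      using bp[of k] by (intro integrable_const_bound[where B="B ^ k"]) (auto simp: power_abs)
    have "expectation (\<lambda>x. \<bar>X x\<bar> ^ n) \<le> expectation (\<lambda>x. B ^ n)"
      using bp[of n] int[of n] by (intro integral_mono_AE) (auto simp: power_abs[symmetric])
    then have e: "expectation (\<lambda>x. \<bar>X x\<bar> ^ n) \<le> B ^ n" by (simp add: prob_space)
    have "cmod (char (distr M borel X) t - (\<Sum>k\<le>n. ((\<i> * t) ^ k / fact k) * expectation (\<lambda>x. X x ^ k))) \<le>
        (2 * \<bar>t\<bar> ^ n / fact n) * expectation (\<lambda>x. \<bar>X x\<bar> ^ n)"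
      by (rule char_approx1'[OF int X refl])
    also have "\<dots> \<le> (2 * \<bar>t\<bar> ^ n / fact n) * B ^ n" by (intro mult_left_mono e) auto
    finally show ?thesis by (simp add: power_mult_distrib)
  qed
  show "char (distr M borel Y) = char (distr M borel Z)"
  proof
    fix t
    let ?d = "cmod (char (distr M borel Y) t - char (distr M borel Z) t)"
    have "?d \<le> 4 * ((\<bar>t\<bar> * B) ^ n / fact n)" for n
    proof -
      let ?s = "\<Sum>k\<le>n. ((\<i> * t) ^ k / fact k) * expectation (\<lambda>x. Y x ^ k)"
      have "?d = cmod ((char (distr M borel Y) t - ?s) - (char (distr M borel Z) t - ?s))" by simp
      also have "\<dots> \<le> cmod (char (distr M borel Y) t - ?s) + cmod (char (distr M borel Z) t - ?s)"
        by (rule norm_triangle_ineq4)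
      also have "\<dots> \<le> 2 * (\<bar>t\<bar> * B) ^ n / fact n + 2 * (\<bar>t\<bar> * B) ^ n / fact n"
        using approx[OF Y bY, of t n] approx[OF Z bZ, of t n] unfolding mom by (rule add_mono)
      finally show ?thesis by simp
    qed
    moreover have "(\<lambda>n. 4 * ((\<bar>t\<bar> * B) ^ n / fact n)) \<longlonglongrightarrow> 4 * 0"
      using summable_LIMSEQ_zero[OF summable_exp[of "\<bar>t\<bar> * B"]]
      by (intro tendsto_mult tendsto_const) (simp add: divide_inverse mult.commute)
    ultimately have "?d \<le> 0" by (intro LIMSEQ_le_const[of _ 0]) auto
    then show "char (distr M borel Y) t = char (distr M borel Z) t" by simp
  qed
qed

section \<open>Moments of Beta variables\<close>

lemma beta_density_times_powers:
  assumes "0 < t" "t < 1"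
  shows "beta_density a b t * (t ^ p * (1 - t) ^ q) = Gamma (a + b) / (Gamma a * Gamma b) *
    (t powr (a + real p - 1) * (1 - t) powr (b + real q - 1))"
proof -
  have "t powr (a + real p - 1) = t powr (a - 1) * t ^ p" "(1 - t) powr (b + real q - 1) = (1 - t) powr (b - 1) * (1 - t) ^ q"
    using assms by (simp_all add: powr_realpow[symmetric] powr_add[symmetric] algebra_simps)
  then show ?thesis using assms by (simp add: beta_density_def)
qed

lemma beta_density_nonneg: "a > 0 \<Longrightarrow> b > 0 \<Longrightarrow> 0 \<le> beta_density a b t"
  by (auto simp: beta_density_def intro!: mult_nonneg_nonneg divide_nonneg_nonneg less_imp_le[OF Gamma_real_pos])

lemma measurable_beta_density [measurable]: "beta_density a b \<in> borel_measurable borel"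
  unfolding beta_density_def[abs_def] by measurable

text \<open>Powers of \<open>t\<close> and \<open>1 - t\<close> only shift the parameters of the
  density, so the moment is a quotient of Beta values, rewritten with Pochhammer symbols.\<close>

lemma beta_moment_has_integral:
  fixes a b :: real
  assumes a: "a > 0" and b: "b > 0"
  shows "has_bochner_integral lborel (\<lambda>t. beta_density a b t * (t ^ p * (1 - t) ^ q))
    (pochhammer a p * pochhammer b q / pochhammer (a + b) (p + q))"
proof (rule has_bochner_integral_nn_integral)
  let ?K = "Gamma (a + b) / (Gamma a * Gamma b)"
  let ?f = "\<lambda>t. t powr (a + real p - 1) * (1 - t) powr (b + real q - 1)"
  have Gp: "Gamma a > 0" "Gamma b > 0" "Gamma (a + b) > 0" using a b by (auto intro!: Gamma_real_pos)
  have K: "?K \<ge> 0" using Gp by simp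
  show "(\<lambda>t. beta_density a b t * (t ^ p * (1 - t) ^ q)) \<in> borel_measurable lborel" by measurable
  show "AE t in lborel. 0 \<le> beta_density a b t * (t ^ p * (1 - t) ^ q)"
  proof (rule AE_I2)
    fix t show "0 \<le> beta_density a b t * (t ^ p * (1 - t) ^ q)"
    proof (cases "0 < t \<and> t < 1")
      case True
      then show ?thesis by (intro mult_nonneg_nonneg beta_density_nonneg[OF a b] zero_le_power) auto
    qed (auto simp: beta_density_def)
  qed
  have nz: "x \<notin> \<int>\<^sub>\<le>\<^sub>0" if "x > 0" for x :: real using that nonpos_Ints_nonpos by fastforce
  show "0 \<le> pochhammer a p * pochhammer b q / pochhammer (a + b) (p + q)"
    using a b by (intro divide_nonneg_nonneg mult_nonneg_nonneg pochhammer_nonneg) auto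
  have hi: "(?f has_integral Beta (a + real p) (b + real q)) {0..1}"
    using a b by (intro has_integral_Beta_real) auto
  have "(\<integral>\<^sup>+t. ennreal (beta_density a b t * (t ^ p * (1 - t) ^ q)) \<partial>lborel) =
      (\<integral>\<^sup>+t. ennreal ?K * ennreal (indicator {0..1} t * ?f t) \<partial>lborel)"
  proof (rule nn_integral_cong_AE)
    have "AE t in lborel. t \<noteq> (0::real)" "AE t in lborel. t \<noteq> (1::real)" by (rule AE_lborel_singleton)+
    then show "AE t in lborel. ennreal (beta_density a b t * (t ^ p * (1 - t) ^ q)) = ennreal ?K * ennreal (indicator {0..1} t * ?f t)"
    proof eventually_elim
      case (elim t)
      show ?case
      proof (cases "0 < t \<and> t < 1")
        case True
        then show ?thesis using K by (simp add: beta_density_times_powers ennreal_mult'[symmetric])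
      next
        case False
        then have "beta_density a b t = 0" "indicator {0..1} t = (0::real)"
          using elim by (auto simp: beta_density_def indicator_def)
        then show ?thesis by simp
      qed
    qed
  qed
  also have "\<dots> = ennreal ?K * ennreal (Beta (a + real p) (b + real q))"
  proof -
    have "(\<integral>\<^sup>+t. ennreal (indicator {0..1} t * ?f t) \<partial>lborel) = ennreal (Beta (a + real p) (b + real q))"
      by (rule nn_integral_has_integral_lebesgue[OF _ hi]) simp
    moreover have "(\<lambda>t. ennreal (indicator {0..1} t * ?f t)) \<in> borel_measurable lborel" by measurable
    ultimately show ?thesis by (simp only: nn_integral_cmult)
  qed
  also have "\<dots> = ennreal (?K * Beta (a + real p) (b + real q))" using K by (rule ennreal_mult'[symmetric])
  also have "?K * Beta (a + real p) (b + real q) = pochhammer a p * pochhammer b q / pochhammer (a + b) (p + q)"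
  proof -
    have 1: "a + real p + (b + real q) = a + b + real (p + q)" by simp
    have 2: "Gamma (a + b + real (p + q)) > 0" using a b by (intro Gamma_real_pos) simp
    have nzs: "a \<notin> \<int>\<^sub>\<le>\<^sub>0" "b \<notin> \<int>\<^sub>\<le>\<^sub>0" "a + b \<notin> \<int>\<^sub>\<le>\<^sub>0" using nz a b by auto
    show ?thesis
      unfolding Beta_def 1 pochhammer_Gamma[OF nzs(1)] pochhammer_Gamma[OF nzs(2)] pochhammer_Gamma[OF nzs(3)]
      using Gp 2 by (simp add: divide_simps)
  qed
  finally show "(\<integral>\<^sup>+t. ennreal (beta_density a b t * (t ^ p * (1 - t) ^ q)) \<partial>lborel) =
      ennreal (pochhammer a p * pochhammer b q / pochhammer (a + b) (p + q))" .
qed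

lemma (in prob_space) beta_distributed_moment:
  assumes Z: "beta_distributed M Z a b" and ab: "a > 0" "b > 0"
  shows "expectation (\<lambda>x. Z x ^ p * (1 - Z x) ^ q) = pochhammer a p * pochhammer b q / pochhammer (a + b) (p + q)"
proof -
  have "expectation (\<lambda>x. Z x ^ p * (1 - Z x) ^ q) = (\<integral>t. beta_density a b t * (t ^ p * (1 - t) ^ q) \<partial>lborel)"
    using Z unfolding beta_distributed_def
    by (intro distributed_integral[symmetric]) (auto simp: beta_density_nonneg[OF ab])
  then show ?thesis using beta_moment_has_integral[OF ab, of p q] by (simp add: has_bochner_integral_iff)
qed

lemma (in prob_space) beta_distributed_AE:
  assumes Z: "beta_distributed M Z a b"
  shows "AE x in M. 0 < Z x \<and> Z x < 1"
proof -
  have Zm: "Z \<in> measurable M lborel" and d: "distr M lborel Z = density lborel (\<lambda>t. ennreal (beta_density a b t))"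
    using Z by (auto simp: beta_distributed_def distributed_def)
  have "AE t in density lborel (\<lambda>t. ennreal (beta_density a b t)). 0 < t \<and> t < 1"
    by (subst AE_density) (measurable, auto simp: beta_density_def)
  then have "AE t in distr M lborel Z. 0 < t \<and> t < 1" unfolding d .
  then show ?thesis using AE_distrD[OF Zm] by blast
qed

section \<open>Independence of lists of event systems, and product moments\<close>

lemma Int_stable_generated_events: "Int_stable (generated_events M N Z)"
proof (rule Int_stableI)
  fix a b assume "a \<in> generated_events M N Z" "b \<in> generated_events M N Z"
  then obtain A B where "A \<in> sets N" "B \<in> sets N" "a = Z -` A \<inter> space M" "b = Z -` B \<inter> space M"
    unfolding generated_events_def by blast
  then have "A \<inter> B \<in> sets N" "a \<inter> b = Z -` (A \<inter> B) \<inter> space M" by auto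
  then show "a \<inter> b \<in> generated_events M N Z" unfolding generated_events_def by blast
qed

lemma (in prob_space) indep_sets_reindex:
  assumes f: "inj_on f I" and ind: "indep_sets F (f ` I)"
  shows "indep_sets (\<lambda>i. F (f i)) I"
  unfolding indep_sets_def
proof (intro conjI ballI allI impI)
  fix i assume "i \<in> I" then show "F (f i) \<subseteq> events" using ind unfolding indep_sets_def by blast
next
  fix J A assume J: "J \<subseteq> I" "J \<noteq> {}" "finite J" and A: "A \<in> Pi J (\<lambda>i. F (f i))"
  let ?g = "the_inv_into J f"
  have inj: "inj_on f J" using f J(1) by (rule inj_on_subset)
  have g: "?g (f i) = i" if "i \<in> J" for i using the_inv_into_f_f[OF inj that] .
  have "\<forall>A\<in>Pi (f ` J) F. prob (\<Inter>j\<in>f ` J. A j) = (\<Prod>j\<in>f ` J. prob (A j))"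
    using ind J unfolding indep_sets_def by (meson finite_imageI image_is_empty image_mono)
  moreover have "(\<lambda>j. A (?g j)) \<in> Pi (f ` J) F" using A g by auto
  ultimately have "prob (\<Inter>j\<in>f ` J. A (?g j)) = (\<Prod>j\<in>f ` J. prob (A (?g j)))" by blast
  moreover have "(\<Inter>j\<in>f ` J. A (?g j)) = (\<Inter>j\<in>J. A j)" using g by auto
  moreover have "(\<Prod>j\<in>f ` J. prob (A (?g j))) = (\<Prod>j\<in>J. prob (A j))"
    using g by (subst prod.reindex[OF inj]) auto
  ultimately show "prob (\<Inter>j\<in>J. A j) = (\<Prod>j\<in>J. prob (A j))" by simp
qed

text \<open>Independence of a list concerns its positions, so every selection of distinct positions,
  in any order, inherits it.\<close>

lemma independent_list_sublist:
  assumes p: "prob_space M" and ind: "independent_list M Fs"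
    and idx: "distinct idx" "set idx \<subseteq> {..<length Fs}"
  shows "independent_list M (map (\<lambda>i. Fs ! i) idx)"
proof -
  interpret prob_space M by fact
  have "indep_sets (\<lambda>i. Fs ! (idx ! i)) {..<length idx}"
  proof (rule indep_sets_reindex[where F="\<lambda>i. Fs ! i" and f="\<lambda>i. idx ! i"])
    show "inj_on ((!) idx) {..<length idx}" using idx(1) by (simp add: inj_on_nth)
    have "(!) idx ` {..<length idx} \<subseteq> {..<length Fs}" using idx(2) nth_mem by blast
    then show "indep_sets ((!) Fs) ((!) idx ` {..<length idx})"
      using ind indep_sets_mono_index unfolding independent_list_def by blast
  qed
  then have "indep_sets (\<lambda>i. map (\<lambda>i. Fs ! i) idx ! i) {..<length (map (\<lambda>i. Fs ! i) idx)}"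
    by (subst indep_sets_cong[where G="\<lambda>i. Fs ! (idx ! i)" and J="{..<length idx}"]) auto
  then show ?thesis unfolding independent_list_def .
qed

lemma (in prob_space) indep_vars_of_generated_events:
  assumes ind: "indep_sets F I" and rv: "\<And>i. i \<in> I \<Longrightarrow> random_variable (N i) (Z i)"
    and F: "\<And>i. i \<in> I \<Longrightarrow> generated_events M (N i) (Z i) \<subseteq> F i"
  shows "indep_vars N Z I"
  unfolding indep_vars_def2
  using rv indep_sets_mono_sets[OF ind, of "\<lambda>i. {Z i -` A \<inter> space M | A. A \<in> sets (N i)}"] F
  by (auto simp: generated_events_def)

lemma generated_events_compose:
  assumes "g \<in> measurable N K" "Z \<in> measurable M N"
  shows "generated_events M K (\<lambda>x. g (Z x)) \<subseteq> generated_events M N Z"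
proof
  fix a assume "a \<in> generated_events M K (\<lambda>x. g (Z x))"
  then obtain A where A: "A \<in> sets K" "a = (\<lambda>x. g (Z x)) -` A \<inter> space M" unfolding generated_events_def by blast
  have "g -` A \<inter> space N \<in> sets N" using assms(1) A(1) by (rule measurable_sets)
  moreover have "a = Z -` (g -` A \<inter> space N) \<inter> space M"
    using A(2) measurable_space[OF assms(2)] by auto
  ultimately show "a \<in> generated_events M N Z" unfolding generated_events_def by blast
qed

text \<open>\<open>F\<close> stands for the events of the random subspace or of the Gaussian matrix,
  and \<open>Q\<close> for a function of one of them; the same factorisation thus serves the second
  and the third variable of the theorem.\<close>

lemma (in prob_space) beta_product_moment:
  fixes k :: nat and Q \<eta>' :: "'a \<Rightarrow> real" and \<eta>s :: "nat \<Rightarrow> 'a \<Rightarrow> real"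
  assumes ind: "independent_list M (F # generated_events M borel \<eta>' # map (\<lambda>i. generated_events M borel (\<eta>s i)) [1..<Suc k])"
    and Q[measurable]: "Q \<in> borel_measurable M" and QF: "generated_events M borel Q \<subseteq> F" and Qb: "AE x in M. \<bar>Q x\<bar> \<le> B"
    and e[measurable]: "\<eta>' \<in> borel_measurable M" and eb: "AE x in M. 0 < \<eta>' x \<and> \<eta>' x < 1"
    and s[measurable]: "\<And>i. i \<in> {1..k} \<Longrightarrow> \<eta>s i \<in> borel_measurable M"
    and sb: "\<And>i. i \<in> {1..k} \<Longrightarrow> AE x in M. 0 < \<eta>s i x \<and> \<eta>s i x < 1"
  shows "expectation (\<lambda>x. ((1 - \<eta>' x) ^ k * (\<Prod>i=1..k. \<eta>s i x) * Q x) ^ m) =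
    expectation (\<lambda>x. (1 - \<eta>' x) ^ (k * m)) * (\<Prod>i=1..k. expectation (\<lambda>x. \<eta>s i x ^ m)) * expectation (\<lambda>x. Q x ^ m)"
proof -
  \<comment> \<open>The numbering follows the list: position 0 for \<open>Q\<close>, position 1 for
    \<open>\<eta>'\<close>, and position \<open>i + 1\<close> for \<open>\<eta>s i\<close>.\<close>
  define Z where "Z j = (if j = 0 then (\<lambda>x. Q x ^ m) else if j = 1 then (\<lambda>x. (1 - \<eta>' x) ^ (k * m)) else (\<lambda>x. \<eta>s (j - 1) x ^ m))" for j :: nat
  let ?L = "F # generated_events M borel \<eta>' # map (\<lambda>i. generated_events M borel (\<eta>s i)) [1..<Suc k]"
  have len: "{..<length ?L} = {..<Suc (Suc k)}" by simp
  have iset: "indep_sets (\<lambda>i. ?L ! i) {..<Suc (Suc k)}"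
    using ind unfolding independent_list_def len .
  have cases: "j = 0 \<or> j = 1 \<or> (\<exists>i\<in>{1..k}. j = Suc i)" if "j < Suc (Suc k)" for j
    using that by (cases j; cases "j - 1") auto
  have nth: "?L ! Suc i = generated_events M borel (\<eta>s i)" if "i \<in> {1..k}" for i
    using that by (cases i) (auto simp: nth_append simp del: upt_Suc)
  have iv: "indep_vars (\<lambda>_. borel) Z {..<Suc (Suc k)}"
  proof (rule indep_vars_of_generated_events[OF iset])
    fix j assume "j \<in> {..<Suc (Suc k)}"
    then consider "j = 0" | "j = 1" | i where "i \<in> {1..k}" "j = Suc i" using cases[of j] by auto
    then show "Z j \<in> borel_measurable M"
      by cases (auto simp: Z_def intro!: borel_measurable_power borel_measurable_diff Q e s)
  next
    fix j assume "j \<in> {..<Suc (Suc k)}"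
    then consider "j = 0" | "j = 1" | i where "i \<in> {1..k}" "j = Suc i" using cases[of j] by auto
    then show "generated_events M borel (Z j) \<subseteq> ?L ! j"
    proof cases
      case 1
      have "generated_events M borel (\<lambda>x. Q x ^ m) \<subseteq> generated_events M borel Q"
        by (rule generated_events_compose[where g="\<lambda>y. y ^ m"]) measurable
      then show ?thesis using 1 QF by (simp add: Z_def)
    next
      case 2
      have "generated_events M borel (\<lambda>x. (1 - \<eta>' x) ^ (k * m)) \<subseteq> generated_events M borel \<eta>'"
        by (rule generated_events_compose[where g="\<lambda>y. (1 - y) ^ (k * m)"]) measurable
      then show ?thesis using 2 by (simp add: Z_def)
    next
      case 3
      have "generated_events M borel (\<lambda>x. \<eta>s i x ^ m) \<subseteq> generated_events M borel (\<eta>s i)"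
        by (rule generated_events_compose[where g="\<lambda>y. y ^ m", OF _ s[OF 3(1)]]) measurable
      moreover have "Z j = (\<lambda>x. \<eta>s i x ^ m)" using 3 by (simp add: Z_def)
      ultimately show ?thesis using nth[OF 3(1)] 3(2) by simp
    qed
  qed
  have int: "integrable M (Z j)" if j: "j \<in> {..<Suc (Suc k)}" for j
  proof -
    consider "j = 0" | "j = 1" | i where "i \<in> {1..k}" "j = Suc i" using cases[of j] j by auto
    then show ?thesis
    proof cases
      case 1
      have "AE x in M. norm (Q x ^ m) \<le> B ^ m"
        using Qb by eventually_elim (auto simp: power_abs intro!: power_mono)
      then show ?thesis using 1 by (auto simp: Z_def intro!: integrable_const_bound[where B="B ^ m"])
    next
      case 2
      have "AE x in M. norm ((1 - \<eta>' x) ^ (k * m)) \<le> 1"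
        using eb by eventually_elim (auto simp: power_abs intro!: power_le_one)
      then show ?thesis using 2 by (auto simp: Z_def intro!: integrable_const_bound[where B=1])
    next
      case 3
      have "AE x in M. norm (\<eta>s i x ^ m) \<le> 1"
        using sb[OF 3(1)] by eventually_elim (auto simp: power_abs intro!: power_le_one)
      then show ?thesis using 3
        by (auto simp: Z_def intro!: integrable_const_bound[where B=1] borel_measurable_power s)
    qed
  qed
  have split: "(\<Prod>j\<in>{..<Suc (Suc k)}. h j) = h 0 * (h 1 * (\<Prod>i=1..k. h (Suc i)))" for h :: "nat \<Rightarrow> real"
  proof -
    have "(\<Prod>j\<in>{..<Suc (Suc k)}. h j) = h 0 * (\<Prod>j\<in>{..<Suc k}. h (Suc j))" by (rule prod.lessThan_Suc_shift)
    also have "(\<Prod>j\<in>{..<Suc k}. h (Suc j)) = h 1 * (\<Prod>j\<in>{..<k}. h (Suc (Suc j)))"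
      using prod.lessThan_Suc_shift[of "\<lambda>j. h (Suc j)" k] by simp
    also have "(\<Prod>j\<in>{..<k}. h (Suc (Suc j))) = (\<Prod>i=1..k. h (Suc i))"
      by (rule prod.reindex_bij_witness[of _ "\<lambda>i. i - 1" Suc]) auto
    finally show ?thesis .
  qed
  have Zs: "Z (Suc i) = (\<lambda>x. \<eta>s i x ^ m)" if "i \<in> {1..k}" for i using that by (auto simp: Z_def)
  have "((1 - \<eta>' x) ^ k * (\<Prod>i=1..k. \<eta>s i x) * Q x) ^ m = (\<Prod>j\<in>{..<Suc (Suc k)}. Z j x)" for x
  proof -
    have "(\<Prod>i=1..k. Z (Suc i) x) = (\<Prod>i=1..k. \<eta>s i x) ^ m"
      unfolding prod_power_distrib by (intro prod.cong refl) (simp add: Zs)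
    then show ?thesis unfolding split by (simp add: Z_def power_mult_distrib power_mult ac_simps)
  qed
  then have "expectation (\<lambda>x. ((1 - \<eta>' x) ^ k * (\<Prod>i=1..k. \<eta>s i x) * Q x) ^ m) = expectation (\<lambda>x. \<Prod>j\<in>{..<Suc (Suc k)}. Z j x)"
    by simp
  also have "\<dots> = (\<Prod>j\<in>{..<Suc (Suc k)}. expectation (Z j))"
    by (rule indep_vars_lebesgue_integral[OF _ iv int]) auto
  also have "\<dots> = expectation (\<lambda>x. Q x ^ m) * (expectation (\<lambda>x. (1 - \<eta>' x) ^ (k * m)) * (\<Prod>i=1..k. expectation (\<lambda>x. \<eta>s i x ^ m)))"
  proof -
    have "(\<Prod>i=1..k. expectation (Z (Suc i))) = (\<Prod>i=1..k. expectation (\<lambda>x. \<eta>s i x ^ m))"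
      by (intro prod.cong refl) (simp add: Zs)
    then show ?thesis unfolding split by (simp add: Z_def)
  qed
  finally show ?thesis by (simp add: ac_simps)
qed

text \<open>\<open>Q\<close> depends on all \<open>X i\<close> jointly, so their event systems are
  merged into the \<sigma>-algebra they generate. Independence from \<eta> survives the merging
  because each system is closed under intersection.\<close>

lemma (in prob_space) grouped_product_moment:
  fixes k :: nat and Q \<eta> :: "'a \<Rightarrow> real" and X :: "nat \<Rightarrow> 'a \<Rightarrow> 'b::topological_space"
  assumes ind: "independent_list M (map (\<lambda>i. generated_events M borel (X i)) [0..<Suc k] @ [generated_events M borel \<eta>])"
    and X: "\<And>i. i \<in> {..k} \<Longrightarrow> X i \<in> borel_measurable M"
    and Q: "Q \<in> borel_measurable (sigma (space M) (\<Union>i\<in>{..k}. generated_events M borel (X i)))"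
    and Qb: "AE x in M. \<bar>Q x\<bar> \<le> B"
    and e[measurable]: "\<eta> \<in> borel_measurable M" and eb: "AE x in M. 0 < \<eta> x \<and> \<eta> x < 1"
  shows "expectation (\<lambda>x. (\<eta> x * (1 - \<eta> x) ^ k * Q x) ^ m) =
      expectation (\<lambda>x. \<eta> x ^ m * (1 - \<eta> x) ^ (k * m)) * expectation (\<lambda>x. Q x ^ m)"
    and "Q \<in> borel_measurable M"
proof -
  let ?G = "\<Union>i\<in>{..k}. generated_events M borel (X i)"
  let ?L = "map (\<lambda>i. generated_events M borel (X i)) [0..<Suc k] @ [generated_events M borel \<eta>]"
  define F where "F i = (if i \<le> k then generated_events M borel (X i) else generated_events M borel \<eta>)" for i
  have GM: "?G \<subseteq> sets M" using X unfolding generated_events_def by (auto intro: measurable_sets)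
  have Gs: "?G \<subseteq> Pow (space M)" unfolding generated_events_def by auto
  have sub: "sets (sigma (space M) ?G) \<subseteq> sets M"
    unfolding sets_measure_of[OF Gs] by (rule sets.sigma_sets_subset[OF GM])
  have spQ: "space (sigma (space M) ?G) = space M" by (rule space_measure_of_conv)
  show Qm[measurable]: "Q \<in> borel_measurable M"
    using Q sub unfolding measurable_def spQ by auto
  have len: "length ?L = Suc (Suc k)" by simp
  have "indep_sets (\<lambda>i. ?L ! i) {..<Suc (Suc k)}"
    using ind unfolding independent_list_def len .
  then have iF: "indep_sets F {..<Suc (Suc k)}"
    by (subst (asm) indep_sets_cong[where G=F and J="{..<Suc (Suc k)}"])
       (auto simp: F_def nth_append less_Suc_eq simp del: upt_Suc)
  \<comment> \<open>Block 0 collects the positions of the points, block 1 is the position of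
    \<eta>.\<close>
  let ?J = "\<lambda>j::nat. if j = 0 then {..k} else {Suc k}"
  have U: "(\<Union>j\<in>{0, 1}. ?J j) = {..<Suc (Suc k)}" by auto
  have "indep_sets (\<lambda>j. sigma_sets (space M) (\<Union>i\<in>?J j. F i)) {0, 1}"
  proof (rule indep_sets_collect_sigma)
    show "indep_sets F (\<Union>j\<in>{0, 1}. ?J j)" unfolding U by (rule iF)
    show "Int_stable (F i)" for i by (simp add: F_def Int_stable_generated_events)
    show "disjoint_family_on ?J {0, 1}" by (auto simp: disjoint_family_on_def)
  qed
  note iG = this
  define Z where "Z j = (if j = 0 then (\<lambda>x. Q x ^ m) else (\<lambda>x. \<eta> x ^ m * (1 - \<eta> x) ^ (k * m)))" for j :: nat
  have iv: "indep_vars (\<lambda>_. borel) Z {0, 1}"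
  proof (rule indep_vars_of_generated_events[OF iG])
    fix j :: nat assume "j \<in> {0, 1}"
    then show "Z j \<in> borel_measurable M" by (auto simp: Z_def)
  next
    fix j :: nat assume "j \<in> {0, 1}"
    then consider "j = 0" | "j = 1" by auto
    then show "generated_events M borel (Z j) \<subseteq> sigma_sets (space M) (\<Union>i\<in>?J j. F i)"
    proof cases
      case 1
      have Qp: "(\<lambda>x. Q x ^ m) \<in> borel_measurable (sigma (space M) ?G)" using Q by measurable
      have "generated_events M borel (\<lambda>x. Q x ^ m) \<subseteq> sets (sigma (space M) ?G)"
      proof
        fix a assume "a \<in> generated_events M borel (\<lambda>x. Q x ^ m)"
        then have "\<exists>A. a = (\<lambda>x. Q x ^ m) -` A \<inter> space M \<and> A \<in> sets borel"
          unfolding generated_events_def mem_Collect_eq .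
        then obtain A where A: "a = (\<lambda>x. Q x ^ m) -` A \<inter> space M" "A \<in> sets borel" by (elim exE conjE)
        show "a \<in> sets (sigma (space M) ?G)"
          using measurable_sets[OF Qp A(2)] unfolding spQ A(1) .
      qed
      also have "\<dots> = sigma_sets (space M) ?G" using Gs by (rule sets_measure_of)
      also have "?G = (\<Union>i\<in>?J j. F i)" using 1 by (simp only: simp_thms if_True) (rule SUP_cong, simp_all add: F_def)
      finally show ?thesis using 1 by (simp add: Z_def)
    next
      case 2
      have "generated_events M borel (\<lambda>x. \<eta> x ^ m * (1 - \<eta> x) ^ (k * m)) \<subseteq> generated_events M borel \<eta>"
        by (rule generated_events_compose[where g="\<lambda>y. y ^ m * (1 - y) ^ (k * m)"]) measurable
      also have "\<dots> \<subseteq> sigma_sets (space M) (\<Union>i\<in>?J j. F i)"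
      proof -
        have "(\<Union>i\<in>?J j. F i) = generated_events M borel \<eta>" using 2 by (simp add: F_def)
        then show ?thesis by (auto intro: sigma_sets.Basic)
      qed
      finally show ?thesis using 2 by (simp add: Z_def)
    qed
  qed
  have int: "integrable M (Z j)" if "j \<in> {0, 1}" for j
  proof -
    have "AE x in M. norm (Q x ^ m) \<le> B ^ m"
      using Qb by eventually_elim (auto simp: power_abs intro!: power_mono)
    then have 1: "integrable M (\<lambda>x. Q x ^ m)" by (auto intro!: integrable_const_bound[where B="B ^ m"])
    have "AE x in M. norm (\<eta> x ^ m * (1 - \<eta> x) ^ (k * m)) \<le> 1"
      using eb
    proof eventually_elim
      case (elim x)
      then have "0 \<le> \<eta> x ^ m" "\<eta> x ^ m \<le> 1" "0 \<le> (1 - \<eta> x) ^ (k * m)" "(1 - \<eta> x) ^ (k * m) \<le> 1"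
        by (auto intro: power_le_one)
      then have "0 \<le> \<eta> x ^ m * (1 - \<eta> x) ^ (k * m)" "\<eta> x ^ m * (1 - \<eta> x) ^ (k * m) \<le> 1"
        by (auto intro: mult_le_one)
      then show ?case by (simp only: real_norm_def abs_of_nonneg)
    qed
    then have 2: "integrable M (\<lambda>x. \<eta> x ^ m * (1 - \<eta> x) ^ (k * m))" by (auto intro!: integrable_const_bound[where B=1])
    show ?thesis using that 1 2 by (auto simp: Z_def)
  qed
  have "(\<eta> x * (1 - \<eta> x) ^ k * Q x) ^ m = (\<Prod>j\<in>{0, 1}. Z j x)" for x
  proof -
    have "(\<eta> x * (1 - \<eta> x) ^ k * Q x) ^ m = Q x ^ m * (\<eta> x ^ m * (1 - \<eta> x) ^ (k * m))"
      unfolding power_mult_distrib power_mult[symmetric] by (rule mult.commute)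
    then show ?thesis by (simp add: Z_def)
  qed
  then have "expectation (\<lambda>x. (\<eta> x * (1 - \<eta> x) ^ k * Q x) ^ m) = expectation (\<lambda>x. \<Prod>j\<in>{0, 1}. Z j x)" by simp
  also have "\<dots> = (\<Prod>j\<in>{0, 1}. expectation (Z j))"
    by (rule indep_vars_lebesgue_integral[OF _ iv int]) auto
  finally show "expectation (\<lambda>x. (\<eta> x * (1 - \<eta> x) ^ k * Q x) ^ m) =
      expectation (\<lambda>x. \<eta> x ^ m * (1 - \<eta> x) ^ (k * m)) * expectation (\<lambda>x. Q x ^ m)"
    by (simp add: Z_def mult.commute)
qed

section \<open>Ellipsoids as affine images of the ball\<close>

definition diag_matrix :: "real^'n \<Rightarrow> real^'n^'n" where
  "diag_matrix l = (\<chi> i j. if i = j then l $ i else 0)"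

lemma transpose_diag_matrix: "transpose (diag_matrix l) = diag_matrix l"
  by (auto simp: diag_matrix_def transpose_def vec_eq_iff)

lemma diag_matrix_mult: "(diag_matrix l ** A) $ i $ j = l $ i * A $ i $ j"
  using sum_delta_mult(3)[of i "\<lambda>_. l $ i" "\<lambda>k. A $ k $ j"]
  by (simp add: diag_matrix_def matrix_matrix_mult_def)

lemma diag_matrix_vector: "(diag_matrix l *v x) $ i = l $ i * x $ i"
  using sum_delta_mult(3)[of i "\<lambda>_. l $ i" "\<lambda>k. x $ k"]
  by (simp add: diag_matrix_def matrix_vector_mult_def)

lemma scale_rows_eq: "scale_rows l A = diag_matrix l ** A"
  by (simp add: vec_eq_iff scale_rows_def diag_matrix_mult)

text \<open>The columns of \<open>U\<close> are the axis directions. In coordinates along these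
  axes, divided by the semi-axes, the defining inequality reads
  \<open>norm z \<le> 1\<close>.\<close>

lemma ellipsoid_affine_image:
  fixes E :: "(real^'n) set"
  assumes "ellipsoid_with_semiaxes l E"
  obtains c :: "real^'n" and U :: "real^'n^'n" where "orthogonal_matrix U"
    "E = (\<lambda>z. c + (U ** diag_matrix l) *v z) ` cball 0 1"
proof -
  obtain c and u :: "'n \<Rightarrow> real^'n" where l: "\<And>i. 0 < l $ i" and u: "\<And>i j. u i \<bullet> u j = (if i = j then 1 else 0)"
    and E: "E = {x. (\<Sum>i\<in>UNIV. (((x - c) \<bullet> u i) / l $ i)\<^sup>2) \<le> 1}"
    using assms unfolding ellipsoid_with_semiaxes_def by blast
  define U :: "real^'n^'n" where "U = (\<chi> i j. u j $ i)"
  have col: "column j U = u j" for j by (simp add: U_def column_def vec_eq_iff)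
  have fU: "frame U" unfolding frame_iff_columns col using u by blast
  then have oU: "orthogonal_matrix U" by (simp add: frame_def orthogonal_matrix)
  have UU: "U *v (transpose U *v x) = x" for x
    using oU by (simp add: orthogonal_matrix_def matrix_vector_mul_assoc del: transpose_matrix_vector)
  have Ut: "(transpose U *v x) $ i = x \<bullet> u i" for x i
    by (simp add: U_def matrix_vector_mult_def transpose_def inner_vec_def mult.commute del: transpose_matrix_vector)
  have norm1: "norm z \<le> 1 \<longleftrightarrow> (\<Sum>i\<in>UNIV. (z $ i)\<^sup>2) \<le> 1" for z :: "real^'n"
  proof -
    have "(norm z)\<^sup>2 = (\<Sum>i\<in>UNIV. (z $ i)\<^sup>2)"
      unfolding power2_norm_eq_inner inner_vec_def by (simp add: power2_eq_square)
    moreover have "norm z \<le> 1 \<longleftrightarrow> (norm z)\<^sup>2 \<le> 1" by (simp add: power_le_one_iff)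
    ultimately show ?thesis by simp
  qed
  have "E = (\<lambda>z. c + (U ** diag_matrix l) *v z) ` cball 0 1"
  proof (intro equalityI subsetI)
    fix x assume x: "x \<in> E"
    define z :: "real^'n" where "z = (\<chi> i. ((x - c) \<bullet> u i) / l $ i)"
    have "diag_matrix l *v z = transpose U *v (x - c)"
      using l by (simp add: vec_eq_iff diag_matrix_vector z_def Ut less_imp_neq[THEN not_sym] del: transpose_matrix_vector)
    then have "(U ** diag_matrix l) *v z = x - c"
      by (simp add: matrix_vector_mul_assoc[symmetric] UU del: transpose_matrix_vector)
    moreover have "norm z \<le> 1" unfolding norm1 using x E by (simp add: z_def)
    ultimately show "x \<in> (\<lambda>z. c + (U ** diag_matrix l) *v z) ` cball 0 1"
      by (intro image_eqI[of _ _ z]) auto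
  next
    fix x assume "x \<in> (\<lambda>z. c + (U ** diag_matrix l) *v z) ` cball 0 1"
    then obtain z where z: "norm z \<le> 1" "x = c + (U ** diag_matrix l) *v z" by auto
    then have "x - c = U *v (diag_matrix l *v z)" by (simp add: matrix_vector_mul_assoc)
    then have "transpose U *v (x - c) = diag_matrix l *v z"
      using frame_transpose_cancel[OF fU] by simp
    then have "(x - c) \<bullet> u i = l $ i * z $ i" for i by (metis Ut diag_matrix_vector)
    moreover have "l $ i \<noteq> 0" for i using l[of i] by simp
    ultimately show "x \<in> E" using z(1) unfolding norm1 E by simp
  qed
  with oU show ?thesis using that by blast
qed

text \<open>An affine bijection multiplies the volume of all Borel sets by the same constant, which
  cancels when the volume of a set is divided by that of the whole ellipsoid.\<close>

lemma (in prob_space) uniform_affine_image_law: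
  fixes T S :: "real^'n^'n" and c :: "real^'n"
  assumes X: "distributed M lborel X (\<lambda>x. ennreal (indicator E x / measure lborel E))"
    and E: "E = (\<lambda>z. c + T *v z) ` cball 0 1" and ST: "S ** T = mat 1" "T ** S = mat 1"
  shows "distr M borel (\<lambda>x. S *v (X x - c)) = unif_ball"
proof (rule measure_eqI)
  have Xm[measurable]: "X \<in> borel_measurable M" using X by (simp add: distributed_def)
  have dX: "distr M lborel X = density lborel (\<lambda>x. ennreal (indicator E x / measure lborel E))"
    using X by (simp add: distributed_def)
  let ?f = "\<lambda>z. c + T *v z"
  have bT: "bij ((*v) T)" by (rule o_bij[of "(*v) S"]) (auto simp: fun_eq_iff matrix_vector_mul_assoc ST)
  have em: "emeasure lborel (?f ` A) * emeasure lborel (ball 0 1 :: (real^'n) set) =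
      emeasure lborel A * emeasure lborel ((*v) T ` ball 0 1)" and fb: "?f ` A \<in> sets borel"
    if A: "A \<in> sets borel" for A
  proof -
    have TA: "(*v) T ` A \<in> sets borel" by (rule linear_bij_borel[OF matrix_vector_mul_linear bT A])
    have im: "?f ` A = (\<lambda>x. x - c) -` ((*v) T ` A)"
    proof (intro equalityI subsetI)
      fix x assume "x \<in> (\<lambda>x. x - c) -` ((*v) T ` A)"
      then obtain z where z: "z \<in> A" "x - c = T *v z" by auto
      then have "x = c + T *v z" by (metis add_diff_cancel_left' diff_add_cancel add.commute)
      then show "x \<in> ?f ` A" using z(1) by blast
    qed auto
    have plus: "(+) (- c) = (\<lambda>x. x - c)" by auto
    have cm: "(\<lambda>x. x - c) \<in> measurable lborel borel" by measurable
    show "?f ` A \<in> sets borel" unfolding im using measurable_sets[OF cm TA] by simp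
    have "emeasure lborel (?f ` A) = emeasure (distr lborel borel (\<lambda>x. x - c)) ((*v) T ` A)"
      unfolding im using cm TA by (simp add: emeasure_distr)
    also have "\<dots> = emeasure lborel ((*v) T ` A)" by (simp only: plus[symmetric] lborel_distr_plus)
    finally show "emeasure lborel (?f ` A) * emeasure lborel (ball 0 1 :: (real^'n) set) =
        emeasure lborel A * emeasure lborel ((*v) T ` ball 0 1)"
      using emeasure_linear_bij[OF matrix_vector_mul_linear bT A] by simp
  qed
  let ?b = "emeasure lborel (ball 0 1 :: (real^'n) set)" and ?t = "emeasure lborel ((*v) T ` ball 0 1)"
  let ?C = "cball 0 1 :: (real^'n) set"
  have Eb: "E \<in> sets borel" unfolding E by (rule fb) simp
  have b: "?b \<noteq> 0" "?b \<noteq> \<infinity>" using emeasure_unit_ball by auto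
  have cE: "compact E" unfolding E by (intro compact_affine_image compact_cball)
  have Ef: "emeasure lborel E \<noteq> \<infinity>" using emeasure_bounded_finite[OF compact_imp_bounded[OF cE]] by simp
  have Cn: "emeasure lborel ?C \<noteq> 0" "emeasure lborel ?C \<noteq> \<infinity>"
    using unit_ball_vol_pos_card[where 'n='n] by (simp_all add: emeasure_unit_cball ennreal_eq_0_iff not_le)
  have Sf: "S *v (?f z - c) = z" for z by (simp add: matrix_vector_mul_assoc ST)
  have fS: "?f (S *v (x - c)) = x" for x by (simp add: matrix_vector_mul_assoc ST)
  \<comment> \<open>The constant is \<open>?t / ?b\<close>; here \<open>?t\<close> is finite because
    \<open>E\<close> is bounded, and nonzero because \<open>T\<close> is invertible.\<close>
  have t: "?t \<noteq> 0" "?t \<noteq> \<infinity>"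
  proof -
    have "emeasure lborel E * ?b = emeasure lborel ?C * ?t" unfolding E by (rule em) simp
    then show "?t \<noteq> \<infinity>" using Ef b Cn by (auto simp: ennreal_mult_eq_top_iff)
    have "emeasure lborel ((*v) S ` (*v) T ` ball 0 1) * ?b = ?t * emeasure lborel ((*v) S ` ball 0 1)"
    proof (rule emeasure_linear_bij)
      show "bij ((*v) S)" by (rule o_bij[of "(*v) T"]) (auto simp: fun_eq_iff matrix_vector_mul_assoc ST)
      show "(*v) T ` ball 0 1 \<in> sets borel" by (rule linear_bij_borel[OF matrix_vector_mul_linear bT]) simp
    qed simp
    moreover have "(*v) S ` (*v) T ` ball 0 1 = ball 0 1" by (simp add: image_image matrix_vector_mul_assoc ST)
    ultimately show "?t \<noteq> 0" using b by auto
  qed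
  have E0: "emeasure lborel E \<noteq> 0"
  proof
    assume "emeasure lborel E = 0"
    then have "emeasure lborel ?C * ?t = 0" using em[of ?C] E by simp
    then show False using Cn t by simp
  qed
  show "sets (distr M borel (\<lambda>x. S *v (X x - c))) = sets unif_ball" by simp
  fix A assume "A \<in> sets (distr M borel (\<lambda>x. S *v (X x - c)))"
  then have A: "A \<in> sets borel" by simp
  have Ym: "(\<lambda>x. S *v (X x - c)) \<in> borel_measurable M"
    by (rule borel_measurable_continuous_on[OF continuous_on_matrix_vector]) measurable
  have AC: "?C \<inter> A \<in> sets borel" using A by (intro sets.Int) simp_all
  have "emeasure (distr M borel (\<lambda>x. S *v (X x - c))) A = emeasure M (X -` (?f ` A) \<inter> space M)"
    using A Ym by (subst emeasure_distr) (auto intro!: arg_cong2[of _ _ _ _ emeasure] simp: Sf image_iff matrix_vector_mul_assoc ST intro: fS[symmetric])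
  also have "\<dots> = emeasure (distr M lborel X) (?f ` A)"
    using fb[OF A] by (subst emeasure_distr) auto
  also have "\<dots> = (\<integral>\<^sup>+x. ennreal (indicator E x / measure lborel E) * indicator (?f ` A) x \<partial>lborel)"
    unfolding dX using fb[OF A] Eb by (subst emeasure_density) auto
  also have "\<dots> = (\<integral>\<^sup>+x. ennreal (1 / measure lborel E) * indicator (?f ` (?C \<inter> A)) x \<partial>lborel)"
  proof (intro nn_integral_cong)
    fix x
    have "?f ` (?C \<inter> A) = E \<inter> ?f ` A"
      unfolding E using bT by (subst image_Int) (auto simp: inj_def bij_def)
    then show "ennreal (indicator E x / measure lborel E) * indicator (?f ` A) x =
        ennreal (1 / measure lborel E) * indicator (?f ` (?C \<inter> A)) x"
      by (auto simp: indicator_def)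
  qed
  also have "\<dots> = ennreal (1 / measure lborel E) * emeasure lborel (?f ` (?C \<inter> A))"
    using fb[OF AC] by (subst nn_integral_cmult) auto
  also have "ennreal (1 / measure lborel E) = 1 / emeasure lborel E"
  proof -
    have "emeasure lborel E = ennreal (measure lborel E)" using Ef by (simp add: emeasure_eq_ennreal_measure)
    moreover have "measure lborel E > 0" using E0 Ef by (simp add: measure_def enn2real_positive_iff less_top zero_less_iff_neq_zero)
    ultimately show ?thesis by (metis divide_ennreal ennreal_1 zero_le_one)
  qed
  also have "1 / emeasure lborel E * emeasure lborel (?f ` (?C \<inter> A)) = emeasure unif_ball A"
  proof -
    let ?e = "emeasure lborel E" and ?a = "emeasure lborel (?f ` (?C \<inter> A))" and ?v = "emeasure lborel ?C" and ?w = "emeasure lborel (?C \<inter> A)"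
    have 1: "?e * ?b = ?v * ?t" unfolding E by (rule em) simp
    have 2: "?a * ?b = ?w * ?t" by (rule em[OF AC])
    have U: "emeasure unif_ball A = ?w / ?v"
      unfolding unif_ball_def using A by (subst emeasure_uniform_measure) auto
    have wf: "?w \<noteq> \<infinity>" using Cn(2) emeasure_mono[of "?C \<inter> A" ?C lborel] by (auto simp: top_unique)
    have "?w * ?t \<noteq> \<infinity>" using wf t by (simp add: ennreal_mult_eq_top_iff)
    then have af: "?a \<noteq> \<infinity>" unfolding 2[symmetric] using b by (metis ennreal_mult_eq_top_iff infinity_ennreal_def)
    have R1: "enn2real ?e * enn2real ?b = enn2real ?v * enn2real ?t" using 1 by (metis enn2real_mult)
    have R2: "enn2real ?a * enn2real ?b = enn2real ?w * enn2real ?t" using 2 by (metis enn2real_mult)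
    have pos: "enn2real ?e > 0" "enn2real ?b > 0" "enn2real ?v > 0" "enn2real ?t > 0"
      using E0 Ef b Cn t by (auto simp: enn2real_positive_iff less_top zero_less_iff_neq_zero)
    have "enn2real ?a / enn2real ?e = (enn2real ?a * enn2real ?b) / (enn2real ?e * enn2real ?b)" using pos by simp
    also have "\<dots> = enn2real ?w / enn2real ?v" unfolding R1 R2 using pos by simp
    finally have R: "enn2real ?a / enn2real ?e = enn2real ?w / enn2real ?v" .
    have dv: "x / y = ennreal (enn2real x / enn2real y)" if "x \<noteq> \<infinity>" "y \<noteq> \<infinity>" "enn2real y > 0" for x y :: ennreal
      using that by (cases x; cases y) (auto simp: divide_ennreal)
    have "1 / ?e * ?a = ?a * (1 / ?e)" by (rule mult.commute)
    also have "\<dots> = ?a * 1 / ?e" by (rule ennreal_times_divide)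
    also have "\<dots> = ?w / ?v" unfolding mult_1_right dv[OF af Ef pos(1)] dv[OF wf Cn(2) pos(3)] R ..
    finally show ?thesis unfolding U .
  qed
  finally show "emeasure (distr M borel (\<lambda>x. S *v (X x - c))) A = emeasure unif_ball A" .
qed

section \<open>The identity between the constants\<close>

text \<open>\<open>fact m\<close> times the binomial coefficient in \<open>simplex_factor\<close> is
  \<open>pochhammer (c + b + k * m) m\<close>, exactly the factor by which the two denominators with
  base \<open>c + b\<close> differ. The powers of 2 cancel, and of the \<open>k + 1\<close> factors
  \<open>pochhammer c m\<close> below one cancels against the one above.\<close>

lemma moment_identity:
  fixes n k m :: nat
  assumes n: "n > 0" and k: "k > 0" "k \<le> n"
  defines "c \<equiv> real n / 2 + 1" and "b \<equiv> real k * real n / 2"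
  shows "pochhammer c m * pochhammer b (k * m) / pochhammer (c + b) (m + k * m) *
      (simplex_factor n k m * gram_moment n k m) =
    pochhammer b (k * m) / pochhammer (c + b) (k * m) *
      (\<Prod>i=1..k. pochhammer ((real n - real k + real i) / 2) m / pochhammer c m)"
proof -
  have pos: "c > 0" "b > 0" using n k by (auto simp: c_def b_def)
  let ?P = "\<Prod>i=1..k. pochhammer ((real n - real k + real i) / 2) m"
  have g: "gram_moment n k m = (2 ^ m) ^ k * ?P"
  proof -
    have "(\<Prod>i<k. pochhammer ((real n - real i) / 2) m) = ?P"
      by (rule prod.reindex_bij_witness[of _ "\<lambda>i. k - i" "\<lambda>i. k - i"]) (auto simp: of_nat_diff)
    then show ?thesis by (simp add: gram_moment_def prod.distrib)
  qed
  let ?x = "real (Suc k) * (real n / 2 + real m)"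
  have "fact m * (?x gchoose m) = pochhammer (?x - real m + 1) m" by (simp add: gbinomial_pochhammer')
  also have "?x - real m + 1 = c + b + real (k * m)" by (simp add: c_def b_def algebra_simps add_divide_distrib)
  finally have s: "simplex_factor n k m = (1 / (2 ^ m * pochhammer c m)) ^ Suc k * (2 ^ m * pochhammer (c + b + real (k * m)) m)"
    unfolding simplex_factor_def c_def by simp
  have p: "pochhammer (c + b) (m + k * m) = pochhammer (c + b) (k * m) * pochhammer (c + b + real (k * m)) m"
    using pochhammer_product[of "k * m" "m + k * m" "c + b"] by simp
  have d: "(\<Prod>i=1..k. pochhammer ((real n - real k + real i) / 2) m / pochhammer c m) = ?P / pochhammer c m ^ k"
    by (simp add: prod_dividef)
  have nz: "pochhammer c m \<noteq> 0" "pochhammer (c + b) (k * m) \<noteq> 0" "pochhammer (c + b + real (k * m)) m \<noteq> 0" "(2::real) ^ m \<noteq> 0"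
    using pos pochhammer_pos[of c m] pochhammer_pos[of "c + b" "k * m"] pochhammer_pos[of "c + b + real (k * m)" m]
    by (auto simp: add_pos_nonneg)
  have alg: "u * v / (y * z) * ((1 / (t * u)) ^ Suc k * (t * z) * (t ^ k * P)) = v / y * (P / u ^ k)"
    if "u \<noteq> 0" "y \<noteq> 0" "z \<noteq> 0" "t \<noteq> 0" for u v y z t P :: real
    using that by (simp add: power_divide power_mult_distrib)
  show ?thesis unfolding g s p d by (rule alg) (use nz in auto)
qed

section \<open>Laws of the Gaussian matrix, the random projection and the vertices\<close>

lemma (in prob_space) gaussian_entries_law:
  fixes G :: "'a \<Rightarrow> real^'k::finite^'n::finite"
  assumes d: "\<And>i j. distributed M lborel (\<lambda>\<omega>. G \<omega> $ i $ j) (\<lambda>t. ennreal (std_normal_density t))"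
    and ind: "indep_vars (\<lambda>_. borel) (\<lambda>(i, j) \<omega>. G \<omega> $ i $ j) UNIV"
  shows "G \<in> borel_measurable M" "distr M borel G = gauss_matrix"
proof -
  let ?V = "\<lambda>(i :: 'n, j :: 'k) \<omega>. G \<omega> $ i $ j"
  have rv: "(\<lambda>\<omega>. G \<omega> $ i $ j) \<in> borel_measurable M" for i j using d[of i j] by (simp add: distributed_def)
  have eG: "(\<lambda>\<omega>. \<chi> i j. G \<omega> $ i $ j) = G" by (simp add: fun_eq_iff vec_eq_iff)
  have "(\<lambda>\<omega>. \<chi> i j. G \<omega> $ i $ j) \<in> borel_measurable M" by (intro measurable_vec_lambda rv)
  then show "G \<in> borel_measurable M" unfolding eG .
  have Vm: "random_variable borel (?V p)" for p by (cases p) (simp add: rv)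
  have dV: "distr M borel (?V p) = std_normal" for p
  proof -
    have "distr M borel (\<lambda>\<omega>. G \<omega> $ fst p $ snd p) = distr M lborel (\<lambda>\<omega>. G \<omega> $ fst p $ snd p)"
      by (rule distr_cong) simp_all
    then show ?thesis using d[of "fst p" "snd p"] by (simp add: distributed_def case_prod_unfold)
  qed
  have "distr M (\<Pi>\<^sub>M p\<in>(UNIV :: ('n \<times> 'k) set). borel) (\<lambda>\<omega>. \<lambda>p\<in>UNIV. ?V p \<omega>) = (\<Pi>\<^sub>M p\<in>(UNIV :: ('n \<times> 'k) set). distr M borel (?V p))"
    using ind by (subst (asm) indep_vars_iff_distr_eq_PiM') (use Vm in auto)
  then have J: "distr M (\<Pi>\<^sub>M p\<in>(UNIV :: ('n \<times> 'k) set). borel) (\<lambda>\<omega> p. ?V p \<omega>) = (\<Pi>\<^sub>M p\<in>(UNIV :: ('n \<times> 'k) set). std_normal)"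
    unfolding dV restrict_UNIV .
  have rs: "(\<lambda>f. \<chi> i j. f (i, j)) \<in> measurable (\<Pi>\<^sub>M p\<in>(UNIV :: ('n \<times> 'k) set). borel) (borel :: (real^'k^'n) measure)"
    by (intro measurable_vec_lambda) measurable
  have Jm: "(\<lambda>\<omega> p. ?V p \<omega>) \<in> measurable M (\<Pi>\<^sub>M p\<in>(UNIV :: ('n \<times> 'k) set). borel)"
    using measurable_restrict[of UNIV ?V M "\<lambda>_. borel", OF Vm] unfolding restrict_UNIV .
  have "gauss_matrix = distr M borel ((\<lambda>f. \<chi> i j. f (i, j)) \<circ> (\<lambda>\<omega> p. ?V p \<omega>))"
    using distr_distr[OF rs Jm] unfolding J gauss_matrix_entries[symmetric] .
  then show "distr M borel G = gauss_matrix" by (simp add: o_def eG)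
qed

lemma orthogonal_projection_rotated:
  fixes Q :: "real^'n^'n" and L :: "(real^'n) set"
  assumes Q: "orthogonal_matrix Q" and L: "subspace L" "dim L = CARD('k::finite)"
  shows "(*v) Q ` L \<in> grassmannian CARD('k)"
    and "matrix (orthogonal_projection ((*v) Q ` L)) = Q ** matrix (orthogonal_projection L) ** transpose Q"
proof -
  obtain A :: "real^'k^'n" where A: "frame A" "range ((*v) A) = L" using frame_exists[OF L] by blast
  have fQ: "frame Q" using Q by (simp add: frame_def orthogonal_matrix)
  have QA: "frame (Q ** A)" using A(1) frame_mult_left[OF fQ, of A A] by (simp add: frame_def)
  have r: "(*v) Q ` L = range ((*v) (Q ** A))" using A(2) by (auto simp: matrix_vector_mul_assoc[symmetric])
  have "inj ((*v) Q)" by (metis fQ frame_transpose_cancel injI)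
  then have "dim ((*v) Q ` L) = CARD('k)"
    using dim_image_eq[OF matrix_vector_mul_linear, of Q L] L(2) inj_on_subset[OF _ subset_UNIV] by metis
  then show "(*v) Q ` L \<in> grassmannian CARD('k)"
    unfolding grassmannian_def using linear_subspace_image[OF matrix_vector_mul_linear L(1), of Q] by simp
  show "matrix (orthogonal_projection ((*v) Q ` L)) = Q ** matrix (orthogonal_projection L) ** transpose Q"
    unfolding r matrix_orthogonal_projection_frame[OF QA]
    unfolding A(2)[symmetric] matrix_orthogonal_projection_frame[OF A(1)]
    by (simp add: matrix_transpose_mul matrix_mul_assoc)
qed

text \<open>Passes from a uniform random subspace to its projection matrix \<open>p\<close>.
  Measurability of \<open>p\<close> is built into the Borel structure of the Grassmannian, and
  rotating a subspace conjugates its projection.\<close>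

lemma uniform_random_projection:
  fixes \<xi> :: "'w \<Rightarrow> (real^'n::finite) set"
  assumes M: "prob_space M" and \<xi>: "uniform_random_subspace M CARD('k::finite) \<xi>"
  defines "p \<equiv> \<lambda>L :: (real^'n) set. matrix (orthogonal_projection L)"
  shows "p \<in> measurable (grassmannian_borel CARD('k)) borel"
    and "\<xi> \<in> measurable M (grassmannian_borel CARD('k))"
    and "\<And>\<omega>. \<omega> \<in> space M \<Longrightarrow> \<xi> \<omega> \<in> grassmannian CARD('k)"
    and "\<And>L. L \<in> grassmannian CARD('k) \<Longrightarrow> p L \<in> frame_projections TYPE('k)"
    and "\<And>Q. rotation_matrix Q \<Longrightarrow>
      distr (distr M borel (\<lambda>\<omega>. p (\<xi> \<omega>))) borel (\<lambda>P. Q ** P ** transpose Q) = distr M borel (\<lambda>\<omega>. p (\<xi> \<omega>))"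
proof -
  let ?g = "grassmannian_borel CARD('k) :: (real^'n) set measure"
  let ?\<nu> = "distr M ?g \<xi>"
  have sg: "space ?g = grassmannian CARD('k)" by (simp add: grassmannian_borel_def)
  show pm: "p \<in> measurable ?g borel"
    unfolding grassmannian_borel_def p_def by (rule measurable_vimage_algebra1) simp
  show xm: "\<xi> \<in> measurable M ?g" using \<xi> unfolding uniform_random_subspace_def by blast
  show "\<xi> \<omega> \<in> grassmannian CARD('k)" if "\<omega> \<in> space M" for \<omega>
    using measurable_space[OF xm that] sg by simp
  show "p L \<in> frame_projections TYPE('k)" if L: "L \<in> grassmannian CARD('k)" for L
  proof -
    obtain A :: "real^'k^'n" where A: "frame A" "range ((*v) A) = L"
      using L frame_exists unfolding grassmannian_def by blast
    then show ?thesis using matrix_orthogonal_projection_frame[OF A(1)] unfolding p_def frame_projections_def by blast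
  qed
  fix Q :: "real^'n^'n" assume Q: "rotation_matrix Q"
  then have oQ: "orthogonal_matrix Q" by (simp add: rotation_matrix_def)
  have rot: "(*v) Q ` L \<in> grassmannian CARD('k)" "p ((*v) Q ` L) = Q ** p L ** transpose Q"
    if "L \<in> space ?\<nu>" for L
    using that orthogonal_projection_rotated[OF oQ, where 'k='k, of L] sg by (auto simp: grassmannian_def p_def)
  have cm: "(\<lambda>P. Q ** P ** transpose Q) \<in> borel_measurable borel" by measurable
  have pn: "p \<in> measurable ?\<nu> borel" using pm by simp
  have qm: "(\<lambda>L. p ((*v) Q ` L)) \<in> measurable ?\<nu> borel"
    by (subst measurable_cong[OF rot(2)]) (use measurable_compose[OF pn cm] in auto)
  \<comment> \<open>Rotation of subspaces is measurable because followed by \<open>p\<close> it is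
    conjugation applied to \<open>p L\<close>.\<close>
  have rm: "(\<lambda>L. (*v) Q ` L) \<in> measurable ?\<nu> ?g"
    unfolding grassmannian_borel_def
    by (rule measurable_vimage_algebra2) (use rot(1) qm in \<open>auto simp: p_def grassmannian_borel_def\<close>)
  have inv: "distr ?\<nu> ?g (\<lambda>L. (*v) Q ` L) = ?\<nu>"
    using \<xi> Q unfolding uniform_random_subspace_def rotation_invariant_prob_def by blast
  have e: "distr M borel (\<lambda>\<omega>. p (\<xi> \<omega>)) = distr ?\<nu> borel p"
    using distr_distr[OF pm xm] by (simp add: o_def)
  have "distr (distr ?\<nu> borel p) borel (\<lambda>P. Q ** P ** transpose Q) = distr ?\<nu> borel (\<lambda>L. Q ** p L ** transpose Q)"
    using distr_distr[OF cm pn] by (simp add: o_def)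
  also have "\<dots> = distr ?\<nu> borel (\<lambda>L. p ((*v) Q ` L))"
    by (rule distr_cong) (simp_all add: rot(2))
  also have "\<dots> = distr (distr ?\<nu> ?g (\<lambda>L. (*v) Q ` L)) borel p"
    using distr_distr[OF pm rm] by (simp add: o_def)
  also have "\<dots> = distr ?\<nu> borel p" unfolding inv ..
  finally show "distr (distr M borel (\<lambda>\<omega>. p (\<xi> \<omega>))) borel (\<lambda>P. Q ** P ** transpose Q) = distr M borel (\<lambda>\<omega>. p (\<xi> \<omega>))"
    unfolding e .
qed

lemma simplex_gram_bounded:
  fixes L :: "real^'n::finite^'n"
  shows "\<exists>B. \<forall>x :: 'k::finite option \<Rightarrow> real^'n. (\<forall>i. norm (x i) \<le> 1) \<longrightarrow> \<bar>gram (L ** edge_matrix x)\<bar> \<le> B"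
proof -
  obtain C N where CN: "\<And>x :: 'k option \<Rightarrow> real^'n. \<bar>gram (L ** edge_matrix x) ^ 1\<bar> \<le> C * (\<Prod>i\<in>UNIV. (1 + norm (x i)) ^ N)"
    using separately_polynomial_simplex[where 'k='k and L=L and s=1] unfolding separately_polynomial_def by blast
  have "\<bar>gram (L ** edge_matrix x)\<bar> \<le> \<bar>C\<bar> * (2 ^ N) ^ CARD('k option)"
    if x: "\<forall>i. norm (x i) \<le> 1" for x :: "'k option \<Rightarrow> real^'n"
  proof -
    have p: "(\<Prod>i\<in>UNIV. (1 + norm (x i)) ^ N) \<le> (\<Prod>i\<in>(UNIV :: 'k option set). 2 ^ N)"
    proof (rule prod_mono)
      fix i :: "'k option"
      have "1 + norm (x i) \<le> 2" using x by (auto simp: add.commute)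
      then show "0 \<le> (1 + norm (x i)) ^ N \<and> (1 + norm (x i)) ^ N \<le> 2 ^ N" by (auto intro!: power_mono)
    qed
    have "\<bar>gram (L ** edge_matrix x)\<bar> \<le> C * (\<Prod>i\<in>UNIV. (1 + norm (x i)) ^ N)" using CN[of x] by simp
    also have "\<dots> \<le> \<bar>C\<bar> * (\<Prod>i\<in>UNIV. (1 + norm (x i)) ^ N)"
      by (intro mult_right_mono prod_nonneg) auto
    also have "\<dots> \<le> \<bar>C\<bar> * (\<Prod>i\<in>(UNIV :: 'k option set). 2 ^ N)" by (rule mult_left_mono[OF p]) simp
    finally show ?thesis by simp
  qed
  then show ?thesis by blast
qed

lemma compressed_det_bounded:
  fixes W :: "real^'n^'n"
  shows "\<exists>B. \<forall>P\<in>frame_projections TYPE('k::finite). \<bar>compressed_det TYPE('k) W P\<bar> \<le> B"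
proof -
  have "bounded (compressed_det TYPE('k) W ` frame_projections TYPE('k))"
    by (intro compact_imp_bounded compact_continuous_image continuous_on_compressed_det compact_frame_projections)
  then show ?thesis unfolding bounded_iff by auto
qed

lemma measurable_generated:
  assumes "i \<in> I" and "X i \<in> space M \<rightarrow> space N"
  shows "X i \<in> measurable (sigma (space M) (\<Union>i\<in>I. generated_events M N (X i))) N"
proof (rule measurableI)
  have s: "(\<Union>i\<in>I. generated_events M N (X i)) \<subseteq> Pow (space M)" by (auto simp: generated_events_def)
  show "X i x \<in> space N" if "x \<in> space (sigma (space M) (\<Union>i\<in>I. generated_events M N (X i)))" for x
    using that assms(2) by (auto simp: space_measure_of_conv)
  fix A assume A: "A \<in> sets N"
  have "X i -` A \<inter> space M \<in> (\<Union>i\<in>I. generated_events M N (X i))"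
    using A assms(1) unfolding generated_events_def by blast
  then show "X i -` A \<inter> space (sigma (space M) (\<Union>i\<in>I. generated_events M N (X i))) \<in> sets (sigma (space M) (\<Union>i\<in>I. generated_events M N (X i)))"
    unfolding sets_measure_of[OF s] space_measure_of_conv by (rule sigma_sets.Basic)
qed

text \<open>Independence makes the joint law of the vertices a product; \<beta> relabels the numbers
  0, ..., k by the index type of the vertices.\<close>

lemma (in prob_space) simplex_law:
  fixes X :: "nat \<Rightarrow> 'a \<Rightarrow> real^'n::finite" and \<beta> :: "'k::finite option \<Rightarrow> nat"
  assumes ind: "indep_sets (\<lambda>i. generated_events M borel (X i)) {..k}" and \<beta>: "bij_betw \<beta> UNIV {..k}"
    and X: "\<And>i. i \<le> k \<Longrightarrow> X i \<in> borel_measurable M" and h: "h \<in> borel_measurable borel"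
    and law: "\<And>i. i \<le> k \<Longrightarrow> distr M borel (\<lambda>\<omega>. h (X i \<omega>)) = N"
  shows "(\<lambda>\<omega> i. h (X (\<beta> i) \<omega>)) \<in> measurable M (\<Pi>\<^sub>M i\<in>UNIV. borel)"
    and "distr M (\<Pi>\<^sub>M i\<in>UNIV. borel) (\<lambda>\<omega> i. h (X (\<beta> i) \<omega>)) = (\<Pi>\<^sub>M i\<in>UNIV. (N :: (real^'n) measure))"
proof -
  have bk: "\<beta> i \<le> k" for i using bij_betwE[OF \<beta>] by auto
  have rv: "random_variable borel (\<lambda>\<omega>. h (X (\<beta> i) \<omega>))" for i
    by (rule measurable_compose[OF X[OF bk] h])
  have "indep_sets (\<lambda>i. generated_events M borel (X (\<beta> i))) UNIV"
    by (rule indep_sets_reindex[where F="\<lambda>i. generated_events M borel (X i)" and f=\<beta>])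
       (use \<beta> ind in \<open>auto simp: bij_betw_def\<close>)
  then have "indep_vars (\<lambda>_. borel) (\<lambda>i \<omega>. h (X (\<beta> i) \<omega>)) UNIV"
    by (rule indep_vars_of_generated_events) (use rv generated_events_compose[OF h X[OF bk]] in auto)
  then have J: "distr M (\<Pi>\<^sub>M i\<in>UNIV. borel) (\<lambda>\<omega>. \<lambda>i\<in>UNIV. h (X (\<beta> i) \<omega>)) = (\<Pi>\<^sub>M i\<in>UNIV. distr M borel (\<lambda>\<omega>. h (X (\<beta> i) \<omega>)))"
    by (subst (asm) indep_vars_iff_distr_eq_PiM') (use rv in auto)
  show "distr M (\<Pi>\<^sub>M i\<in>UNIV. borel) (\<lambda>\<omega> i. h (X (\<beta> i) \<omega>)) = (\<Pi>\<^sub>M i\<in>UNIV. N)"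
    using J unfolding restrict_UNIV law[OF bk] .
  show "(\<lambda>\<omega> i. h (X (\<beta> i) \<omega>)) \<in> measurable M (\<Pi>\<^sub>M i\<in>UNIV. borel)"
    using measurable_restrict[of UNIV "\<lambda>i \<omega>. h (X (\<beta> i) \<omega>)" M "\<lambda>_. borel", OF rv] unfolding restrict_UNIV .
qed

section \<open>Measurability, bounds and moments of the three variables\<close>

text \<open>Collects what the moment method asks of the second and the third variable, where
  \<open>Q\<close> is the geometric factor.\<close>

lemma (in prob_space) beta_product_variable:
  fixes k :: nat and Q \<eta>' :: "'a \<Rightarrow> real" and \<eta>s :: "nat \<Rightarrow> 'a \<Rightarrow> real" and a b B :: real
  assumes ind: "independent_list M (F # generated_events M borel \<eta>' # map (\<lambda>i. generated_events M borel (\<eta>s i)) [1..<Suc k])"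
    and Q: "Q \<in> borel_measurable M" and QF: "generated_events M borel Q \<subseteq> F" and Qb: "AE x in M. \<bar>Q x\<bar> \<le> B"
    and e: "beta_distributed M \<eta>' a b" "a > 0" "b > 0"
    and s: "\<And>i. i \<in> {1..k} \<Longrightarrow> beta_distributed M (\<eta>s i) (as i) (bs i)"
      "\<And>i. i \<in> {1..k} \<Longrightarrow> as i > 0" "\<And>i. i \<in> {1..k} \<Longrightarrow> bs i > 0"
  shows "(\<lambda>x. (1 - \<eta>' x) ^ k * (\<Prod>i=1..k. \<eta>s i x) * Q x) \<in> borel_measurable M"
    and "AE x in M. \<bar>(1 - \<eta>' x) ^ k * (\<Prod>i=1..k. \<eta>s i x) * Q x\<bar> \<le> B"
    and "expectation (\<lambda>x. ((1 - \<eta>' x) ^ k * (\<Prod>i=1..k. \<eta>s i x) * Q x) ^ m) =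
      pochhammer b (k * m) / pochhammer (a + b) (k * m) *
      (\<Prod>i=1..k. pochhammer (as i) m / pochhammer (as i + bs i) m) * expectation (\<lambda>x. Q x ^ m)"
proof -
  have em: "\<eta>' \<in> borel_measurable M" using e(1) by (simp add: beta_distributed_def distributed_def)
  have sm: "\<eta>s i \<in> borel_measurable M" if "i \<in> {1..k}" for i
    using s(1)[OF that] by (simp add: beta_distributed_def distributed_def)
  note eb = beta_distributed_AE[OF e(1)] and sb = beta_distributed_AE[OF s(1)]
  show "(\<lambda>x. (1 - \<eta>' x) ^ k * (\<Prod>i=1..k. \<eta>s i x) * Q x) \<in> borel_measurable M"
    by (intro borel_measurable_times borel_measurable_power borel_measurable_diff borel_measurable_const borel_measurable_prod em sm Q)
  have "AE x in M. \<forall>i\<in>{1..k}. 0 < \<eta>s i x \<and> \<eta>s i x < 1"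
    by (intro AE_finite_allI sb) simp_all
  with eb Qb show "AE x in M. \<bar>(1 - \<eta>' x) ^ k * (\<Prod>i=1..k. \<eta>s i x) * Q x\<bar> \<le> B"
  proof eventually_elim
    case (elim x)
    have 1: "\<bar>(1 - \<eta>' x) ^ k\<bar> \<le> 1" using elim(1) by (auto simp: power_abs intro!: power_le_one)
    have 2: "\<bar>\<Prod>i=1..k. \<eta>s i x\<bar> \<le> 1" unfolding abs_prod
    proof (rule prod_le_1)
      fix i assume "i \<in> {1..k}"
      then have "0 < \<eta>s i x \<and> \<eta>s i x < 1" using elim(3) by blast
      then show "0 \<le> \<bar>\<eta>s i x\<bar> \<and> \<bar>\<eta>s i x\<bar> \<le> 1" by simp
    qed
    have "\<bar>(1 - \<eta>' x) ^ k\<bar> * \<bar>\<Prod>i=1..k. \<eta>s i x\<bar> * \<bar>Q x\<bar> \<le> 1 * \<bar>Q x\<bar>"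
      by (intro mult_right_mono mult_le_one 1 2) auto
    then show ?case using elim(2) by (simp add: abs_mult)
  qed
  have "expectation (\<lambda>x. ((1 - \<eta>' x) ^ k * (\<Prod>i=1..k. \<eta>s i x) * Q x) ^ m) =
    expectation (\<lambda>x. (1 - \<eta>' x) ^ (k * m)) * (\<Prod>i=1..k. expectation (\<lambda>x. \<eta>s i x ^ m)) * expectation (\<lambda>x. Q x ^ m)"
    by (rule beta_product_moment[OF ind Q QF Qb em eb sm sb])
  also have "expectation (\<lambda>x. (1 - \<eta>' x) ^ (k * m)) = pochhammer b (k * m) / pochhammer (a + b) (k * m)"
    using beta_distributed_moment[OF e, of 0 "k * m"] by simp
  also have "(\<Prod>i=1..k. expectation (\<lambda>x. \<eta>s i x ^ m)) = (\<Prod>i=1..k. pochhammer (as i) m / pochhammer (as i + bs i) m)"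
  proof (rule prod.cong[OF refl])
    fix i assume i: "i \<in> {1..k}"
    show "expectation (\<lambda>x. \<eta>s i x ^ m) = pochhammer (as i) m / pochhammer (as i + bs i) m"
      using beta_distributed_moment[OF s(1)[OF i] s(2)[OF i] s(3)[OF i], of m 0] by simp
  qed
  finally show "expectation (\<lambda>x. ((1 - \<eta>' x) ^ k * (\<Prod>i=1..k. \<eta>s i x) * Q x) ^ m) =
      pochhammer b (k * m) / pochhammer (a + b) (k * m) *
      (\<Prod>i=1..k. pochhammer (as i) m / pochhammer (as i + bs i) m) * expectation (\<lambda>x. Q x ^ m)" .
qed

lemma edge_matrix_affine:
  fixes T :: "real^'n^'m"
  shows "edge_matrix (\<lambda>i. c + T *v y i) = T ** edge_matrix y"
  unfolding edge_matrix_def vec_eq_iff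
  by (simp add: matrix_vector_mult_def matrix_matrix_mult_def right_diff_distrib sum_subtractf)

lemma diag_matrix_inverse:
  assumes "\<And>i. l $ i \<noteq> 0"
  shows "diag_matrix l ** diag_matrix (\<chi> i. 1 / l $ i) = mat 1"
    and "diag_matrix (\<chi> i. 1 / l $ i) ** diag_matrix l = mat 1"
  unfolding vec_eq_iff diag_matrix_mult using assms by (simp_all add: diag_matrix_def mat_def)

text \<open>The counterpart for the first variable: \<open>h\<close> will be the affine map that
  makes the points uniform in the ball, and \<open>L\<close> the diagonal matrix of
  semi-axes.\<close>

lemma (in prob_space) ball_simplex_variable:
  fixes X :: "nat \<Rightarrow> 'a \<Rightarrow> real^'n::finite" and \<beta> :: "'k::finite option \<Rightarrow> nat" and L :: "real^'n^'n"
    and \<eta> :: "'a \<Rightarrow> real" and h :: "real^'n \<Rightarrow> real^'n" and a b :: real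
  defines "Q \<equiv> \<lambda>\<omega>. gram (L ** edge_matrix (\<lambda>i. h (X (\<beta> i) \<omega>)))"
  assumes \<beta>: "bij_betw \<beta> UNIV {..k}"
    and ind: "independent_list M (map (\<lambda>i. generated_events M borel (X i)) [0..<Suc k] @ [generated_events M borel \<eta>])"
    and X: "\<And>i. i \<in> {..k} \<Longrightarrow> X i \<in> borel_measurable M" and h: "h \<in> borel_measurable borel"
    and law: "\<And>i. i \<in> {..k} \<Longrightarrow> distr M borel (\<lambda>\<omega>. h (X i \<omega>)) = unif_ball"
    and e: "beta_distributed M \<eta> a b" "a > 0" "b > 0"
  shows "(\<lambda>\<omega>. \<eta> \<omega> * (1 - \<eta> \<omega>) ^ k * Q \<omega>) \<in> borel_measurable M"
    and "\<exists>B. AE \<omega> in M. \<bar>\<eta> \<omega> * (1 - \<eta> \<omega>) ^ k * Q \<omega>\<bar> \<le> B"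
    and "expectation (\<lambda>\<omega>. (\<eta> \<omega> * (1 - \<eta> \<omega>) ^ k * Q \<omega>) ^ m) =
      pochhammer a m * pochhammer b (k * m) / pochhammer (a + b) (m + k * m) *
      (simplex_factor CARD('n) CARD('k) m * (\<integral>G. gram (L ** G) ^ m \<partial>(gauss_matrix :: (real^'k^'n) measure)))"
proof -
  have bk: "\<beta> i \<in> {..k}" for i using bij_betwE[OF \<beta>] by auto
  have em[measurable]: "\<eta> \<in> borel_measurable M" using e(1) by (simp add: beta_distributed_def distributed_def)
  note eb = beta_distributed_AE[OF e(1)]
  let ?F = "\<lambda>x :: 'k option \<Rightarrow> real^'n. gram (L ** edge_matrix x)"
  have Fm: "(\<lambda>x. ?F x ^ s) \<in> borel_measurable (\<Pi>\<^sub>M i\<in>UNIV. borel)" for s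
    using separately_polynomial_simplex[where 'k='k and L=L and s=s] unfolding separately_polynomial_def by blast
  have Xb: "AE \<omega> in M. norm (h (X i \<omega>)) \<le> 1" if i: "i \<in> {..k}" for i
  proof -
    have "AE x in distr M borel (\<lambda>\<omega>. h (X i \<omega>)). norm x \<le> 1" unfolding law[OF i] by (rule AE_unif_ball)
    then show ?thesis using AE_distrD[OF measurable_compose[OF X[OF i] h]] by blast
  qed
  obtain B where B: "\<And>x :: 'k option \<Rightarrow> real^'n. (\<forall>i. norm (x i) \<le> 1) \<Longrightarrow> \<bar>?F x\<bar> \<le> B"
    using simplex_gram_bounded by blast
  have "AE \<omega> in M. \<forall>i\<in>(UNIV :: 'k option set). norm (h (X (\<beta> i) \<omega>)) \<le> 1"
    by (intro AE_finite_allI Xb bk) simp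
  then have Qb: "AE \<omega> in M. \<bar>Q \<omega>\<bar> \<le> B"
    by eventually_elim (auto simp: Q_def intro: B)
  have len: "length (map (\<lambda>i. generated_events M borel (X i)) [0..<Suc k] @ [generated_events M borel \<eta>]) = Suc (Suc k)" by simp
  have "indep_sets (\<lambda>i. (map (\<lambda>i. generated_events M borel (X i)) [0..<Suc k] @ [generated_events M borel \<eta>]) ! i) {..k}"
    using ind unfolding independent_list_def len by (rule indep_sets_mono_index[rotated]) auto
  then have iX: "indep_sets (\<lambda>i. generated_events M borel (X i)) {..k}"
    by (subst (asm) indep_sets_cong[where G="\<lambda>i. generated_events M borel (X i)" and J="{..k}"])
       (auto simp: nth_append simp del: upt_Suc)
  have Xm: "X i \<in> borel_measurable M" and Xl: "distr M borel (\<lambda>\<omega>. h (X i \<omega>)) = unif_ball" if "i \<le> k" for i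
    using X[of i] law[of i] that by simp_all
  have J: "(\<lambda>\<omega> i. h (X (\<beta> i) \<omega>)) \<in> measurable M (\<Pi>\<^sub>M i\<in>UNIV. borel)"
    "distr M (\<Pi>\<^sub>M i\<in>UNIV. borel) (\<lambda>\<omega> i. h (X (\<beta> i) \<omega>)) = (\<Pi>\<^sub>M i\<in>UNIV. (unif_ball :: (real^'n) measure))"
    by (rule simplex_law[OF iX \<beta> Xm h Xl], assumption+)+
  \<comment> \<open>To be grouped apart from \<eta>, the Gram determinant has to be measurable with
    respect to the \<sigma>-algebra generated by the points alone.\<close>
  let ?S = "sigma (space M) (\<Union>i\<in>{..k}. generated_events M borel (X i))"
  have "(\<lambda>\<omega>. h (X (\<beta> i) \<omega>)) \<in> borel_measurable ?S" for i
    by (rule measurable_compose[OF measurable_generated[OF bk] h]) simp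
  from measurable_restrict[of UNIV "\<lambda>i \<omega>. h (X (\<beta> i) \<omega>)" ?S "\<lambda>_. borel", OF this]
  have JS: "(\<lambda>\<omega> i. h (X (\<beta> i) \<omega>)) \<in> measurable ?S (\<Pi>\<^sub>M i\<in>UNIV. borel)" unfolding restrict_UNIV .
  have QS: "Q \<in> borel_measurable ?S"
    using measurable_compose[OF JS Fm[of 1]] by (simp add: Q_def)
  note g = grouped_product_moment[OF ind X QS Qb em eb]
  note Qm[measurable] = g(2)
  show "(\<lambda>\<omega>. \<eta> \<omega> * (1 - \<eta> \<omega>) ^ k * Q \<omega>) \<in> borel_measurable M" by measurable
  have "AE \<omega> in M. \<bar>\<eta> \<omega> * (1 - \<eta> \<omega>) ^ k * Q \<omega>\<bar> \<le> B"
    using eb Qb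
  proof eventually_elim
    case (elim x)
    have "\<bar>\<eta> x\<bar> * \<bar>(1 - \<eta> x) ^ k\<bar> * \<bar>Q x\<bar> \<le> 1 * \<bar>Q x\<bar>"
      using elim(1) by (intro mult_right_mono mult_le_one) (auto simp: power_abs intro!: power_le_one)
    then show ?case using elim(2) by (simp add: abs_mult)
  qed
  then show "\<exists>B. AE \<omega> in M. \<bar>\<eta> \<omega> * (1 - \<eta> \<omega>) ^ k * Q \<omega>\<bar> \<le> B" ..
  have "expectation (\<lambda>\<omega>. Q \<omega> ^ m) = (\<integral>x. ?F x ^ m \<partial>distr M (\<Pi>\<^sub>M i\<in>UNIV. borel) (\<lambda>\<omega> i. h (X (\<beta> i) \<omega>)))"
    unfolding Q_def by (rule integral_distr[OF J(1) Fm, symmetric])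
  also have "\<dots> = simplex_factor CARD('n) CARD('k) m * (\<integral>G. gram (L ** G) ^ m \<partial>(gauss_matrix :: (real^'k^'n) measure))"
    unfolding J(2) by (rule ball_simplex_moment)
  finally have Q: "expectation (\<lambda>\<omega>. Q \<omega> ^ m) =
    simplex_factor CARD('n) CARD('k) m * (\<integral>G. gram (L ** G) ^ m \<partial>(gauss_matrix :: (real^'k^'n) measure))" .
  show "expectation (\<lambda>\<omega>. (\<eta> \<omega> * (1 - \<eta> \<omega>) ^ k * Q \<omega>) ^ m) =
      pochhammer a m * pochhammer b (k * m) / pochhammer (a + b) (m + k * m) *
      (simplex_factor CARD('n) CARD('k) m * (\<integral>G. gram (L ** G) ^ m \<partial>(gauss_matrix :: (real^'k^'n) measure)))"
    using g(1)[of m] unfolding beta_distributed_moment[OF e] Q .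
qed

text \<open>In ball coordinates the edge matrix is multiplied by \<open>U ** diag_matrix l\<close>,
  and the orthogonal part \<open>U\<close> drops out of the Gram determinant.\<close>

lemma (in prob_space) ellipsoid_simplex_variable:
  fixes X :: "nat \<Rightarrow> 'a \<Rightarrow> real^'n::finite" and \<eta> :: "'a \<Rightarrow> real" and a b :: real
  defines "V \<equiv> \<lambda>\<omega>. (fact CARD('k::finite))\<^sup>2 * \<eta> \<omega> * (1 - \<eta> \<omega>) ^ CARD('k) *
      (k_volume TYPE('k) (convex hull ((\<lambda>i. X i \<omega>) ` {0..CARD('k)})))\<^sup>2"
  assumes kn: "CARD('k) \<le> CARD('n)" and E: "ellipsoid_with_semiaxes l E"
    and X: "\<And>i. i \<in> {0..CARD('k)} \<Longrightarrow> distributed M lborel (X i) (\<lambda>x. ennreal (indicator E x / measure lborel E))"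
    and ind: "independent_list M (map (\<lambda>i. generated_events M borel (X i)) [0..<Suc CARD('k)] @ [generated_events M borel \<eta>])"
    and e: "beta_distributed M \<eta> a b" "a > 0" "b > 0"
  shows "V \<in> borel_measurable M"
    and "\<exists>B. AE \<omega> in M. \<bar>V \<omega>\<bar> \<le> B"
    and "expectation (\<lambda>\<omega>. V \<omega> ^ m) =
      pochhammer a m * pochhammer b (CARD('k) * m) / pochhammer (a + b) (m + CARD('k) * m) *
      (simplex_factor CARD('n) CARD('k) m * (\<integral>G. gram (diag_matrix l ** G) ^ m \<partial>(gauss_matrix :: (real^'k^'n) measure)))"
proof -
  let ?k = "CARD('k)"
  have l: "l $ i \<noteq> 0" for i using E unfolding ellipsoid_with_semiaxes_def by (metis less_irrefl)
  obtain c :: "real^'n" and U :: "real^'n^'n" where U: "orthogonal_matrix U"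
    and Ei: "E = (\<lambda>z. c + (U ** diag_matrix l) *v z) ` cball 0 1"
    using ellipsoid_affine_image[OF E] by blast
  have fU: "frame U" using U by (simp add: frame_def orthogonal_matrix)
  define T where "T = U ** diag_matrix l"
  define S where "S = diag_matrix (\<chi> i. 1 / l $ i) ** transpose U"
  have UU: "U ** transpose U = mat 1" "transpose U ** U = mat 1" using U by (auto simp: orthogonal_matrix_def)
  have "S ** T = diag_matrix (\<chi> i. 1 / l $ i) ** (transpose U ** U) ** diag_matrix l"
    by (simp add: S_def T_def matrix_mul_assoc)
  then have ST: "S ** T = mat 1" by (simp add: UU diag_matrix_inverse[OF l])
  have "T ** S = U ** (diag_matrix l ** diag_matrix (\<chi> i. 1 / l $ i)) ** transpose U"
    by (simp add: S_def T_def matrix_mul_assoc)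
  then have TS: "T ** S = mat 1" by (simp add: UU diag_matrix_inverse[OF l])
  let ?h = "\<lambda>x. S *v (x - c)"
  have h: "?h \<in> borel_measurable borel"
    by (rule borel_measurable_continuous_on[OF continuous_on_matrix_vector]) measurable
  have "\<exists>\<beta> :: 'k option \<Rightarrow> nat. bij_betw \<beta> UNIV {..?k}" by (rule finite_same_card_bij) simp_all
  then obtain \<beta> :: "'k option \<Rightarrow> nat" where \<beta>: "bij_betw \<beta> UNIV {..?k}" by blast
  have Xm: "X i \<in> borel_measurable M" if "i \<in> {..?k}" for i using X[of i] that by (simp add: distributed_def)
  have law: "distr M borel (\<lambda>\<omega>. ?h (X i \<omega>)) = unif_ball" if "i \<in> {..?k}" for i
    using that uniform_affine_image_law[OF X Ei[folded T_def] ST TS, of i] by simp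
  have V: "V \<omega> = \<eta> \<omega> * (1 - \<eta> \<omega>) ^ ?k * gram (diag_matrix l ** edge_matrix (\<lambda>i. ?h (X (\<beta> i) \<omega>)))" for \<omega>
  proof -
    have r: "range (\<lambda>i. X (\<beta> i) \<omega>) = (\<lambda>i. X i \<omega>) ` {0..?k}"
      using \<beta> unfolding bij_betw_def image_image[symmetric, of "\<lambda>i. X i \<omega>" \<beta>] by (simp only: atLeast0AtMost)
    have "edge_matrix (\<lambda>i. X (\<beta> i) \<omega>) = edge_matrix (\<lambda>i. c + T *v ?h (X (\<beta> i) \<omega>))"
      by (simp add: matrix_vector_mul_assoc TS)
    also have "\<dots> = U ** (diag_matrix l ** edge_matrix (\<lambda>i. ?h (X (\<beta> i) \<omega>)))"
      unfolding edge_matrix_affine T_def by (simp add: matrix_mul_assoc)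
    finally have "gram (edge_matrix (\<lambda>i. X (\<beta> i) \<omega>)) = gram (diag_matrix l ** edge_matrix (\<lambda>i. ?h (X (\<beta> i) \<omega>)))"
      by (simp only: gram_frame_left[OF fU])
    then have "(fact ?k * k_volume TYPE('k) (convex hull ((\<lambda>i. X i \<omega>) ` {0..?k})))\<^sup>2 =
        gram (diag_matrix l ** edge_matrix (\<lambda>i. ?h (X (\<beta> i) \<omega>)))"
      using k_volume_simplex[OF kn, of "\<lambda>i. X (\<beta> i) \<omega>"] unfolding r by simp
    then show ?thesis unfolding V_def by (simp add: power_mult_distrib mult.assoc mult.left_commute)
  qed
  have Vf: "V = (\<lambda>\<omega>. \<eta> \<omega> * (1 - \<eta> \<omega>) ^ ?k * gram (diag_matrix l ** edge_matrix (\<lambda>i. ?h (X (\<beta> i) \<omega>))))"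
    using V by (rule ext)
  note v = ball_simplex_variable[OF \<beta> ind Xm h law e, of "diag_matrix l"]
  show "V \<in> borel_measurable M" unfolding Vf by (rule v(1))
  show "\<exists>B. AE \<omega> in M. \<bar>V \<omega>\<bar> \<le> B" unfolding Vf by (rule v(2))
  show "expectation (\<lambda>\<omega>. V \<omega> ^ m) =
      pochhammer a m * pochhammer b (?k * m) / pochhammer (a + b) (m + ?k * m) *
      (simplex_factor CARD('n) ?k m * (\<integral>G. gram (diag_matrix l ** G) ^ m \<partial>(gauss_matrix :: (real^'k^'n) measure)))"
    unfolding Vf by (rule v(3))
qed

text \<open>For \<open>gram G\<close> nonzero the ratio is the value of
  \<open>compressed_det\<close> at a projection, and that function is continuous on a compact
  set.\<close>

lemma gram_ratio_bounded:
  fixes L :: "real^'n::finite^'n"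
  assumes kn: "CARD('k::finite) \<le> CARD('n)"
  shows "\<exists>B. AE G in (gauss_matrix :: (real^'k^'n) measure). \<bar>gram (L ** G) / gram G\<bar> \<le> B"
proof -
  obtain B where B: "\<And>P :: real^'n^'n. P \<in> frame_projections TYPE('k) \<Longrightarrow> \<bar>compressed_det TYPE('k) (transpose L ** L) P\<bar> \<le> B"
    using compressed_det_bounded by blast
  have "\<bar>gram (L ** G) / gram G\<bar> \<le> B" if G: "gram G \<noteq> 0" for G :: "real^'k^'n"
  proof -
    obtain A :: "real^'k^'n" where A: "frame A"
      and dA: "\<And>W. det (transpose G ** W ** G) = gram G * det (transpose A ** W ** A)"
      using column_projection_frame[OF G] by blast
    have "gram (L ** G) = det (transpose G ** (transpose L ** L) ** G)"
      by (simp add: gram_def matrix_transpose_mul matrix_mul_assoc)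
    also have "\<dots> = gram G * compressed_det TYPE('k) (transpose L ** L) (A ** transpose A)"
      unfolding dA compressed_det_frame[OF A] ..
    finally have "gram (L ** G) / gram G = compressed_det TYPE('k) (transpose L ** L) (A ** transpose A)"
      using G by simp
    moreover have "A ** transpose A \<in> frame_projections TYPE('k)" using A unfolding frame_projections_def by blast
    ultimately show ?thesis using B by metis
  qed
  then have "AE G in (gauss_matrix :: (real^'k^'n) measure). \<bar>gram (L ** G) / gram G\<bar> \<le> B"
    using gauss_matrix_gram(1)[OF kn] by (rule eventually_mono[rotated]) blast
  then show ?thesis ..
qed

text \<open>\<open>Q\<close> is the squared projected volume without the factor from the unit ball,
  written as a measurable function of \<xi>. In this form it inherits the independence properties of
  \<xi>, and its moments are those of the Gaussian ratio.\<close>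

lemma (in prob_space) projected_ellipsoid_moments:
  fixes \<xi> :: "'a \<Rightarrow> (real^'n::finite) set"
  assumes kn: "CARD('k::finite) \<le> CARD('n)" and E: "ellipsoid_with_semiaxes l E"
    and \<xi>: "uniform_random_subspace M CARD('k) \<xi>"
  obtains Q :: "'a \<Rightarrow> real" and B :: real where "Q \<in> borel_measurable M"
    "generated_events M borel Q \<subseteq> generated_events M (grassmannian_borel CARD('k)) \<xi>"
    "AE \<omega> in M. \<bar>Q \<omega>\<bar> \<le> B"
    "\<And>\<omega>. \<omega> \<in> space M \<Longrightarrow>
      (k_volume TYPE('k) (orthogonal_projection (\<xi> \<omega>) ` E))\<^sup>2 = (unit_ball_vol (real CARD('k)))\<^sup>2 * Q \<omega>"
    "\<And>m. expectation (\<lambda>\<omega>. Q \<omega> ^ m) =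
      (\<integral>G. (gram (diag_matrix l ** G) / gram G) ^ m \<partial>(gauss_matrix :: (real^'k^'n) measure))"
    "\<And>m. gram_moment CARD('n) CARD('k) m *
      (\<integral>G. (gram (diag_matrix l ** G) / gram G) ^ m \<partial>(gauss_matrix :: (real^'k^'n) measure)) =
      (\<integral>G. gram (diag_matrix l ** G) ^ m \<partial>(gauss_matrix :: (real^'k^'n) measure))"
proof -
  obtain c :: "real^'n" and U :: "real^'n^'n" where U: "orthogonal_matrix U"
    and Ei: "E = (\<lambda>z. c + (U ** diag_matrix l) *v z) ` cball 0 1"
    using ellipsoid_affine_image[OF E] by blast
  define T where "T = U ** diag_matrix l"
  define W where "W = T ** transpose T"
  define p where "p L = matrix (orthogonal_projection L)" for L :: "(real^'n) set"
  define Q where "Q \<omega> = compressed_det TYPE('k) W (p (\<xi> \<omega>))" for \<omega>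
  let ?\<gamma> = "gauss_matrix :: (real^'k^'n) measure"
  note u = uniform_random_projection[OF prob_space_axioms \<xi>, folded p_def]
  have pm: "(\<lambda>\<omega>. p (\<xi> \<omega>)) \<in> borel_measurable M" by (rule measurable_compose[OF u(2,1)])
  have cm: "(\<lambda>P. compressed_det TYPE('k) W P ^ m) \<in> borel_measurable borel" for m by measurable
  have c1: "compressed_det TYPE('k) W \<in> borel_measurable borel" by measurable
  let ?\<mu> = "distr M borel (\<lambda>\<omega>. p (\<xi> \<omega>))"
  have \<mu>: "prob_space ?\<mu>" "sets ?\<mu> = sets borel" by (rule prob_space_distr[OF pm]) simp
  have mem: "p (\<xi> \<omega>) \<in> frame_projections TYPE('k)" if "\<omega> \<in> space M" for \<omega>
    by (rule u(4)[OF u(3)[OF that]])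
  have fpb: "frame_projections TYPE('k) \<in> sets (borel :: (real^'n^'n) measure)"
    by (intro borel_closed compact_imp_closed compact_frame_projections)
  have A\<mu>: "AE P in ?\<mu>. P \<in> frame_projections TYPE('k)"
    using fpb mem by (subst AE_distr_iff[OF pm]) (auto intro!: AE_I2)
  note inv = invariant_projection_moments[where W=W, OF kn \<mu> A\<mu> u(5)]
    and inv' = invariant_projection_moments[where W="diag_matrix l ** diag_matrix l", OF kn \<mu> A\<mu> u(5)]
  have Qm: "Q \<in> borel_measurable M" unfolding Q_def by (rule measurable_compose[OF pm c1])
  have Qg: "generated_events M borel Q \<subseteq> generated_events M (grassmannian_borel CARD('k)) \<xi>"
    unfolding Q_def by (rule generated_events_compose[OF measurable_compose[OF u(1) c1] u(2)])
  obtain B where B: "\<And>P :: real^'n^'n. P \<in> frame_projections TYPE('k) \<Longrightarrow> \<bar>compressed_det TYPE('k) W P\<bar> \<le> B"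
    using compressed_det_bounded by blast
  have Qb: "AE \<omega> in M. \<bar>Q \<omega>\<bar> \<le> B" unfolding Q_def by (intro AE_I2 B mem)
  have vol: "(k_volume TYPE('k) (orthogonal_projection (\<xi> \<omega>) ` E))\<^sup>2 = (unit_ball_vol (real CARD('k)))\<^sup>2 * Q \<omega>"
    if w: "\<omega> \<in> space M" for \<omega>
  proof -
    obtain A :: "real^'k^'n" where A: "frame A" "range ((*v) A) = \<xi> \<omega>"
      using u(3)[OF w] frame_exists unfolding grassmannian_def by blast
    have "orthogonal_projection (\<xi> \<omega>) = (\<lambda>x. A *v (transpose A *v x))"
      unfolding A(2)[symmetric] by (rule ext) (rule orthogonal_projection_frame[OF A(1)])
    then have "(k_volume TYPE('k) (orthogonal_projection (\<xi> \<omega>) ` E))\<^sup>2 =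
        (unit_ball_vol (real CARD('k)))\<^sup>2 * det (transpose A ** (T ** transpose T) ** A)"
      unfolding Ei T_def[symmetric] by (simp only: k_volume_projected_ellipsoid[OF A(1) kn])
    also have "det (transpose A ** (T ** transpose T) ** A) = Q \<omega>"
      unfolding Q_def p_def A(2)[symmetric] matrix_orthogonal_projection_frame[OF A(1)] compressed_det_frame[OF A(1)] W_def ..
    finally show ?thesis .
  qed
  have mom: "expectation (\<lambda>\<omega>. Q \<omega> ^ m) = (\<integral>G. (gram (diag_matrix l ** G) / gram G) ^ m \<partial>?\<gamma>)" for m
  proof -
    let ?R = "transpose U"
    have oR: "orthogonal_matrix ?R" using U by (simp add: orthogonal_matrix_transpose)
    have fR: "frame ?R" using oR by (simp add: frame_def orthogonal_matrix)
    have Rm: "(\<lambda>G :: real^'k^'n. ?R ** G) \<in> measurable ?\<gamma> borel" by measurable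
    have fm: "(\<lambda>G :: real^'k^'n. (gram (diag_matrix l ** G) / gram G) ^ m) \<in> borel_measurable borel" by measurable
    have "expectation (\<lambda>\<omega>. Q \<omega> ^ m) = (\<integral>P. compressed_det TYPE('k) W P ^ m \<partial>?\<mu>)"
      unfolding Q_def by (rule integral_distr[OF pm cm, symmetric])
    also have "\<dots> = (\<integral>G. (det (transpose G ** W ** G) / gram G) ^ m \<partial>?\<gamma>)" by (rule inv(1))
    \<comment> \<open>Up to the orthogonal \<open>U\<close>, the matrix \<open>W\<close> is the
      square of \<open>diag_matrix l\<close>; the orthogonal factor is absorbed into the Gaussian
      matrix, whose law it preserves.\<close>
    also have "\<dots> = (\<integral>G. (gram (diag_matrix l ** (?R ** G)) / gram (?R ** G)) ^ m \<partial>?\<gamma>)"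
    proof -
      have "det (transpose G ** W ** G) = gram (diag_matrix l ** (?R ** G))" for G :: "real^'k^'n"
        unfolding gram_def W_def T_def
        by (simp add: matrix_transpose_mul transpose_diag_matrix matrix_mul_assoc)
      then show ?thesis by (simp only: gram_frame_left[OF fR])
    qed
    also have "\<dots> = (\<integral>G. (gram (diag_matrix l ** G) / gram G) ^ m \<partial>distr ?\<gamma> borel (\<lambda>G. ?R ** G))"
      by (rule integral_distr[OF Rm fm, symmetric])
    finally show ?thesis unfolding distr_gauss_matrix_left[OF oR] .
  qed
  have D: "det (transpose G ** (diag_matrix l ** diag_matrix l) ** G) = gram (diag_matrix l ** G)" for G :: "real^'k^'n"
    by (simp add: gram_def matrix_transpose_mul transpose_diag_matrix matrix_mul_assoc)
  \<comment> \<open>The random projection is only an intermediary between two Gaussian integrals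
    here, so the square of the diagonal matrix is taken directly as \<open>W\<close>.\<close>
  have "gram_moment CARD('n) CARD('k) m * (\<integral>G. (gram (diag_matrix l ** G) / gram G) ^ m \<partial>?\<gamma>) =
      (\<integral>G. gram (diag_matrix l ** G) ^ m \<partial>?\<gamma>)" for m
    using inv'[of m] unfolding D by simp
  with Qm Qg Qb vol mom show ?thesis by (rule that)
qed

lemma (in prob_space) equal_in_distribution_bounded_moments:
  assumes Y: "Y \<in> borel_measurable M" and Z: "Z \<in> borel_measurable M"
    and bY: "\<exists>B. AE x in M. \<bar>Y x\<bar> \<le> B" and bZ: "\<exists>B. AE x in M. \<bar>Z x\<bar> \<le> B"
    and mom: "\<And>m::nat. expectation (\<lambda>x. Y x ^ m) = expectation (\<lambda>x. Z x ^ m)"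
  shows "equal_in_distribution M Y Z"
proof -
  obtain B C where B: "AE x in M. \<bar>Y x\<bar> \<le> B" and C: "AE x in M. \<bar>Z x\<bar> \<le> C" using bY bZ by blast
  have "AE x in M. \<bar>Y x\<bar> \<le> max B C" using B by eventually_elim simp
  moreover have "AE x in M. \<bar>Z x\<bar> \<le> max B C" using C by eventually_elim simp
  ultimately have "distr M borel Y = distr M borel Z"
    using bounded_moments_determine_distribution[OF Y Z _ _ mom] by blast
  then show ?thesis using Y Z unfolding equal_in_distribution_def by blast
qed

text \<open>Selects the two sublists that occur in the first two variables: the points with \<eta>,
  and the subspace with \<open>\<eta>'\<close> and the \<open>\<eta>s i\<close>.\<close>

lemma independent_list_parts:
  assumes M: "prob_space M" and ind: "independent_list M (xs @ [a, b] @ ys @ [c])"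
  shows "independent_list M (xs @ [a])" "independent_list M (c # b # ys)"
proof -
  let ?L = "xs @ [a, b] @ ys @ [c]" and ?p = "length xs" and ?q = "length ys"
  have "map (\<lambda>i. ?L ! i) [0..<Suc ?p] = xs @ [a]"
    by (rule nth_equalityI) (auto simp: nth_append simp del: upt_Suc)
  moreover have "independent_list M (map (\<lambda>i. ?L ! i) [0..<Suc ?p])"
    by (rule independent_list_sublist[OF M ind]) auto
  ultimately show "independent_list M (xs @ [a])" by simp
  have "map (\<lambda>i. ?L ! i) [?p + 2..<?p + 2 + ?q] = ys"
    by (rule nth_equalityI) (auto simp: nth_append simp del: upt_Suc)
  then have "map (\<lambda>i. ?L ! i) ((?p + 2 + ?q) # (?p + 1) # [?p + 2..<?p + 2 + ?q]) = c # b # ys"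
    by (simp add: nth_append)
  moreover have "independent_list M (map (\<lambda>i. ?L ! i) ((?p + 2 + ?q) # (?p + 1) # [?p + 2..<?p + 2 + ?q]))"
    by (rule independent_list_sublist[OF M ind]) auto
  ultimately show "independent_list M (c # b # ys)" by metis
qed

section \<open>Coincidence of the three moment sequences\<close>

theorem theorem1p9:
  fixes M :: "'w measure"
    and d k :: nat
    and E :: "(real^'n) set"
    and l :: "real^'n"
    and X :: "nat \<Rightarrow> 'w \<Rightarrow> real^'n"
    and \<eta> \<eta>' :: "'w \<Rightarrow> real"
    and \<eta>s :: "nat \<Rightarrow> 'w \<Rightarrow> real"
    and \<xi> :: "'w \<Rightarrow> (real^'n) set"
    and G :: "'w \<Rightarrow> real^'k^'n"
  assumes "prob_space M"
    and "d = CARD('n)" and "k = CARD('k)" and "k \<in> {1..d}"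
    and "ellipsoid_with_semiaxes l E"
    and "\<And>i. i \<in> {0..k} \<Longrightarrow>
           distributed M lborel (X i) (\<lambda>x. ennreal (indicator E x / measure lborel E))"
    and "beta_distributed M \<eta> (real d / 2 + 1) (real k * real d / 2)"
    and "beta_distributed M \<eta>' (real d / 2 + 1) (real k * real d / 2)"
    and "\<And>i. i \<in> {1..k} \<Longrightarrow>
           beta_distributed M (\<eta>s i) ((real d - real k + real i) / 2) ((real k - real i) / 2 + 1)"
    and "uniform_random_subspace M k \<xi>"
    and "independent_list M
           (map (\<lambda>i. generated_events M borel (X i)) [0..<Suc k] @
            [generated_events M borel \<eta>, generated_events M borel \<eta>'] @
            map (\<lambda>i. generated_events M borel (\<eta>s i)) [1..<Suc k] @
            [generated_events M (grassmannian_borel k) \<xi>])"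
    and "\<And>i j. distributed M lborel (\<lambda>\<omega>. G \<omega> $ i $ j) (\<lambda>t. ennreal (std_normal_density t))"
    and "prob_space.indep_vars M (\<lambda>_. borel) (\<lambda>(i, j) \<omega>. G \<omega> $ i $ j) UNIV"
    and "independent_list M
           (generated_events M borel G # generated_events M borel \<eta>' #
            map (\<lambda>i. generated_events M borel (\<eta>s i)) [1..<Suc k])"
  shows "equal_in_distribution M
           (\<lambda>\<omega>. (fact k)\<^sup>2 * \<eta> \<omega> * (1 - \<eta> \<omega>) ^ k *
                (k_volume TYPE('k) (convex hull ((\<lambda>i. X i \<omega>) ` {0..k})))\<^sup>2)
           (\<lambda>\<omega>. inverse ((unit_ball_vol (real k))\<^sup>2) * (1 - \<eta>' \<omega>) ^ k * (\<Prod>i = 1..k. \<eta>s i \<omega>) *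
                (k_volume TYPE('k) (orthogonal_projection (\<xi> \<omega>) ` E))\<^sup>2)
       \<and> equal_in_distribution M
           (\<lambda>\<omega>. inverse ((unit_ball_vol (real k))\<^sup>2) * (1 - \<eta>' \<omega>) ^ k * (\<Prod>i = 1..k. \<eta>s i \<omega>) *
                (k_volume TYPE('k) (orthogonal_projection (\<xi> \<omega>) ` E))\<^sup>2)
           (\<lambda>\<omega>. (1 - \<eta>' \<omega>) ^ k * (\<Prod>i = 1..k. \<eta>s i \<omega>) *
                (det (transpose (scale_rows l (G \<omega>)) ** scale_rows l (G \<omega>)) /
                 det (transpose (G \<omega>) ** G \<omega>)))"
proof -
  interpret prob_space M by fact
  note k = assms(3) and d = assms(2)
  have kn: "CARD('k) \<le> CARD('n)" using assms(4) k d by simp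
  define c b where "c = real d / 2 + 1" and "b = real k * real d / 2"
  have pos: "c > 0" "b > 0" using k d by (auto simp: c_def b_def)
  define as bs where "as i = (real d - real k + real i) / 2" and "bs i = (real k - real i) / 2 + 1" for i :: nat
  have spos: "as i > 0" "bs i > 0" if "i \<in> {1..k}" for i 
  proof -
    have "real i \<le> real k" "real k \<le> real d" "real i > 0" using that kn k d by auto
    then have 1: "(real d - real k + real i) / 2 > 0" and 2: "(real k - real i) / 2 \<ge> 0" by simp_all
    show "as i > 0" unfolding as_def by (rule 1)
    show "bs i > 0" unfolding bs_def by (rule add_nonneg_pos[OF 2]) simp
  qed
  \<comment> \<open>The two parameters of every \<open>\<eta>s i\<close> add up to the first
    parameter of \<eta>; this is why all their moments share the denominator
    \<open>pochhammer c m\<close>.\<close>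
  have abs: "as i + bs i = c" for i by (simp add: as_def bs_def c_def field_simps)
  note e = assms(7,8)[folded c_def b_def]
  have s: "beta_distributed M (\<eta>s i) (as i) (bs i)" if "i \<in> {1..k}" for i
    unfolding as_def bs_def by (rule assms(9)[OF that])
  note parts = independent_list_parts[OF assms(1,11)]
  let ?\<gamma> = "gauss_matrix :: (real^'k^'n) measure"
  \<comment> \<open>\<open>J\<close> is the common geometric moment and \<open>C\<close> the common
    product of Beta moments; each of the three variables turns out to have the moments
    \<open>C m * J m\<close>.\<close>
  define J where "J m = (\<integral>A. (gram (diag_matrix l ** A) / gram A) ^ m \<partial>?\<gamma>)" for m
  define C where "C m = pochhammer b (k * m) / pochhammer (c + b) (k * m) *
      (\<Prod>i=1..k. pochhammer (as i) m / pochhammer c m)" for m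
  obtain Q B where Q: "Q \<in> borel_measurable M"
      "generated_events M borel Q \<subseteq> generated_events M (grassmannian_borel CARD('k)) \<xi>"
      "AE \<omega> in M. \<bar>Q \<omega>\<bar> \<le> B"
    and vol: "\<And>\<omega>. \<omega> \<in> space M \<Longrightarrow>
      (k_volume TYPE('k) (orthogonal_projection (\<xi> \<omega>) ` E))\<^sup>2 = (unit_ball_vol (real CARD('k)))\<^sup>2 * Q \<omega>"
    and EQ: "\<And>m. expectation (\<lambda>\<omega>. Q \<omega> ^ m) = J m"
    and gm: "\<And>m. gram_moment CARD('n) CARD('k) m * J m = (\<integral>A. gram (diag_matrix l ** A) ^ m \<partial>?\<gamma>)"
    using projected_ellipsoid_moments[OF kn assms(5) assms(10)[unfolded k]] unfolding J_def by blast
  define V1 where "V1 \<omega> = (fact k)\<^sup>2 * \<eta> \<omega> * (1 - \<eta> \<omega>) ^ k *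
      (k_volume TYPE('k) (convex hull ((\<lambda>i. X i \<omega>) ` {0..k})))\<^sup>2" for \<omega>
  define V2 where "V2 \<omega> = inverse ((unit_ball_vol (real k))\<^sup>2) * (1 - \<eta>' \<omega>) ^ k * (\<Prod>i = 1..k. \<eta>s i \<omega>) *
      (k_volume TYPE('k) (orthogonal_projection (\<xi> \<omega>) ` E))\<^sup>2" for \<omega>
  define V3 where "V3 \<omega> = (1 - \<eta>' \<omega>) ^ k * (\<Prod>i = 1..k. \<eta>s i \<omega>) *
      (det (transpose (scale_rows l (G \<omega>)) ** scale_rows l (G \<omega>)) / det (transpose (G \<omega>) ** G \<omega>))" for \<omega>

  note X = assms(6)[unfolded k] and i1 = parts(1)[unfolded k]
  have v1: "V1 \<in> borel_measurable M" "\<exists>B. AE \<omega> in M. \<bar>V1 \<omega>\<bar> \<le> B"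
    "expectation (\<lambda>\<omega>. V1 \<omega> ^ m) = pochhammer c m * pochhammer b (k * m) / pochhammer (c + b) (m + k * m) *
      (simplex_factor d k m * (\<integral>A. gram (diag_matrix l ** A) ^ m \<partial>?\<gamma>))" for m
    unfolding V1_def[abs_def] k d by (rule ellipsoid_simplex_variable[OF kn assms(5) X i1 e(1) pos], assumption)+
  have m1: "expectation (\<lambda>\<omega>. V1 \<omega> ^ m) = C m * J m" for m
  proof -
    have "expectation (\<lambda>\<omega>. V1 \<omega> ^ m) = pochhammer c m * pochhammer b (k * m) / pochhammer (c + b) (m + k * m) *
        (simplex_factor d k m * gram_moment d k m) * J m"
      unfolding v1(3) k d gm[symmetric] by (simp only: mult.assoc)
    \<comment> \<open>The Beta factor of \<eta>, \<open>simplex_factor\<close> and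
      \<open>gram_moment\<close> combine to the product of Beta moments on the other side.\<close>
    also have "\<dots> = C m * J m"
      using moment_identity[of d k m] assms(4) d k unfolding C_def as_def c_def b_def by simp
    finally show ?thesis .
  qed

  have QG: "generated_events M borel Q \<subseteq> generated_events M (grassmannian_borel k) \<xi>" using Q(2) k by simp
  \<comment> \<open>The identity is available on \<open>space M\<close>, where \<xi> takes its
    values in the Grassmannian and the squared unit ball volume cancels.\<close>
  have V2: "V2 \<omega> = (1 - \<eta>' \<omega>) ^ k * (\<Prod>i=1..k. \<eta>s i \<omega>) * Q \<omega>" if "\<omega> \<in> space M" for \<omega>
  proof -
    have "unit_ball_vol (real CARD('k)) \<noteq> 0" using unit_ball_vol_pos[of "real CARD('k)", OF of_nat_0_le_iff] by (rule less_imp_neq[THEN not_sym])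
    then show ?thesis using vol[OF that] unfolding V2_def k by (simp add: field_simps)
  qed
  \<comment> \<open>Used twice: with \<open>F\<close> the events generated by \<xi>, and with
    \<open>F\<close> those generated by the Gaussian matrix.\<close>
  have w: "(\<lambda>\<omega>. (1 - \<eta>' \<omega>) ^ k * (\<Prod>i=1..k. \<eta>s i \<omega>) * R \<omega>) \<in> borel_measurable M"
      "AE \<omega> in M. \<bar>(1 - \<eta>' \<omega>) ^ k * (\<Prod>i=1..k. \<eta>s i \<omega>) * R \<omega>\<bar> \<le> B'"
      "expectation (\<lambda>\<omega>. ((1 - \<eta>' \<omega>) ^ k * (\<Prod>i=1..k. \<eta>s i \<omega>) * R \<omega>) ^ m) = C m * expectation (\<lambda>\<omega>. R \<omega> ^ m)"
    if "independent_list M (F # generated_events M borel \<eta>' # map (\<lambda>i. generated_events M borel (\<eta>s i)) [1..<Suc k])"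
      "R \<in> borel_measurable M" "generated_events M borel R \<subseteq> F" "AE \<omega> in M. \<bar>R \<omega>\<bar> \<le> B'" for R F B' m
    using beta_product_variable[OF that e(2) pos s spos] unfolding abs C_def by blast+
  note y = w[OF parts(2) Q(1) QG Q(3)]
  have v2: "V2 \<in> borel_measurable M"
    using measurable_cong[of M V2 _ borel, OF V2] y(1) by blast
  have "AE \<omega> in M. \<bar>V2 \<omega>\<bar> \<le> B"
    using y(2) AE_space by eventually_elim (simp add: V2)
  then have b2: "\<exists>B. AE \<omega> in M. \<bar>V2 \<omega>\<bar> \<le> B" ..
  have m2: "expectation (\<lambda>\<omega>. V2 \<omega> ^ m) = C m * J m" for m
  proof -
    have "expectation (\<lambda>\<omega>. V2 \<omega> ^ m) = expectation (\<lambda>\<omega>. ((1 - \<eta>' \<omega>) ^ k * (\<Prod>i=1..k. \<eta>s i \<omega>) * Q \<omega>) ^ m)"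
      by (rule Bochner_Integration.integral_cong[OF refl]) (simp only: V2)
    then show ?thesis unfolding y(3) EQ .
  qed

  note G = gaussian_entries_law[OF assms(12,13)]
  let ?R = "\<lambda>A :: real^'k^'n. gram (diag_matrix l ** A) / gram A"
  have Rm: "?R \<in> borel_measurable borel" by measurable
  have Rpm: "(\<lambda>A. ?R A ^ m) \<in> borel_measurable borel" for m by measurable
  obtain B3 where "AE A in ?\<gamma>. \<bar>?R A\<bar> \<le> B3" using gram_ratio_bounded[OF kn] by blast
  then have Rb: "AE \<omega> in M. \<bar>?R (G \<omega>)\<bar> \<le> B3"
    unfolding G(2)[symmetric] by (rule AE_distrD[OF G(1)])
  have ER: "expectation (\<lambda>\<omega>. ?R (G \<omega>) ^ m) = J m" for m
    using integral_distr[OF G(1) Rpm, of m] unfolding G(2) J_def by simp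
  note x = w[OF assms(14) measurable_compose[OF G(1) Rm] generated_events_compose[OF Rm G(1)] Rb]
  have V3: "V3 = (\<lambda>\<omega>. (1 - \<eta>' \<omega>) ^ k * (\<Prod>i=1..k. \<eta>s i \<omega>) * ?R (G \<omega>))"
    by (simp add: V3_def fun_eq_iff scale_rows_eq gram_def)
  have v3: "V3 \<in> borel_measurable M" unfolding V3 by (rule x(1))
  have "AE \<omega> in M. \<bar>V3 \<omega>\<bar> \<le> B3" unfolding V3 by (rule x(2))
  then have b3: "\<exists>B. AE \<omega> in M. \<bar>V3 \<omega>\<bar> \<le> B" ..
  have m3: "expectation (\<lambda>\<omega>. V3 \<omega> ^ m) = C m * J m" for m
    unfolding V3 x(3) ER ..

  have "equal_in_distribution M V1 V2"
    by (rule equal_in_distribution_bounded_moments[OF v1(1) v2 v1(2) b2]) (simp only: m1 m2)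
  moreover have "equal_in_distribution M V2 V3"
    by (rule equal_in_distribution_bounded_moments[OF v2 v3 b2 b3]) (simp only: m2 m3)
  ultimately show ?thesis unfolding V1_def V2_def V3_def by blast
qed

end
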